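(* Let $\kappa\in\{1,-1\}$, and let $q$ be the global solution of $i\partial_tq=-\frac12\partial_x^2q+\kappa|q|^2q$ with initial value $q_0\in X_5$. Then $$\sigma(D(t))=\sigma(D(0)),\qquad t\in\mathbb R,$$ where $\sigma$ denotes the entire complex operator spectrum. For every $z\in\mathbb C$ there is an invertible matrix $\mathsf B(t,x,z)$ such that, for all $t,x,y\in\mathbb R$, $$\mathsf Y(t;x,y,z)=\mathsf B(t,x,z)\,\mathsf Y(0;x,y,z)\,\mathsf B(t,y,z)^{-1}.$$ For every $T,K<\infty$, $$\sup_{|t|\le T,\ x\in\mathbb R,\ |z|\le K}\bigl(\|\mathsf B(t,x,z)\|+\|\mathsf B(t,x,z)^{-1}\|+\|\partial_x\mathsf B(t,x,z)\|\bigr)<\infty.$$ Consequently, both growth rates $\overline\lambda_\epsilon(t,z;y)$ and $\underline\lambda_\epsilon(t,z;y)$ are independent of $t$. In particular, every spatial Lyapunov exponent defined by an existing limit of these transfer norms is preserved. Multiplication by $\mathsf B(t,\cdot,z)$ gives bijections between the corresponding spaces (at times $0$ and $t$) of solutions of $D(\cdot)f=zf$ square integrable at either end of the line, and between $\ker(D(0)-z)$ and $\ker(D(t)-z)$. For $z$ in the common resolvent set, the norms of the resolvents $(D(0)-z)^{-1}$ and $(D(t)-z)^{-1}$ are comparable, with comparison constants uniform for $|t|\le T$ and $|z|\le K$. The same conclusions hold for every global classical solution $q$ of the equation whose spatial derivatives through order two are jointly continuous and bounded on each finite time strip $[-T,T]\times\mathbb R$.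
   Context: Choose a real, even $\chi\in C_c^\infty((-1,1))$ with $\sum_{k\in\mathbb Z}\chi(\xi-k)=1$; with $\widehat f(\xi)=\int e^{-ix\xi}f(x)\,dx$ put $\Box_kf=\mathcal F^{-1}(\chi(\xi-k)\widehat f(\xi))$. For $s\ge0$, $X_s=\{f\in\mathcal S'(\mathbb R):\|f\|_s:=\sum_k(1+k^2)^{s/2}\|\Box_kf\|_\infty<\infty\}$ (complex-valued). For every $q_0\in X_5$ the equation has a global classical solution $q\in C(\mathbb R;X_5)\cap C^1(\mathbb R;X_3)$, $q(0)=q_0$, unique among classical solutions $v$ with $v,v_x$ bounded on every finite time strip; this is the global solution meant in the claim. Matrix norms are Euclidean operator norms. Let $\sigma_3=\operatorname{diag}(1,-1)$, $$\mathsf Q(t,x)=\begin{pmatrix}0&q(t,x)\\\kappa\overline{q(t,x)}&0\end{pmatrix},\qquad D(t)=i\sigma_3\partial_x+\mathsf Q(t,\cdot),\qquad\operatorname{Dom}D(t)=H^1(\mathbb R;\mathbb C^2),$$ a closed operator on $L^2(\mathbb R;\mathbb C^2)$. The transfer matrix $\mathsf Y(t;x,y,z)$ is determined by $\partial_x\mathsf Y(t;x,y,z)=\mathsf U(t,x,z)\mathsf Y(t;x,y,z)$, $\mathsf Y(t;y,y,z)=I$, with $\mathsf U(t,x,z)=-iz\sigma_3+i\sigma_3\mathsf Q(t,x)$; thus $D(t)f=zf$ is equivalent to $f_x=\mathsf U(t,x,z)f$. For $\epsilon\in\{-1,1\}$ and a fixed base point $y\in\mathbb R$, $$\overline\lambda_\epsilon(t,z;y)=\limsup_{L\to\infty}\tfrac1L\log\|\mathsf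 Y(t;y+\epsilon L,y,z)\|,\qquad\underline\lambda_\epsilon(t,z;y)=\liminf_{L\to\infty}\tfrac1L\log\|\mathsf Y(t;y+\epsilon L,y,z)\|.$$ *)

theory Defs
  imports "HOL-Analysis.Analysis"
begin

section \<open>Smooth functions and tempered distributions on the real line\<close>

definition vderiv :: "(real \<Rightarrow> 'a::real_normed_vector) \<Rightarrow> real \<Rightarrow> 'a" where
  "vderiv f x = vector_derivative f (at x)"

definition smooth :: "(real \<Rightarrow> 'a::real_normed_vector) \<Rightarrow> bool" where
  "smooth f \<longleftrightarrow> (\<forall>n x. (vderiv ^^ n) f differentiable (at x))"

definition test_function :: "real set \<Rightarrow> (real \<Rightarrow> real) \<Rightarrow> bool" where
  "test_function S \<phi> \<longleftrightarrow>
     smooth \<phi> \<and> compact (closure {x. \<phi> x \<noteq> 0}) \<and> closure {x. \<phi> x \<noteq> 0} \<subseteq> S"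

definition schwartz :: "(real \<Rightarrow> complex) set" where
  "schwartz = {\<phi>. smooth \<phi> \<and> (\<forall>m n. bounded (range (\<lambda>x. x ^ m *\<^sub>R (vderiv ^^ n) \<phi> x)))}"

definition schwartz_seminorm :: "nat \<Rightarrow> nat \<Rightarrow> (real \<Rightarrow> complex) \<Rightarrow> real" where
  "schwartz_seminorm m n \<phi> = (SUP x. norm (x ^ m *\<^sub>R (vderiv ^^ n) \<phi> x))"

text \<open>A distribution is a functional on all functions of which only the values on
  \<open>schwartz\<close> matter; every notion below depends on these values only.\<close>

type_synonym distribution = "(real \<Rightarrow> complex) \<Rightarrow> complex"

definition tempered :: "distribution \<Rightarrow> bool" where
  "tempered F \<longleftrightarrow>
     (\<forall>\<phi>\<in>schwartz. \<forall>\<psi>\<in>schwartz. F (\<lambda>x. \<phi> x + \<psi> x) = F \<phi> + F \<psi>) \<and>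
     (\<forall>c. \<forall>\<phi>\<in>schwartz. F (\<lambda>x. c * \<phi> x) = c * F \<phi>) \<and>
     (\<exists>N C. \<forall>\<phi>\<in>schwartz. norm (F \<phi>) \<le> C * (\<Sum>m\<le>N. \<Sum>n\<le>N. schwartz_seminorm m n \<phi>))"

definition fun_dist :: "(real \<Rightarrow> complex) \<Rightarrow> distribution" where
  "fun_dist g \<phi> = (LINT x|lborel. g x * \<phi> x)"

text \<open>The integrability condition excludes spurious zeros of non-existing integrals.\<close>

definition represents :: "(real \<Rightarrow> complex) \<Rightarrow> distribution \<Rightarrow> bool" where
  "represents g F \<longleftrightarrow>
     (\<forall>\<phi>\<in>schwartz. integrable lborel (\<lambda>x. g x * \<phi> x) \<and> F \<phi> = fun_dist g \<phi>)"

definition fourier :: "(real \<Rightarrow> complex) \<Rightarrow> real \<Rightarrow> complex" where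
  "fourier \<phi> \<xi> = (LINT x|lborel. exp (- \<i> * of_real (x * \<xi>)) * \<phi> x)"

definition inv_fourier :: "(real \<Rightarrow> complex) \<Rightarrow> real \<Rightarrow> complex" where
  "inv_fourier \<phi> x = 1 / (2 * of_real pi) * (LINT \<xi>|lborel. exp (\<i> * of_real (x * \<xi>)) * \<phi> \<xi>)"

text \<open>On distributions the operations are defined by transposition; both transforms have a
  symmetric kernel, hence are their own transposes.\<close>

definition fourier_dist :: "distribution \<Rightarrow> distribution" where
  "fourier_dist F \<phi> = F (fourier \<phi>)"

definition inv_fourier_dist :: "distribution \<Rightarrow> distribution" where
  "inv_fourier_dist F \<phi> = F (inv_fourier \<phi>)"

definition mult_dist :: "(real \<Rightarrow> real) \<Rightarrow> distribution \<Rightarrow> distribution" where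
  "mult_dist m F \<phi> = F (\<lambda>\<xi>. of_real (m \<xi>) * \<phi> \<xi>)"

text \<open>The \<open>L\<^sup>\<infinity>\<close> norm of a distribution; it is \<open>\<infinity>\<close> if no bounded function represents it.\<close>

definition linf_norm :: "distribution \<Rightarrow> ennreal" where
  "linf_norm F = Inf {ennreal C | C. 0 \<le> C \<and>
     (\<exists>g \<in> borel_measurable lborel. represents g F \<and> (AE x in lborel. norm (g x) \<le> C))}"


section \<open>The spaces \<open>X\<^sub>s\<close>\<close>

definition partition_profile :: "(real \<Rightarrow> real) \<Rightarrow> bool" where
  "partition_profile \<eta> \<longleftrightarrow>
     test_function {-1<..<1} \<eta> \<and> (\<forall>\<xi>. \<eta> (- \<xi>) = \<eta> \<xi>) \<and>
     (\<forall>\<xi>. ((\<lambda>k::int. \<eta> (\<xi> - of_int k)) has_sum 1) UNIV)"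

definition freq_box :: "(real \<Rightarrow> real) \<Rightarrow> int \<Rightarrow> distribution \<Rightarrow> distribution" where
  "freq_box \<eta> k F = inv_fourier_dist (mult_dist (\<lambda>\<xi>. \<eta> (\<xi> - of_int k)) (fourier_dist F))"

definition X_norm :: "(real \<Rightarrow> real) \<Rightarrow> real \<Rightarrow> distribution \<Rightarrow> ennreal" where
  "X_norm \<eta> s F =
     (\<Sum>\<^sub>\<infinity>k::int. ennreal ((1 + (of_int k)\<^sup>2) powr (s / 2)) * linf_norm (freq_box \<eta> k F))"

definition X_space :: "(real \<Rightarrow> real) \<Rightarrow> real \<Rightarrow> distribution set" where
  "X_space \<eta> s = {F. tempered F \<and> X_norm \<eta> s F < \<infinity>}"

definition X_continuous :: "(real \<Rightarrow> real) \<Rightarrow> real \<Rightarrow> (real \<Rightarrow> distribution) \<Rightarrow> bool" where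
  "X_continuous \<eta> s F \<longleftrightarrow>
     (\<forall>t. F t \<in> X_space \<eta> s) \<and>
     (\<forall>t. ((\<lambda>r. X_norm \<eta> s (\<lambda>\<phi>. F r \<phi> - F t \<phi>)) \<longlongrightarrow> 0) (at t))"

definition X_C1 :: "(real \<Rightarrow> real) \<Rightarrow> real \<Rightarrow> (real \<Rightarrow> distribution) \<Rightarrow> bool" where
  "X_C1 \<eta> s F \<longleftrightarrow>
     X_continuous \<eta> s F \<and>
     (\<exists>F'. X_continuous \<eta> s F' \<and>
        (\<forall>t. ((\<lambda>h. X_norm \<eta> s (\<lambda>\<phi>. (F (t + h) \<phi> - F t \<phi>) / of_real h - F' t \<phi>)) \<longlongrightarrow> 0)
               (at 0)))"


section \<open>Global solutions of the cubic nonlinear Schroedinger equation\<close>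

text \<open>Derivatives exist pointwise; their continuity is deliberately not part of the notion.\<close>

definition classical_solution :: "real \<Rightarrow> (real \<Rightarrow> real \<Rightarrow> complex) \<Rightarrow> bool" where
  "classical_solution \<kappa> q \<longleftrightarrow>
     (\<forall>t x. (\<lambda>r. q r x) differentiable (at t) \<and>
            q t differentiable (at x) \<and> vderiv (q t) differentiable (at x) \<and>
            \<i> * vderiv (\<lambda>r. q r x) t =
              - (1 / 2) * vderiv (vderiv (q t)) x
              + of_real \<kappa> * of_real ((norm (q t x))\<^sup>2) * q t x)"

definition X_global_solution ::
  "(real \<Rightarrow> real) \<Rightarrow> real \<Rightarrow> distribution \<Rightarrow> (real \<Rightarrow> real \<Rightarrow> complex) \<Rightarrow> bool" where
  "X_global_solution \<eta> \<kappa> q\<^sub>0 q \<longleftrightarrow>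
     classical_solution \<kappa> q \<and> represents (q 0) q\<^sub>0 \<and>
     (\<forall>t. represents (q t) (fun_dist (q t))) \<and>
     X_continuous \<eta> 5 (\<lambda>t. fun_dist (q t)) \<and> X_C1 \<eta> 3 (\<lambda>t. fun_dist (q t))"

definition strip_regular :: "(real \<Rightarrow> real \<Rightarrow> complex) \<Rightarrow> bool" where
  "strip_regular q \<longleftrightarrow>
     (\<forall>T. \<forall>j\<le>2. continuous_on ({-T..T} \<times> UNIV) (\<lambda>(t, x). (vderiv ^^ j) (q t) x) \<and>
                bounded ((\<lambda>(t, x). (vderiv ^^ j) (q t) x) ` ({-T..T} \<times> UNIV)))"


section \<open>The Hilbert space \<open>L\<^sup>2(\<real>; \<complex>\<^sup>2)\<close>\<close>

definition square_integrable :: "(real \<Rightarrow> complex ^ 2) \<Rightarrow> bool" where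
  "square_integrable f \<longleftrightarrow>
     f \<in> borel_measurable lborel \<and> integrable lborel (\<lambda>x. (norm (f x))\<^sup>2)"

definition L2_eq :: "(real \<Rightarrow> complex ^ 2) \<Rightarrow> (real \<Rightarrow> complex ^ 2) \<Rightarrow> bool" where
  "L2_eq f g \<longleftrightarrow> square_integrable f \<and> square_integrable g \<and> (AE x in lborel. f x = g x)"

lemma square_integrable_zero: "square_integrable (\<lambda>x. 0)"
  by (simp add: square_integrable_def)

lemma square_integrable_add:
  assumes "square_integrable f" "square_integrable g"
  shows "square_integrable (\<lambda>x. f x + g x)"
proof -
  have m: "f \<in> borel_measurable lborel" "g \<in> borel_measurable lborel"
    using assms by (auto simp: square_integrable_def)
  have b: "(norm (f x + g x))\<^sup>2 \<le> 2 * (norm (f x))\<^sup>2 + 2 * (norm (g x))\<^sup>2" for x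
  proof -
    have "(norm (f x + g x))\<^sup>2 \<le> (norm (f x) + norm (g x))\<^sup>2"
      by (intro power_mono norm_triangle_ineq) auto
    also have "\<dots> \<le> 2 * (norm (f x))\<^sup>2 + 2 * (norm (g x))\<^sup>2"
      using sum_squares_bound[of "norm (f x)" "norm (g x)"] by (simp add: power2_sum)
    finally show ?thesis .
  qed
  have "integrable lborel (\<lambda>x. (norm (f x + g x))\<^sup>2)"
  proof (rule Bochner_Integration.integrable_bound)
    show "integrable lborel (\<lambda>x. 2 * (norm (f x))\<^sup>2 + 2 * (norm (g x))\<^sup>2)"
      using assms by (auto simp: square_integrable_def)
    show "(\<lambda>x. (norm (f x + g x))\<^sup>2) \<in> borel_measurable lborel"
      using m by measurable
    show "AE x in lborel. norm ((norm (f x + g x))\<^sup>2)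
            \<le> norm (2 * (norm (f x))\<^sup>2 + 2 * (norm (g x))\<^sup>2)"
      using b by (intro AE_I2) auto
  qed
  then show ?thesis using m by (auto simp: square_integrable_def)
qed

lemma square_integrable_scaleR:
  assumes "square_integrable f"
  shows "square_integrable (\<lambda>x. c *\<^sub>R f x)"
  using assms by (auto simp: square_integrable_def power_mult_distrib)

lemma square_integrable_diff:
  assumes "square_integrable f" "square_integrable g"
  shows "square_integrable (\<lambda>x. f x - g x)"
  using square_integrable_add[OF assms(1) square_integrable_scaleR[OF assms(2), of "-1"]] by simp

lemma norm_vector_scalar_mult: "norm (c *s (v :: complex ^ 2)) = norm c * norm v"
  by (simp add: norm_vec_def norm_mult L2_set_right_distrib)

lemma square_integrable_cscale:
  assumes "square_integrable f"
  shows "square_integrable (\<lambda>x. c *s f x)"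
proof -
  have "continuous_on UNIV (\<lambda>v :: complex ^ 2. c *s v)"
    unfolding vector_scalar_mult_def by (intro continuous_intros)
  then have "(\<lambda>v :: complex ^ 2. c *s v) \<in> borel_measurable borel"
    by (rule borel_measurable_continuous_onI)
  then have "(\<lambda>x. c *s f x) \<in> borel_measurable lborel"
    using assms by (auto simp: square_integrable_def)
  then show ?thesis
    using assms by (auto simp: square_integrable_def norm_vector_scalar_mult power_mult_distrib)
qed

lemma square_integrable_inner:
  assumes "square_integrable f" "square_integrable g"
  shows "integrable lborel (\<lambda>x. f x \<bullet> g x)"
proof (rule Bochner_Integration.integrable_bound)
  show "integrable lborel (\<lambda>x. (norm (f x))\<^sup>2 + (norm (g x))\<^sup>2)"
    using assms by (auto simp: square_integrable_def)
  show "(\<lambda>x. f x \<bullet> g x) \<in> borel_measurable lborel"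
    using assms by (auto simp: square_integrable_def)
  have "norm (f x \<bullet> g x) \<le> norm ((norm (f x))\<^sup>2 + (norm (g x))\<^sup>2)" for x
  proof -
    have "\<bar>f x \<bullet> g x\<bar> \<le> norm (f x) * norm (g x)" by (rule Cauchy_Schwarz_ineq2)
    moreover have "0 \<le> norm (f x) * norm (g x)" by simp
    ultimately show ?thesis
      using sum_squares_bound[of "norm (f x)" "norm (g x)"] by simp
  qed
  then show "AE x in lborel. norm (f x \<bullet> g x) \<le> norm ((norm (f x))\<^sup>2 + (norm (g x))\<^sup>2)"
    by (intro AE_I2)
qed

quotient_type L2 = "real \<Rightarrow> complex ^ 2" / partial: L2_eq
proof (rule part_equivpI)
  show "\<exists>f. L2_eq f f"
    using square_integrable_zero by (auto simp: L2_eq_def)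
  show "symp L2_eq"
    by (auto simp: symp_def L2_eq_def)
  show "transp L2_eq"
    by (auto simp: transp_def L2_eq_def)
qed

instantiation L2 :: real_inner
begin

lift_definition zero_L2 :: L2 is "\<lambda>x. 0"
  by (simp add: L2_eq_def square_integrable_zero)

lift_definition plus_L2 :: "L2 \<Rightarrow> L2 \<Rightarrow> L2" is "\<lambda>f g x. f x + g x"
  by (auto simp: L2_eq_def square_integrable_add)

lift_definition scaleR_L2 :: "real \<Rightarrow> L2 \<Rightarrow> L2" is "\<lambda>c f x. c *\<^sub>R f x"
  by (auto simp: L2_eq_def square_integrable_scaleR)

lift_definition uminus_L2 :: "L2 \<Rightarrow> L2" is "\<lambda>f x. - f x"
  by (auto simp: L2_eq_def square_integrable_def)

lift_definition minus_L2 :: "L2 \<Rightarrow> L2 \<Rightarrow> L2" is "\<lambda>f g x. f x - g x"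
  by (auto simp: L2_eq_def square_integrable_diff)

lift_definition inner_L2 :: "L2 \<Rightarrow> L2 \<Rightarrow> real" is "\<lambda>f g. LINT x|lborel. f x \<bullet> g x"
  by (rule integral_cong_AE) (auto simp: L2_eq_def square_integrable_def)

definition norm_L2 :: "L2 \<Rightarrow> real" where
  "norm_L2 f = sqrt (f \<bullet> f)"

definition dist_L2 :: "L2 \<Rightarrow> L2 \<Rightarrow> real" where
  "dist_L2 f g = norm (f - g)"

definition sgn_L2 :: "L2 \<Rightarrow> L2" where
  "sgn_L2 f = scaleR (inverse (norm f)) f"

definition uniformity_L2 :: "(L2 \<times> L2) filter" where
  "uniformity_L2 = (INF e\<in>{0<..}. principal {(f, g). dist f g < e})"

definition open_L2 :: "L2 set \<Rightarrow> bool" where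
  "open_L2 S = (\<forall>f\<in>S. \<forall>\<^sub>F (f', g) in uniformity. f' = f \<longrightarrow> g \<in> S)"

instance
proof
  fix f g h :: L2 and a b :: real and S :: "L2 set"
  show "f + g + h = f + (g + h)"
    by transfer (auto simp: L2_eq_def square_integrable_add add.assoc)
  show "f + g = g + f"
    by transfer (auto simp: L2_eq_def square_integrable_add add.commute)
  show "0 + f = f"
    by transfer (auto simp: L2_eq_def)
  show "- f + f = 0"
    by transfer (auto simp: L2_eq_def square_integrable_zero)
  show "f - g = f + - g"
    by transfer (auto simp: L2_eq_def square_integrable_diff)
  show "a *\<^sub>R (f + g) = a *\<^sub>R f + a *\<^sub>R g"
    by transfer (auto simp: L2_eq_def square_integrable_add square_integrable_scaleR algebra_simps)
  show "(a + b) *\<^sub>R f = a *\<^sub>R f + b *\<^sub>R f"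
    by transfer (auto simp: L2_eq_def square_integrable_add square_integrable_scaleR algebra_simps)
  show "a *\<^sub>R b *\<^sub>R f = (a * b) *\<^sub>R f"
    by transfer (auto simp: L2_eq_def square_integrable_scaleR)
  show "1 *\<^sub>R f = f"
    by transfer (auto simp: L2_eq_def)
  show "dist f g = norm (f - g)"
    by (simp add: dist_L2_def)
  show "sgn f = scaleR (inverse (norm f)) f"
    by (simp add: sgn_L2_def)
  show "uniformity = (INF e\<in>{0<..}. principal {(f, g). dist f (g :: L2) < e})"
    by (simp add: uniformity_L2_def)
  show "open S = (\<forall>f\<in>S. \<forall>\<^sub>F (f', g) in uniformity. f' = f \<longrightarrow> g \<in> S)"
    by (simp add: open_L2_def)
  show "f \<bullet> g = g \<bullet> f"
    by transfer (simp add: inner_commute)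
  show "(f + g) \<bullet> h = f \<bullet> h + g \<bullet> h"
    by transfer (auto simp: L2_eq_def inner_add_left square_integrable_inner)
  show "a *\<^sub>R f \<bullet> g = a * (f \<bullet> g)"
    by transfer auto
  show "0 \<le> f \<bullet> f"
    by transfer auto
  show "f \<bullet> f = 0 \<longleftrightarrow> f = 0"
  proof transfer
    fix f assume "L2_eq f f"
    then have sq: "square_integrable f" by (simp add: L2_eq_def)
    have "(LINT x|lborel. f x \<bullet> f x) = 0 \<longleftrightarrow> (AE x in lborel. f x \<bullet> f x = 0)"
      by (rule integral_nonneg_eq_0_iff_AE) (auto simp: square_integrable_inner sq)
    then show "(LINT x|lborel. f x \<bullet> f x) = 0 \<longleftrightarrow> L2_eq f (\<lambda>x. 0)"
      using sq by (simp add: L2_eq_def square_integrable_zero)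
  qed
  show "norm f = sqrt (f \<bullet> f)"
    by (simp add: norm_L2_def)
qed

end

lift_definition cscale :: "complex \<Rightarrow> L2 \<Rightarrow> L2" is "\<lambda>c f x. c *s f x"
  by (auto simp: L2_eq_def square_integrable_cscale)


section \<open>Unbounded operators on \<open>L\<^sup>2(\<real>; \<complex>\<^sup>2)\<close>\<close>

text \<open>An operator is given by its domain \<open>A\<close> and a map \<open>T\<close> whose values outside \<open>A\<close>
  are irrelevant.\<close>

definition resolvent :: "L2 set \<Rightarrow> (L2 \<Rightarrow> L2) \<Rightarrow> complex \<Rightarrow> L2 \<Rightarrow> L2" where
  "resolvent A T z = inv_into A (\<lambda>f. T f - cscale z f)"

definition resolvent_set :: "L2 set \<Rightarrow> (L2 \<Rightarrow> L2) \<Rightarrow> complex set" where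
  "resolvent_set A T =
     {z. bij_betw (\<lambda>f. T f - cscale z f) A UNIV \<and> bounded_linear (resolvent A T z)}"

definition op_spectrum :: "L2 set \<Rightarrow> (L2 \<Rightarrow> L2) \<Rightarrow> complex set" where
  "op_spectrum A T = - resolvent_set A T"

definition op_kernel :: "L2 set \<Rightarrow> (L2 \<Rightarrow> L2) \<Rightarrow> complex \<Rightarrow> L2 set" where
  "op_kernel A T z = {f \<in> A. T f - cscale z f = 0}"

definition L2_weak_deriv :: "L2 \<Rightarrow> L2 \<Rightarrow> bool" where
  "L2_weak_deriv f g \<longleftrightarrow>
     (\<forall>\<phi>. test_function UNIV \<phi> \<longrightarrow>
        (LINT x|lborel. vderiv \<phi> x *\<^sub>R rep_L2 f x) = - (LINT x|lborel. \<phi> x *\<^sub>R rep_L2 g x))"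

definition H1 :: "L2 set" where
  "H1 = {f. \<exists>g. L2_weak_deriv f g}"

definition H1_deriv :: "L2 \<Rightarrow> L2" where
  "H1_deriv f = (THE g. L2_weak_deriv f g)"

text \<open>Meaningful when the product is square integrable, e.g. for bounded measurable \<open>A\<close>.\<close>

definition L2_mult :: "(real \<Rightarrow> complex ^ 2 ^ 2) \<Rightarrow> L2 \<Rightarrow> L2" where
  "L2_mult A f = abs_L2 (\<lambda>x. A x *v rep_L2 f x)"


section \<open>The Dirac operator and the transfer matrices\<close>

definition opnorm :: "complex ^ 2 ^ 2 \<Rightarrow> real" where
  "opnorm A = onorm (\<lambda>v. A *v v)"

definition sigma3 :: "complex ^ 2 ^ 2" where
  "sigma3 = vector [vector [1, 0], vector [0, -1]]"

definition Q_matrix :: "real \<Rightarrow> complex \<Rightarrow> complex ^ 2 ^ 2" where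
  "Q_matrix \<kappa> w = vector [vector [0, w], vector [of_real \<kappa> * cnj w, 0]]"

text \<open>Below \<open>u\<close> is the potential at a fixed time; \<open>mat c\<close> is the scalar matrix.\<close>

definition dirac :: "real \<Rightarrow> (real \<Rightarrow> complex) \<Rightarrow> L2 \<Rightarrow> L2" where
  "dirac \<kappa> u f =
     L2_mult (\<lambda>x. mat \<i> ** sigma3) (H1_deriv f) + L2_mult (\<lambda>x. Q_matrix \<kappa> (u x)) f"

definition U_matrix :: "real \<Rightarrow> (real \<Rightarrow> complex) \<Rightarrow> real \<Rightarrow> complex \<Rightarrow> complex ^ 2 ^ 2" where
  "U_matrix \<kappa> u x z = mat (- \<i> * z) ** sigma3 + mat \<i> ** sigma3 ** Q_matrix \<kappa> (u x)"

definition transfer_matrix ::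
  "real \<Rightarrow> (real \<Rightarrow> complex) \<Rightarrow> real \<Rightarrow> real \<Rightarrow> complex \<Rightarrow> complex ^ 2 ^ 2" where
  "transfer_matrix \<kappa> u x y z =
     (THE Y. Y y = mat 1 \<and>
        (\<forall>w. (Y has_vector_derivative (U_matrix \<kappa> u w z ** Y w)) (at w))) x"

definition growth_quotient ::
  "real \<Rightarrow> (real \<Rightarrow> complex) \<Rightarrow> real \<Rightarrow> complex \<Rightarrow> real \<Rightarrow> real \<Rightarrow> real" where
  "growth_quotient \<kappa> u \<epsilon> z y L = ln (opnorm (transfer_matrix \<kappa> u (y + \<epsilon> * L) y z)) / L"

definition upper_growth :: "real \<Rightarrow> (real \<Rightarrow> complex) \<Rightarrow> real \<Rightarrow> complex \<Rightarrow> real \<Rightarrow> ereal" where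
  "upper_growth \<kappa> u \<epsilon> z y = Limsup at_top (\<lambda>L. ereal (growth_quotient \<kappa> u \<epsilon> z y L))"

definition lower_growth :: "real \<Rightarrow> (real \<Rightarrow> complex) \<Rightarrow> real \<Rightarrow> complex \<Rightarrow> real \<Rightarrow> ereal" where
  "lower_growth \<kappa> u \<epsilon> z y = Liminf at_top (\<lambda>L. ereal (growth_quotient \<kappa> u \<epsilon> z y L))"

definition dirac_solution ::
  "real \<Rightarrow> (real \<Rightarrow> complex) \<Rightarrow> complex \<Rightarrow> (real \<Rightarrow> complex ^ 2) \<Rightarrow> bool" where
  "dirac_solution \<kappa> u z f \<longleftrightarrow>
     (\<forall>x. f differentiable (at x) \<and>
          (mat \<i> ** sigma3) *v vderiv f x + Q_matrix \<kappa> (u x) *v f x = z *s f x)"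

text \<open>Solutions are continuous, so the cut-off point \<open>0\<close> of the half-lines is immaterial.\<close>

definition solutions_right ::
  "real \<Rightarrow> (real \<Rightarrow> complex) \<Rightarrow> complex \<Rightarrow> (real \<Rightarrow> complex ^ 2) set" where
  "solutions_right \<kappa> u z =
     {f. dirac_solution \<kappa> u z f \<and> set_integrable lborel {0..} (\<lambda>x. (norm (f x))\<^sup>2)}"

definition solutions_left ::
  "real \<Rightarrow> (real \<Rightarrow> complex) \<Rightarrow> complex \<Rightarrow> (real \<Rightarrow> complex ^ 2) set" where
  "solutions_left \<kappa> u z =
     {f. dirac_solution \<kappa> u z f \<and> set_integrable lborel {..0} (\<lambda>x. (norm (f x))\<^sup>2)}"

end

theory Submission
  imports Defs "HOL-Probability.Probability"
begin

text \<open>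
  The cubic Schroedinger equation is the compatibility condition \<open>U\<^sub>t - V\<^sub>x + [U, V] = 0\<close> of the linear
  systems \<open>Y\<^sub>x = U Y\<close> and \<open>Y\<^sub>t = V Y\<close>, where \<open>V\<close> depends on \<open>q\<close>, \<open>q\<^sub>x\<close> and polynomially on \<open>z\<close> only. Hence the
  solution of \<open>B\<^sub>t = V B\<close>, \<open>B = 1\<close> at time \<open>0\<close>, conjugates the transfer matrices at times \<open>0\<close> and \<open>t\<close>, and
  Gronwall's inequality in \<open>t\<close>, at fixed \<open>x\<close>, bounds it uniformly in \<open>x\<close>. Differentiability in the
  parameter is only needed at one base point: \<open>B(t, x) = Y(t; x, 0) b(t) Y(0; x, 0)\<^sup>-\<^sup>1\<close>, where \<open>b\<close> solves the
  time equation at \<open>x = 0\<close>. From \<open>B\<^sub>x = U(t) B - B U(0)\<close> one obtains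
  \<open>(D(t) - z) B = \<sigma>\<^sub>3 B \<sigma>\<^sub>3 (D(0) - z)\<close> on \<open>H\<^sup>1\<close>, so \<open>D(t) - z\<close> and \<open>D(0) - z\<close> are equivalent up to bounded
  multiplication operators with bounded inverses.

  For solutions in \<open>X\<^sub>5\<close> the necessary regularity comes from Bernstein's inequality on each frequency
  box, stated for finite differences: \<open>\<parallel>\<Delta>\<^bsub>h1\<^esub> \<dots> \<Delta>\<^bsub>hj\<^esub> f\<parallel>\<^sub>\<infinity> \<le> A |h1| \<dots> |hj| \<parallel>f\<parallel>\<^bsub>X5\<^esub>\<close> for \<open>j \<le> 3\<close>. It bounds the
  pointwise derivatives of \<open>f\<close> up to order two and the Lipschitz constant of the second.
\<close>

section \<open>Linear differential equations on the real line\<close>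

text \<open>The two equations for \<open>B\<close> supply different things. The product formula
  satisfies the equation in x by construction but hides the bound, as \<open>Y t x z\<close> may
  grow exponentially in |x|; the equation in t gives the bound but says nothing about x. Proving
  both for one matrix avoids mixed derivatives of solutions. The factor sigma3 B sigma3 is forced:
  the derivative in the Dirac operator carries the matrix i sigma3, which does not commute with
  \<open>B\<close>. \<open>H1\<close> is defined by smooth test functions, while a test function
  times an entry of \<open>B\<close> is handled as a C^1 function only, so integration by parts is
  first extended to C^1. Finite differences replace derivatives because a classical solution has
  pointwise derivatives of unknown continuity: these cannot be identified at once with
  distributional derivatives, whereas a difference means the same for a function and for the
  distribution that it represents. Differences of order at most two bound the jet, third ones make
  the second derivative Lipschitz, and the weight of exponent 5 dominates the factor (1 + |k|)^j, j
  at most 3, that Bernstein's inequality costs on the k-th box.\<close>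

lemma gronwall_forward:
  fixes u :: "real \<Rightarrow> 'a::real_inner"
  assumes u: "\<And>x. (u has_vector_derivative u' x) (at x)"
    and b: "\<And>x. 0 \<le> x \<Longrightarrow> x \<le> X \<Longrightarrow> norm (u' x) \<le> C * norm (u x) + e"
    and C: "0 \<le> C" "0 \<le> e" "0 \<le> X"
  shows "(norm (u X))\<^sup>2 \<le> exp ((2 * C + 1) * X) * ((norm (u 0))\<^sup>2 + e\<^sup>2 * X)"
proof -
  define k where "k = 2 * C + 1"
  \<comment> \<open>The square of the norm is differentiable even where \<open>u\<close> vanishes.
    In \<open>k = 2 * C + 1\<close> the summand 1 absorbs the cross term, by
    \<open>2 * norm (u x) * e\<close> being at most the sum of the two squares. The subtracted
    linear term pays for the square of \<open>e\<close>, since the exponential factor is at most 1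
    for x nonnegative.\<close>
  define \<phi> where "\<phi> = (\<lambda>x. exp (- k * x) * (u x \<bullet> u x) - e\<^sup>2 * x)"
  have d: "DERIV \<phi> x :> exp (- k * x) * (2 * (u x \<bullet> u' x)) - k * exp (- k * x) * (u x \<bullet> u x) - e\<^sup>2" for x
  proof -
    have "((\<lambda>x. u x \<bullet> u x) has_real_derivative 2 * (u x \<bullet> u' x)) (at x)"
      using has_derivative_inner[OF u[of x, unfolded has_vector_derivative_def] u[of x, unfolded has_vector_derivative_def]]
      unfolding has_field_derivative_def
      by (rule has_derivative_eq_rhs) (auto simp: fun_eq_iff inner_commute algebra_simps)
    then show ?thesis unfolding \<phi>_def
      by (auto intro!: derivative_eq_intros)
  qed
  have "\<phi> X \<le> \<phi> 0"
  proof (rule DERIV_nonpos_imp_nonincreasing[OF C(3)])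
    fix x assume x: "0 \<le> x" "x \<le> X"
    have "u x \<bullet> u' x \<le> norm (u x) * norm (u' x)" by (rule norm_cauchy_schwarz)
    also have "\<dots> \<le> norm (u x) * (C * norm (u x) + e)"
      by (intro mult_left_mono b x) auto
    finally have "2 * (u x \<bullet> u' x) \<le> 2 * C * (norm (u x))\<^sup>2 + 2 * norm (u x) * e"
      by (simp add: power2_eq_square algebra_simps)
    also have "\<dots> \<le> k * (norm (u x))\<^sup>2 + e\<^sup>2"
      using sum_squares_bound[of "norm (u x)" e] by (simp add: k_def algebra_simps)
    finally have i: "2 * (u x \<bullet> u' x) \<le> k * (u x \<bullet> u x) + e\<^sup>2" by (simp add: power2_norm_eq_inner)
    have "exp (- k * x) * (2 * (u x \<bullet> u' x)) \<le> exp (- k * x) * (k * (u x \<bullet> u x) + e\<^sup>2)"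
      using i by (intro mult_left_mono) auto
    moreover have "exp (- k * x) * e\<^sup>2 \<le> 1 * e\<^sup>2"
      using C x by (intro mult_right_mono) (auto simp: k_def mult_nonpos_nonneg)
    ultimately have "exp (- k * x) * (2 * (u x \<bullet> u' x)) - k * exp (- k * x) * (u x \<bullet> u x) - e\<^sup>2 \<le> 0"
      by (simp add: algebra_simps)
    then show "\<exists>y. DERIV \<phi> x :> y \<and> y \<le> 0" using d by blast
  qed
  then have "exp (- k * X) * (norm (u X))\<^sup>2 \<le> (norm (u 0))\<^sup>2 + e\<^sup>2 * X"
    by (simp add: \<phi>_def power2_norm_eq_inner)
  then have "exp (k * X) * (exp (- k * X) * (norm (u X))\<^sup>2) \<le> exp (k * X) * ((norm (u 0))\<^sup>2 + e\<^sup>2 * X)"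
    by (intro mult_left_mono) auto
  moreover have "exp (k * X) * (exp (- k * X) * (norm (u X))\<^sup>2) = (norm (u X))\<^sup>2"
    by (simp add: mult.assoc[symmetric] flip: exp_add)
  ultimately show ?thesis unfolding k_def by linarith
qed

lemma gronwall:
  fixes u :: "real \<Rightarrow> 'a::real_inner"
  assumes u: "\<And>x. (u has_vector_derivative u' x) (at x)"
    and b: "\<And>x. \<bar>x\<bar> \<le> R \<Longrightarrow> norm (u' x) \<le> C * norm (u x) + e"
    and C: "0 \<le> C" "0 \<le> e" "\<bar>x\<bar> \<le> R"
  shows "(norm (u x))\<^sup>2 \<le> exp ((2 * C + 1) * \<bar>x\<bar>) * ((norm (u 0))\<^sup>2 + e\<^sup>2 * \<bar>x\<bar>)"
proof (cases "0 \<le> x")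
  case True
  then show ?thesis using gronwall_forward[of u u' x C e, OF u b] C by simp
next
  case False
  have "((\<lambda>x. u (- x)) has_vector_derivative - u' (- y)) (at y)" for y
    using vector_diff_chain_at[of uminus "-1" y u "u' (- y)"] u[of "- y"]
      has_vector_derivative_minus[OF has_vector_derivative_id[of "at y"]]
    by (simp add: o_def id_def)
  from gronwall_forward[of "\<lambda>x. u (- x)" _ "- x" C e, OF this] b False C show ?thesis by simp
qed

text \<open>Uniqueness for continuous coefficients: \<open>A\<close> is bounded in operator norm on
  the compact interval from -|x| to |x|, and Gronwall with \<open>e = 0\<close> propagates the
  initial value 0.\<close>

lemma linear_ode_zero:
  fixes u :: "real \<Rightarrow> 'a::real_inner" and A :: "real \<Rightarrow> 'a \<Rightarrow>\<^sub>L 'a"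
  assumes A: "continuous_on UNIV A"
    and u: "\<And>x. (u has_vector_derivative A x (u x)) (at x)" and "u 0 = 0"
  shows "u x = 0"
proof -
  have "compact (A ` {-\<bar>x\<bar>..\<bar>x\<bar>})"
    using A by (intro compact_continuous_image continuous_on_subset[OF A]) auto
  then obtain C where C: "\<And>y. \<bar>y\<bar> \<le> \<bar>x\<bar> \<Longrightarrow> norm (A y) \<le> C" "0 \<le> C"
    using compact_imp_bounded bounded_pos by (metis abs_le_iff atLeastAtMost_iff image_eqI less_imp_le minus_le_iff)
  have "norm (A y (u y)) \<le> C * norm (u y) + 0" if "\<bar>y\<bar> \<le> \<bar>x\<bar>" for y
    using norm_blinfun[of "A y" "u y"] C(1)[OF that]
    by (smt (verit) mult_right_mono norm_ge_zero)
  from gronwall[of u _ "\<bar>x\<bar>" C 0 x, OF u this] show ?thesis using C assms(3) by simp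
qed

text \<open>At least one of the two intervals is empty or a point, so this is the oriented integral
  from 0 to x for either sign of x.\<close>

definition antiderivative :: "(real \<Rightarrow> 'a::banach) \<Rightarrow> real \<Rightarrow> 'a" where
  "antiderivative f x = integral {0..x} f - integral {x..0} f"

lemma antiderivative_0 [simp]: "antiderivative f 0 = 0"
  by (simp add: antiderivative_def)

lemma has_vector_derivative_antiderivative:
  assumes f: "continuous_on UNIV f"
  shows "(antiderivative f has_vector_derivative f x) (at x)"
proof -
  define R where "R = \<bar>x\<bar> + 1"
  have x: "x \<in> {-R<..<R}" by (auto simp: R_def)
  have int: "f integrable_on {a..b}" for a b
    by (intro integrable_continuous_interval continuous_on_subset[OF f]) auto
  have "((\<lambda>u. integral {-R..u} f) has_vector_derivative f x) (at x within {-R..R})"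
    by (intro integral_has_vector_derivative continuous_on_subset[OF f]) (use x in auto)
  then have "((\<lambda>u. integral {-R..u} f) has_vector_derivative f x) (at x within {-R<..<R})"
    by (rule has_vector_derivative_within_subset) auto
  then have "((\<lambda>u. integral {-R..u} f) has_vector_derivative f x) (at x)"
    using x by (subst (asm) has_vector_derivative_within_open) auto
  then have d: "((\<lambda>u. integral {-R..u} f - integral {-R..0} f) has_vector_derivative f x) (at x)"
    by (auto intro!: derivative_eq_intros)
  have eq: "integral {-R..w} f - integral {-R..0} f = antiderivative f w" if "w \<in> {-R<..<R}" for w
  proof (cases "0 \<le> w")
    case True
    have "integral {-R..0} f + integral {0..w} f = integral {-R..w} f"
      by (rule Henstock_Kurzweil_Integration.integral_combine) (use True int that in auto)
    then show ?thesis using True by (cases "w = 0") (auto simp: antiderivative_def algebra_simps)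
  next
    case False
    have "integral {-R..w} f + integral {w..0} f = integral {-R..0} f"
      by (rule Henstock_Kurzweil_Integration.integral_combine) (use False that int in auto)
    then show ?thesis using False by (auto simp: antiderivative_def algebra_simps)
  qed
  show ?thesis
    by (rule has_vector_derivative_transform_within_open[OF d, of "{-R<..<R}"]) (use x eq in auto)
qed

text \<open>Each integration raises the exponent and divides by it; iterated, this produces the
  factorials that make the Picard series converge.\<close>

lemma norm_antiderivative_le:
  assumes f: "continuous_on UNIV f" and K: "\<And>s. \<bar>s\<bar> \<le> R \<Longrightarrow> norm (f s) \<le> K * \<bar>s\<bar> ^ n" and x: "\<bar>x\<bar> \<le> R"
  shows "norm (antiderivative f x) \<le> K * \<bar>x\<bar> ^ Suc n / Suc n"
proof -
  have int: "f integrable_on {a..b}" for a b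
    by (intro integrable_continuous_interval continuous_on_subset[OF f]) auto
  show ?thesis
  proof (cases "0 \<le> x")
    case True
    have h: "((\<lambda>s. K * s ^ n) has_integral K * x ^ Suc n / Suc n - K * 0 ^ Suc n / Suc n) {0..x}"
    proof (rule fundamental_theorem_of_calculus[OF True])
      fix s
      have "((\<lambda>s. K * s ^ Suc n / Suc n) has_real_derivative K * s ^ n) (at s within {0..x})"
        by (auto intro!: derivative_eq_intros simp: field_simps simp del: of_nat_Suc power_Suc)
      then show "((\<lambda>s. K * s ^ Suc n / Suc n) has_vector_derivative K * s ^ n) (at s within {0..x})"
        by (rule has_real_derivative_iff_has_vector_derivative[THEN iffD1])
    qed
    have "norm (integral {0..x} f) \<le> integral {0..x} (\<lambda>s. K * s ^ n)"
      by (rule integral_norm_bound_integral[OF int]) (use h K x True in \<open>auto simp: has_integral_integrable\<close>,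
          metis abs_of_nonneg order_trans)
    then show ?thesis using True integral_unique[OF h] by (cases "x = 0") (auto simp: antiderivative_def)
  next
    case False
    have h: "((\<lambda>s. K * (- s) ^ n) has_integral (- K * (- 0) ^ Suc n / Suc n) - (- K * (- x) ^ Suc n / Suc n)) {x..0}"
    proof (rule fundamental_theorem_of_calculus)
      show "x \<le> 0" using False by simp
      fix s
      have "((\<lambda>s. - K * (- s) ^ Suc n / Suc n) has_real_derivative K * (- s) ^ n) (at s within {x..0})"
        by (auto intro!: derivative_eq_intros simp: field_simps simp del: of_nat_Suc power_Suc)
      then show "((\<lambda>s. - K * (- s) ^ Suc n / Suc n) has_vector_derivative K * (- s) ^ n) (at s within {x..0})"
        by (rule has_real_derivative_iff_has_vector_derivative[THEN iffD1])
    qed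
    have "norm (f s) \<le> K * (- s) ^ n" if "s \<in> {x..0}" for s
      using K[of s] that x by auto
    then have "norm (integral {x..0} f) \<le> integral {x..0} (\<lambda>s. K * (- s) ^ n)"
      by (intro integral_norm_bound_integral[OF int]) (use h in \<open>auto simp: has_integral_integrable\<close>)
    then show ?thesis using False integral_unique[OF h] by (auto simp: antiderivative_def)
  qed
qed

text \<open>These are the terms of the Neumann series, that is, the increments of the usual Picard
  iterates; the solution is their sum, not their limit.\<close>

primrec picard :: "(real \<Rightarrow> 'a::banach \<Rightarrow>\<^sub>L 'a) \<Rightarrow> 'a \<Rightarrow> nat \<Rightarrow> real \<Rightarrow> 'a" where
  "picard A c 0 = (\<lambda>x. c)"
| "picard A c (Suc n) = antiderivative (\<lambda>s. A s (picard A c n s))"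

text \<open>On every bounded interval the Neumann series and its termwise derivatives are dominated
  by an exponential series. The sum is therefore defined on the whole line at once, and no local
  solutions have to be glued.\<close>

lemma linear_ode_exists:
  fixes A :: "real \<Rightarrow> 'a::banach \<Rightarrow>\<^sub>L 'a"
  assumes A: "continuous_on UNIV A"
  shows "\<exists>u. u 0 = c \<and> (\<forall>x. (u has_vector_derivative A x (u x)) (at x))"
proof -
  let ?y = "picard A c"
  have cont: "continuous_on UNIV (?y n)" for n
  proof (induction n)
    case (Suc n)
    have "continuous_on UNIV (\<lambda>s. A s (?y n s))"
      by (intro continuous_intros A Suc)
    from has_vector_derivative_antiderivative[OF this] show ?case
      by (auto intro!: continuous_at_imp_continuous_on has_vector_derivative_continuous)
  qed simp
  have contA: "continuous_on UNIV (\<lambda>s. A s (?y n s))" for n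
    by (intro continuous_intros A cont)
  have deriv: "(?y (Suc n) has_vector_derivative A x (?y n x)) (at x)" for n x
    using has_vector_derivative_antiderivative[OF contA] by simp
  have "\<exists>M\<ge>0. \<forall>s. \<bar>s\<bar> \<le> R \<longrightarrow> norm (A s) \<le> M" for R
  proof -
    have "compact (A ` {-R..R})"
      using A by (intro compact_continuous_image continuous_on_subset[OF A]) auto
    then obtain M where "M > 0" "\<forall>a \<in> A ` {-R..R}. norm a \<le> M"
      using compact_imp_bounded bounded_pos by metis
    then show ?thesis by (intro exI[of _ M]) (auto simp: abs_le_iff)
  qed
  then obtain M where M: "\<And>R. M R \<ge> 0" "\<And>R s. \<bar>s\<bar> \<le> R \<Longrightarrow> norm (A s) \<le> M R" by metis
  have MA: "norm (A s v) \<le> M R * norm v" if "\<bar>s\<bar> \<le> R" for s R v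
    using norm_blinfun[of "A s" v] M(2)[OF that] by (smt (verit) mult_right_mono norm_ge_zero)
  have bound: "norm (?y n x) \<le> norm c * M R ^ n / fact n * \<bar>x\<bar> ^ n" if "\<bar>x\<bar> \<le> R" for n x R
    using that
  proof (induction n arbitrary: x)
    case (Suc n)
    have "norm (antiderivative (\<lambda>s. A s (?y n s)) x) \<le> (norm c * M R ^ Suc n / fact n) * \<bar>x\<bar> ^ Suc n / Suc n"
    proof (rule norm_antiderivative_le[OF contA _ Suc.prems])
      fix s assume s: "\<bar>s\<bar> \<le> R"
      have "norm (A s (?y n s)) \<le> M R * (norm c * M R ^ n / fact n * \<bar>s\<bar> ^ n)"
        using MA[OF s, of "?y n s"] mult_left_mono[OF Suc.IH[OF s] M(1)[of R]] by linarith
      then show "norm (A s (?y n s)) \<le> norm c * M R ^ Suc n / fact n * \<bar>s\<bar> ^ n"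
        by (simp add: algebra_simps)
    qed
    then show ?case by (simp add: field_simps)
  qed simp
  have bound': "norm (?y n x) \<le> norm c * ((M R * R) ^ n / fact n)" if "\<bar>x\<bar> \<le> R" for n x R
  proof -
    have "norm c * M R ^ n / fact n * \<bar>x\<bar> ^ n \<le> norm c * M R ^ n / fact n * R ^ n"
      using that M(1)[of R] by (intro mult_left_mono power_mono) auto
    then show ?thesis using bound[OF that, of n] by (simp add: power_mult_distrib)
  qed
  have summ: "summable (\<lambda>n. norm c * ((M R * R) ^ n / fact n))" for R
    using summable_exp[of "M R * R"] by (intro summable_mult) (simp add: field_simps)
  have sumy: "summable (\<lambda>n. ?y n x)" for x
    by (rule summable_comparison_test'[OF summ[of "\<bar>x\<bar>"], of 0]) (use bound'[of x "\<bar>x\<bar>"] in auto)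
  \<comment> \<open>The termwise derivatives: the constant term contributes 0 and term n + 1
    contributes \<open>A\<close> applied to term n. This shift by one index turns the sum of the
    derivatives into \<open>A\<close> applied to the sum.\<close>
  define D where "D = (\<lambda>n x. case n of 0 \<Rightarrow> 0 | Suc n \<Rightarrow> A x (?y n x))"
  have Dd: "(?y n has_derivative (\<lambda>h. h *\<^sub>R D n x)) (at x within S)" for n x S
    using deriv[of _ x] by (cases n) (auto simp: D_def has_vector_derivative_def intro: has_derivative_at_withinI)
  have sumD: "summable (\<lambda>n. D n x)" "suminf (\<lambda>n. D n x) = A x (\<Sum>n. ?y n x)" for x
  proof -
    have "(\<lambda>n. A x (?y n x)) sums (A x (\<Sum>n. ?y n x))"
      by (intro bounded_linear.sums[OF blinfun.bounded_linear_right] summable_sums sumy)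
    then have "(\<lambda>n. D (Suc n) x) sums (A x (\<Sum>n. ?y n x))" by (simp add: D_def)
    then have "(\<lambda>n. D n x) sums (A x (\<Sum>n. ?y n x))" by (subst (asm) sums_Suc_iff) (simp add: D_def)
    then show "summable (\<lambda>n. D n x)" "suminf (\<lambda>n. D n x) = A x (\<Sum>n. ?y n x)"
      by (auto simp: sums_iff)
  qed
  define u where "u x = (\<Sum>n. ?y n x)" for x
  have "(u has_vector_derivative A x (u x)) (at x)" for x
  proof -
    define R where "R = \<bar>x\<bar> + 1"
    define S where "S = {-R<..<R}"
    have xS: "x \<in> S" "open S" "convex S" by (auto simp: S_def R_def)
    have unif: "uniform_limit S (\<lambda>n x. \<Sum>i<n. D i x) (\<lambda>x. suminf (\<lambda>i. D i x)) sequentially"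
    proof (rule Weierstrass_m_test)
      show "norm (D n x) \<le> (case n of 0 \<Rightarrow> 0 | Suc n \<Rightarrow> M R * (norm c * ((M R * R) ^ n / fact n)))" if "x \<in> S" for n x
      proof (cases n)
        case (Suc k)
        have "\<bar>x\<bar> \<le> R" using that by (auto simp: S_def)
        then show ?thesis
          using Suc MA[of x R "?y k x"] mult_left_mono[OF bound'[of x R k] M(1)[of R]] by (simp add: D_def)
      qed (simp add: D_def)
      show "summable (\<lambda>n. case n of 0 \<Rightarrow> 0 | Suc n \<Rightarrow> M R * (norm c * ((M R * R) ^ n / fact n)))"
        by (subst summable_Suc_iff[symmetric]) (use summable_mult[OF summ[of R], of "M R"] in simp)
    qed
    have "\<exists>g. \<forall>x\<in>S. (\<lambda>n. ?y n x) sums g x \<and> (g has_derivative (\<lambda>h. h *\<^sub>R suminf (\<lambda>i. D i x))) (at x within S)"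
    proof (rule has_derivative_series[OF xS(3) Dd _ xS(1)])
      show "(\<lambda>n. ?y n x) sums u x" unfolding u_def by (rule summable_sums[OF sumy])
      fix e :: real assume "0 < e"
      then have "\<forall>\<^sub>F n in sequentially. \<forall>x\<in>S. dist (\<Sum>i<n. D i x) (suminf (\<lambda>i. D i x)) < e"
        using unif by (auto simp: uniform_limit_iff)
      then show "\<forall>\<^sub>F n in sequentially. \<forall>x\<in>S. \<forall>h. norm ((\<Sum>i<n. h *\<^sub>R D i x) - h *\<^sub>R suminf (\<lambda>i. D i x)) \<le> e * norm h"
      proof eventually_elim
        case (elim n)
        show ?case
        proof (intro ballI allI)
          fix x h assume "x \<in> S"
          have "norm ((\<Sum>i<n. h *\<^sub>R D i x) - h *\<^sub>R suminf (\<lambda>i. D i x)) = \<bar>h\<bar> * dist (\<Sum>i<n. D i x) (suminf (\<lambda>i. D i x))"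
            by (simp add: dist_norm flip: scaleR_sum_right scaleR_diff_right)
          also have "\<dots> \<le> \<bar>h\<bar> * e"
            using elim \<open>x \<in> S\<close> by (intro mult_left_mono) (auto intro: less_imp_le)
          finally show "norm ((\<Sum>i<n. h *\<^sub>R D i x) - h *\<^sub>R suminf (\<lambda>i. D i x)) \<le> e * norm h"
            by (simp add: mult.commute)
        qed
      qed
    qed
    then obtain g where g: "\<And>x. x \<in> S \<Longrightarrow> (\<lambda>n. ?y n x) sums g x"
        "\<And>x. x \<in> S \<Longrightarrow> (g has_derivative (\<lambda>h. h *\<^sub>R suminf (\<lambda>i. D i x))) (at x within S)" by blast
    have "(g has_vector_derivative A x (u x)) (at x within S)"
      using g(2)[OF xS(1)] by (simp add: has_vector_derivative_def sumD u_def)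
    then have "(g has_vector_derivative A x (u x)) (at x)"
      using xS by (subst (asm) has_vector_derivative_within_open) auto
    then show ?thesis
      by (rule has_vector_derivative_transform_within_open[OF _ xS(2,1)])
         (use g(1) in \<open>auto simp: u_def sums_iff\<close>)
  qed
  moreover have "u 0 = c"
  proof -
    have "?y n 0 = (if n = 0 then c else 0)" for n by (cases n) auto
    then show ?thesis unfolding u_def using suminf_finite[of "{0}" "\<lambda>n. ?y n 0"] by simp
  qed
  ultimately show ?thesis by blast
qed

lemma bounded_bilinear_matrix_matrix_mult:
  "bounded_bilinear (\<lambda>(A :: complex ^ 2 ^ 2) (B :: complex ^ 2 ^ 2). A ** B)"
proof (subst bilinear_conv_bounded_bilinear[symmetric])
  show "bilinear (\<lambda>(A :: complex ^ 2 ^ 2) (B :: complex ^ 2 ^ 2). A ** B)"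
    by (auto simp: bilinear_def linear_iff matrix_matrix_mult_def vec_eq_iff UNIV_2 algebra_simps)
qed

lemma bounded_bilinear_matrix_vector_mult:
  "bounded_bilinear (\<lambda>(A :: complex ^ 2 ^ 2) v. A *v v)"
proof (subst bilinear_conv_bounded_bilinear[symmetric])
  show "bilinear (\<lambda>(A :: complex ^ 2 ^ 2) v. A *v v)"
    by (auto simp: bilinear_def linear_iff matrix_vector_mult_def vec_eq_iff UNIV_2 algebra_simps)
qed

section \<open>Transfer matrices\<close>

text \<open>A general bilinear product covers both the matrix equation with the coefficient on the
  left and the adjoint one with it on the right and a minus sign. Translation by \<open>y\<close>
  reduces to the initial point 0.\<close>

lemma
  fixes prod :: "'b::euclidean_space \<Rightarrow> 'a::euclidean_space \<Rightarrow> 'a"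
  assumes prod: "bounded_bilinear prod" and A: "continuous_on UNIV A"
  shows bilinear_ode_exists: "\<exists>u. u y = c \<and> (\<forall>x. (u has_vector_derivative prod (A x) (u x)) (at x))"
    and bilinear_ode_unique:
      "\<lbrakk>\<And>x. (u has_vector_derivative prod (A x) (u x)) (at x);
        \<And>x. (v has_vector_derivative prod (A x) (v x)) (at x); u y = v y\<rbrakk> \<Longrightarrow> u = v"
proof -
  interpret bounded_bilinear prod by (rule prod)
  define L where "L a = Blinfun (prod a)" for a
  have L: "blinfun_apply (L a) v = prod a v" for a v
    unfolding L_def by (simp add: bounded_linear_Blinfun_apply bounded_linear_right)
  have "linear L"
    by (rule linearI; rule blinfun_eqI) (simp_all add: L add_left scaleR_left blinfun.add_left blinfun.scaleR_left)
  then have cL: "continuous_on UNIV (\<lambda>x. L (A (x + y)))"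
    by (intro linear_continuous_on_compose[of UNIV _ L]
        continuous_on_compose2[OF A] continuous_intros) auto
  have shift: "((\<lambda>x. f (x + s)) has_vector_derivative f') (at x)"
    if "(f has_vector_derivative f') (at (x + s))" for f :: "real \<Rightarrow> 'a" and f' x s
    using vector_diff_chain_at[of "\<lambda>x. x + s" 1 x f f'] that
      has_vector_derivative_add[OF has_vector_derivative_id[of "at x"] has_vector_derivative_const[of s]]
    by (simp add: o_def)
  from linear_ode_exists[OF cL, of c] obtain w where
    w: "w 0 = c" "\<And>x. (w has_vector_derivative prod (A (x + y)) (w x)) (at x)"
    by (auto simp: L)
  show "\<exists>u. u y = c \<and> (\<forall>x. (u has_vector_derivative prod (A x) (u x)) (at x))"
    using w(1) shift[of w _ _ "- y"] w(2)[of "_ - y"]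
    by (intro exI[of _ "\<lambda>x. w (x - y)"]) simp
  assume u: "\<And>x. (u has_vector_derivative prod (A x) (u x)) (at x)"
    and v: "\<And>x. (v has_vector_derivative prod (A x) (v x)) (at x)" and uv: "u y = v y"
  show "u = v"
  proof
    fix x
    have "((\<lambda>x. u (x + y) - v (x + y)) has_vector_derivative L (A (w + y)) (u (w + y) - v (w + y))) (at w)" for w
      unfolding L diff_right by (intro has_vector_derivative_diff shift u v)
    from linear_ode_zero[OF cL this, of "x - y"] uv show "u x = v x" by simp
  qed
qed

lemmas matrix_ode_exists = bilinear_ode_exists[OF bounded_bilinear_matrix_matrix_mult]
lemmas matrix_ode_unique = bilinear_ode_unique[OF bounded_bilinear_matrix_matrix_mult]

lemma has_vector_derivative_matrix_mult:
  fixes F G :: "real \<Rightarrow> complex ^ 2 ^ 2"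
  assumes "(F has_vector_derivative F') (at x)" "(G has_vector_derivative G') (at x)"
  shows "((\<lambda>x. F x ** G x) has_vector_derivative F x ** G' + F' ** G x) (at x)"
  using bounded_bilinear.has_vector_derivative[OF bounded_bilinear_matrix_matrix_mult assms] .

lemma minus_matrix_mult: "(- A) ** B = - (A ** B)" for A B :: "complex ^ 2 ^ 2"
  using bounded_bilinear.minus_left[OF bounded_bilinear_matrix_matrix_mult] .

lemma matrix_mult_minus: "A ** (- B) = - (A ** B)" for A B :: "complex ^ 2 ^ 2"
  using bounded_bilinear.minus_right[OF bounded_bilinear_matrix_matrix_mult] .

lemma
  fixes A :: "complex ^ 2 ^ 2"
  assumes "invertible A"
  shows matrix_mult_inv: "A ** matrix_inv A = mat 1" and matrix_inv_mult: "matrix_inv A ** A = mat 1"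
  using someI_ex[OF assms[unfolded invertible_def]] unfolding matrix_inv_def by auto

lemma matrix_inv_eqI:
  fixes A B :: "complex ^ 2 ^ 2"
  assumes "B ** A = mat 1"
  shows "invertible A" "matrix_inv A = B"
proof -
  have AB: "A ** B = mat 1" using assms matrix_left_right_inverse by blast
  then show i: "invertible A" using assms by (auto simp: invertible_def)
  have "matrix_inv A ** (A ** B) = B"
    unfolding matrix_mul_assoc using matrix_inv_mult[OF i] by (simp add: matrix_mul_lid)
  then show "matrix_inv A = B" by (simp add: AB matrix_mul_rid)
qed

text \<open>The solution \<open>M\<close> of the adjoint equation M' = - M A makes
  \<open>M x ** Y x\<close> constant, hence 1. Invertibility and the derivative of the inverse come
  together, without differentiating matrix inversion.\<close>

lemma fundamental_matrix_inverse:
  fixes Y A :: "real \<Rightarrow> complex ^ 2 ^ 2"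
  assumes A: "continuous_on UNIV A" and Y: "\<And>x. (Y has_vector_derivative A x ** Y x) (at x)"
    and y: "Y y = mat 1"
  shows "invertible (Y x)"
    and "((\<lambda>x. matrix_inv (Y x)) has_vector_derivative - (matrix_inv (Y x) ** A x)) (at x)"
proof -
  have bb: "bounded_bilinear (\<lambda>(A :: complex ^ 2 ^ 2) (B :: complex ^ 2 ^ 2). - (B ** A))"
    using bounded_bilinear.comp1[OF bounded_bilinear.flip[OF bounded_bilinear_matrix_matrix_mult]
        bounded_linear_minus[OF bounded_linear_ident]]
    by (subst (asm) matrix_mult_minus)
  obtain M where M: "M y = mat 1" "\<And>x. (M has_vector_derivative - (M x ** A x)) (at x)"
    using bilinear_ode_exists[OF bb A] by metis
  have "((\<lambda>x. M x ** Y x) has_vector_derivative 0) (at x)" for x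
    using has_vector_derivative_matrix_mult[OF M(2) Y, of x]
    by (simp add: minus_matrix_mult matrix_mul_assoc)
  then have "\<exists>c. \<forall>x. M x ** Y x = c"
    using has_vector_derivative_zero_constant[of UNIV "\<lambda>x. M x ** Y x"] by (metis UNIV_I convex_UNIV)
  then have MY: "M x ** Y x = mat 1" for x
    using M(1) y by (metis matrix_mul_lid)
  then show "invertible (Y x)" using matrix_inv_eqI by blast
  have "matrix_inv (Y x) = M x" for x using matrix_inv_eqI(2)[OF MY] .
  with M(2) show "((\<lambda>x. matrix_inv (Y x)) has_vector_derivative - (matrix_inv (Y x) ** A x)) (at x)"
    by simp
qed

section \<open>Calculus of two-by-two matrices by entries\<close>

definition mat2 :: "complex \<Rightarrow> complex \<Rightarrow> complex \<Rightarrow> complex \<Rightarrow> complex ^ 2 ^ 2" where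
  "mat2 a b c d = vector [vector [a, b], vector [c, d]]"

lemma mat2_nth [simp]:
  "mat2 a b c d $ 1 $ 1 = a" "mat2 a b c d $ 1 $ 2 = b" "mat2 a b c d $ 2 $ 1 = c" "mat2 a b c d $ 2 $ 2 = d"
  by (simp_all add: mat2_def)

lemma mat2_eqI:
  "A $ 1 $ 1 = B $ 1 $ 1 \<Longrightarrow> A $ 1 $ 2 = B $ 1 $ 2 \<Longrightarrow> A $ 2 $ 1 = B $ 2 $ 1 \<Longrightarrow> A $ 2 $ 2 = B $ 2 $ 2 \<Longrightarrow> A = B"
  for A B :: "complex ^ 2 ^ 2"
  by (simp add: vec_eq_iff forall_2)

lemma mat2_simps:
  "mat2 a b c d + mat2 a' b' c' d' = mat2 (a + a') (b + b') (c + c') (d + d')"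
  "mat2 a b c d - mat2 a' b' c' d' = mat2 (a - a') (b - b') (c - c') (d - d')"
  "r *\<^sub>R mat2 a b c d = mat2 (r *\<^sub>R a) (r *\<^sub>R b) (r *\<^sub>R c) (r *\<^sub>R d)"
  "mat2 a b c d ** mat2 a' b' c' d' = mat2 (a * a' + b * c') (a * b' + b * d') (c * a' + d * c') (c * b' + d * d')"
  by (rule mat2_eqI; simp add: matrix_matrix_mult_def sum_2)+

lemma norm_mat2_le: "norm (mat2 a b c d) \<le> norm a + norm b + norm c + norm d"
proof -
  have "mat2 a b c d = mat2 a 0 0 0 + mat2 0 b 0 0 + mat2 0 0 c 0 + mat2 0 0 0 d"
    by (simp add: mat2_simps)
  moreover have "norm (mat2 a 0 0 0) = norm a" "norm (mat2 0 b 0 0) = norm b"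
    "norm (mat2 0 0 c 0) = norm c" "norm (mat2 0 0 0 d) = norm d"
    by (simp_all add: norm_vec_def L2_set_def sum_2)
  moreover have "norm (A + B + C + D) \<le> norm A + norm B + norm C + norm D" for A B C D :: "complex ^ 2 ^ 2"
    by (intro order_trans[OF norm_triangle_ineq] add_mono order_refl)
  ultimately show ?thesis by metis
qed

lemma has_vector_derivative_mat2:
  assumes "(a has_vector_derivative a') (at x)" "(b has_vector_derivative b') (at x)"
    "(c has_vector_derivative c') (at x)" "(d has_vector_derivative d') (at x)"
  shows "((\<lambda>x. mat2 (a x) (b x) (c x) (d x)) has_vector_derivative mat2 a' b' c' d') (at x)"
proof -
  have l: "bounded_linear (\<lambda>a. mat2 a 0 0 0)" "bounded_linear (\<lambda>a. mat2 0 a 0 0)"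
    "bounded_linear (\<lambda>a. mat2 0 0 a 0)" "bounded_linear (\<lambda>a. mat2 0 0 0 a)"
    by (auto simp: linear_conv_bounded_linear[symmetric] linear_iff mat2_simps)
  have eq: "mat2 a b c d = mat2 a 0 0 0 + mat2 0 b 0 0 + mat2 0 0 c 0 + mat2 0 0 0 d" for a b c d
    by (simp add: mat2_simps)
  show ?thesis
    by (subst (1 2) eq) (intro has_vector_derivative_add assms bounded_linear.has_vector_derivative[OF l(1)]
       bounded_linear.has_vector_derivative[OF l(2)] bounded_linear.has_vector_derivative[OF l(3)]
       bounded_linear.has_vector_derivative[OF l(4)])
qed

lemma continuous_on_mat2 [continuous_intros]:
  assumes "continuous_on S a" "continuous_on S b" "continuous_on S c" "continuous_on S d"
  shows "continuous_on S (\<lambda>x. mat2 (a x) (b x) (c x) (d x))"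
proof -
  have l: "bounded_linear (\<lambda>a. mat2 a 0 0 0)" "bounded_linear (\<lambda>a. mat2 0 a 0 0)"
    "bounded_linear (\<lambda>a. mat2 0 0 a 0)" "bounded_linear (\<lambda>a. mat2 0 0 0 a)"
    by (auto simp: linear_conv_bounded_linear[symmetric] linear_iff mat2_simps)
  have eq: "mat2 a b c d = mat2 a 0 0 0 + mat2 0 b 0 0 + mat2 0 0 c 0 + mat2 0 0 0 d" for a b c d
    by (simp add: mat2_simps)
  show ?thesis
    by (subst eq) (intro continuous_on_add assms bounded_linear.continuous_on[OF l(1)]
       bounded_linear.continuous_on[OF l(2)] bounded_linear.continuous_on[OF l(3)]
       bounded_linear.continuous_on[OF l(4)])
qed

lemma U_matrix_mat2:
  "U_matrix \<kappa> u x z = mat2 (- \<i> * z) (\<i> * u x) (- \<i> * \<kappa> * cnj (u x)) (\<i> * z)"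
  by (rule mat2_eqI; simp add: U_matrix_def sigma3_def Q_matrix_def mat_def matrix_matrix_mult_def sum_2)

lemma continuous_U_matrix:
  "continuous_on UNIV u \<Longrightarrow> continuous_on UNIV (\<lambda>x. U_matrix \<kappa> u x z)"
  unfolding U_matrix_mat2 by (intro continuous_intros)

text \<open>Existence and uniqueness of the fundamental solution justify the definite description in
  \<open>transfer_matrix\<close>; afterwards only these three facts about it are used.\<close>

lemma
  assumes u: "continuous_on UNIV u"
  shows transfer_matrix_self: "transfer_matrix \<kappa> u y y z = mat 1"
    and has_vector_derivative_transfer_matrix:
      "((\<lambda>x. transfer_matrix \<kappa> u x y z) has_vector_derivative
         U_matrix \<kappa> u x z ** transfer_matrix \<kappa> u x y z) (at x)"
    and transfer_matrix_unique:
      "\<lbrakk>Y y = mat 1; \<And>x. (Y has_vector_derivative U_matrix \<kappa> u x z ** Y x) (at x)\<rbrakk>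
        \<Longrightarrow> transfer_matrix \<kappa> u x y z = Y x"
proof -
  let ?P = "\<lambda>Y. Y y = mat 1 \<and> (\<forall>w. (Y has_vector_derivative U_matrix \<kappa> u w z ** Y w) (at w))"
  have uniq: "Y = Y'" if "?P Y" "?P Y'" for Y Y'
    by (rule matrix_ode_unique[OF continuous_U_matrix[OF u], where y = y]) (use that in auto)
  have ex: "\<exists>!Y. ?P Y"
    using matrix_ode_exists[OF continuous_U_matrix[OF u]] uniq by (rule ex_ex1I)
  have t: "(\<lambda>x. transfer_matrix \<kappa> u x y z) = The ?P"
    by (simp add: transfer_matrix_def fun_eq_iff)
  have P: "?P (\<lambda>x. transfer_matrix \<kappa> u x y z)"
    using theI'[OF ex] unfolding t[symmetric] .
  then show "transfer_matrix \<kappa> u y y z = mat 1"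
    "((\<lambda>x. transfer_matrix \<kappa> u x y z) has_vector_derivative
         U_matrix \<kappa> u x z ** transfer_matrix \<kappa> u x y z) (at x)" by blast+
  assume "Y y = mat 1" "\<And>x. (Y has_vector_derivative U_matrix \<kappa> u x z ** Y x) (at x)"
  with uniq[OF P, of Y] show "transfer_matrix \<kappa> u x y z = Y x" by (auto simp: fun_eq_iff)
qed

lemma invertible_transfer_matrix:
  "continuous_on UNIV u \<Longrightarrow> invertible (transfer_matrix \<kappa> u x y z)"
  by (rule fundamental_matrix_inverse[OF continuous_U_matrix has_vector_derivative_transfer_matrix
        transfer_matrix_self])

text \<open>Both sides solve the same equation in \<open>x\<close> and equal 1 at
  \<open>x = y\<close>. This reduces every base point to 0, the only one at which the time
  dependence is studied.\<close>

lemma transfer_matrix_eq_mult_inv: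
  assumes u: "continuous_on UNIV u"
  shows "transfer_matrix \<kappa> u x y z = transfer_matrix \<kappa> u x 0 z ** matrix_inv (transfer_matrix \<kappa> u y 0 z)"
proof (rule transfer_matrix_unique[OF u])
  show "transfer_matrix \<kappa> u y 0 z ** matrix_inv (transfer_matrix \<kappa> u y 0 z) = mat 1"
    using matrix_mult_inv[OF invertible_transfer_matrix[OF u]] .
  fix x
  show "((\<lambda>x. transfer_matrix \<kappa> u x 0 z ** matrix_inv (transfer_matrix \<kappa> u y 0 z)) has_vector_derivative
      U_matrix \<kappa> u x z ** (transfer_matrix \<kappa> u x 0 z ** matrix_inv (transfer_matrix \<kappa> u y 0 z))) (at x)"
    unfolding matrix_mul_assoc
    by (rule bounded_linear.has_vector_derivative[OF
          bounded_bilinear.bounded_linear_left[OF bounded_bilinear_matrix_matrix_mult]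
          has_vector_derivative_transfer_matrix[OF u]])
qed

section \<open>The zero-curvature equation\<close>

locale nls_solution =
  fixes \<kappa> :: real and q :: "real \<Rightarrow> real \<Rightarrow> complex"
  assumes kappa: "\<kappa> \<in> {1, -1}"
    and classical: "classical_solution \<kappa> q"
    and regular: "strip_regular q"
begin

abbreviation "qx t \<equiv> vderiv (q t)"
abbreviation "qxx t \<equiv> vderiv (vderiv (q t))"

text \<open>The equation solved for the time derivative. In this form its joint continuity is
  inherited from \<open>q\<close> and \<open>qxx\<close>.\<close>

definition "qt t x = \<i> / 2 * qxx t x - \<i> * of_real \<kappa> * of_real ((norm (q t x))\<^sup>2) * q t x"

lemma abs_kappa [simp]: "\<bar>\<kappa>\<bar> = 1"
  using kappa by auto

lemma q_derivatives:
  shows "(q t has_vector_derivative qx t x) (at x)"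
    and "(qx t has_vector_derivative qxx t x) (at x)"
    and "((\<lambda>r. q r x) has_vector_derivative qt t x) (at t)"
proof -
  have c: "(\<lambda>r. q r x) differentiable (at t)" "q t differentiable (at x)" "vderiv (q t) differentiable (at x)"
    and e: "\<i> * vderiv (\<lambda>r. q r x) t = - (1 / 2) * vderiv (vderiv (q t)) x
              + of_real \<kappa> * of_real ((norm (q t x))\<^sup>2) * q t x"
    using classical unfolding classical_solution_def by auto
  show "(q t has_vector_derivative qx t x) (at x)" "(qx t has_vector_derivative qxx t x) (at x)"
    using c vector_derivative_works by (auto simp: vderiv_def[abs_def])
  have "vderiv (\<lambda>r. q r x) t = - \<i> * (\<i> * vderiv (\<lambda>r. q r x) t)" by simp
  also have "\<dots> = qt t x" unfolding e qt_def by (simp add: algebra_simps)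
  finally show "((\<lambda>r. q r x) has_vector_derivative qt t x) (at t)"
    using c(1) unfolding vderiv_def by (simp add: vector_derivative_works)
qed

lemma vderiv_power_le_2: "(vderiv ^^ 0) (q t) = q t" "(vderiv ^^ 1) (q t) = qx t" "(vderiv ^^ 2) (q t) = qxx t"
  by (simp_all add: numeral_2_eq_2)

text \<open>Continuity relative to closed strips becomes continuity at a point, because the strip of
  half-width |t| + 1 contains the point in its interior.\<close>

lemma continuous_on_jet:
  assumes "j \<le> 2"
  shows "continuous_on UNIV (\<lambda>p. (vderiv ^^ j) (q (fst p)) (snd p))"
proof (rule continuous_at_imp_continuous_on, rule ballI)
  fix p :: "real \<times> real"
  define T where "T = \<bar>fst p\<bar> + 1"
  have "continuous_on ({-T..T} \<times> UNIV) (\<lambda>p. (vderiv ^^ j) (q (fst p)) (snd p))"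
    using regular assms unfolding strip_regular_def by (simp add: case_prod_unfold)
  then have "continuous_on ({-T<..<T} \<times> UNIV) (\<lambda>p. (vderiv ^^ j) (q (fst p)) (snd p))"
    by (rule continuous_on_subset) auto
  then show "isCont (\<lambda>p. (vderiv ^^ j) (q (fst p)) (snd p)) p"
    by (rule continuous_on_interior) (auto simp: interior_open open_Times T_def mem_Times_iff)
qed

lemma q_continuous:
  shows "continuous_on UNIV (\<lambda>p. q (fst p) (snd p))"
    and "continuous_on UNIV (\<lambda>p. qx (fst p) (snd p))"
    and "continuous_on UNIV (\<lambda>p. qxx (fst p) (snd p))"
    and "continuous_on UNIV (\<lambda>p. qt (fst p) (snd p))"
proof -
  show "continuous_on UNIV (\<lambda>p. q (fst p) (snd p))"
    and "continuous_on UNIV (\<lambda>p. qx (fst p) (snd p))"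
    and "continuous_on UNIV (\<lambda>p. qxx (fst p) (snd p))"
    using continuous_on_jet[of 0] continuous_on_jet[of 1] continuous_on_jet[of 2]
    by (simp_all add: numeral_2_eq_2)
  then show "continuous_on UNIV (\<lambda>p. qt (fst p) (snd p))"
    unfolding qt_def by (intro continuous_intros)
qed

lemma q_continuous_slices:
  "continuous_on S (q t)" "continuous_on S (\<lambda>r. q r x)" "continuous_on S (\<lambda>r. qx r x)"
  using continuous_on_compose2[OF q_continuous(1), of S "\<lambda>x. (t, x)"]
    continuous_on_compose2[OF q_continuous(1), of S "\<lambda>r. (r, x)"]
    continuous_on_compose2[OF q_continuous(2), of S "\<lambda>r. (r, x)"]
  by (simp_all add: continuous_on_Pair continuous_on_id continuous_on_const)

lemma q_bounded:
  obtains C where "0 \<le> C" "\<And>t x. \<bar>t\<bar> \<le> T \<Longrightarrow> norm (q t x) \<le> C"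
    "\<And>t x. \<bar>t\<bar> \<le> T \<Longrightarrow> norm (qx t x) \<le> C" "\<And>t x. \<bar>t\<bar> \<le> T \<Longrightarrow> norm (qxx t x) \<le> C"
proof -
  have "\<exists>c. \<forall>t x. \<bar>t\<bar> \<le> T \<longrightarrow> norm ((vderiv ^^ j) (q t) x) \<le> c" if "j \<le> 2" for j
    using regular that unfolding strip_regular_def bounded_iff
    by (force simp: abs_le_iff)
  then obtain c where
    "\<forall>j\<le>2. \<forall>t x. \<bar>t\<bar> \<le> T \<longrightarrow> norm ((vderiv ^^ j) (q t) x) \<le> c j"
    by metis
  then have c: "\<forall>t x. \<bar>t\<bar> \<le> T \<longrightarrow> norm (q t x) \<le> c 0" "\<forall>t x. \<bar>t\<bar> \<le> T \<longrightarrow> norm (qx t x) \<le> c 1"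
    "\<forall>t x. \<bar>t\<bar> \<le> T \<longrightarrow> norm (qxx t x) \<le> c 2"
    using vderiv_power_le_2 by (metis le_numeral_extra(3) zero_le, metis one_le_numeral, metis order_refl)
  show thesis
    by (rule that[of "max 0 (max (c 0) (max (c 1) (c 2)))"]) (use c in \<open>auto simp: le_max_iff_disj\<close>)
qed

abbreviation U where "U t x z \<equiv> U_matrix \<kappa> (q t) x z"
abbreviation Y where "Y t x z \<equiv> transfer_matrix \<kappa> (q t) x 0 z"

text \<open>The time component of the Zakharov--Shabat pair; its off-diagonal entries are \<open>z u + \<i> u\<^sub>x / 2\<close> and
  \<open>z r - \<i> r\<^sub>x / 2\<close> with \<open>u = \<i> q\<close> and \<open>r = - \<i> \<kappa> cnj q\<close>, those of \<open>U\<close>.\<close>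

definition V where
  "V t x z = mat2 (- \<i> * z\<^sup>2 - \<i> / 2 * of_real \<kappa> * (q t x * cnj (q t x))) (\<i> * z * q t x - qx t x / 2)
     (- \<i> * of_real \<kappa> * z * cnj (q t x) - of_real \<kappa> * cnj (qx t x) / 2)
     (\<i> * z\<^sup>2 + \<i> / 2 * of_real \<kappa> * (q t x * cnj (q t x)))"

text \<open>The time derivative of \<open>U\<close>; the spectral parameter enters \<open>U\<close>
  only through time-independent terms and drops out.\<close>

definition Ut where "Ut t x = mat2 0 (\<i> * qt t x) (- \<i> * \<kappa> * cnj (qt t x)) 0"

lemma q_continuous_qt: "continuous_on S (qt t)"
  using continuous_on_compose2[OF q_continuous(4), of S "\<lambda>x. (t, x)"]
  by (simp add: continuous_on_Pair continuous_on_id continuous_on_const)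

text \<open>In the upper right entry of the commutator the quadratic terms in \<open>z\<close>
  cancel, the linear one matches the linear term of the derivative of \<open>V\<close>, and the
  constant terms leave the Schroedinger equation, which enters through \<open>qt\<close>. The
  diagonal is the product rule for \<open>q * cnj q\<close>, and the lower left entry is
  analogous.\<close>

lemma zero_curvature:
  "((\<lambda>x. V t x z) has_vector_derivative Ut t x + U t x z ** V t x z - V t x z ** U t x z) (at x)"
proof -
  note cn = has_vector_derivative_cnj[OF q_derivatives(1)] has_vector_derivative_cnj[OF q_derivatives(2)]
  have n: "complex_of_real (cmod (q t x)) * complex_of_real (cmod (q t x)) = q t x * cnj (q t x)"
    using complex_norm_square[of "q t x"] by (simp add: power2_eq_square)
  have k: "complex_of_real \<kappa> * complex_of_real \<kappa> = 1" using kappa by auto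
  show ?thesis unfolding V_def
    apply (rule has_vector_derivative_eq_rhs, rule has_vector_derivative_mat2)
        apply (rule derivative_eq_intros q_derivatives cn refl)+
    apply (rule mat2_eqI)
    apply (simp_all add: Ut_def U_matrix_mat2 mat2_simps qt_def)
    apply (simp_all add: algebra_simps power2_eq_square n)
    done
qed

lemma bounded_matrix_mult:
  obtains K where "K > 0" "\<And>(A :: complex ^ 2 ^ 2) (B :: complex ^ 2 ^ 2). norm (A ** B) \<le> K * norm A * norm B"
proof -
  obtain K where "K > 0" "\<And>(A :: complex ^ 2 ^ 2) (B :: complex ^ 2 ^ 2). norm (A ** B) \<le> norm A * norm B * K"
    using bounded_bilinear.pos_bounded[OF bounded_bilinear_matrix_matrix_mult] by blast
  then show thesis by (intro that[of K]) (auto simp: ac_simps)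
qed

lemma U_bounded:
  obtains C where "0 \<le> C" "\<And>t x z. \<bar>t\<bar> \<le> T \<Longrightarrow> norm z \<le> K \<Longrightarrow> norm (U t x z) \<le> C"
proof -
  obtain C where C: "0 \<le> C" "\<And>t x. \<bar>t\<bar> \<le> T \<Longrightarrow> norm (q t x) \<le> C"
    using q_bounded by metis
  \<comment> \<open>The absolute value keeps the constant nonnegative when \<open>K\<close> is
    negative and the claim is vacuous.\<close>
  have "norm (U t x z) \<le> 2 * \<bar>K\<bar> + 2 * C" if "\<bar>t\<bar> \<le> T" "norm z \<le> K" for t x z
    using norm_mat2_le[of "- \<i> * z" "\<i> * q t x" "- \<i> * \<kappa> * cnj (q t x)" "\<i> * z"] C(2)[OF that(1), of x] that(2)
    unfolding U_matrix_mat2 by (simp add: norm_mult)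
  then show thesis using that[of "2 * \<bar>K\<bar> + 2 * C"] C(1) by auto
qed

lemma V_bounded:
  obtains C where "0 \<le> C" "\<And>t x z. \<bar>t\<bar> \<le> T \<Longrightarrow> norm z \<le> K \<Longrightarrow> norm (V t x z) \<le> C"
proof -
  obtain C where C: "0 \<le> C" "\<And>t x. \<bar>t\<bar> \<le> T \<Longrightarrow> norm (q t x) \<le> C" "\<And>t x. \<bar>t\<bar> \<le> T \<Longrightarrow> norm (qx t x) \<le> C"
    using q_bounded by metis
  define a where "a = K\<^sup>2 + C\<^sup>2"
  define b where "b = \<bar>K\<bar> * C + C"
  have "norm (V t x z) \<le> a + b + b + a" if t: "\<bar>t\<bar> \<le> T" and z: "norm z \<le> K" for t x z
  proof -
    have z2: "norm (z\<^sup>2) \<le> K\<^sup>2" using z by (simp add: norm_power power_mono)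
    have q2: "norm (\<i> / 2 * of_real \<kappa> * (q t x * cnj (q t x))) \<le> C\<^sup>2"
    proof -
      have "norm (q t x) * norm (q t x) \<le> C * C" using C(1) C(2)[OF t] by (intro mult_mono) auto
      moreover have "0 \<le> C * C" by (rule zero_le_square)
      ultimately have "norm (q t x) * norm (q t x) \<le> C * C * 2" by linarith
      then show ?thesis by (simp add: norm_mult norm_divide power2_eq_square)
    qed
    have zq: "norm (z * q t x) \<le> \<bar>K\<bar> * C"
      unfolding norm_mult using z C(1) C(2)[OF t] by (intro mult_mono) auto
    have p: "norm (qx t x / 2) \<le> C" using C(3)[OF t, of x] C(1) by (simp add: norm_divide)
    have 1: "norm (- \<i> * z\<^sup>2 - \<i> / 2 * of_real \<kappa> * (q t x * cnj (q t x))) \<le> a"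
      unfolding a_def by (intro order_trans[OF norm_triangle_ineq4] add_mono q2) (use z2 in \<open>simp add: norm_mult\<close>)
    have 2: "norm (\<i> * z * q t x - qx t x / 2) \<le> b"
      unfolding b_def by (intro order_trans[OF norm_triangle_ineq4] add_mono p) (use zq in \<open>simp add: norm_mult\<close>)
    have 3: "norm (- \<i> * of_real \<kappa> * z * cnj (q t x) - of_real \<kappa> * cnj (qx t x) / 2) \<le> b"
      unfolding b_def by (intro order_trans[OF norm_triangle_ineq4] add_mono)
        (use zq p in \<open>simp_all add: norm_mult norm_divide\<close>)
    have 4: "norm (\<i> * z\<^sup>2 + \<i> / 2 * of_real \<kappa> * (q t x * cnj (q t x))) \<le> a"
      unfolding a_def by (intro order_trans[OF norm_triangle_ineq] add_mono q2) (use z2 in \<open>simp add: norm_mult\<close>)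
    show ?thesis unfolding V_def
      by (intro order_trans[OF norm_mat2_le] add_mono 1 2 3 4)
  qed
  moreover have "0 \<le> a + b + b + a" using C(1) by (simp add: a_def b_def)
  ultimately show thesis using that by blast
qed

lemma has_vector_derivative_Y: "((\<lambda>x. Y t x z) has_vector_derivative U t x z ** Y t x z) (at x)"
  by (rule has_vector_derivative_transfer_matrix[OF q_continuous_slices(1)])

lemma Y_0 [simp]: "Y t 0 z = mat 1"
  by (rule transfer_matrix_self[OF q_continuous_slices(1)])

text \<open>The bound is uniform in time but only local in x. That suffices for difference quotients
  at a fixed point; bounds uniform in x are obtained later for \<open>B\<close>, not for
  \<open>Y\<close>.\<close>

lemma Y_bounded:
  obtains M where "0 \<le> M" "\<And>t x. \<bar>t\<bar> \<le> T \<Longrightarrow> \<bar>x\<bar> \<le> X \<Longrightarrow> norm (Y t x z) \<le> M"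
proof -
  obtain C where C: "0 \<le> C" "\<And>t x. \<bar>t\<bar> \<le> T \<Longrightarrow> norm (U t x z) \<le> C"
    using U_bounded[of T "norm z"] by (metis order_refl)
  obtain K where K: "K > 0" "\<And>(A :: complex ^ 2 ^ 2) (B :: complex ^ 2 ^ 2). norm (A ** B) \<le> K * norm A * norm B"
    using bounded_matrix_mult by blast
  define I where "I = (norm (mat 1 :: complex ^ 2 ^ 2))\<^sup>2"
  have "norm (Y t x z) \<le> sqrt (exp ((2 * (K * C) + 1) * X) * I)" if t: "\<bar>t\<bar> \<le> T" and x: "\<bar>x\<bar> \<le> X" for t x
  proof -
    have "norm (U t w z ** Y t w z) \<le> K * C * norm (Y t w z) + 0" for w
      using order_trans[OF K(2) mult_right_mono[OF mult_left_mono[OF C(2)[OF t] less_imp_le[OF K(1)]] norm_ge_zero]]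
      by simp
    from gronwall[of "\<lambda>x. Y t x z", OF has_vector_derivative_Y this, where R = X and x = x] K C(1) x
    have "(norm (Y t x z))\<^sup>2 \<le> exp ((2 * (K * C) + 1) * \<bar>x\<bar>) * I" by (simp add: I_def)
    also have "\<dots> \<le> exp ((2 * (K * C) + 1) * X) * I"
      using x K C(1) by (intro mult_right_mono) (auto simp: I_def intro!: mult_left_mono)
    finally show ?thesis by (rule real_le_rsqrt)
  qed
  moreover have "0 \<le> sqrt (exp ((2 * (K * C) + 1) * X) * I)" by (simp add: I_def)
  ultimately show thesis using that by blast
qed

text \<open>The mean value inequality in time, at fixed x, with the oscillation of \<open>qt\<close>
  controlled by uniform continuity on a compact rectangle. Uniformity in x is what lets the estimate
  enter a differential equation in x.\<close>

lemma difference_quotient_q: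
  assumes "e > 0"
  shows "\<forall>\<^sub>F h in at 0. \<forall>x. \<bar>x\<bar> \<le> X \<longrightarrow> norm ((1 / h) *\<^sub>R (q (t + h) x - q t x) - qt t x) \<le> e"
proof -
  define S where "S = {t - 1..t + 1} \<times> {-X..X}"
  have "uniformly_continuous_on S (\<lambda>p. qt (fst p) (snd p))"
    by (intro compact_uniformly_continuous continuous_on_subset[OF q_continuous(4)])
       (auto simp: S_def intro: compact_Times)
  then obtain d where d: "d > 0" "\<And>p p'. p \<in> S \<Longrightarrow> p' \<in> S \<Longrightarrow> dist p' p < d \<Longrightarrow>
      dist (qt (fst p') (snd p')) (qt (fst p) (snd p)) < e"
    using assms unfolding uniformly_continuous_on_def by metis
  have "norm ((1 / h) *\<^sub>R (q (t + h) x - q t x) - qt t x) \<le> e"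
    if h: "h \<noteq> 0" "\<bar>h\<bar> < min d 1" and x: "\<bar>x\<bar> \<le> X" for h x
  proof -
    have "norm (q (t + h) x - q t x - (t + h - t) *\<^sub>R qt t x) \<le> norm (t + h - t) * e"
    proof (rule vector_differentiable_bound_linearization[where S = "closed_segment t (t + h)" and f' = "\<lambda>r. qt r x"])
      show "((\<lambda>r. q r x) has_vector_derivative qt r x) (at r within closed_segment t (t + h))" for r
        by (rule has_vector_derivative_at_within[OF q_derivatives(3)])
      fix r assume r: "r \<in> closed_segment t (t + h)"
      then have r: "\<bar>r - t\<bar> \<le> \<bar>h\<bar>" by (auto simp: closed_segment_eq_real_ivl split: if_splits)
      then have "(t, x) \<in> S" "(r, x) \<in> S" using h x by (auto simp: S_def)
      then show "norm (qt r x - qt t x) \<le> e"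
        using d(2)[of "(t, x)" "(r, x)"] h r by (auto simp: dist_Pair_Pair dist_norm)
    qed auto
    then have "norm ((1 / h) *\<^sub>R (q (t + h) x - q t x - h *\<^sub>R qt t x)) \<le> (1 / \<bar>h\<bar>) * (\<bar>h\<bar> * e)"
      unfolding norm_scaleR by (intro mult_mono) auto
    then show ?thesis using h by (simp add: scaleR_diff_right)
  qed
  then show ?thesis
    unfolding eventually_at using d(1) by (intro exI[of _ "min d 1"]) (auto simp: dist_norm)
qed

text \<open>The matrix \<open>Z = V(t, x) Y - Y V(t, 0)\<close> solves the inhomogeneous equation
  \<open>Z\<^sub>x = U Z + U\<^sub>t Y\<close>, which is also the equation of \<open>\<partial>\<^sub>t Y\<close>; Gronwall's inequality compares
  \<open>Z\<close> with the difference quotients of \<open>Y\<close> in \<open>t\<close>.\<close>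

lemma has_vector_derivative_Y_time:
  "((\<lambda>t. Y t x z) has_vector_derivative V t x z ** Y t x z - Y t x z ** V t 0 z) (at t)"
proof -
  define X where "X = \<bar>x\<bar>"
  define Z where "Z w = V t w z ** Y t w z - Y t w z ** V t 0 z" for w
  \<comment> \<open>\<open>E\<close> is the error of the difference quotient of \<open>Y\<close>
    against the proposed derivative \<open>Z\<close>, and \<open>N\<close> is the corresponding
    error for \<open>U\<close>. The aim is that smallness of \<open>N\<close> forces smallness of
    \<open>E\<close>.\<close>
  define E where "E h w = (1 / h) *\<^sub>R (Y (t + h) w z - Y t w z) - Z w" for h w
  define N where "N h w = (1 / h) *\<^sub>R (U (t + h) w z - U t w z) - Ut t w" for h w
  interpret mm: bounded_bilinear "\<lambda>(A :: complex ^ 2 ^ 2) (B :: complex ^ 2 ^ 2). A ** B" by (rule bounded_bilinear_matrix_matrix_mult)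
  have Z': "(Z has_vector_derivative Ut t w ** Y t w z + U t w z ** Z w) (at w)" for w
    unfolding Z_def[abs_def]
    by (rule has_vector_derivative_eq_rhs, rule has_vector_derivative_diff,
        rule has_vector_derivative_matrix_mult[OF zero_curvature has_vector_derivative_Y],
        rule has_vector_derivative_matrix_mult[OF has_vector_derivative_Y has_vector_derivative_const])
       (simp add: mm.add_left mm.add_right mm.diff_left mm.diff_right matrix_mul_assoc)
  \<comment> \<open>The product difference is split so that \<open>N\<close> multiplies
    \<open>Y\<close> at time t + h. The resulting discrepancy \<open>Ut\<close> times
    \<open>Y (t + h) - Y t\<close> is rewritten as \<open>h\<close> times \<open>Ut\<close> times
    \<open>E + Z\<close>, which is again linear in \<open>E\<close>.\<close>
  have E'_eq: "(1 / h) *\<^sub>R (U (t + h) w z ** Y (t + h) w z - U t w z ** Y t w z) - (Ut t w ** Y t w z + U t w z ** Z w) =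
      U t w z ** ((1 / h) *\<^sub>R (Y (t + h) w z - Y t w z) - Z w) + N h w ** Y (t + h) w z +
      h *\<^sub>R (Ut t w ** ((1 / h) *\<^sub>R (Y (t + h) w z - Y t w z) - Z w + Z w))"
    if "h \<noteq> 0" for h w
  proof -
    have 1: "h *\<^sub>R (Ut t w ** ((1 / h) *\<^sub>R (Y (t + h) w z - Y t w z) - Z w + Z w)) =
        Ut t w ** Y (t + h) w z - Ut t w ** Y t w z"
      using that by (simp add: mm.diff_right mm.scaleR_right)
    have 2: "N h w ** Y (t + h) w z =
        (1 / h) *\<^sub>R (U (t + h) w z ** Y (t + h) w z - U t w z ** Y (t + h) w z) - Ut t w ** Y (t + h) w z"
      by (simp add: N_def mm.diff_left mm.scaleR_left)
    have 3: "U t w z ** ((1 / h) *\<^sub>R (Y (t + h) w z - Y t w z) - Z w) =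
        (1 / h) *\<^sub>R (U t w z ** Y (t + h) w z - U t w z ** Y t w z) - U t w z ** Z w"
      by (simp add: mm.diff_right mm.scaleR_right)
    show ?thesis unfolding 1 2 3 by (simp add: scaleR_diff_right)
  qed
  have E': "(E h has_vector_derivative
      U t w z ** E h w + N h w ** Y (t + h) w z + h *\<^sub>R (Ut t w ** (E h w + Z w))) (at w)"
    if "h \<noteq> 0" for h w
    unfolding E_def[abs_def]
    by (rule has_vector_derivative_eq_rhs, rule has_vector_derivative_diff,
        rule bounded_linear.has_vector_derivative[OF bounded_linear_scaleR_right],
        rule has_vector_derivative_diff[OF has_vector_derivative_Y has_vector_derivative_Y], rule Z')
       (rule E'_eq[OF that])
  have E0: "E h 0 = 0" for h by (simp add: E_def Z_def)
  obtain K where K: "K > 0" "\<And>(A :: complex ^ 2 ^ 2) (B :: complex ^ 2 ^ 2). norm (A ** B) \<le> K * norm A * norm B"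
    using bounded_matrix_mult by blast
  obtain CU where CU: "0 \<le> CU" "\<And>x. norm (U t x z) \<le> CU"
    using U_bounded[of "\<bar>t\<bar>" "norm z"] by (metis order_refl)
  obtain M where M: "0 \<le> M" "\<And>s w. \<bar>s\<bar> \<le> \<bar>t\<bar> + 1 \<Longrightarrow> \<bar>w\<bar> \<le> X \<Longrightarrow> norm (Y s w z) \<le> M"
    using Y_bounded by metis
  have contZ: "continuous_on UNIV Z"
    using Z' by (auto intro!: continuous_at_imp_continuous_on has_vector_derivative_continuous)
  have contUt: "continuous_on UNIV (Ut t)"
    unfolding Ut_def[abs_def] by (intro continuous_intros q_continuous_qt)
  have bdd: "\<exists>C\<ge>0. \<forall>w. \<bar>w\<bar> \<le> X \<longrightarrow> norm (f w) \<le> C" if "continuous_on UNIV f" for f :: "real \<Rightarrow> complex ^ 2 ^ 2"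
  proof -
    have "compact (f ` {-X..X})"
      by (intro compact_continuous_image continuous_on_subset[OF that]) auto
    then obtain M where "M > 0" "\<forall>a \<in> f ` {-X..X}. norm a \<le> M"
      using compact_imp_bounded bounded_pos by metis
    then show ?thesis by (intro exI[of _ M]) (auto simp: abs_le_iff)
  qed
  obtain CZ where CZ: "0 \<le> CZ" "\<And>w. \<bar>w\<bar> \<le> X \<Longrightarrow> norm (Z w) \<le> CZ" using bdd[OF contZ] by blast
  obtain Ct where Ct: "0 \<le> Ct" "\<And>w. \<bar>w\<bar> \<le> X \<Longrightarrow> norm (Ut t w) \<le> Ct" using bdd[OF contUt] by blast
  \<comment> \<open>\<open>C\<close> multiplies the norm of \<open>E\<close>: the first summand
    comes from \<open>U\<close>, the second from \<open>Ut\<close> with |h| at most 1.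
    \<open>D\<close> is the source per unit of \<open>e\<close>: \<open>N\<close> times
    \<open>Y\<close>, where \<open>M\<close> bounds \<open>Y\<close> at times up to |t| + 1, and
    \<open>h\<close> times \<open>Ut\<close> times \<open>Z\<close> with |h| at most
    \<open>e\<close>.\<close>
  define C where "C = K * CU + K * Ct"
  define D where "D = K * M + K * Ct * CZ"
  have CD: "0 \<le> C" "0 \<le> D" using K CU Ct CZ M by (auto simp: C_def D_def)
  define G where "G = sqrt (exp ((2 * C + 1) * X) * X)"
  have est: "\<forall>\<^sub>F h in at 0. norm (E h x) \<le> G * (D * e)" if e: "e > 0" for e
  proof -
    have "\<forall>\<^sub>F h in at 0. \<bar>h\<bar> \<le> min 1 e \<and> h \<noteq> 0"
      unfolding eventually_at using e by (intro exI[of _ "min 1 e"]) (auto simp: dist_norm)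
    moreover have "\<forall>\<^sub>F h in at 0. \<forall>x. \<bar>x\<bar> \<le> X \<longrightarrow> norm ((1 / h) *\<^sub>R (q (t + h) x - q t x) - qt t x) \<le> e / 2"
      by (rule difference_quotient_q) (use e in auto)
    ultimately show ?thesis
    proof eventually_elim
      case (elim h)
      have N: "norm (N h w) \<le> e" if w: "\<bar>w\<bar> \<le> X" for w
      proof -
        define d where "d = (1 / h) *\<^sub>R (q (t + h) w - q t w) - qt t w"
        have "N h w = mat2 0 (\<i> * d) (- \<i> * \<kappa> * cnj d) 0"
          by (rule mat2_eqI) (auto simp: N_def U_matrix_mat2 mat2_simps Ut_def d_def algebra_simps scaleR_conv_of_real[where 'a = complex])
        also have "norm \<dots> \<le> norm d + norm d"
          using norm_mat2_le[of 0 "\<i> * d" "- \<i> * \<kappa> * cnj d" 0] by (simp add: norm_mult)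
        finally show ?thesis using elim w by (auto simp: d_def)
      qed
      have "norm (U t w z ** E h w + N h w ** Y (t + h) w z + h *\<^sub>R (Ut t w ** (E h w + Z w))) \<le> C * norm (E h w) + D * e"
        if w: "\<bar>w\<bar> \<le> X" for w
      proof -
        have 1: "norm (U t w z ** E h w) \<le> K * CU * norm (E h w)"
          using K(1) CU by (intro order_trans[OF K(2)] mult_right_mono mult_left_mono) auto
        have 2: "norm (N h w ** Y (t + h) w z) \<le> K * e * M"
          using K(1) N[OF w] M(2)[of "t + h" w] elim w e
          by (intro order_trans[OF K(2)] mult_mono) auto
        have "norm (Ut t w ** (E h w + Z w)) \<le> K * Ct * (norm (E h w) + CZ)"
          using K(1) Ct(1) Ct(2)[OF w] CZ(2)[OF w]
          by (intro order_trans[OF K(2)] mult_mono order_trans[OF norm_triangle_ineq] add_mono) auto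
        then have 3: "norm (h *\<^sub>R (Ut t w ** (E h w + Z w))) \<le> \<bar>h\<bar> * (K * Ct * (norm (E h w) + CZ))"
          unfolding norm_scaleR by (intro mult_left_mono) auto
        have "\<bar>h\<bar> * (K * Ct * (norm (E h w) + CZ)) = \<bar>h\<bar> * (K * Ct * norm (E h w)) + \<bar>h\<bar> * (K * Ct * CZ)"
          by (simp add: algebra_simps)
        also have "\<dots> \<le> 1 * (K * Ct * norm (E h w)) + e * (K * Ct * CZ)"
          using elim K(1) Ct CZ by (intro add_mono mult_right_mono) auto
        finally have "\<bar>h\<bar> * (K * Ct * (norm (E h w) + CZ)) \<le> K * Ct * norm (E h w) + K * Ct * CZ * e"
          by (simp add: algebra_simps)
        with 3 have 3: "norm (h *\<^sub>R (Ut t w ** (E h w + Z w))) \<le> K * Ct * norm (E h w) + K * Ct * CZ * e"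
          by linarith
        have "C * norm (E h w) + D * e = K * CU * norm (E h w) + K * e * M + (K * Ct * norm (E h w) + K * Ct * CZ * e)"
          by (simp add: C_def D_def algebra_simps)
        then show ?thesis
          using 1 2 3 by (intro order_trans[OF norm_triangle_ineq] order_trans[OF add_mono[OF norm_triangle_ineq order_refl]]) linarith
      qed
      from gronwall[of "E h", OF E' this, where R = X and x = x] elim CD e
      have "(norm (E h x))\<^sup>2 \<le> exp ((2 * C + 1) * X) * ((D * e)\<^sup>2 * X)" by (simp add: E0 X_def)
      then have "norm (E h x) \<le> sqrt (exp ((2 * C + 1) * X) * ((D * e)\<^sup>2 * X))" by (rule real_le_rsqrt)
      also have "\<dots> = G * (D * e)"
      proof -
        have "exp ((2 * C + 1) * X) * ((D * e)\<^sup>2 * X) = (exp ((2 * C + 1) * X) * X) * (D * e)\<^sup>2"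
          by (simp only: mult.assoc mult.commute[of X])
        moreover have "0 \<le> D * e" using CD e by simp
        ultimately show ?thesis unfolding G_def by (simp only: real_sqrt_mult real_sqrt_abs abs_of_nonneg)
      qed
      finally show ?case .
    qed
  qed
  have "((\<lambda>h. E h x) \<longlongrightarrow> 0) (at 0)"
  proof (rule tendstoI)
    fix e :: real assume "e > 0"
    \<comment> \<open>The tolerance is divided by \<open>G * D + 1\<close> rather than by
      \<open>G * D\<close>, which may be 0 and would not give a strict inequality.\<close>
    have G: "0 \<le> G * D" using CD by (simp add: G_def X_def)
    have "\<forall>\<^sub>F h in at 0. norm (E h x) \<le> G * (D * (e / (G * D + 1)))"
      using G \<open>e > 0\<close> by (intro est) auto
    then show "\<forall>\<^sub>F h in at 0. dist (E h x) 0 < e"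
    proof eventually_elim
      case (elim h)
      have "G * (D * (e / (G * D + 1))) < e" using G \<open>e > 0\<close> by (simp add: field_simps)
      with elim show ?case by simp
    qed
  qed
  then have "((\<lambda>h. norm (E h x)) \<longlongrightarrow> 0) (at 0)" by (rule tendsto_norm_zero)
  then have "((\<lambda>h. norm (Y (t + h) x z - Y t x z - h *\<^sub>R Z x) / norm h) \<longlongrightarrow> 0) (at 0)"
  proof (rule Lim_transform_eventually)
    show "\<forall>\<^sub>F h in at 0. norm (E h x) = norm (Y (t + h) x z - Y t x z - h *\<^sub>R Z x) / norm h"
      unfolding eventually_at
    proof (intro exI[of _ 1] conjI ballI impI, simp)
      fix h :: real assume "h \<noteq> 0 \<and> dist h 0 < 1"
      then have "E h x = (1 / h) *\<^sub>R (Y (t + h) x z - Y t x z - h *\<^sub>R Z x)"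
        by (simp add: E_def scaleR_diff_right)
      then show "norm (E h x) = norm (Y (t + h) x z - Y t x z - h *\<^sub>R Z x) / norm h" by simp
    qed
  qed
  then show ?thesis
    by (simp add: has_vector_derivative_def has_derivative_at bounded_linear_scaleR_left Z_def)
qed

end

section \<open>Gauge transformations of the Dirac system\<close>

lemma dirac_solution_iff:
  "dirac_solution \<kappa> u z f \<longleftrightarrow> (\<forall>x. (f has_vector_derivative U_matrix \<kappa> u x z *v f x) (at x))"
proof -
  have eq: "(mat \<i> ** sigma3) *v g + Q_matrix \<kappa> w *v v = z *s v \<longleftrightarrow>
      g = mat2 (- \<i> * z) (\<i> * w) (- \<i> * \<kappa> * cnj w) (\<i> * z) *v v" for g v :: "complex ^ 2" and w
  proof -
    have c: "\<i> * a + b = c \<longleftrightarrow> a = - \<i> * c + \<i> * b" "- (\<i> * a) + b = c \<longleftrightarrow> a = \<i> * c - \<i> * b" for a b c :: complex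
      by (auto simp: algebra_simps complex_eq_iff)
    have "(mat \<i> ** sigma3) *v g + Q_matrix \<kappa> w *v v = z *s v \<longleftrightarrow>
        \<i> * g $ 1 + w * v $ 2 = z * v $ 1 \<and> - (\<i> * g $ 2) + \<kappa> * cnj w * v $ 1 = z * v $ 2"
      by (simp add: vec_eq_iff forall_2 mat_def sigma3_def Q_matrix_def matrix_vector_mult_def
          matrix_matrix_mult_def sum_2)
    also have "\<dots> \<longleftrightarrow> g = mat2 (- \<i> * z) (\<i> * w) (- \<i> * \<kappa> * cnj w) (\<i> * z) *v v"
      unfolding c by (auto simp: vec_eq_iff forall_2 matrix_vector_mult_def sum_2 algebra_simps)
    finally show ?thesis .
  qed
  show ?thesis
    unfolding dirac_solution_def eq U_matrix_mat2 vderiv_def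
    by (metis vector_derivative_works vector_derivative_at differentiableI_vector)
qed

text \<open>The differential equation says that multiplication by \<open>G\<close> carries the
  first-order system of \<open>u\<close> to that of \<open>v\<close>. The bound makes this usable in
  square-integrable spaces. The pointwise inverse of an invertible gauge satisfies the equation with
  \<open>u\<close> and \<open>v\<close> exchanged.\<close>

definition dirac_gauge ::
  "real \<Rightarrow> (real \<Rightarrow> complex) \<Rightarrow> (real \<Rightarrow> complex) \<Rightarrow> complex \<Rightarrow> (real \<Rightarrow> complex ^ 2 ^ 2) \<Rightarrow> real \<Rightarrow> bool" where
  "dirac_gauge \<kappa> u v z G C \<longleftrightarrow> 0 \<le> C \<and>
     (\<forall>x. (G has_vector_derivative U_matrix \<kappa> v x z ** G x - G x ** U_matrix \<kappa> u x z) (at x) \<and>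
          norm (G x) \<le> C)"

lemma opnorm_facts:
  fixes A B :: "complex ^ 2 ^ 2"
  shows norm_matrix_vector_le: "norm (A *v v) \<le> opnorm A * norm v"
    and opnorm_nonneg: "0 \<le> opnorm A"
    and opnorm_mult_le: "opnorm (A ** B) \<le> opnorm A * opnorm B"
    and opnorm_pos: "invertible A \<Longrightarrow> 0 < opnorm A"
proof -
  have bl: "bounded_linear (\<lambda>v. A *v v)" for A :: "complex ^ 2 ^ 2"
    by (rule bounded_bilinear.bounded_linear_right[OF bounded_bilinear_matrix_vector_mult])
  show le: "norm (A *v v) \<le> opnorm A * norm v" for v unfolding opnorm_def by (rule onorm[OF bl])
  show nn: "0 \<le> opnorm A" unfolding opnorm_def by (rule onorm_pos_le[OF bl])
  show "opnorm (A ** B) \<le> opnorm A * opnorm B"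
    unfolding opnorm_def using onorm_compose[OF bl bl, of A B] by (simp add: o_def matrix_vector_mul_assoc)
  show "0 < opnorm A" if "invertible A"
  proof (rule ccontr)
    assume "\<not> 0 < opnorm A"
    then have "A *v v = 0" for v using le[of v] nn by simp
    then have "matrix_inv A *v (A *v axis 1 1) = 0" by simp
    then have "(axis 1 1 :: complex ^ 2) = 0" using matrix_inv_mult[OF that] by (simp add: matrix_vector_mul_assoc)
    then show False by (simp add: axis_eq_0_iff)
  qed
qed

lemma opnorm_le_norm:
  obtains c where "0 < c" "\<And>A. opnorm A \<le> c * norm A"
proof -
  obtain K where K: "K > 0" "\<And>(A :: complex ^ 2 ^ 2) v. norm (A *v v) \<le> norm A * norm v * K"
    using bounded_bilinear.pos_bounded[OF bounded_bilinear_matrix_vector_mult] by blast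
  have "opnorm A \<le> K * norm A" for A
    unfolding opnorm_def
  proof (rule onorm_bound)
    show "norm (A *v v) \<le> K * norm A * norm v" for v
      using K(2)[of A v] by (simp add: ac_simps)
  qed (use K(1) in auto)
  then show thesis using K(1) that by blast
qed

lemma gauge_dirac_solution:
  assumes G: "dirac_gauge \<kappa> u v z G C" and f: "dirac_solution \<kappa> u z f"
  shows "dirac_solution \<kappa> v z (\<lambda>x. G x *v f x)"
  unfolding dirac_solution_iff
proof
  fix x
  have "((\<lambda>x. G x *v f x) has_vector_derivative
      G x *v (U_matrix \<kappa> u x z *v f x) + (U_matrix \<kappa> v x z ** G x - G x ** U_matrix \<kappa> u x z) *v f x) (at x)"
    by (rule bounded_bilinear.has_vector_derivative[OF bounded_bilinear_matrix_vector_mult])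
       (use G f in \<open>auto simp: dirac_gauge_def dirac_solution_iff\<close>)
  then show "((\<lambda>x. G x *v f x) has_vector_derivative U_matrix \<kappa> v x z *v (G x *v f x)) (at x)"
    by (simp add: matrix_vector_mul_assoc matrix_vector_mult_diff_rdistrib)
qed

lemma gauge_square_integrable:
  assumes G: "dirac_gauge \<kappa> u v z G C" and f: "dirac_solution \<kappa> u z f"
    and "set_integrable lborel S (\<lambda>x. (norm (f x))\<^sup>2)" "S \<in> sets lborel"
  shows "set_integrable lborel S (\<lambda>x. (norm (G x *v f x))\<^sup>2)"
proof -
  obtain c where c: "0 < c" "\<And>A. opnorm A \<le> c * norm A" using opnorm_le_norm by blast
  have i: "set_integrable lborel S (\<lambda>x. (c * C)\<^sup>2 * (norm (f x))\<^sup>2)"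
    using assms(3) by (intro set_integrable_mult_right)
  have "continuous_on UNIV (\<lambda>x. G x *v f x)"
    using gauge_dirac_solution[OF G f] unfolding dirac_solution_iff
    by (auto intro!: continuous_at_imp_continuous_on has_vector_derivative_continuous)
  then have m: "(\<lambda>x. (norm (G x *v f x))\<^sup>2) \<in> borel_measurable borel"
    by (intro borel_measurable_continuous_onI continuous_intros)
  have le: "(norm (G x *v f x))\<^sup>2 \<le> (c * C)\<^sup>2 * (norm (f x))\<^sup>2" for x
  proof -
    have "opnorm (G x) \<le> c * C"
      using c G by (intro order_trans[OF c(2)] mult_left_mono) (auto simp: dirac_gauge_def)
    then have "norm (G x *v f x) \<le> c * C * norm (f x)"
      by (intro order_trans[OF norm_matrix_vector_le] mult_right_mono) auto
    then show ?thesis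
      unfolding power_mult_distrib[symmetric] by (rule power_mono) auto
  qed
  show ?thesis
    by (rule set_integrable_bound[OF i]) (use m assms(4) le in \<open>auto simp: set_borel_measurable_def\<close>)
qed

lemma gauge_solutions:
  assumes "dirac_gauge \<kappa> u v z G C"
  shows "f \<in> solutions_right \<kappa> u z \<Longrightarrow> (\<lambda>x. G x *v f x) \<in> solutions_right \<kappa> v z"
    and "f \<in> solutions_left \<kappa> u z \<Longrightarrow> (\<lambda>x. G x *v f x) \<in> solutions_left \<kappa> v z"
  using gauge_dirac_solution[OF assms] gauge_square_integrable[OF assms]
  by (auto simp: solutions_right_def solutions_left_def)

lemma gauge_bij_solutions:
  assumes G: "dirac_gauge \<kappa> u v z G C" "dirac_gauge \<kappa> v u z (\<lambda>x. matrix_inv (G x)) C" "\<And>x. invertible (G x)"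
  shows "bij_betw (\<lambda>f x. G x *v f x) (solutions_right \<kappa> u z) (solutions_right \<kappa> v z)"
    and "bij_betw (\<lambda>f x. G x *v f x) (solutions_left \<kappa> u z) (solutions_left \<kappa> v z)"
  by (rule bij_betw_byWitness[where f' = "\<lambda>f x. matrix_inv (G x) *v f x"];
      auto intro: gauge_solutions[OF G(1)] gauge_solutions[OF G(2)]
        simp: matrix_vector_mul_assoc matrix_mult_inv[OF G(3)] matrix_inv_mult[OF G(3)])+

text \<open>Eventually \<open>f\<close> is below \<open>g + e\<close>, so both limits of
  \<open>f\<close> are at most those of \<open>g\<close> plus \<open>e\<close>. Arguing with finite
  \<open>e\<close> in the extended reals also covers infinite limits; the converse is the same with
  the roles exchanged.\<close>

lemma Limsup_Liminf_eq_of_diff: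
  fixes f g :: "real \<Rightarrow> real"
  assumes "((\<lambda>L. f L - g L) \<longlongrightarrow> 0) at_top"
  shows "Limsup at_top (\<lambda>L. ereal (f L)) = Limsup at_top (\<lambda>L. ereal (g L))"
    and "Liminf at_top (\<lambda>L. ereal (f L)) = Liminf at_top (\<lambda>L. ereal (g L))"
proof -
  have "Limsup at_top (\<lambda>L. ereal (f L)) \<le> Limsup at_top (\<lambda>L. ereal (g L)) \<and>
      Liminf at_top (\<lambda>L. ereal (f L)) \<le> Liminf at_top (\<lambda>L. ereal (g L))"
    if "((\<lambda>L. f L - g L) \<longlongrightarrow> 0) at_top" for f g :: "real \<Rightarrow> real"
  proof -
    have ev: "\<forall>\<^sub>F L in at_top. ereal (f L) \<le> ereal (g L) + ereal e" if "e > 0" for e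
      using tendstoD[OF \<open>((\<lambda>L. f L - g L) \<longlongrightarrow> 0) at_top\<close> that]
      by eventually_elim (auto simp: dist_real_def)
    have "Limsup at_top (\<lambda>L. ereal (f L)) \<le> Limsup at_top (\<lambda>L. ereal (g L)) + ereal e" if "e > 0" for e
      using Limsup_mono[OF ev[OF that]] by (subst (asm) Limsup_add_ereal_right) auto
    moreover have "Liminf at_top (\<lambda>L. ereal (f L)) \<le> Liminf at_top (\<lambda>L. ereal (g L)) + ereal e" if "e > 0" for e
      using Liminf_mono[OF ev[OF that]] by (subst (asm) Liminf_add_ereal_right) auto
    ultimately show ?thesis using ereal_le_epsilon2 by blast
  qed
  note le = this
  have "((\<lambda>L. g L - f L) \<longlongrightarrow> 0) at_top"
    using tendsto_minus[OF assms] by simp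
  from le[OF assms] le[OF this] show "Limsup at_top (\<lambda>L. ereal (f L)) = Limsup at_top (\<lambda>L. ereal (g L))"
    "Liminf at_top (\<lambda>L. ereal (f L)) = Liminf at_top (\<lambda>L. ereal (g L))" by auto
qed

section \<open>The conjugating matrix and its consequences for growth rates\<close>

context nls_solution
begin

definition b where
  "b z = (SOME b. b 0 = mat 1 \<and> (\<forall>t. (b has_vector_derivative V t 0 z ** b t) (at t)))"

lemma continuous_on_V: "continuous_on S (\<lambda>t. V t x z)"
  unfolding V_def by (intro continuous_intros q_continuous_slices) auto

lemma b_0: "b z 0 = mat 1" and has_vector_derivative_b: "(b z has_vector_derivative V t 0 z ** b z t) (at t)"
  using someI_ex[OF matrix_ode_exists[OF continuous_on_V, of 0 "mat 1" 0 z]] unfolding b_def by blast+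

lemma invertible_Y [simp]: "invertible (Y t x z)"
  by (rule invertible_transfer_matrix[OF q_continuous_slices(1)])

lemma invertible_b [simp]: "invertible (b z t)"
  by (rule fundamental_matrix_inverse[OF continuous_on_V has_vector_derivative_b b_0])

definition B where "B t x z = Y t x z ** b z t ** matrix_inv (Y 0 x z)"

lemma has_vector_derivative_inv_Y:
  "((\<lambda>x. matrix_inv (Y t x z)) has_vector_derivative - (matrix_inv (Y t x z) ** U t x z)) (at x)"
  by (rule fundamental_matrix_inverse(2)[OF continuous_U_matrix[OF q_continuous_slices(1)] has_vector_derivative_Y Y_0])

lemma B_0: "B 0 x z = mat 1"
  by (simp add: B_def b_0 matrix_mult_inv)

text \<open>The term - \<open>Y\<close> \<open>V t 0 z\<close> in the time derivative of
  \<open>Y\<close> cancels against the derivative of \<open>b\<close>. This is why \<open>b\<close>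
  is taken to solve the time equation at the base point 0.\<close>

lemma has_vector_derivative_B_time: "((\<lambda>t. B t x z) has_vector_derivative V t x z ** B t x z) (at t)"
proof -
  have "((\<lambda>t. Y t x z ** b z t) has_vector_derivative
      Y t x z ** (V t 0 z ** b z t) + (V t x z ** Y t x z - Y t x z ** V t 0 z) ** b z t) (at t)"
    by (rule has_vector_derivative_matrix_mult[OF has_vector_derivative_Y_time has_vector_derivative_b])
  then have "((\<lambda>t. Y t x z ** b z t) has_vector_derivative V t x z ** (Y t x z ** b z t)) (at t)"
    by (simp add: bounded_bilinear.diff_left[OF bounded_bilinear_matrix_matrix_mult] matrix_mul_assoc)
  from bounded_linear.has_vector_derivative[OF bounded_bilinear.bounded_linear_left[OF bounded_bilinear_matrix_matrix_mult] this,
      of "matrix_inv (Y 0 x z)"]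
  show ?thesis unfolding B_def by (simp add: matrix_mul_assoc)
qed

text \<open>Read off the time equation at fixed \<open>x\<close>, where \<open>B\<close> starts from
  the identity. The derivative of the inverse is recorded because Gronwall is applied to it as
  well.\<close>

lemma invertible_B [simp]: "invertible (B t x z)"
  and has_vector_derivative_inv_B_time:
    "((\<lambda>t. matrix_inv (B t x z)) has_vector_derivative - (matrix_inv (B t x z) ** V t x z)) (at t)"
  by (rule fundamental_matrix_inverse[OF continuous_on_V has_vector_derivative_B_time B_0])+

text \<open>The inverse has the same shape as \<open>B\<close> with the two times exchanged, so its
  equation in \<open>x\<close> is derived in the same way.\<close>

lemma inv_B: "matrix_inv (B t x z) = Y 0 x z ** matrix_inv (b z t) ** matrix_inv (Y t x z)"
proof (rule matrix_inv_eqI(2))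
  have "Y 0 x z ** matrix_inv (b z t) ** matrix_inv (Y t x z) ** B t x z =
      Y 0 x z ** (matrix_inv (b z t) ** ((matrix_inv (Y t x z) ** Y t x z) ** b z t)) ** matrix_inv (Y 0 x z)"
    by (simp only: B_def matrix_mul_assoc)
  then show "Y 0 x z ** matrix_inv (b z t) ** matrix_inv (Y t x z) ** B t x z = mat 1"
    by (simp add: matrix_inv_mult matrix_mult_inv)
qed

lemma has_vector_derivative_B_space:
  "((\<lambda>x. B t x z) has_vector_derivative U t x z ** B t x z - B t x z ** U 0 x z) (at x)"
  unfolding B_def
  using has_vector_derivative_matrix_mult[OF has_vector_derivative_matrix_mult[OF has_vector_derivative_Y
      has_vector_derivative_const] has_vector_derivative_inv_Y]
  by (simp add: matrix_mult_minus matrix_mul_assoc)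

lemma has_vector_derivative_inv_B_space:
  "((\<lambda>x. matrix_inv (B t x z)) has_vector_derivative
      U 0 x z ** matrix_inv (B t x z) - matrix_inv (B t x z) ** U t x z) (at x)"
  unfolding inv_B
  using has_vector_derivative_matrix_mult[OF has_vector_derivative_matrix_mult[OF has_vector_derivative_Y
      has_vector_derivative_const] has_vector_derivative_inv_Y]
  by (simp add: matrix_mult_minus matrix_mul_assoc)

text \<open>With both transfer matrices based at 0, the product telescopes: the factors at time 0
  cancel at \<open>x\<close> and at \<open>y\<close>, then \<open>b z t\<close> cancels against its
  inverse.\<close>

lemma transfer_matrix_conjugation:
  "transfer_matrix \<kappa> (q t) x y z = B t x z ** transfer_matrix \<kappa> (q 0) x y z ** matrix_inv (B t y z)"
proof -
  have "B t x z ** (Y 0 x z ** matrix_inv (Y 0 y z)) ** matrix_inv (B t y z) =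
      Y t x z ** (b z t ** (matrix_inv (Y 0 x z) ** Y 0 x z) ** (matrix_inv (Y 0 y z) ** Y 0 y z) **
      matrix_inv (b z t)) ** matrix_inv (Y t y z)"
    unfolding inv_B unfolding B_def by (simp only: matrix_mul_assoc)
  also have "\<dots> = Y t x z ** matrix_inv (Y t y z)" by (simp add: matrix_inv_mult matrix_mult_inv)
  finally show ?thesis
    using transfer_matrix_eq_mult_inv[OF q_continuous_slices(1), where \<kappa> = \<kappa> and x = x and y = y and z = z, of t]
      transfer_matrix_eq_mult_inv[OF q_continuous_slices(1), where \<kappa> = \<kappa> and x = x and y = y and z = z, of 0]
    by presburger
qed

text \<open>At fixed x the matrix and its inverse solve linear equations in time with initial value
  1 and coefficient \<open>V\<close>. On a finite strip \<open>V\<close> is bounded uniformly in x,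
  hence so is the Gronwall constant, although the factors \<open>Y\<close> of \<open>B\<close> have
  no such bound. One \<open>C\<close> serves both directions.\<close>

lemma B_gauge:
  obtains C where "\<And>t z. \<bar>t\<bar> \<le> T \<Longrightarrow> norm z \<le> K \<Longrightarrow> dirac_gauge \<kappa> (q 0) (q t) z (\<lambda>x. B t x z) C"
    "\<And>t z. \<bar>t\<bar> \<le> T \<Longrightarrow> norm z \<le> K \<Longrightarrow> dirac_gauge \<kappa> (q t) (q 0) z (\<lambda>x. matrix_inv (B t x z)) C"
proof -
  obtain CV where CV: "0 \<le> CV" "\<And>t x z. \<bar>t\<bar> \<le> T \<Longrightarrow> norm z \<le> K \<Longrightarrow> norm (V t x z) \<le> CV"
    using V_bounded by blast
  obtain c where c: "c > 0" "\<And>(A :: complex ^ 2 ^ 2) (B :: complex ^ 2 ^ 2). norm (A ** B) \<le> c * norm A * norm B"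
    using bounded_matrix_mult by blast
  define I where "I = (norm (mat 1 :: complex ^ 2 ^ 2))\<^sup>2"
  define C where "C = sqrt (exp ((2 * (c * CV) + 1) * T) * I)"
  have est: "norm (F t) \<le> C"
    if F: "\<And>t. (F has_vector_derivative F' t) (at t)" "F 0 = mat 1"
      and F': "\<And>t. \<bar>t\<bar> \<le> T \<Longrightarrow> norm (F' t) \<le> c * CV * norm (F t)" and t: "\<bar>t\<bar> \<le> T"
    for F F' :: "real \<Rightarrow> complex ^ 2 ^ 2" and t
  proof -
    have "(norm (F t))\<^sup>2 \<le> exp ((2 * (c * CV) + 1) * \<bar>t\<bar>) * ((norm (F 0))\<^sup>2 + 0\<^sup>2 * \<bar>t\<bar>)"
      by (rule gronwall[OF F(1), where R = T]) (use F' t c(1) CV(1) in auto)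
    also have "\<dots> \<le> exp ((2 * (c * CV) + 1) * T) * I"
      using t c CV(1) by (auto simp: I_def F(2) intro!: mult_right_mono mult_left_mono)
    finally show ?thesis unfolding C_def by (rule real_le_rsqrt)
  qed
  have C: "0 \<le> C" by (simp add: C_def I_def)
  have "norm (B t x z) \<le> C" if t: "\<bar>t\<bar> \<le> T" and z: "norm z \<le> K" for t x z
  proof (rule est[OF has_vector_derivative_B_time B_0 _ t])
    fix t assume "\<bar>t\<bar> \<le> T"
    then show "norm (V t x z ** B t x z) \<le> c * CV * norm (B t x z)"
      using c CV z by (intro order_trans[OF c(2)] mult_right_mono mult_left_mono) auto
  qed
  moreover have "norm (matrix_inv (B t x z)) \<le> C" if t: "\<bar>t\<bar> \<le> T" and z: "norm z \<le> K" for t x z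
  proof (rule est[OF has_vector_derivative_inv_B_time _ _ t])
    have "mat 1 ** mat 1 = (mat 1 :: complex ^ 2 ^ 2)" by simp
    then show "matrix_inv (B 0 x z) = mat 1" unfolding B_0 by (rule matrix_inv_eqI)
    fix t assume t: "\<bar>t\<bar> \<le> T"
    have "norm (matrix_inv (B t x z) ** V t x z) \<le> c * norm (matrix_inv (B t x z)) * CV"
      using c CV z t by (intro order_trans[OF c(2)] mult_left_mono) auto
    then show "norm (- (matrix_inv (B t x z) ** V t x z)) \<le> c * CV * norm (matrix_inv (B t x z))"
      by (simp add: ac_simps)
  qed
  ultimately show thesis
    using has_vector_derivative_B_space has_vector_derivative_inv_B_space C
    by (intro that[of C]) (auto simp: dirac_gauge_def)
qed

lemma B_bounded:
  "bdd_above {opnorm (B t x z) + opnorm (matrix_inv (B t x z)) + opnorm (vderiv (\<lambda>w. B t w z) x) | t x z.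
     \<bar>t\<bar> \<le> T \<and> norm z \<le> K}"
proof -
  obtain C where C: "\<And>t z. \<bar>t\<bar> \<le> T \<Longrightarrow> norm z \<le> K \<Longrightarrow> dirac_gauge \<kappa> (q 0) (q t) z (\<lambda>x. B t x z) C"
    "\<And>t z. \<bar>t\<bar> \<le> T \<Longrightarrow> norm z \<le> K \<Longrightarrow> dirac_gauge \<kappa> (q t) (q 0) z (\<lambda>x. matrix_inv (B t x z)) C"
    using B_gauge by blast
  obtain CU where CU: "0 \<le> CU" "\<And>t x z. \<bar>t\<bar> \<le> T \<Longrightarrow> norm z \<le> K \<Longrightarrow> norm (U t x z) \<le> CU"
    using U_bounded by blast
  obtain c where c: "c > 0" "\<And>(A :: complex ^ 2 ^ 2) (B :: complex ^ 2 ^ 2). norm (A ** B) \<le> c * norm A * norm B"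
    using bounded_matrix_mult by blast
  obtain k where k: "0 < k" "\<And>A. opnorm A \<le> k * norm A" using opnorm_le_norm by blast
  have "opnorm (B t x z) + opnorm (matrix_inv (B t x z)) + opnorm (vderiv (\<lambda>w. B t w z) x)
      \<le> k * C + k * C + k * (c * CU * C + c * C * CU)" if t: "\<bar>t\<bar> \<le> T" and z: "norm z \<le> K" for t x z
  proof -
    have B: "norm (B t x z) \<le> C" "norm (matrix_inv (B t x z)) \<le> C" "0 \<le> C"
      using C[OF t z] by (auto simp: dirac_gauge_def)
    have U: "norm (U t x z) \<le> CU" "norm (U 0 x z) \<le> CU" using CU(2) t z by auto
    have "vderiv (\<lambda>w. B t w z) x = U t x z ** B t x z - B t x z ** U 0 x z"
      unfolding vderiv_def by (rule vector_derivative_at[OF has_vector_derivative_B_space])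
    also have "norm \<dots> \<le> c * CU * C + c * C * CU"
      using c CU(1) U B by (intro order_trans[OF norm_triangle_ineq4] add_mono order_trans[OF c(2)] mult_mono) auto
    finally show ?thesis
      using k(1) B by (intro add_mono order_trans[OF k(2)] mult_left_mono) auto
  qed
  then show ?thesis by (intro bdd_aboveI) blast
qed

text \<open>The conjugation changes each norm by at most a fixed factor, in either direction. The
  logarithms then differ by a bounded amount, which the division by \<open>L\<close> removes in the
  limit.\<close>

lemma growth_quotient_diff:
  assumes eps: "\<epsilon> \<in> {-1, 1}"
  shows "((\<lambda>L. growth_quotient \<kappa> (q t) \<epsilon> z y L - growth_quotient \<kappa> (q 0) \<epsilon> z y L) \<longlongrightarrow> 0) at_top"
proof -
  obtain C where C: "dirac_gauge \<kappa> (q 0) (q t) z (\<lambda>x. B t x z) C"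
    "dirac_gauge \<kappa> (q t) (q 0) z (\<lambda>x. matrix_inv (B t x z)) C"
    using B_gauge[of "\<bar>t\<bar>" "norm z"] by (metis order_refl)
  obtain k where k: "0 < k" "\<And>A. opnorm A \<le> k * norm A" using opnorm_le_norm by blast
  \<comment> \<open>The maximum with 1 keeps the factor positive, so that the logarithm of the
    product splits.\<close>
  define D where "D = max 1 (k * C)"
  have D: "1 \<le> D" by (simp add: D_def)
  have oB: "opnorm (B t x z) \<le> D" "opnorm (matrix_inv (B t x z)) \<le> D" for x
    using C k(1) by (auto simp: D_def dirac_gauge_def intro!: order_trans[OF k(2)] max.coboundedI2 mult_left_mono)
  let ?T = "\<lambda>t x. transfer_matrix \<kappa> (q t) x y z"
  have comp: "opnorm (P ** M ** R) \<le> D\<^sup>2 * opnorm M" if "opnorm P \<le> D" "opnorm R \<le> D" for P M R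
  proof -
    have "opnorm (P ** M ** R) \<le> opnorm P * opnorm M * opnorm R"
      by (meson mult_right_mono opnorm_mult_le opnorm_nonneg order_trans)
    also have "\<dots> \<le> D * opnorm M * D"
      using that D by (intro mult_mono mult_nonneg_nonneg) (auto simp: opnorm_nonneg)
    finally show ?thesis by (simp add: power2_eq_square ac_simps)
  qed
  have le1: "opnorm (?T t x) \<le> D\<^sup>2 * opnorm (?T 0 x)" for x
    unfolding transfer_matrix_conjugation[of t] by (rule comp[OF oB])
  have "?T 0 x = matrix_inv (B t x z) ** ?T t x ** B t y z" for x
  proof -
    have "matrix_inv (B t x z) ** (B t x z ** ?T 0 x ** matrix_inv (B t y z)) ** B t y z =
       (matrix_inv (B t x z) ** B t x z) ** ?T 0 x ** (matrix_inv (B t y z) ** B t y z)"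
      by (simp only: matrix_mul_assoc)
    then show ?thesis unfolding transfer_matrix_conjugation[of t] by (simp add: matrix_inv_mult)
  qed
  then have le2: "opnorm (?T 0 x) \<le> D\<^sup>2 * opnorm (?T t x)" for x
    using comp[OF oB(2) oB(1)] by metis
  have pos: "0 < opnorm (?T t x)" for t x
    by (intro opnorm_pos invertible_transfer_matrix q_continuous_slices(1))
  have ln: "\<bar>ln (opnorm (?T t x)) - ln (opnorm (?T 0 x))\<bar> \<le> ln (D\<^sup>2)" for x
  proof -
    have D2: "D\<^sup>2 > 0" using D by simp
    have "ln (opnorm (?T t x)) \<le> ln (D\<^sup>2 * opnorm (?T 0 x))"
      by (subst ln_le_cancel_iff) (use pos le1 D2 in auto)
    moreover have "ln (opnorm (?T 0 x)) \<le> ln (D\<^sup>2 * opnorm (?T t x))"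
      by (subst ln_le_cancel_iff) (use pos le2 D2 in auto)
    moreover have "ln (D\<^sup>2 * opnorm (?T s x)) = ln (D\<^sup>2) + ln (opnorm (?T s x))" for s
      by (rule ln_mult_pos) (use pos D2 in auto)
    ultimately show ?thesis by (simp add: abs_le_iff)
  qed
  show ?thesis
  proof (rule Lim_null_comparison)
    show "((\<lambda>L. ln (D\<^sup>2) / L) \<longlongrightarrow> 0) at_top"
      by (intro tendsto_divide_0[OF tendsto_const] filterlim_at_top_imp_at_infinity filterlim_ident)
    show "\<forall>\<^sub>F L in at_top. norm (growth_quotient \<kappa> (q t) \<epsilon> z y L - growth_quotient \<kappa> (q 0) \<epsilon> z y L) \<le> ln (D\<^sup>2) / L"
      using eventually_gt_at_top[of 0]
    proof eventually_elim
      case (elim L)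
      then show ?case
        using ln[of "y + \<epsilon> * L"]
        by (simp add: growth_quotient_def divide_right_mono flip: diff_divide_distrib)
    qed
  qed
qed

lemma growth_invariant:
  assumes "\<epsilon> \<in> {-1, 1}"
  shows "upper_growth \<kappa> (q t) \<epsilon> z y = upper_growth \<kappa> (q s) \<epsilon> z y"
    and "lower_growth \<kappa> (q t) \<epsilon> z y = lower_growth \<kappa> (q s) \<epsilon> z y"
    and "(growth_quotient \<kappa> (q s) \<epsilon> z y \<longlongrightarrow> \<Lambda>) at_top \<longleftrightarrow> (growth_quotient \<kappa> (q t) \<epsilon> z y \<longlongrightarrow> \<Lambda>) at_top"
proof -
  have "((\<lambda>L. growth_quotient \<kappa> (q t) \<epsilon> z y L - growth_quotient \<kappa> (q s) \<epsilon> z y L) \<longlongrightarrow> 0) at_top"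
    using tendsto_diff[OF growth_quotient_diff[OF assms, of t z y] growth_quotient_diff[OF assms, of s z y]] by simp
  note d = this
  show "upper_growth \<kappa> (q t) \<epsilon> z y = upper_growth \<kappa> (q s) \<epsilon> z y"
    "lower_growth \<kappa> (q t) \<epsilon> z y = lower_growth \<kappa> (q s) \<epsilon> z y"
    unfolding upper_growth_def lower_growth_def by (rule Limsup_Liminf_eq_of_diff[OF d])+
  show "(growth_quotient \<kappa> (q s) \<epsilon> z y \<longlongrightarrow> \<Lambda>) at_top \<longleftrightarrow> (growth_quotient \<kappa> (q t) \<epsilon> z y \<longlongrightarrow> \<Lambda>) at_top"
    using tendsto_add[OF d, of "growth_quotient \<kappa> (q s) \<epsilon> z y" \<Lambda>]
      tendsto_diff[OF _ d, of "growth_quotient \<kappa> (q t) \<epsilon> z y" \<Lambda>] by auto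
qed

end

section \<open>Smooth functions and test functions\<close>

text \<open>An explicit chain of functions, each the derivative of the one before, must be the chain
  of iterated derivatives. All smoothness claims below are proved by exhibiting such a
  chain.\<close>

lemma vderiv_power_eq:
  assumes "\<And>n x. (D n has_vector_derivative D (Suc n) x) (at x)"
  shows "(vderiv ^^ n) (D 0) = D n"
proof (induction n)
  case (Suc n)
  have "vderiv (D n) = D (Suc n)"
    unfolding vderiv_def[abs_def] by (intro ext vector_derivative_at assms)
  then show ?case using Suc by simp
qed simp

lemma smoothI:
  assumes "\<And>n x. (D n has_vector_derivative D (Suc n) x) (at x)"
  shows "smooth (D 0)"
  unfolding smooth_def vderiv_power_eq[of D, OF assms] using assms differentiableI_vector by blast

lemma smooth_has_vector_derivative:
  assumes "smooth f"
  shows "((vderiv ^^ n) f has_vector_derivative (vderiv ^^ Suc n) f x) (at x)"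
  using assms unfolding smooth_def by (simp add: vderiv_def vector_derivative_works)

lemma continuous_on_smooth:
  assumes "smooth f"
  shows "continuous_on S ((vderiv ^^ n) f)"
  using smooth_has_vector_derivative[OF assms]
  by (auto intro!: continuous_at_imp_continuous_on has_vector_derivative_continuous)

lemma smooth_vderiv: "smooth f \<Longrightarrow> smooth (vderiv f)"
  using smoothI[of "\<lambda>n. (vderiv ^^ Suc n) f"] smooth_has_vector_derivative[of f "Suc _"] by simp

context
  fixes f g :: "real \<Rightarrow> 'a::real_normed_vector"
  assumes f: "smooth f" and g: "smooth g"
begin

lemma vderiv_power_add: "(vderiv ^^ n) (\<lambda>x. f x + g x) = (\<lambda>x. (vderiv ^^ n) f x + (vderiv ^^ n) g x)"
  and smooth_add: "smooth (\<lambda>x. f x + g x)"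
proof -
  have *: "((\<lambda>x. (vderiv ^^ n) f x + (vderiv ^^ n) g x) has_vector_derivative
      (vderiv ^^ Suc n) f x + (vderiv ^^ Suc n) g x) (at x)" for n x
    by (intro has_vector_derivative_add smooth_has_vector_derivative f g)
  from vderiv_power_eq[of "\<lambda>n x. (vderiv ^^ n) f x + (vderiv ^^ n) g x", OF *]
  show "(vderiv ^^ n) (\<lambda>x. f x + g x) = (\<lambda>x. (vderiv ^^ n) f x + (vderiv ^^ n) g x)" by simp
  from smoothI[of "\<lambda>n x. (vderiv ^^ n) f x + (vderiv ^^ n) g x", OF *]
  show "smooth (\<lambda>x. f x + g x)" by simp
qed

end

lemma
  assumes f: "smooth f" and L: "bounded_linear L"
  shows vderiv_power_linear: "(vderiv ^^ n) (\<lambda>x. L (f x)) = (\<lambda>x. L ((vderiv ^^ n) f x))"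
    and smooth_linear: "smooth (\<lambda>x. L (f x))"
proof -
  have *: "((\<lambda>x. L ((vderiv ^^ n) f x)) has_vector_derivative L ((vderiv ^^ Suc n) f x)) (at x)" for n x
    by (intro bounded_linear.has_vector_derivative[OF L] smooth_has_vector_derivative f)
  from vderiv_power_eq[of "\<lambda>n x. L ((vderiv ^^ n) f x)", OF *]
  show "(vderiv ^^ n) (\<lambda>x. L (f x)) = (\<lambda>x. L ((vderiv ^^ n) f x))" by simp
  from smoothI[of "\<lambda>n x. L ((vderiv ^^ n) f x)", OF *] show "smooth (\<lambda>x. L (f x))" by simp
qed

lemma
  assumes f: "smooth f"
  shows vderiv_power_affine: "(vderiv ^^ n) (\<lambda>x. f (a * x + c)) = (\<lambda>x. a ^ n *\<^sub>R (vderiv ^^ n) f (a * x + c))"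
    and smooth_affine: "smooth (\<lambda>x. f (a * x + c))"
proof -
  have *: "((\<lambda>x. a ^ n *\<^sub>R (vderiv ^^ n) f (a * x + c)) has_vector_derivative
      a ^ Suc n *\<^sub>R (vderiv ^^ Suc n) f (a * x + c)) (at x)" for n x
  proof -
    have "((\<lambda>x. a * x + c) has_vector_derivative a) (at x)"
      by (rule has_real_derivative_iff_has_vector_derivative[THEN iffD1]) (auto intro!: derivative_eq_intros)
    from vector_diff_chain_at[OF this smooth_has_vector_derivative[OF f, of n]]
    have "((\<lambda>x. (vderiv ^^ n) f (a * x + c)) has_vector_derivative a *\<^sub>R (vderiv ^^ Suc n) f (a * x + c)) (at x)"
      by (simp add: o_def)
    from bounded_linear.has_vector_derivative[OF bounded_linear_scaleR_right this, of "a ^ n"]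
    show ?thesis by (simp add: mult.commute)
  qed
  from vderiv_power_eq[of "\<lambda>n x. a ^ n *\<^sub>R (vderiv ^^ n) f (a * x + c)", OF *]
  show "(vderiv ^^ n) (\<lambda>x. f (a * x + c)) = (\<lambda>x. a ^ n *\<^sub>R (vderiv ^^ n) f (a * x + c))" by simp
  from smoothI[of "\<lambda>n x. a ^ n *\<^sub>R (vderiv ^^ n) f (a * x + c)", OF *]
  show "smooth (\<lambda>x. f (a * x + c))" by simp
qed

text \<open>Leibniz's rule for an arbitrary bounded bilinear product. The right-hand sides form a
  chain of successive derivatives, which yields the formula and the smoothness at once.\<close>

lemma
  fixes prod :: "'a::real_normed_vector \<Rightarrow> 'b::real_normed_vector \<Rightarrow> 'c::real_normed_vector"
  assumes prod: "bounded_bilinear prod" and f: "smooth f" and g: "smooth g"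
  shows vderiv_power_prod: "(vderiv ^^ n) (\<lambda>x. prod (f x) (g x)) =
      (\<lambda>x. \<Sum>k\<le>n. real (n choose k) *\<^sub>R prod ((vderiv ^^ k) f x) ((vderiv ^^ (n - k)) g x))"
    and smooth_prod: "smooth (\<lambda>x. prod (f x) (g x))"
proof -
  define D where "D n x = (\<Sum>k\<le>n. real (n choose k) *\<^sub>R prod ((vderiv ^^ k) f x) ((vderiv ^^ (n - k)) g x))" for n x
  have *: "(D n has_vector_derivative D (Suc n) x) (at x)" for n x
  proof -
    define a where "a k = prod ((vderiv ^^ k) f x) ((vderiv ^^ (Suc n - k)) g x)" for k
    have "(D n has_vector_derivative (\<Sum>k\<le>n. real (n choose k) *\<^sub>R (a k + a (Suc k)))) (at x)"
      unfolding D_def[abs_def]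
    proof (intro has_vector_derivative_sum)
      fix k assume "k \<in> {..n}"
      then have k: "Suc n - k = Suc (n - k)" "Suc n - Suc k = n - k" by auto
      show "((\<lambda>x. real (n choose k) *\<^sub>R prod ((vderiv ^^ k) f x) ((vderiv ^^ (n - k)) g x)) has_vector_derivative
          real (n choose k) *\<^sub>R (a k + a (Suc k))) (at x)"
        unfolding a_def k
        by (intro bounded_linear.has_vector_derivative[OF bounded_linear_scaleR_right]
            bounded_bilinear.has_vector_derivative[OF prod] smooth_has_vector_derivative f g)
    qed
    also have "(\<Sum>k\<le>n. real (n choose k) *\<^sub>R (a k + a (Suc k))) =
        (\<Sum>k\<le>n. real (n choose k) *\<^sub>R a k) + (\<Sum>k\<le>n. real (n choose k) *\<^sub>R a (Suc k))"
      by (simp add: scaleR_add_right sum.distrib)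
    \<comment> \<open>The added last term has coefficient \<open>n choose Suc n = 0\<close>.
      Extending the range allows the index shift after which Pascal's rule merges the two
      sums.\<close>
    also have "(\<Sum>k\<le>n. real (n choose k) *\<^sub>R a k) = (\<Sum>k\<le>Suc n. real (n choose k) *\<^sub>R a k)" by simp
    also have "\<dots> = a 0 + (\<Sum>k\<le>n. real (n choose Suc k) *\<^sub>R a (Suc k))"
      by (subst sum.atMost_Suc_shift) simp
    also have "\<dots> + (\<Sum>k\<le>n. real (n choose k) *\<^sub>R a (Suc k)) =
        a 0 + (\<Sum>k\<le>n. real (Suc n choose Suc k) *\<^sub>R a (Suc k))"
      by (simp add: scaleR_add_left sum.distrib)
    also have "\<dots> = D (Suc n) x"
      unfolding D_def by (subst sum.atMost_Suc_shift) (simp add: a_def)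
    finally show ?thesis .
  qed
  have D0: "D 0 = (\<lambda>x. prod (f x) (g x))" by (simp add: D_def[abs_def])
  from vderiv_power_eq[of D, OF *] show "(vderiv ^^ n) (\<lambda>x. prod (f x) (g x)) =
      (\<lambda>x. \<Sum>k\<le>n. real (n choose k) *\<^sub>R prod ((vderiv ^^ k) f x) ((vderiv ^^ (n - k)) g x))"
    unfolding D0 by (simp add: D_def[abs_def])
  from smoothI[of D, OF *] show "smooth (\<lambda>x. prod (f x) (g x))" unfolding D0 .
qed

lemma smooth_poly: "smooth (poly p)" for p :: "real poly"
proof -
  have "(poly ((pderiv ^^ n) p) has_vector_derivative poly ((pderiv ^^ Suc n) p) x) (at x)" for n x
    using poly_DERIV[of "(pderiv ^^ n) p" x] by (simp add: has_real_derivative_iff_has_vector_derivative)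
  from smoothI[of "\<lambda>n. poly ((pderiv ^^ n) p)", OF this] show ?thesis by simp
qed

text \<open>The classical smooth function that is flat at 0: all its derivatives vanish there. It is
  the building block of every cut-off below.\<close>

definition flat_exp :: "real \<Rightarrow> real" where
  "flat_exp x = (if 0 < x then exp (- (1 / x)) else 0)"

lemma poly_times_exp_neg_tendsto_0:
  fixes p :: "real poly"
  shows "((\<lambda>y. poly p y * exp (- y)) \<longlongrightarrow> 0) at_top"
proof -
  have "((\<lambda>y. \<Sum>i\<le>degree p. coeff p i * (y ^ i / exp y)) \<longlongrightarrow> (\<Sum>i\<le>degree p. coeff p i * 0)) at_top"
    by (intro tendsto_sum tendsto_mult tendsto_const tendsto_power_div_exp_0)
  moreover have "(\<Sum>i\<le>degree p. coeff p i * (y ^ i / exp y)) = poly p y * exp (- y)" for y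
    by (simp add: poly_altdef sum_distrib_right exp_minus divide_inverse mult.assoc)
  ultimately show ?thesis by simp
qed

lemma smooth_flat_exp: "smooth flat_exp"
proof -
  \<comment> \<open>With y = 1/x, the derivative of p(y) exp(-y) in x is y^2 (p - p')(y) exp(-y).
    The recursion follows this rule, so the derivatives on the right half-line stay polynomials in
    1/x times the exponential.\<close>
  define p :: "nat \<Rightarrow> real poly" where "p n = ((\<lambda>r. [:0, 0, 1:] * (r - pderiv r)) ^^ n) 1" for n
  have p_Suc: "p (Suc n) = [:0, 0, 1:] * (p n - pderiv (p n))" for n by (simp add: p_def)
  define D where "D n x = (if 0 < x then poly (p n) (1 / x) * exp (- (1 / x)) else 0)" for n and x :: real
  have "(D n has_real_derivative D (Suc n) x) (at x)" for n x
  proof -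
    consider "x > 0" | "x < 0" | "x = 0" by linarith
    then show ?thesis
    proof cases
      case 1
      have "((\<lambda>x. poly (p n) (1 / x) * exp (- (1 / x))) has_real_derivative
          poly (pderiv (p n)) (1 / x) * (- (1 / x\<^sup>2)) * exp (- (1 / x)) +
          poly (p n) (1 / x) * (exp (- (1 / x)) * (1 / x\<^sup>2))) (at x)"
        using 1 by (auto intro!: derivative_eq_intros DERIV_chain2[OF poly_DERIV] simp: power2_eq_square field_simps)
      moreover have "D (Suc n) x = poly (pderiv (p n)) (1 / x) * (- (1 / x\<^sup>2)) * exp (- (1 / x)) +
          poly (p n) (1 / x) * (exp (- (1 / x)) * (1 / x\<^sup>2))"
        using 1 by (simp add: D_def p_Suc power2_eq_square algebra_simps)
      ultimately have "((\<lambda>x. poly (p n) (1 / x) * exp (- (1 / x))) has_real_derivative D (Suc n) x) (at x)" by simp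
      then show ?thesis
        by (rule has_field_derivative_transform_within_open[of _ _ _ "{0<..}"]) (use 1 in \<open>auto simp: D_def\<close>)
    next
      case 2
      have "((\<lambda>x. 0) has_real_derivative D (Suc n) x) (at x)" using 2 by (simp add: D_def)
      then show ?thesis
        by (rule has_field_derivative_transform_within_open[of _ _ _ "{..<0}"]) (use 2 in \<open>auto simp: D_def\<close>)
    next
      case 3
      \<comment> \<open>At the origin the difference quotient from the right is y p(y) exp(-y) with
        y = 1/h, which tends to 0 as y grows.\<close>
      have "((\<lambda>h. D n h / h) \<longlongrightarrow> 0) (at_right 0)"
      proof (rule Lim_transform_eventually)
        have "((\<lambda>y. poly ([:0, 1:] * p n) y * exp (- y)) \<longlongrightarrow> 0) at_top" by (rule poly_times_exp_neg_tendsto_0)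
        then show "((\<lambda>h. poly ([:0, 1:] * p n) (inverse h) * exp (- inverse h)) \<longlongrightarrow> 0) (at_right 0)"
          by (rule filterlim_compose) (rule filterlim_inverse_at_top_right)
        show "\<forall>\<^sub>F h in at_right 0. poly ([:0, 1:] * p n) (inverse h) * exp (- inverse h) = D n h / h"
          using eventually_at_right_less[of 0]
          by eventually_elim (simp add: D_def field_simps)
      qed
      moreover have "((\<lambda>h. D n h / h) \<longlongrightarrow> 0) (at_left 0)"
      proof (rule Lim_transform_eventually[OF tendsto_const])
        show "\<forall>\<^sub>F h in at_left 0. 0 = D n h / h"
          using eventually_at_left_real[of "-1" "0::real", simplified] by eventually_elim (auto simp: D_def)
      qed
      ultimately have "((\<lambda>h. D n h / h) \<longlongrightarrow> 0) (at 0)" by (simp add: filterlim_at_split)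
      then show ?thesis using 3 by (simp add: DERIV_def D_def)
    qed
  qed
  then have "(D n has_vector_derivative D (Suc n) x) (at x)" for n x
    by (simp add: has_real_derivative_iff_has_vector_derivative)
  then have "smooth (D 0)" by (rule smoothI)
  moreover have "D 0 = flat_exp" by (auto simp: D_def flat_exp_def p_def)
  ultimately show ?thesis by simp
qed

lemma flat_exp_nonneg: "0 \<le> flat_exp x" and flat_exp_le_1: "flat_exp x \<le> 1"
  and flat_exp_pos_iff: "0 < flat_exp x \<longleftrightarrow> 0 < x"
  by (auto simp: flat_exp_def)

lemma test_functionI:
  assumes "smooth \<phi>" "\<And>x. \<phi> x \<noteq> 0 \<Longrightarrow> x \<in> {a..b}"
  shows "test_function UNIV \<phi>"
proof -
  have "closure {x. \<phi> x \<noteq> 0} \<subseteq> {a..b}" using assms(2) by (intro closure_minimal) auto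
  then show ?thesis
    using assms(1) compact_closure bounded_subset[OF bounded_closed_interval]
    by (auto simp: test_function_def compact_eq_bounded_closed)
qed

lemma test_function_bump:
  assumes c: "0 < c"
  shows "test_function UNIV (\<lambda>x. flat_exp (c * (x - a)) * flat_exp (c * (b - x)))"
proof (rule test_functionI)
  have "smooth (\<lambda>x. flat_exp (c * x + (- c * a)) * flat_exp ((- c) * x + c * b))"
    by (intro smooth_prod[OF bounded_bilinear_mult] smooth_affine smooth_flat_exp)
  then show "smooth (\<lambda>x. flat_exp (c * (x - a)) * flat_exp (c * (b - x)))"
    by (simp add: algebra_simps)
  show "x \<in> {a..b}" if "flat_exp (c * (x - a)) * flat_exp (c * (b - x)) \<noteq> 0" for x :: real
    using that c by (auto simp: flat_exp_def zero_less_mult_iff split: if_splits)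
qed

text \<open>Stretching the argument drives \<open>flat_exp\<close> to 1 at every positive point
  while it remains 0 elsewhere. Open intervals thus become dominated limits of test
  functions.\<close>

lemma bump_tendsto:
  assumes "a < b"
  shows "(\<lambda>n. flat_exp (real (Suc n) * (x - a)) * flat_exp (real (Suc n) * (b - x))) \<longlonglongrightarrow> indicat_real {a<..<b} x"
proof (cases "x \<in> {a<..<b}")
  case True
  have "(\<lambda>n. flat_exp (real (Suc n) * d)) \<longlonglongrightarrow> 1" if "d > 0" for d
  proof -
    have "(\<lambda>n. exp (- (1 / (real (Suc n) * d)))) \<longlonglongrightarrow> exp (- 0)"
    proof (intro tendsto_exp tendsto_minus)
      have "(\<lambda>n. inverse (real (Suc n)) * (1 / d)) \<longlonglongrightarrow> 0 * (1 / d)"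
        by (intro tendsto_mult LIMSEQ_inverse_real_of_nat tendsto_const)
      then show "(\<lambda>n. 1 / (real (Suc n) * d)) \<longlonglongrightarrow> 0" by (simp add: field_simps)
    qed
    then show ?thesis using that by (simp add: flat_exp_def)
  qed
  from tendsto_mult[OF this this, of "x - a" "b - x"] True show ?thesis by simp
next
  case False
  have "flat_exp (real (Suc n) * (x - a)) * flat_exp (real (Suc n) * (b - x)) = 0" for n
    using False by (auto simp: flat_exp_def zero_less_mult_iff)
  then show ?thesis using False by (simp only: indicator_simps) simp
qed

section \<open>Weak derivatives\<close>

text \<open>Half-lines are closed under intersection and generate the Borel sets, so a Dynkin
  argument makes the integral over every Borel set vanish. The vanishing total integral handles
  complements.\<close>

lemma AE_zero_of_half_line_integrals:
  fixes k :: "real \<Rightarrow> real"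
  assumes k: "integrable lborel k" and z: "\<And>a. (LINT x:{..a}|lborel. k x) = 0" and tot: "(LINT x|lborel. k x) = 0"
  shows "AE x in lborel. k x = 0"
proof (rule density_unique_real[OF k])
  have si: "set_integrable lborel A k" if "A \<in> sets borel" for A
    unfolding set_integrable_def using integrable_mult_indicator[OF _ k] that by auto
  fix A :: "real set" assume "A \<in> sets lborel"
  then have A: "A \<in> sigma_sets UNIV (range (\<lambda>a::real. {..a}))"
    using borel_eq_atMost[where 'a = real] by (metis sets_lborel sets_measure_of subset_UNIV Pow_UNIV)
  have *: "Int_stable (range (\<lambda>a::real. {..a}))" "range (\<lambda>a::real. {..a}) \<subseteq> Pow UNIV"
    by (auto simp: Int_stable_def)
  from A have "(LINT x:A|lborel. k x) = 0"
  proof (induction rule: sigma_sets_induct_disjoint[OF *, consumes 1, case_names basic empty compl union])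
    case (compl A)
    then have A: "A \<in> sets borel"
      using borel_eq_atMost[where 'a = real] by (metis sets_measure_of subset_UNIV Pow_UNIV)
    have "(LINT x:(UNIV - A) \<union> A|lborel. k x) = (LINT x:UNIV - A|lborel. k x) + (LINT x:A|lborel. k x)"
      by (rule set_integral_Un) (use A si in auto)
    then show ?case using compl tot by (simp add: set_lebesgue_integral_def)
  next
    case (union A)
    then have A: "A i \<in> sets borel" for i
      using borel_eq_atMost[where 'a = real] by (metis rangeI sets_measure_of subset_UNIV Pow_UNIV subsetD)
    have "(LINT x:\<Union>(range A)|lborel. k x) = (\<Sum>i. (LINT x:A i|lborel. k x))"
      by (rule lebesgue_integral_countable_add)
         (use A union(1) si in \<open>auto simp: disjoint_family_on_def intro!: si sets.countable_UN\<close>)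
    then show ?case using union by simp
  qed (use z in \<open>auto simp: set_lebesgue_integral_def\<close>)
  then show "(LINT x:A|lborel. k x) = (LINT x:A|lborel. 0)" by (simp add: set_lebesgue_integral_def)
qed auto

text \<open>The fundamental lemma of the calculus of variations: dominated limits of test functions
  give zero integrals over bounded open intervals, and these determine the function on every
  [-R, R].\<close>

lemma AE_zero_of_test_integrals:
  fixes h :: "real \<Rightarrow> real"
  assumes h: "\<And>R. set_integrable lborel {-R..R} h" and [measurable]: "h \<in> borel_measurable borel"
    and z: "\<And>\<phi>. test_function UNIV \<phi> \<Longrightarrow> (LINT x|lborel. \<phi> x * h x) = 0"
  shows "AE x in lborel. h x = 0"
proof -
  have iv: "(LINT x|lborel. indicator {a<..<b} x * h x) = 0" if ab: "a < b" for a b :: real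
  proof -
    let ?\<phi> = "\<lambda>n x. flat_exp (real (Suc n) * (x - a)) * flat_exp (real (Suc n) * (b - x))"
    define R where "R = max \<bar>a\<bar> \<bar>b\<bar>"
    have [measurable]: "flat_exp \<in> borel_measurable borel" unfolding flat_exp_def[abs_def] by measurable
    have "(\<lambda>n. LINT x|lborel. ?\<phi> n x * h x) \<longlonglongrightarrow> (LINT x|lborel. indicator {a<..<b} x * h x)"
    proof (rule integral_dominated_convergence[where w = "\<lambda>x. indicator {-R..R} x * \<bar>h x\<bar>"])
      show "integrable lborel (\<lambda>x. indicator {-R..R} x * \<bar>h x\<bar>)"
        using set_integrable_abs[OF h[of R]] by (simp add: set_integrable_def)
      show "AE x in lborel. (\<lambda>n. ?\<phi> n x * h x) \<longlonglongrightarrow> indicator {a<..<b} x * h x"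
        by (intro AE_I2 tendsto_mult bump_tendsto[OF ab] tendsto_const)
      fix n
      have "norm (?\<phi> n x * h x) \<le> indicator {-R..R} x * \<bar>h x\<bar>" for x
      proof (cases "x \<in> {-R..R}")
        case True
        have "?\<phi> n x \<le> 1 * 1" by (intro mult_mono flat_exp_le_1 flat_exp_nonneg) auto
        then have "\<bar>?\<phi> n x\<bar> \<le> 1" using flat_exp_nonneg by (simp add: abs_mult abs_of_nonneg)
        then show ?thesis using True mult_right_mono[of "\<bar>?\<phi> n x\<bar>" 1 "\<bar>h x\<bar>"] by (simp add: abs_mult)
      next
        case False
        then have "x \<le> a \<or> b \<le> x" by (auto simp: R_def)
        then have "?\<phi> n x = 0" by (auto simp: flat_exp_def zero_less_mult_iff)
        then have "?\<phi> n x * h x = 0" by (simp only: mult_zero_left)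
        then show ?thesis by (simp only: norm_zero) simp
      qed
      then show "AE x in lborel. norm (?\<phi> n x * h x) \<le> indicator {-R..R} x * \<bar>h x\<bar>" by simp
    qed measurable
    moreover have "(LINT x|lborel. ?\<phi> n x * h x) = 0" for n by (intro z test_function_bump) auto
    ultimately show ?thesis by (simp add: LIMSEQ_const_iff)
  qed
  have R: "AE x in lborel. indicator {-R..R} x * h x = 0" if "R > 0" for R :: real
  proof (rule AE_zero_of_half_line_integrals)
    show i: "integrable lborel (\<lambda>x. indicator {-R..R} x * h x)"
      using h[of R] by (simp add: set_integrable_def)
    have half: "(LINT x|lborel. indicator ({..a} \<inter> {-R..R}) x * h x) = 0" for a
    proof -
      \<comment> \<open>Up to two endpoints of measure zero the intersection is an open interval,
        possibly empty, so the previous fact applies.\<close>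
      have "(LINT x|lborel. indicator ({..a} \<inter> {-R..R}) x * h x) =
          (LINT x|lborel. indicator {-R<..<min a R} x * h x)"
      proof (rule integral_cong_AE)
        have "AE x in lborel. x \<noteq> -R \<and> x \<noteq> min a R"
          using AE_lborel_singleton[of "-R"] AE_lborel_singleton[of "min a R"] by eventually_elim simp
        then show "AE x in lborel. indicator ({..a} \<inter> {-R..R}) x * h x = indicator {-R<..<min a R} x * h x"
          by eventually_elim (auto simp: indicator_def min_def split: if_splits)
      qed measurable
      then show ?thesis using iv[of "-R" "min a R"] by (cases "-R < min a R") auto
    qed
    show "(LINT x:{..a}|lborel. indicator {-R..R} x * h x) = 0" for a
      using half[of a] by (simp only: set_lebesgue_integral_def real_scaleR_def indicator_inter_arith mult.assoc)
    have "{..R} \<inter> {-R..R} = {-R..R}" by auto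
    then show "(LINT x|lborel. indicator {-R..R} x * h x) = 0"
      using half[of R] by simp
  qed
  have "AE x in lborel. \<forall>n::nat. indicator {-real (Suc n)..real (Suc n)} x * h x = 0"
    unfolding AE_all_countable by (intro allI R) simp
  then show ?thesis
  proof eventually_elim
    case (elim x)
    obtain n where "\<bar>x\<bar> \<le> real n" using real_arch_simple by blast
    then have "x \<in> {-real (Suc n)..real (Suc n)}" by auto
    then show ?case using elim[rule_format, of n] by (simp add: indicator_def split: if_splits)
  qed
qed

text \<open>On a bounded interval \<open>norm (f x)\<close> is at most 1 plus its square, so square
  integrability implies local integrability.\<close>

lemma square_integrable_on_bounded:
  assumes f: "square_integrable f" and w: "w \<in> borel_measurable borel" "\<And>x. \<bar>w x\<bar> \<le> indicator {a..b} x * C"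
  shows "integrable lborel (\<lambda>x. w x *\<^sub>R f x)"
proof (rule Bochner_Integration.integrable_bound)
  have [measurable]: "f \<in> borel_measurable borel" using f by (simp add: square_integrable_def)
  show "integrable lborel (\<lambda>x. C * indicator {a..b} x + C * (norm (f x))\<^sup>2)"
    using f by (intro Bochner_Integration.integrable_add integrable_mult_right integrable_real_indicator)
      (auto simp: square_integrable_def emeasure_lborel_Icc_eq)
  show "(\<lambda>x. w x *\<^sub>R f x) \<in> borel_measurable lborel" using w(1) by measurable
  have "norm (w x *\<^sub>R f x) \<le> norm (C * indicator {a..b} x + C * (norm (f x))\<^sup>2)" for x
  proof (cases "x \<in> {a..b}")
    case True
    have C: "\<bar>w x\<bar> \<le> C" "0 \<le> C" using w(2)[of x] True by auto
    have "norm (f x) \<le> 1 + (norm (f x))\<^sup>2"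
      using sum_squares_bound[of 1 "norm (f x)"] by (simp add: power2_eq_square)
        (smt (verit) norm_ge_zero mult_nonneg_nonneg)
    then have "\<bar>w x\<bar> * norm (f x) \<le> C * (1 + (norm (f x))\<^sup>2)" using C by (intro mult_mono) auto
    then show ?thesis using True C by (simp add: algebra_simps)
  next
    case False
    then have "w x = 0" using w(2)[of x] by simp
    moreover have "C * (norm (f x))\<^sup>2 = 0 \<or> True" by simp
    ultimately show ?thesis by simp
  qed
  then show "AE x in lborel. norm (w x *\<^sub>R f x) \<le> norm (C * indicator {a..b} x + C * (norm (f x))\<^sup>2)" by simp
qed

lemma test_function_bounds:
  assumes "test_function UNIV \<phi>"
  obtains R C where "\<And>x. \<bar>\<phi> x\<bar> \<le> indicator {-R..R} x * C" "\<And>x. \<bar>vderiv \<phi> x\<bar> \<le> indicator {-R..R} x * C"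
proof -
  have s: "smooth \<phi>" and c: "compact (closure {x. \<phi> x \<noteq> 0})" using assms by (auto simp: test_function_def)
  obtain R where R: "\<And>x. \<phi> x \<noteq> 0 \<Longrightarrow> \<bar>x\<bar> < R"
    using compact_imp_bounded[OF c] closure_subset unfolding bounded_iff
    by (metis (mono_tags, lifting) gt_ex le_less_trans mem_Collect_eq real_norm_def subsetD)
  have z: "\<phi> x = 0" if "x \<notin> {-R..R}" for x using R[of x] that by (cases "\<phi> x = 0") auto
  have z': "vderiv \<phi> x = 0" if "x \<notin> {-R..R}" for x
  proof -
    have "(\<phi> has_vector_derivative 0) (at x)"
      by (rule has_vector_derivative_transform_within_open[OF has_vector_derivative_const, where S = "- {-R..R}"])
         (use that z in auto)
    then show ?thesis unfolding vderiv_def by (rule vector_derivative_at)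
  qed
  have "bounded (\<phi> ` {-R..R})" "bounded (vderiv \<phi> ` {-R..R})"
    using continuous_on_smooth[OF s, of "{-R..R}" 0] continuous_on_smooth[OF s, of "{-R..R}" 1]
    by (auto intro!: compact_imp_bounded compact_continuous_image)
  then obtain C1 C2 where "\<forall>x\<in>{-R..R}. \<bar>\<phi> x\<bar> \<le> C1" "\<forall>x\<in>{-R..R}. \<bar>vderiv \<phi> x\<bar> \<le> C2"
    unfolding bounded_iff by auto
  then show thesis using z z' by (intro that[of R "max C1 C2"]) (auto simp: indicator_def le_max_iff_disj)
qed

text \<open>The relation \<open>L2_weak_deriv\<close> for functions instead of equivalence classes;
  square integrability, which the type of classes carries implicitly, is made explicit.\<close>

definition weak_deriv :: "(real \<Rightarrow> complex ^ 2) \<Rightarrow> (real \<Rightarrow> complex ^ 2) \<Rightarrow> bool" where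
  "weak_deriv f g \<longleftrightarrow> square_integrable f \<and> square_integrable g \<and>
     (\<forall>\<phi>. test_function UNIV \<phi> \<longrightarrow>
        (LINT x|lborel. vderiv \<phi> x *\<^sub>R f x) = - (LINT x|lborel. \<phi> x *\<^sub>R g x))"

lemma test_function_integrable:
  assumes "test_function UNIV \<phi>" "square_integrable f"
  shows "integrable lborel (\<lambda>x. \<phi> x *\<^sub>R f x)" "integrable lborel (\<lambda>x. vderiv \<phi> x *\<^sub>R f x)"
proof -
  have s: "smooth \<phi>" using assms by (auto simp: test_function_def)
  obtain R C where b: "\<And>x. \<bar>\<phi> x\<bar> \<le> indicator {-R..R} x * C" "\<And>x. \<bar>vderiv \<phi> x\<bar> \<le> indicator {-R..R} x * C"
    using test_function_bounds[OF assms(1)] by metis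
  have m: "\<phi> \<in> borel_measurable borel" "vderiv \<phi> \<in> borel_measurable borel"
    using continuous_on_smooth[OF s, of UNIV 0] continuous_on_smooth[OF s, of UNIV 1]
    by (auto intro: borel_measurable_continuous_onI)
  show "integrable lborel (\<lambda>x. \<phi> x *\<^sub>R f x)" "integrable lborel (\<lambda>x. vderiv \<phi> x *\<^sub>R f x)"
    by (rule square_integrable_on_bounded[OF assms(2) m(1) b(1)] square_integrable_on_bounded[OF assms(2) m(2) b(2)])+
qed

lemma weak_deriv_unique:
  assumes "weak_deriv f g" "weak_deriv f h"
  shows "AE x in lborel. g x = h x"
proof -
  have sq: "square_integrable g" "square_integrable h" "square_integrable (\<lambda>x. g x - h x)"
    using assms by (auto simp: weak_deriv_def square_integrable_diff)
  have int: "(LINT x|lborel. \<phi> x *\<^sub>R (g x - h x)) = 0" if "test_function UNIV \<phi>" for \<phi>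
    using assms that test_function_integrable[OF that sq(1)] test_function_integrable[OF that sq(2)]
    by (simp add: weak_deriv_def scaleR_diff_right)
  have [measurable]: "g \<in> borel_measurable borel" "h \<in> borel_measurable borel"
    using sq by (auto simp: square_integrable_def)
  have "AE x in lborel. (g x - h x) \<bullet> b = 0" for b
  proof (rule AE_zero_of_test_integrals)
    show "set_integrable lborel {-R..R} (\<lambda>x. (g x - h x) \<bullet> b)" for R
    proof -
      have "integrable lborel (\<lambda>x. indicat_real {-R..R} x *\<^sub>R (g x - h x))"
        by (rule square_integrable_on_bounded[OF sq(3), of _ "-R" R 1]) auto
      then have "integrable lborel (\<lambda>x. (indicat_real {-R..R} x *\<^sub>R (g x - h x)) \<bullet> b)" by (rule integrable_inner_left)
      then show ?thesis by (simp add: set_integrable_def)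
    qed
    fix \<phi> assume "test_function UNIV \<phi>"
    then have "(LINT x|lborel. (\<phi> x *\<^sub>R (g x - h x)) \<bullet> b) = 0"
      by (subst integral_inner_left) (use int test_function_integrable(1)[OF _ sq(3)] in auto)
    then show "(LINT x|lborel. \<phi> x * ((g x - h x) \<bullet> b)) = 0" by simp
  qed measurable
  then have "AE x in lborel. \<forall>b\<in>Basis. (g x - h x) \<bullet> b = 0"
    by (subst AE_finite_all) auto
  then show ?thesis
    by eventually_elim (auto intro: euclidean_eqI simp: inner_diff_left)
qed

lemma weak_deriv_cong_AE:
  assumes "weak_deriv f g" "AE x in lborel. f x = f' x" "AE x in lborel. g x = g' x"
    and "square_integrable f'" "square_integrable g'"
  shows "weak_deriv f' g'"
proof -
  have [measurable]: "f \<in> borel_measurable borel" "g \<in> borel_measurable borel"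
    "f' \<in> borel_measurable borel" "g' \<in> borel_measurable borel"
    using assms by (auto simp: weak_deriv_def square_integrable_def)
  have "(LINT x|lborel. vderiv \<phi> x *\<^sub>R f' x) = - (LINT x|lborel. \<phi> x *\<^sub>R g' x)" if t: "test_function UNIV \<phi>" for \<phi>
  proof -
    have s: "smooth \<phi>" using t by (auto simp: test_function_def)
    have [measurable]: "\<phi> \<in> borel_measurable borel" "vderiv \<phi> \<in> borel_measurable borel"
      using continuous_on_smooth[OF s, of UNIV 0] continuous_on_smooth[OF s, of UNIV 1]
      by (auto intro: borel_measurable_continuous_onI)
    have "(LINT x|lborel. vderiv \<phi> x *\<^sub>R f' x) = (LINT x|lborel. vderiv \<phi> x *\<^sub>R f x)"
      by (rule integral_cong_AE) (use assms(2) in auto)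
    moreover have "(LINT x|lborel. \<phi> x *\<^sub>R g' x) = (LINT x|lborel. \<phi> x *\<^sub>R g x)"
      by (rule integral_cong_AE) (use assms(3) in auto)
    ultimately show ?thesis using assms(1) t by (simp add: weak_deriv_def)
  qed
  then show ?thesis using assms by (simp add: weak_deriv_def)
qed

text \<open>Dividing \<open>\<psi>\<close> by a smooth cut-off \<open>\<theta>\<close> that is positive on a neighbourhood of its support, and
  multiplying a polynomial approximation of the quotient by \<open>\<theta>\<close> again, approximates \<open>\<psi>\<close> by test
  functions in \<open>C\<^sup>1\<close>.\<close>

lemma C1_approximation_by_test_functions:
  fixes \<psi> \<psi>' :: "real \<Rightarrow> real"
  assumes d: "\<And>x. (\<psi> has_real_derivative \<psi>' x) (at x)" and c: "continuous_on UNIV \<psi>'"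
    and z: "\<And>x. x \<notin> {-r..r} \<Longrightarrow> \<psi> x = 0" and r: "0 < r"
  obtains \<phi> R C where "\<And>n. test_function UNIV (\<phi> n)"
    "\<And>x. (\<lambda>n. \<phi> n x) \<longlonglongrightarrow> \<psi> x" "\<And>x. (\<lambda>n. vderiv (\<phi> n) x) \<longlonglongrightarrow> \<psi>' x"
    "\<And>n x. \<bar>\<phi> n x\<bar> \<le> indicator {-R..R} x * C" "\<And>n x. \<bar>vderiv (\<phi> n) x\<bar> \<le> indicator {-R..R} x * C"
proof -
  \<comment> \<open>The margin 1 makes the cut-off \<open>\<theta>\<close> positive on an open
    interval containing the closed interval outside which \<open>\<psi>\<close> vanishes.\<close>
  define R where "R = r + 1"
  define \<theta> where "\<theta> = (\<lambda>x. flat_exp (x + R) * flat_exp (- x + R))"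
  define \<theta>' where "\<theta>' = vderiv \<theta>"
  have s\<theta>: "smooth \<theta>"
    using smooth_prod[OF bounded_bilinear_mult smooth_affine[OF smooth_flat_exp, of 1 R] smooth_affine[OF smooth_flat_exp, of "-1" R]]
    by (simp add: \<theta>_def)
  have d\<theta>: "(\<theta> has_real_derivative \<theta>' x) (at x)" for x
    using smooth_has_vector_derivative[OF s\<theta>, of 0 x]
    by (simp add: \<theta>'_def has_real_derivative_iff_has_vector_derivative)
  have c\<theta>': "continuous_on UNIV \<theta>'" and c\<theta>: "continuous_on UNIV \<theta>"
    using continuous_on_smooth[OF s\<theta>, of UNIV 1] continuous_on_smooth[OF s\<theta>, of UNIV 0] by (auto simp: \<theta>'_def)
  have \<theta>_pos: "0 < \<theta> x \<longleftrightarrow> x \<in> {-R<..<R}" for x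
    using flat_exp_nonneg[of "x + R"] flat_exp_nonneg[of "- x + R"]
    by (auto simp: \<theta>_def zero_less_mult_iff flat_exp_pos_iff)
  have \<theta>_nonneg: "0 \<le> \<theta> x" for x by (auto simp: \<theta>_def flat_exp_nonneg)
  have \<theta>_0: "\<theta> x = 0" if "x \<notin> {-R<..<R}" for x using \<theta>_pos[of x] \<theta>_nonneg[of x] that by auto
  \<comment> \<open>The cut-off is nonnegative, so each of its zeros is a minimum and its derivative
    vanishes there too.\<close>
  have \<theta>'_0: "\<theta>' x = 0" if "x \<notin> {-R<..<R}" for x
  proof -
    have \<open>\<theta> x \<le> \<theta> y\<close> for y using \<theta>_0[OF that] \<theta>_nonneg[of y] by simp
    then show ?thesis using DERIV_local_min[OF d\<theta>, of 1 x] by simp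
  qed
  have \<psi>'_0: "\<psi>' x = 0" if x: "x \<notin> {-r..r}" for x
  proof -
    have "((\<lambda>x. 0) has_real_derivative \<psi>' x) (at x)"
      by (rule has_field_derivative_transform_within_open[OF d, where S = "- {-r..r}"]) (use x z in auto)
    then show ?thesis using DERIV_unique DERIV_const by blast
  qed
  \<comment> \<open>Where the cut-off vanishes, \<open>\<psi>\<close> and its derivative vanish as
    well, and division by zero returns 0. These formulas therefore give the right values on the
    whole line.\<close>
  define \<omega> where "\<omega> x = \<psi> x / \<theta> x" for x
  define \<omega>' where "\<omega>' x = (\<psi>' x * \<theta> x - \<psi> x * \<theta>' x) / (\<theta> x)\<^sup>2" for x
  \<comment> \<open>Two open sets cover the line: on one the denominator is positive, on the other
    everything is locally zero. Differentiability of the quotient and continuity of its derivative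
    are checked on each.\<close>
  have cov: "x \<in> {-R<..<R} \<or> x \<in> - {-r..r}" for x by (auto simp: R_def)
  have d\<omega>: "(\<omega> has_real_derivative \<omega>' x) (at x)" for x
    using cov[of x]
  proof
    assume "x \<in> {-R<..<R}"
    then have "\<theta> x \<noteq> 0" using \<theta>_pos[of x] by simp
    then show ?thesis unfolding \<omega>_def[abs_def] \<omega>'_def
      using DERIV_divide[OF d d\<theta>, of x] by (simp add: power2_eq_square)
  next
    assume x: "x \<in> - {-r..r}"
    have "((\<lambda>x. 0) has_real_derivative \<omega>' x) (at x)" using x z \<psi>'_0 by (simp add: \<omega>'_def)
    then show ?thesis
      by (rule has_field_derivative_transform_within_open[where S = "- {-r..r}"]) (use x z in \<open>auto simp: \<omega>_def\<close>)
  qed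
  have "isCont \<omega>' x" for x
    using cov[of x]
  proof
    assume x: "x \<in> {-R<..<R}"
    have "continuous_on {-R<..<R} \<omega>'"
      unfolding \<omega>'_def
      using \<theta>_pos \<theta>_nonneg DERIV_continuous_on[OF has_field_derivative_at_within[OF d]]
      by (intro continuous_intros continuous_on_subset[OF c] continuous_on_subset[OF c\<theta>] continuous_on_subset[OF c\<theta>'])
         (auto simp: less_le)
    then show ?thesis using x by (simp add: continuous_on_eq_continuous_at)
  next
    assume x: "x \<in> - {-r..r}"
    have "continuous_on (- {-r..r}) (\<lambda>x. 0::real)" by (rule continuous_on_const)
    then have "continuous_on (- {-r..r}) \<omega>'"
      by (rule continuous_on_eq) (use z \<psi>'_0 in \<open>auto simp: \<omega>'_def\<close>)
    then show ?thesis using x by (subst (asm) continuous_on_eq_continuous_at) auto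
  qed
  then have c\<omega>': "continuous_on {-R..R} \<omega>'" by (auto intro: continuous_at_imp_continuous_on)
  have \<theta>\<omega>: "\<theta> x * \<omega> x = \<psi> x" "\<theta> x * \<omega>' x + \<theta>' x * \<omega> x = \<psi>' x" if "x \<in> {-R<..<R}" for x
    using \<theta>_pos[of x] that by (auto simp: \<omega>_def \<omega>'_def power2_eq_square field_simps)
  have out: "\<psi> x = 0" "\<psi>' x = 0" if "x \<notin> {-R<..<R}" for x
    using cov[of x] that z \<psi>'_0 by auto
  \<comment> \<open>Weierstrass is applied to the derivative of the quotient; integrating the
    approximating polynomial then approximates the quotient itself. The other order would give no
    control of derivatives.\<close>
  have approx: "\<exists>P. \<forall>x\<in>{-R..R}. \<bar>poly (pderiv P) x - \<omega>' x\<bar> < e \<and> \<bar>poly P x - \<omega> x\<bar> \<le> 2 * R * e" if e: "e > 0" for e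
  proof -
    obtain g where g: "real_polynomial_function g" "\<And>x. x \<in> {-R..R} \<Longrightarrow> \<bar>\<omega>' x - g x\<bar> < e"
      using Stone_Weierstrass_real_polynomial_function[OF _ c\<omega>' e] by auto
    then obtain a n where ga: "g = (\<lambda>x. \<Sum>i\<le>n. a i * x ^ i)"
      by (auto simp: real_polynomial_function_iff_sum)
    define Q where "Q = (\<Sum>i\<le>n. monom (a i / real (Suc i)) (Suc i))"
    \<comment> \<open>The constant makes \<open>P\<close> agree with the quotient at the left
      endpoint, so the error grows at rate at most \<open>e\<close> over an interval of length
      \<open>2 * R\<close>.\<close>
    define P where "P = Q + [:\<omega> (-R) - poly Q (-R):]"
    have pQ: "poly Q x = (\<Sum>i\<le>n. a i / real (Suc i) * x ^ Suc i)" for x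
      by (simp add: Q_def poly_sum poly_monom del: of_nat_Suc power_Suc)
    have dQ: "(poly Q has_real_derivative g x) (at x)" for x
      unfolding pQ ga
      by (auto intro!: derivative_eq_intros sum.cong simp: field_simps simp del: of_nat_Suc power_Suc)
    then have "poly (pderiv Q) x = g x" for x
      using poly_DERIV[of Q x] DERIV_unique by blast
    then have pd: "poly (pderiv P) x = g x" for x by (simp add: P_def pderiv_add pderiv_pCons)
    have "\<bar>poly P x - \<omega> x\<bar> \<le> 2 * R * e" if x: "x \<in> {-R..R}" for x
    proof -
      have "norm ((poly P x - \<omega> x) - (poly P (-R) - \<omega> (-R))) \<le> e * norm (x - (-R))"
      proof (rule field_differentiable_bound[where S = "{-R..R}" and f' = "\<lambda>x. poly (pderiv P) x - \<omega>' x"])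
        fix w assume w: "w \<in> {-R..R}"
        show "((\<lambda>x. poly P x - \<omega> x) has_field_derivative poly (pderiv P) w - \<omega>' w) (at w within {-R..R})"
          by (rule has_field_derivative_at_within[OF DERIV_diff[OF poly_DERIV d\<omega>]])
        show "norm (poly (pderiv P) w - \<omega>' w) \<le> e" using g(2)[OF w] by (simp add: pd abs_minus_commute)
      qed (use x in auto)
      moreover have "poly P (-R) - \<omega> (-R) = 0" by (simp add: P_def)
      moreover have "e * norm (x - (-R)) \<le> e * (2 * R)" using x e by (intro mult_left_mono) auto
      ultimately show ?thesis by (simp add: ac_simps)
    qed
    moreover have "\<bar>poly (pderiv P) x - \<omega>' x\<bar> < e" if "x \<in> {-R..R}" for x
      using g(2)[OF that] by (simp add: pd abs_minus_commute)
    ultimately show ?thesis by blast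
  qed
  have "\<exists>P. \<forall>n. \<forall>x\<in>{-R..R}. \<bar>poly (pderiv (P n)) x - \<omega>' x\<bar> < inverse (real (Suc n)) \<and>
      \<bar>poly (P n) x - \<omega> x\<bar> \<le> 2 * R * inverse (real (Suc n))"
    by (rule choice) (intro allI approx, simp)
  then obtain P where P: "\<And>n x. x \<in> {-R..R} \<Longrightarrow> \<bar>poly (pderiv (P n)) x - \<omega>' x\<bar> \<le> inverse (real (Suc n))"
      "\<And>n x. x \<in> {-R..R} \<Longrightarrow> \<bar>poly (P n) x - \<omega> x\<bar> \<le> 2 * R * inverse (real (Suc n))"
    by (meson less_imp_le)
  have lim: "(\<lambda>n. poly (pderiv (P n)) x) \<longlonglongrightarrow> \<omega>' x" "(\<lambda>n. poly (P n) x) \<longlonglongrightarrow> \<omega> x" if "x \<in> {-R..R}" for x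
  proof -
    have 1: "(\<lambda>n. inverse (real (Suc n))) \<longlonglongrightarrow> 0" by (rule LIMSEQ_inverse_real_of_nat)
    have 2: "(\<lambda>n. 2 * R * inverse (real (Suc n))) \<longlonglongrightarrow> 0" using tendsto_mult_left[OF 1, of "2 * R"] by simp
    show "(\<lambda>n. poly (pderiv (P n)) x) \<longlonglongrightarrow> \<omega>' x"
      by (rule LIM_zero_cancel, rule Lim_null_comparison[OF _ 1]) (use P(1)[OF that] in \<open>auto intro!: always_eventually\<close>)
    show "(\<lambda>n. poly (P n) x) \<longlonglongrightarrow> \<omega> x"
      by (rule LIM_zero_cancel, rule Lim_null_comparison[OF _ 2]) (use P(2)[OF that] in \<open>auto intro!: always_eventually\<close>)
  qed
  define \<phi> where "\<phi> n x = \<theta> x * poly (P n) x" for n x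
  have v\<phi>: "vderiv (\<phi> n) x = \<theta> x * poly (pderiv (P n)) x + \<theta>' x * poly (P n) x" for n x
  proof -
    have "(\<phi> n has_real_derivative \<theta> x * poly (pderiv (P n)) x + \<theta>' x * poly (P n) x) (at x)"
      unfolding \<phi>_def[abs_def] using DERIV_mult[OF d\<theta>[of x] poly_DERIV[of "P n" x]] by (simp add: algebra_simps)
    then show ?thesis
      unfolding vderiv_def by (intro vector_derivative_at) (simp add: has_real_derivative_iff_has_vector_derivative)
  qed
  have "test_function UNIV (\<phi> n)" for n
  proof (rule test_functionI)
    show "smooth (\<phi> n)"
      unfolding \<phi>_def[abs_def] by (intro smooth_prod[OF bounded_bilinear_mult] s\<theta> smooth_poly)
    show "x \<in> {-R..R}" if "\<phi> n x \<noteq> 0" for x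
      using \<theta>_0[of x] that by (cases "x \<in> {-R<..<R}") (auto simp: \<phi>_def)
  qed
  moreover have "(\<lambda>n. \<phi> n x) \<longlonglongrightarrow> \<psi> x" for x
  proof (cases "x \<in> {-R<..<R}")
    case True
    then have "(\<lambda>n. \<phi> n x) \<longlonglongrightarrow> \<theta> x * \<omega> x" unfolding \<phi>_def by (intro tendsto_mult tendsto_const lim) auto
    then show ?thesis using \<theta>\<omega>[OF True] by simp
  next
    case False
    then show ?thesis by (simp add: \<phi>_def \<theta>_0 out)
  qed
  moreover have "(\<lambda>n. vderiv (\<phi> n) x) \<longlonglongrightarrow> \<psi>' x" for x
  proof (cases "x \<in> {-R<..<R}")
    case True
    then have "(\<lambda>n. vderiv (\<phi> n) x) \<longlonglongrightarrow> \<theta> x * \<omega>' x + \<theta>' x * \<omega> x"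
      unfolding v\<phi> by (intro tendsto_add tendsto_mult tendsto_const lim) auto
    then show ?thesis using \<theta>\<omega>[OF True] by simp
  next
    case False
    then show ?thesis by (simp add: v\<phi> \<theta>_0 \<theta>'_0 out)
  qed
  moreover have "\<exists>C. \<forall>n x. \<bar>\<phi> n x\<bar> \<le> indicator {-R..R} x * C \<and> \<bar>vderiv (\<phi> n) x\<bar> \<le> indicator {-R..R} x * C"
  proof -
    have "\<exists>C. \<forall>x\<in>{-R..R}. \<bar>f x\<bar> \<le> C" if "continuous_on {-R..R} f" for f :: "real \<Rightarrow> real"
      using compact_imp_bounded[OF compact_continuous_image[OF that compact_Icc]] by (auto simp: bounded_iff)
    from this[OF continuous_on_subset[OF c\<theta>]] this[OF continuous_on_subset[OF c\<theta>']] this[OF c\<omega>']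
      this[OF DERIV_continuous_on[OF has_field_derivative_at_within[OF d\<omega>]]]
    obtain a b c d where abcd: "\<And>x. x \<in> {-R..R} \<Longrightarrow> \<bar>\<theta> x\<bar> \<le> a" "\<And>x. x \<in> {-R..R} \<Longrightarrow> \<bar>\<theta>' x\<bar> \<le> b"
      "\<And>x. x \<in> {-R..R} \<Longrightarrow> \<bar>\<omega>' x\<bar> \<le> c" "\<And>x. x \<in> {-R..R} \<Longrightarrow> \<bar>\<omega> x\<bar> \<le> d" by blast
    have R: "R > 0" using r by (simp add: R_def)
    have ab: "a \<ge> 0" "b \<ge> 0" "c \<ge> 0" "d \<ge> 0" using abcd[of 0] R by auto
    have i1: "inverse (real (Suc n)) \<le> 1" for n by (simp add: field_simps)
    have p: "\<bar>poly (P n) x\<bar> \<le> d + 2 * R" "\<bar>poly (pderiv (P n)) x\<bar> \<le> c + 1" if x: "x \<in> {-R..R}" for n x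
    proof -
      have "2 * R * inverse (real (Suc n)) \<le> 2 * R * 1" using R by (intro mult_left_mono i1) auto
      then show "\<bar>poly (P n) x\<bar> \<le> d + 2 * R" using P(2)[OF x, of n] abcd(4)[OF x] by linarith
      show "\<bar>poly (pderiv (P n)) x\<bar> \<le> c + 1" using P(1)[OF x, of n] i1[of n] abcd(3)[OF x] by linarith
    qed
    have m: "\<bar>u * v\<bar> \<le> s * t" if "\<bar>u\<bar> \<le> s" "\<bar>v\<bar> \<le> t" for u v s t :: real
      unfolding abs_mult using that by (intro mult_mono) auto
    define C where "C = a * (d + 2 * R) + a * (c + 1) + b * (d + 2 * R)"
    have "\<bar>\<phi> n x\<bar> \<le> indicator {-R..R} x * C \<and> \<bar>vderiv (\<phi> n) x\<bar> \<le> indicator {-R..R} x * C" for n x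
    proof (cases "x \<in> {-R..R}")
      case True
      have "\<bar>\<phi> n x\<bar> \<le> a * (d + 2 * R)" unfolding \<phi>_def using True by (intro m abcd p)
      moreover have "\<bar>vderiv (\<phi> n) x\<bar> \<le> a * (c + 1) + b * (d + 2 * R)"
        unfolding v\<phi> using True by (intro order_trans[OF abs_triangle_ineq] add_mono m abcd p)
      moreover have "0 \<le> a * (d + 2 * R)" "0 \<le> a * (c + 1)" "0 \<le> b * (d + 2 * R)" using ab R by auto
      ultimately show ?thesis using True by (auto simp: C_def)
    next
      case False
      then have "x \<notin> {-R<..<R}" by auto
      with False show ?thesis by (simp add: \<phi>_def v\<phi> \<theta>_0 \<theta>'_0)
    qed
    then show ?thesis by blast
  qed
  ultimately show thesis using that by blast
qed

text \<open>Extends the defining identity to compactly supported C^1 functions by dominated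
  convergence. This is needed because a test function times a coefficient that is only known to be
  C^1 need not be a test function.\<close>

lemma weak_deriv_C1:
  fixes \<psi> \<psi>' :: "real \<Rightarrow> real"
  assumes fg: "weak_deriv f g"
    and d: "\<And>x. (\<psi> has_real_derivative \<psi>' x) (at x)" and c: "continuous_on UNIV \<psi>'"
    and z: "\<And>x. x \<notin> {-r..r} \<Longrightarrow> \<psi> x = 0"
  shows "(LINT x|lborel. \<psi>' x *\<^sub>R f x) = - (LINT x|lborel. \<psi> x *\<^sub>R g x)"
proof -
  have z': "\<And>x. x \<notin> {- max r 1..max r 1} \<Longrightarrow> \<psi> x = 0" using z by force
  obtain \<phi> R C where \<phi>: "\<And>n. test_function UNIV (\<phi> n)"
    "\<And>x. (\<lambda>n. \<phi> n x) \<longlonglongrightarrow> \<psi> x" "\<And>x. (\<lambda>n. vderiv (\<phi> n) x) \<longlonglongrightarrow> \<psi>' x"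
    "\<And>n x. \<bar>\<phi> n x\<bar> \<le> indicator {-R..R} x * C" "\<And>n x. \<bar>vderiv (\<phi> n) x\<bar> \<le> indicator {-R..R} x * C"
    using C1_approximation_by_test_functions[OF d c z'] by (metis less_max_iff_disj zero_less_one)
  have [measurable]: "\<phi> n \<in> borel_measurable borel" "vderiv (\<phi> n) \<in> borel_measurable borel" for n
    using \<phi>(1)[of n] continuous_on_smooth[of "\<phi> n" UNIV 0] continuous_on_smooth[of "\<phi> n" UNIV 1]
    by (auto simp: test_function_def intro: borel_measurable_continuous_onI)
  have [measurable]: "\<psi> \<in> borel_measurable borel" "\<psi>' \<in> borel_measurable borel"
    using c DERIV_continuous_on[OF has_field_derivative_at_within[OF d], of UNIV]
    by (auto intro: borel_measurable_continuous_onI)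
  have [measurable]: "f \<in> borel_measurable borel" "g \<in> borel_measurable borel"
    and sq: "square_integrable f" "square_integrable g"
    using fg by (auto simp: weak_deriv_def square_integrable_def)
  have conv: "(\<lambda>n. LINT x|lborel. a n x *\<^sub>R h x) \<longlonglongrightarrow> (LINT x|lborel. b x *\<^sub>R h x)"
    if [measurable]: "\<And>n. a n \<in> borel_measurable borel" "b \<in> borel_measurable borel" and "square_integrable h"
      and "\<And>x. (\<lambda>n. a n x) \<longlonglongrightarrow> b x" and le: "\<And>n x. \<bar>a n x\<bar> \<le> indicator {-R..R} x * C"
    for a :: "nat \<Rightarrow> real \<Rightarrow> real" and b :: "real \<Rightarrow> real" and h :: "real \<Rightarrow> complex ^ 2"
  proof (rule integral_dominated_convergence[where w = "\<lambda>x. norm ((indicator {-R..R} x * C) *\<^sub>R h x)"])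
    have [measurable]: "h \<in> borel_measurable borel" using that by (simp add: square_integrable_def)
    show "(\<lambda>x. b x *\<^sub>R h x) \<in> borel_measurable lborel" "(\<lambda>x. a n x *\<^sub>R h x) \<in> borel_measurable lborel" for n
      by measurable
    have C: "\<bar>indicator {-R..R} x * C\<bar> = indicator {-R..R} x * \<bar>C\<bar>" for x by (simp add: abs_mult)
    show "integrable lborel (\<lambda>x. norm ((indicator {-R..R} x * C) *\<^sub>R h x))"
      by (intro integrable_norm square_integrable_on_bounded[where C = "\<bar>C\<bar>" and a = "-R" and b = R] that(3))
         (auto simp: C)
    show "AE x in lborel. (\<lambda>n. a n x *\<^sub>R h x) \<longlonglongrightarrow> b x *\<^sub>R h x"
      by (intro AE_I2 tendsto_scaleR tendsto_const that)
    show "AE x in lborel. norm (a n x *\<^sub>R h x) \<le> norm ((indicator {-R..R} x * C) *\<^sub>R h x)" for n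
      unfolding norm_scaleR real_norm_def
      by (intro AE_I2 mult_right_mono norm_ge_zero order_trans[OF le abs_ge_self])
  qed
  have "(\<lambda>n. LINT x|lborel. vderiv (\<phi> n) x *\<^sub>R f x) \<longlonglongrightarrow> (LINT x|lborel. \<psi>' x *\<^sub>R f x)"
    by (intro conv \<phi> sq) auto
  moreover have "(\<lambda>n. - (LINT x|lborel. \<phi> n x *\<^sub>R g x)) \<longlonglongrightarrow> - (LINT x|lborel. \<psi> x *\<^sub>R g x)"
    by (intro tendsto_minus conv \<phi> sq) auto
  moreover have "(LINT x|lborel. vderiv (\<phi> n) x *\<^sub>R f x) = - (LINT x|lborel. \<phi> n x *\<^sub>R g x)" for n
    using fg \<phi>(1)[of n] by (simp add: weak_deriv_def)
  ultimately show ?thesis using LIMSEQ_unique by simp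
qed

lemma square_integrable_mult_bounded:
  assumes a: "a \<in> borel_measurable borel" "\<And>x. \<bar>a x\<bar> \<le> C" and f: "square_integrable f"
  shows "square_integrable (\<lambda>x. a x *\<^sub>R f x)"
proof -
  have [measurable]: "f \<in> borel_measurable borel" "a \<in> borel_measurable borel" using f a by (auto simp: square_integrable_def)
  have "integrable lborel (\<lambda>x. (norm (a x *\<^sub>R f x))\<^sup>2)"
  proof (rule Bochner_Integration.integrable_bound)
    show "integrable lborel (\<lambda>x. C\<^sup>2 * (norm (f x))\<^sup>2)" using f by (auto simp: square_integrable_def)
    have "(norm (a x *\<^sub>R f x))\<^sup>2 \<le> C\<^sup>2 * (norm (f x))\<^sup>2" for x
    proof -
      have "\<bar>a x\<bar>\<^sup>2 \<le> C\<^sup>2" using a(2)[of x] by (intro power_mono) auto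
      then show ?thesis unfolding norm_scaleR power_mult_distrib by (intro mult_right_mono) auto
    qed
    then show "AE x in lborel. norm ((norm (a x *\<^sub>R f x))\<^sup>2) \<le> norm (C\<^sup>2 * (norm (f x))\<^sup>2)" by (simp add: abs_mult)
  qed measurable
  then show ?thesis by (simp add: square_integrable_def)
qed

lemma square_integrable_linear:
  assumes L: "bounded_linear L" and f: "square_integrable f"
  shows "square_integrable (\<lambda>x. L (f x))"
proof -
  obtain K where K: "\<And>v. norm (L v) \<le> norm v * K" using bounded_linear.bounded[OF L] by blast
  have [measurable]: "f \<in> borel_measurable borel" using f by (auto simp: square_integrable_def)
  have m: "(\<lambda>x. L (f x)) \<in> borel_measurable borel"
    by (rule borel_measurable_continuous_on[OF linear_continuous_on[OF L]]) measurable
  have "integrable lborel (\<lambda>x. (norm (L (f x)))\<^sup>2)"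
  proof (rule Bochner_Integration.integrable_bound)
    show "integrable lborel (\<lambda>x. K\<^sup>2 * (norm (f x))\<^sup>2)" using f by (auto simp: square_integrable_def)
    have "(norm (L (f x)))\<^sup>2 \<le> (norm (f x) * K)\<^sup>2" for x using K[of "f x"] by (intro power_mono) auto
    then show "AE x in lborel. norm ((norm (L (f x)))\<^sup>2) \<le> norm (K\<^sup>2 * (norm (f x))\<^sup>2)"
      by (simp add: abs_mult power_mult_distrib mult.commute)
    show "(\<lambda>x. (norm (L (f x)))\<^sup>2) \<in> borel_measurable lborel" using m by measurable
  qed
  then show ?thesis using m by (simp add: square_integrable_def)
qed

lemma weak_deriv_add:
  assumes "weak_deriv f g" "weak_deriv f' g'"
  shows "weak_deriv (\<lambda>x. f x + f' x) (\<lambda>x. g x + g' x)"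
  using assms test_function_integrable
  by (auto simp: weak_deriv_def square_integrable_add scaleR_add_right)

lemma weak_deriv_zero: "weak_deriv (\<lambda>x. 0) (\<lambda>x. 0)"
  by (simp add: weak_deriv_def square_integrable_zero)

lemma weak_deriv_sum:
  assumes "finite I" "\<And>i. i \<in> I \<Longrightarrow> weak_deriv (f i) (g i)"
  shows "weak_deriv (\<lambda>x. \<Sum>i\<in>I. f i x) (\<lambda>x. \<Sum>i\<in>I. g i x)"
  using assms by (induction I rule: finite_induct) (auto simp: weak_deriv_zero intro: weak_deriv_add)

lemma weak_deriv_linear:
  assumes L: "bounded_linear L" and fg: "weak_deriv f g"
  shows "weak_deriv (\<lambda>x. L (f x)) (\<lambda>x. L (g x))"
proof -
  interpret bounded_linear L by (rule L)
  have int: "(LINT x|lborel. a x *\<^sub>R L (h x)) = L (LINT x|lborel. a x *\<^sub>R h x)"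
    if "integrable lborel (\<lambda>x. a x *\<^sub>R h x)" for a h
    using integral_bounded_linear[OF L that] by (simp add: scaleR)
  show ?thesis
    using fg test_function_integrable
    by (auto simp: weak_deriv_def int neg square_integrable_linear[OF L])
qed

text \<open>The product rule is the C^1 identity for \<open>f\<close> tested with
  \<open>\<phi>\<close> times \<open>a\<close>; the derivative of that product supplies the extra
  term.\<close>

lemma weak_deriv_mult:
  fixes a a' :: "real \<Rightarrow> real"
  assumes fg: "weak_deriv f g" and a: "\<And>x. (a has_real_derivative a' x) (at x)" and ca': "continuous_on UNIV a'"
    and b: "\<And>x. \<bar>a x\<bar> \<le> C" "\<And>x. \<bar>a' x\<bar> \<le> C"
  shows "weak_deriv (\<lambda>x. a x *\<^sub>R f x) (\<lambda>x. a' x *\<^sub>R f x + a x *\<^sub>R g x)"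
proof -
  have ca: "continuous_on UNIV a" using DERIV_continuous_on[OF has_field_derivative_at_within[OF a]] .
  have m: "a \<in> borel_measurable borel" "a' \<in> borel_measurable borel"
    using ca ca' by (auto intro: borel_measurable_continuous_onI)
  have sq: "square_integrable f" "square_integrable g" using fg by (auto simp: weak_deriv_def)
  have sqs: "square_integrable (\<lambda>x. a x *\<^sub>R f x)" "square_integrable (\<lambda>x. a' x *\<^sub>R f x)"
    "square_integrable (\<lambda>x. a x *\<^sub>R g x)" "square_integrable (\<lambda>x. a' x *\<^sub>R f x + a x *\<^sub>R g x)"
    by (intro square_integrable_add square_integrable_mult_bounded[OF m(1) b(1)]
        square_integrable_mult_bounded[OF m(2) b(2)] sq)+
  have "(LINT x|lborel. vderiv \<phi> x *\<^sub>R a x *\<^sub>R f x) = - (LINT x|lborel. \<phi> x *\<^sub>R (a' x *\<^sub>R f x + a x *\<^sub>R g x))"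
    if t: "test_function UNIV \<phi>" for \<phi>
  proof -
    have s: "smooth \<phi>" using t by (auto simp: test_function_def)
    obtain R D where R: "\<And>x. \<bar>\<phi> x\<bar> \<le> indicator {-R..R} x * D" using test_function_bounds[OF t] by metis
    have "(LINT x|lborel. (vderiv \<phi> x * a x + \<phi> x * a' x) *\<^sub>R f x) = - (LINT x|lborel. (\<phi> x * a x) *\<^sub>R g x)"
    proof (rule weak_deriv_C1[OF fg, where r = R])
      have "(\<phi> has_real_derivative vderiv \<phi> x) (at x)" for x
        using smooth_has_vector_derivative[OF s, of 0 x] by (simp add: has_real_derivative_iff_has_vector_derivative)
      from DERIV_mult[OF this a]
      show "((\<lambda>x. \<phi> x * a x) has_real_derivative vderiv \<phi> x * a x + \<phi> x * a' x) (at x)" for x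
        by (simp add: algebra_simps)
      show "continuous_on UNIV (\<lambda>x. vderiv \<phi> x * a x + \<phi> x * a' x)"
        using continuous_on_smooth[OF s, of UNIV 0] continuous_on_smooth[OF s, of UNIV 1] ca ca'
        by (auto intro!: continuous_intros)
      show "\<phi> x * a x = 0" if "x \<notin> {-R..R}" for x using R[of x] that by simp
    qed
    moreover have "(LINT x|lborel. (vderiv \<phi> x * a x + \<phi> x * a' x) *\<^sub>R f x) =
        (LINT x|lborel. vderiv \<phi> x *\<^sub>R a x *\<^sub>R f x) + (LINT x|lborel. \<phi> x *\<^sub>R a' x *\<^sub>R f x)"
      using test_function_integrable(2)[OF t sqs(1)] test_function_integrable(1)[OF t sqs(2)]
      by (simp add: scaleR_add_left)
    moreover have "(LINT x|lborel. \<phi> x *\<^sub>R (a' x *\<^sub>R f x + a x *\<^sub>R g x)) =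
        (LINT x|lborel. \<phi> x *\<^sub>R a' x *\<^sub>R f x) + (LINT x|lborel. \<phi> x *\<^sub>R a x *\<^sub>R g x)"
      using test_function_integrable(1)[OF t sqs(2)] test_function_integrable(1)[OF t sqs(3)]
      by (simp add: scaleR_add_right)
    ultimately show ?thesis by (simp add: add_eq_0_iff algebra_simps)
  qed
  then show ?thesis using sqs by (simp add: weak_deriv_def)
qed

section \<open>Multiplication operators and resolvents\<close>

lemma square_integrable_rep [simp]: "square_integrable (rep_L2 F)"
  using Quotient3_rep_reflp[OF Quotient3_L2, of F] by (simp add: L2_eq_def)

lemma rep_abs_L2: "square_integrable f \<Longrightarrow> AE x in lborel. rep_L2 (abs_L2 f) x = f x"
  using rep_abs_rsp[OF Quotient3_L2, of f f] by (auto simp: L2_eq_def elim: AE_mp)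

lemma abs_rep_L2 [simp]: "abs_L2 (rep_L2 F) = F"
  by (rule Quotient3_abs_rep[OF Quotient3_L2])

lemma L2_eqI: "AE x in lborel. rep_L2 F x = rep_L2 G x \<Longrightarrow> F = G"
  using Quotient3_rel_rep[OF Quotient3_L2, of F G] by (simp add: L2_eq_def)

lemma L2_eq_rep [simp]: "L2_eq (rep_L2 F) (rep_L2 F)"
  by (simp add: L2_eq_def)

lemma measurable_rep [measurable]: "rep_L2 F \<in> borel_measurable borel"
  using square_integrable_rep[of F] by (simp add: square_integrable_def)

lemma
  shows rep_L2_plus: "AE x in lborel. rep_L2 (F + G) x = rep_L2 F x + rep_L2 G x"
    and rep_L2_minus: "AE x in lborel. rep_L2 (F - G) x = rep_L2 F x - rep_L2 G x"
    and rep_L2_scaleR: "AE x in lborel. rep_L2 (c *\<^sub>R F) x = c *\<^sub>R rep_L2 F x"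
    and rep_L2_cscale: "AE x in lborel. rep_L2 (cscale z F) x = z *s rep_L2 F x"
  using rep_abs_L2[OF square_integrable_add[OF square_integrable_rep[of F] square_integrable_rep[of G]]]
    rep_abs_L2[OF square_integrable_diff[OF square_integrable_rep[of F] square_integrable_rep[of G]]]
    rep_abs_L2[OF square_integrable_scaleR[OF square_integrable_rep[of F]], of c]
    rep_abs_L2[OF square_integrable_cscale[OF square_integrable_rep[of F]], of z]
    plus_L2.abs_eq[of "rep_L2 F" "rep_L2 G"] minus_L2.abs_eq[of "rep_L2 F" "rep_L2 G"]
    scaleR_L2.abs_eq[of "rep_L2 F" c] cscale.abs_eq[of "rep_L2 F" z]
  by simp_all

lemma norm_L2_power2: "(norm F)\<^sup>2 = (LINT x|lborel. (norm (rep_L2 F x))\<^sup>2)"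
  using inner_L2.abs_eq[of "rep_L2 F" "rep_L2 F"] by (simp add: power2_norm_eq_inner)

lemma L2_weak_deriv_iff: "L2_weak_deriv F G \<longleftrightarrow> weak_deriv (rep_L2 F) (rep_L2 G)"
  by (simp add: L2_weak_deriv_def weak_deriv_def)

lemma H1_deriv:
  assumes "F \<in> H1"
  shows "weak_deriv (rep_L2 F) (rep_L2 (H1_deriv F))"
proof -
  obtain g where g: "L2_weak_deriv F g" using assms by (auto simp: H1_def)
  have "\<exists>!g. L2_weak_deriv F g"
    using g L2_eqI weak_deriv_unique by (auto simp: L2_weak_deriv_iff)
  then have "L2_weak_deriv F (H1_deriv F)" unfolding H1_deriv_def by (rule theI')
  then show ?thesis by (simp add: L2_weak_deriv_iff)
qed

lemma H1_I:
  assumes w: "weak_deriv f g" and f: "AE x in lborel. rep_L2 F x = f x"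
  shows "F \<in> H1" and "AE x in lborel. rep_L2 (H1_deriv F) x = g x"
proof -
  have sq: "square_integrable f" "square_integrable g" using w by (auto simp: weak_deriv_def)
  have a: "AE x in lborel. rep_L2 (abs_L2 g) x = g x" by (rule rep_abs_L2[OF sq(2)])
  have "AE x in lborel. f x = rep_L2 F x" "AE x in lborel. g x = rep_L2 (abs_L2 g) x"
    using f a by (eventually_elim, simp)+
  then have w': "weak_deriv (rep_L2 F) (rep_L2 (abs_L2 g))"
    by (rule weak_deriv_cong_AE[OF w]) simp_all
  then show H: "F \<in> H1" by (auto simp: H1_def L2_weak_deriv_iff)
  from weak_deriv_unique[OF H1_deriv[OF H] w'] a show "AE x in lborel. rep_L2 (H1_deriv F) x = g x"
    by eventually_elim simp
qed

definition bounded_matrix :: "(real \<Rightarrow> complex ^ 2 ^ 2) \<Rightarrow> real \<Rightarrow> bool" where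
  "bounded_matrix A C \<longleftrightarrow> A \<in> borel_measurable borel \<and> (\<forall>x. norm (A x) \<le> C)"

text \<open>Fixed once for all, so that operator bounds for different times, potentials and spectral
  parameters share one constant and the resolvent comparison is uniform.\<close>

definition bilinear_const :: real where
  "bilinear_const = (SOME K. 0 < K \<and> (\<forall>(A :: complex ^ 2 ^ 2) v. norm (A *v v) \<le> K * norm A * norm v))"

lemma bilinear_const: "0 < bilinear_const" "norm (A *v v) \<le> bilinear_const * norm (A :: complex ^ 2 ^ 2) * norm v"
proof -
  obtain K where K: "K > 0" "\<And>(A :: complex ^ 2 ^ 2) v. norm (A *v v) \<le> norm A * norm v * K"
    using bounded_bilinear.pos_bounded[OF bounded_bilinear_matrix_vector_mult] by blast
  then have "0 < K \<and> (\<forall>(A :: complex ^ 2 ^ 2) v. norm (A *v v) \<le> K * norm A * norm v)"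
    by (auto simp: mult.commute mult.left_commute)
  from someI[of "\<lambda>K. 0 < K \<and> (\<forall>(A :: complex ^ 2 ^ 2) v. norm (A *v v) \<le> K * norm A * norm v)", OF this]
  show "0 < bilinear_const" "norm (A *v v) \<le> bilinear_const * norm (A :: complex ^ 2 ^ 2) * norm v"
    unfolding bilinear_const_def by blast+
qed

lemma
  assumes A: "bounded_matrix A C" and f: "square_integrable f"
  shows square_integrable_matrix_mult: "square_integrable (\<lambda>x. A x *v f x)"
    and integral_matrix_mult_le:
      "(LINT x|lborel. (norm (A x *v f x))\<^sup>2) \<le> (bilinear_const * C)\<^sup>2 * (LINT x|lborel. (norm (f x))\<^sup>2)"
proof -
  have [measurable]: "A \<in> borel_measurable borel" "f \<in> borel_measurable borel"
    using A f by (auto simp: bounded_matrix_def square_integrable_def)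
  have "continuous_on UNIV (\<lambda>p :: (complex ^ 2 ^ 2) \<times> (complex ^ 2). fst p *v snd p)"
    by (intro bounded_bilinear.continuous_on[OF bounded_bilinear_matrix_vector_mult] continuous_intros)
  from borel_measurable_continuous_on[OF this, of "\<lambda>x. (A x, f x)" borel]
  have "(\<lambda>x. (\<lambda>p. fst p *v snd p) (A x, f x)) \<in> borel_measurable borel"
    using borel_measurable_Pair[of A borel f] A f by (simp add: bounded_matrix_def square_integrable_def)
  then have m: "(\<lambda>x. A x *v f x) \<in> borel_measurable borel" by simp
  have le: "(norm (A x *v f x))\<^sup>2 \<le> (bilinear_const * C)\<^sup>2 * (norm (f x))\<^sup>2" for x
  proof -
    have "norm (A x *v f x) \<le> bilinear_const * C * norm (f x)"
      using A bilinear_const(1)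
      by (intro order_trans[OF bilinear_const(2)] mult_right_mono mult_left_mono) (auto simp: bounded_matrix_def)
    then show ?thesis unfolding power_mult_distrib[symmetric] by (intro power_mono) auto
  qed
  have i: "integrable lborel (\<lambda>x. (bilinear_const * C)\<^sup>2 * (norm (f x))\<^sup>2)"
    using f by (auto simp: square_integrable_def)
  have j: "integrable lborel (\<lambda>x. (norm (A x *v f x))\<^sup>2)"
    by (rule Bochner_Integration.integrable_bound[OF i]) (use m le in \<open>auto intro!: AE_I2\<close>)
  then show "square_integrable (\<lambda>x. A x *v f x)" using m by (simp add: square_integrable_def)
  have "(LINT x|lborel. (norm (A x *v f x))\<^sup>2) \<le> (LINT x|lborel. (bilinear_const * C)\<^sup>2 * (norm (f x))\<^sup>2)"
    by (rule integral_mono[OF j i le])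
  then show "(LINT x|lborel. (norm (A x *v f x))\<^sup>2) \<le> (bilinear_const * C)\<^sup>2 * (LINT x|lborel. (norm (f x))\<^sup>2)"
    by simp
qed

lemma rep_L2_mult:
  "bounded_matrix A C \<Longrightarrow> AE x in lborel. rep_L2 (L2_mult A F) x = A x *v rep_L2 F x"
  unfolding L2_mult_def by (intro rep_abs_L2 square_integrable_matrix_mult square_integrable_rep)

lemma bounded_matrix_nonneg: "bounded_matrix A C \<Longrightarrow> 0 \<le> C"
  unfolding bounded_matrix_def using norm_ge_zero order_trans by blast

lemma norm_L2_mult_le:
  assumes A: "bounded_matrix A C"
  shows "norm (L2_mult A F) \<le> bilinear_const * C * norm F"
proof -
  have sq: "square_integrable (\<lambda>x. A x *v rep_L2 F x)"
    by (rule square_integrable_matrix_mult[OF A square_integrable_rep])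
  have [measurable]: "(\<lambda>x. A x *v rep_L2 F x) \<in> borel_measurable borel"
    using sq by (simp add: square_integrable_def)
  have "(norm (L2_mult A F))\<^sup>2 = (LINT x|lborel. (norm (A x *v rep_L2 F x))\<^sup>2)"
    unfolding norm_L2_power2
    by (rule integral_cong_AE, measurable, use rep_L2_mult[OF A, of F] in eventually_elim, simp)
  also have "\<dots> \<le> (bilinear_const * C * norm F)\<^sup>2"
    using integral_matrix_mult_le[OF A square_integrable_rep, of F] by (simp add: norm_L2_power2 power_mult_distrib)
  finally show ?thesis
    by (rule power2_le_imp_le) (use bilinear_const(1) bounded_matrix_nonneg[OF A] in auto)
qed

lemma bounded_linear_L2_mult:
  assumes A: "bounded_matrix A C"
  shows "bounded_linear (L2_mult A)" and "onorm (L2_mult A) \<le> bilinear_const * C"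
proof -
  interpret bounded_bilinear "\<lambda>(A :: complex ^ 2 ^ 2) v. A *v v" by (rule bounded_bilinear_matrix_vector_mult)
  show "bounded_linear (L2_mult A)"
  proof (rule bounded_linear_intro)
    fix F G c
    show "L2_mult A (F + G) = L2_mult A F + L2_mult A G"
    proof (rule L2_eqI)
      show "AE x in lborel. rep_L2 (L2_mult A (F + G)) x = rep_L2 (L2_mult A F + L2_mult A G) x"
        using rep_L2_mult[OF A, of F] rep_L2_mult[OF A, of G] rep_L2_mult[OF A, of "F + G"]
          rep_L2_plus[of F G] rep_L2_plus[of "L2_mult A F" "L2_mult A G"]
        by eventually_elim (simp add: add_right)
    qed
    show "L2_mult A (c *\<^sub>R F) = c *\<^sub>R L2_mult A F"
    proof (rule L2_eqI)
      show "AE x in lborel. rep_L2 (L2_mult A (c *\<^sub>R F)) x = rep_L2 (c *\<^sub>R L2_mult A F) x"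
        using rep_L2_mult[OF A, of F] rep_L2_mult[OF A, of "c *\<^sub>R F"]
          rep_L2_scaleR[of c F] rep_L2_scaleR[of c "L2_mult A F"]
        by eventually_elim (simp add: scaleR_right)
    qed
    show "norm (L2_mult A F) \<le> norm F * (bilinear_const * C)"
      using norm_L2_mult_le[OF A, of F] by (simp add: mult.commute)
  qed
  show "onorm (L2_mult A) \<le> bilinear_const * C"
    by (rule onorm_bound) (use norm_L2_mult_le[OF A] bilinear_const(1) bounded_matrix_nonneg[OF A] in auto)
qed

lemma L2_mult_mult:
  assumes A: "bounded_matrix A C" and B: "bounded_matrix B D" and AB: "\<And>x. A x ** B x = mat 1"
  shows "L2_mult A (L2_mult B F) = F"
proof (rule L2_eqI)
  show "AE x in lborel. rep_L2 (L2_mult A (L2_mult B F)) x = rep_L2 F x"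
    using rep_L2_mult[OF A, of "L2_mult B F"] rep_L2_mult[OF B, of F]
    by eventually_elim (simp add: matrix_vector_mul_assoc AB)
qed

text \<open>Expanding \<open>G\<close> in the real basis of the matrix space reduces the claim to
  real scalar coefficients times constant matrices, and the latter commute with weak
  differentiation.\<close>

lemma weak_deriv_matrix_mult:
  fixes G G' :: "real \<Rightarrow> complex ^ 2 ^ 2"
  assumes fg: "weak_deriv f g" and G: "\<And>x. (G has_vector_derivative G' x) (at x)" and c: "continuous_on UNIV G'"
    and b: "\<And>x. norm (G x) \<le> C" "\<And>x. norm (G' x) \<le> C"
  shows "weak_deriv (\<lambda>x. G x *v f x) (\<lambda>x. G' x *v f x + G x *v g x)"
proof -
  interpret mv: bounded_bilinear "\<lambda>(A :: complex ^ 2 ^ 2) v. A *v v" by (rule bounded_bilinear_matrix_vector_mult)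
  have expand: "A *v v = (\<Sum>b\<in>Basis. (A \<bullet> b) *\<^sub>R (b *v v))" for A :: "complex ^ 2 ^ 2" and v
  proof -
    have "A *v v = (\<Sum>b\<in>Basis. (A \<bullet> b) *\<^sub>R b) *v v" by (simp add: euclidean_representation)
    also have "\<dots> = (\<Sum>b\<in>Basis. (A \<bullet> b) *\<^sub>R (b *v v))" by (simp add: mv.sum_left mv.scaleR_left)
    finally show ?thesis .
  qed
  have "weak_deriv (\<lambda>x. \<Sum>b\<in>Basis. (G x \<bullet> b) *\<^sub>R (b *v f x))
      (\<lambda>x. \<Sum>b\<in>Basis. (G' x \<bullet> b) *\<^sub>R (b *v f x) + (G x \<bullet> b) *\<^sub>R (b *v g x))"
  proof (rule weak_deriv_sum[OF finite_Basis])
    fix b :: "complex ^ 2 ^ 2" assume b: "b \<in> Basis"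
    have "weak_deriv (\<lambda>x. b *v f x) (\<lambda>x. b *v g x)"
      by (rule weak_deriv_linear[OF mv.bounded_linear_right fg])
    moreover have "((\<lambda>x. G x \<bullet> b) has_real_derivative G' x \<bullet> b) (at x)" for x
      using bounded_linear.has_vector_derivative[OF bounded_linear_inner_left G]
      by (simp add: has_real_derivative_iff_has_vector_derivative)
    moreover have "continuous_on UNIV (\<lambda>x. G' x \<bullet> b)" by (intro continuous_intros c)
    moreover have "\<bar>G x \<bullet> b\<bar> \<le> C" "\<bar>G' x \<bullet> b\<bar> \<le> C" for x
      using Basis_le_norm[OF b, of "G x"] Basis_le_norm[OF b, of "G' x"] assms(4,5)[of x] by linarith+
    ultimately show "weak_deriv (\<lambda>x. (G x \<bullet> b) *\<^sub>R (b *v f x)) (\<lambda>x. (G' x \<bullet> b) *\<^sub>R (b *v f x) + (G x \<bullet> b) *\<^sub>R (b *v g x))"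
      by (rule weak_deriv_mult)
  qed
  then show ?thesis by (simp add: expand[symmetric] sum.distrib)
qed

section \<open>The intertwining relation for Dirac operators\<close>

definition bounded_potential :: "(real \<Rightarrow> complex) \<Rightarrow> bool" where
  "bounded_potential u \<longleftrightarrow> continuous_on UNIV u \<and> (\<exists>M. \<forall>x. norm (u x) \<le> M)"

lemma bounded_matrixI:
  "continuous_on UNIV A \<Longrightarrow> (\<And>x. norm (A x) \<le> C) \<Longrightarrow> bounded_matrix A C"
  by (auto simp: bounded_matrix_def intro: borel_measurable_continuous_onI)

lemma Q_matrix_mat2: "Q_matrix \<kappa> w = mat2 0 w (of_real \<kappa> * cnj w) 0"
  by (simp add: Q_matrix_def mat2_def)

lemma sigma3_mat2: "sigma3 = mat2 1 0 0 (-1)" "mat \<i> ** sigma3 = mat2 \<i> 0 0 (- \<i>)"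
  by (simp add: sigma3_def mat2_def)
    (rule mat2_eqI; simp add: sigma3_def mat_def matrix_matrix_mult_def sum_2)

lemma rep_dirac:
  assumes "bounded_potential u"
  shows "AE x in lborel. rep_L2 (dirac \<kappa> u F) x =
      (mat \<i> ** sigma3) *v rep_L2 (H1_deriv F) x + Q_matrix \<kappa> (u x) *v rep_L2 F x"
proof -
  obtain M where M: "\<And>x. norm (u x) \<le> M" and c: "continuous_on UNIV u"
    using assms by (auto simp: bounded_potential_def)
  have 1: "bounded_matrix (\<lambda>x. mat \<i> ** sigma3) (norm (mat \<i> ** sigma3 :: complex ^ 2 ^ 2))"
    by (rule bounded_matrixI) auto
  have 2: "bounded_matrix (\<lambda>x. Q_matrix \<kappa> (u x)) (M + \<bar>\<kappa>\<bar> * M)"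
  proof (rule bounded_matrixI)
    show "continuous_on UNIV (\<lambda>x. Q_matrix \<kappa> (u x))"
      unfolding Q_matrix_mat2 by (intro continuous_intros c)
    show "norm (Q_matrix \<kappa> (u x)) \<le> M + \<bar>\<kappa>\<bar> * M" for x
      unfolding Q_matrix_mat2 using M[of x]
      by (intro order_trans[OF norm_mat2_le]) (auto simp: norm_mult intro!: add_mono mult_left_mono)
  qed
  show ?thesis
    unfolding dirac_def
    using rep_L2_mult[OF 1, of "H1_deriv F"] rep_L2_mult[OF 2, of F]
      rep_L2_plus[of "L2_mult (\<lambda>x. mat \<i> ** sigma3) (H1_deriv F)" "L2_mult (\<lambda>x. Q_matrix \<kappa> (u x)) F"]
    by eventually_elim simp
qed

text \<open>Conjugation by sigma3, which is its own inverse. It appears when the matrix i sigma3 in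
  front of the derivative is moved past \<open>G\<close>.\<close>

definition sigma3_conj :: "(real \<Rightarrow> complex ^ 2 ^ 2) \<Rightarrow> real \<Rightarrow> complex ^ 2 ^ 2" where
  "sigma3_conj G x = sigma3 ** G x ** sigma3"

text \<open>Since i sigma3 U = z - Q, the term with U of \<open>v\<close> cancels the potential and
  spectral terms of \<open>v\<close> on the left. What remains is i sigma3 G (f' - U f) with U of
  \<open>u\<close>; moving i sigma3 past \<open>G\<close> conjugates \<open>G\<close> and recreates
  the operator of \<open>u\<close>.\<close>

lemma intertwining_pointwise:
  "(mat \<i> ** sigma3) *v ((U_matrix \<kappa> v x z ** G - G ** U_matrix \<kappa> u x z) *v f + G *v f') +
     Q_matrix \<kappa> (v x) *v (G *v f) - z *s (G *v f) =
   (sigma3 ** G ** sigma3) *v ((mat \<i> ** sigma3) *v f' + Q_matrix \<kappa> (u x) *v f - z *s f)"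
  unfolding sigma3_mat2(2) unfolding sigma3_mat2(1) U_matrix_mat2 Q_matrix_mat2
  by (simp add: vec_eq_iff forall_2 matrix_vector_mult_def matrix_matrix_mult_def sum_2 algebra_simps)

context
  fixes \<kappa> :: real and u v :: "real \<Rightarrow> complex" and z :: complex and G :: "real \<Rightarrow> complex ^ 2 ^ 2" and C :: real
  assumes G: "dirac_gauge \<kappa> u v z G C" and u: "bounded_potential u" and v: "bounded_potential v"
begin

lemma continuous_on_gauge: "continuous_on UNIV G"
  using G by (auto simp: dirac_gauge_def intro!: continuous_at_imp_continuous_on has_vector_derivative_continuous)

lemma gauge_bounded_matrix: "bounded_matrix G C"
  using G continuous_on_gauge by (intro bounded_matrixI) (auto simp: dirac_gauge_def)

text \<open>The conjugation only flips the signs of the off-diagonal entries. The factor 4 comes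
  from bounding the norm by the sum of the four entries.\<close>

lemma gauge_bounded_matrix_conj: "bounded_matrix (sigma3_conj G) (4 * C)"
proof (rule bounded_matrixI)
  have e: "sigma3_conj G x = mat2 (G x $ 1 $ 1) (- G x $ 1 $ 2) (- G x $ 2 $ 1) (G x $ 2 $ 2)" for x
    unfolding sigma3_conj_def sigma3_mat2
    by (rule mat2_eqI; simp add: matrix_matrix_mult_def sum_2)
  show "continuous_on UNIV (sigma3_conj G)"
    unfolding e[abs_def] by (intro continuous_intros continuous_on_gauge)
  have n: "norm (A $ i $ j) \<le> norm A" for A :: "complex ^ 2 ^ 2" and i j
    by (rule order_trans[OF Finite_Cartesian_Product.norm_nth_le Finite_Cartesian_Product.norm_nth_le])
  show "norm (sigma3_conj G x) \<le> 4 * C" for x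
    unfolding e using order_trans[OF n, of "G x" C] G
    by (intro order_trans[OF norm_mat2_le]) (simp add: dirac_gauge_def, smt (verit))
qed

text \<open>The gauge equation bounds the derivative of \<open>G\<close> by the coefficient matrices
  and \<open>G\<close> itself, so \<open>G\<close> is a bounded C^1 multiplier with bounded
  derivative and preserves \<open>H1\<close>. The identity is then pointwise almost
  everywhere.\<close>

lemma gauge_intertwines:
  assumes F: "F \<in> H1"
  shows "L2_mult G F \<in> H1"
    and "dirac \<kappa> v (L2_mult G F) - cscale z (L2_mult G F) =
      L2_mult (sigma3_conj G) (dirac \<kappa> u F - cscale z F)"
proof -
  let ?G' = "\<lambda>x. U_matrix \<kappa> v x z ** G x - G x ** U_matrix \<kappa> u x z"
  have cU: "continuous_on UNIV (\<lambda>x. U_matrix \<kappa> w x z)" "\<exists>M. \<forall>x. norm (U_matrix \<kappa> w x z) \<le> M"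
    if w: "bounded_potential w" for w
  proof -
    obtain M where M: "\<And>x. norm (w x) \<le> M" and c: "continuous_on UNIV w"
      using w by (auto simp: bounded_potential_def)
    show "continuous_on UNIV (\<lambda>x. U_matrix \<kappa> w x z)" by (rule continuous_U_matrix[OF c])
    have "norm (U_matrix \<kappa> w x z) \<le> norm z + M + \<bar>\<kappa>\<bar> * M + norm z" for x
      unfolding U_matrix_mat2 using M[of x]
      by (intro order_trans[OF norm_mat2_le]) (auto simp: norm_mult intro!: add_mono mult_left_mono)
    then show "\<exists>M. \<forall>x. norm (U_matrix \<kappa> w x z) \<le> M" by blast
  qed
  obtain Mu Mv where M: "\<And>x. norm (U_matrix \<kappa> u x z) \<le> Mu" "\<And>x. norm (U_matrix \<kappa> v x z) \<le> Mv"
    using cU(2)[OF u] cU(2)[OF v] by blast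
  obtain K where K: "K > 0" "\<And>(A :: complex ^ 2 ^ 2) (B :: complex ^ 2 ^ 2). norm (A ** B) \<le> norm A * norm B * K"
    using bounded_bilinear.pos_bounded[OF bounded_bilinear_matrix_matrix_mult] by blast
  have GC: "\<And>x. norm (G x) \<le> C" "0 \<le> C" using G by (auto simp: dirac_gauge_def)
  have Mnn: "0 \<le> Mu" "0 \<le> Mv" using M norm_ge_zero order_trans by blast+
  have G'b: "norm (?G' x) \<le> Mv * C * K + C * Mu * K" for x
    using M[of x] GC(1)[of x] GC(2) Mnn K(1)
    by (intro order_trans[OF norm_triangle_ineq4] add_mono order_trans[OF K(2)] mult_right_mono mult_mono) auto
  have b: "norm (G x) \<le> C + (Mv * C * K + C * Mu * K)" "norm (?G' x) \<le> C + (Mv * C * K + C * Mu * K)" for x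
    using G'b[of x] GC(1)[of x] GC(2) Mnn K(1) by (auto intro: add_increasing add_increasing2)
  have cG': "continuous_on UNIV ?G'"
    by (intro continuous_on_diff bounded_bilinear.continuous_on[OF bounded_bilinear_matrix_matrix_mult]
        cU u v continuous_on_gauge)
  have "weak_deriv (\<lambda>x. G x *v rep_L2 F x) (\<lambda>x. ?G' x *v rep_L2 F x + G x *v rep_L2 (H1_deriv F) x)"
    by (rule weak_deriv_matrix_mult[OF H1_deriv[OF F] _ cG' b]) (use G in \<open>auto simp: dirac_gauge_def\<close>)
  note H = H1_I[OF this rep_L2_mult[OF gauge_bounded_matrix]]
  show "L2_mult G F \<in> H1" by (rule H(1))
  show "dirac \<kappa> v (L2_mult G F) - cscale z (L2_mult G F) =
      L2_mult (sigma3_conj G) (dirac \<kappa> u F - cscale z F)"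
  proof (rule L2_eqI)
    show "AE x in lborel. rep_L2 (dirac \<kappa> v (L2_mult G F) - cscale z (L2_mult G F)) x =
        rep_L2 (L2_mult (sigma3_conj G) (dirac \<kappa> u F - cscale z F)) x"
      using rep_L2_minus[of "dirac \<kappa> v (L2_mult G F)" "cscale z (L2_mult G F)"]
        rep_dirac[OF v, of \<kappa> "L2_mult G F"] H(2) rep_L2_mult[OF gauge_bounded_matrix, of F]
        rep_L2_cscale[of z "L2_mult G F"] rep_L2_mult[OF gauge_bounded_matrix_conj, of "dirac \<kappa> u F - cscale z F"]
        rep_L2_minus[of "dirac \<kappa> u F" "cscale z F"] rep_L2_cscale[of z F] rep_dirac[OF u, of \<kappa> F]
      by eventually_elim (simp only: intertwining_pointwise sigma3_conj_def)
  qed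
qed

end

context
  fixes \<kappa> :: real and u v :: "real \<Rightarrow> complex" and z :: complex and G :: "real \<Rightarrow> complex ^ 2 ^ 2" and C :: real
  assumes G: "dirac_gauge \<kappa> u v z G C" and G_inv: "dirac_gauge \<kappa> v u z (\<lambda>x. matrix_inv (G x)) C"
    and inv: "\<And>x. invertible (G x)" and u: "bounded_potential u" and v: "bounded_potential v"
begin

private abbreviation "N \<equiv> \<lambda>x. matrix_inv (G x)"

lemma gauge_inverse:
  "L2_mult G (L2_mult N F) = F" "L2_mult N (L2_mult G F) = F"
  "L2_mult (sigma3_conj G) (L2_mult (sigma3_conj N) F) = F"
  "L2_mult (sigma3_conj N) (L2_mult (sigma3_conj G) F) = F"
proof -
  note bG = gauge_bounded_matrix[OF G u v] gauge_bounded_matrix[OF G_inv v u]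
  note cG = gauge_bounded_matrix_conj[OF G u v] gauge_bounded_matrix_conj[OF G_inv v u]
  have s: "sigma3 ** sigma3 = mat 1"
    unfolding sigma3_mat2 by (rule mat2_eqI; simp add: matrix_matrix_mult_def sum_2 mat_def)
  have conj: "(sigma3 ** A ** sigma3) ** (sigma3 ** B ** sigma3) = mat 1" if "A ** B = mat 1" for A B
  proof -
    have "(sigma3 ** A ** sigma3) ** (sigma3 ** B ** sigma3) = sigma3 ** (A ** (sigma3 ** sigma3) ** B) ** sigma3"
      by (simp only: matrix_mul_assoc)
    then show ?thesis by (simp add: s that)
  qed
  show "L2_mult G (L2_mult N F) = F" by (rule L2_mult_mult[OF bG]) (simp add: matrix_mult_inv inv)
  show "L2_mult N (L2_mult G F) = F" by (rule L2_mult_mult[OF bG(2,1)]) (simp add: matrix_inv_mult inv)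
  show "L2_mult (sigma3_conj G) (L2_mult (sigma3_conj N) F) = F"
    by (rule L2_mult_mult[OF cG]) (simp add: sigma3_conj_def conj matrix_mult_inv inv)
  show "L2_mult (sigma3_conj N) (L2_mult (sigma3_conj G) F) = F"
    by (rule L2_mult_mult[OF cG(2,1)]) (simp add: sigma3_conj_def conj matrix_inv_mult inv)
qed

lemma gauge_kernel_bij: "bij_betw (L2_mult G) (op_kernel H1 (dirac \<kappa> u) z) (op_kernel H1 (dirac \<kappa> v) z)"
proof (rule bij_betw_byWitness[where f' = "L2_mult N"])
  have 0: "L2_mult (sigma3_conj G) 0 = 0" "L2_mult (sigma3_conj N) 0 = 0"
    using bounded_linear_L2_mult(1)[OF gauge_bounded_matrix_conj[OF G u v]]
      bounded_linear_L2_mult(1)[OF gauge_bounded_matrix_conj[OF G_inv v u]]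
    by (simp_all add: linear_simps)
  show "L2_mult G ` op_kernel H1 (dirac \<kappa> u) z \<subseteq> op_kernel H1 (dirac \<kappa> v) z"
    using gauge_intertwines[OF G u v] 0 by (auto simp: op_kernel_def simp del: right_minus_eq)
  show "L2_mult N ` op_kernel H1 (dirac \<kappa> v) z \<subseteq> op_kernel H1 (dirac \<kappa> u) z"
    using gauge_intertwines[OF G_inv v u] 0 by (auto simp: op_kernel_def simp del: right_minus_eq)
qed (auto simp: gauge_inverse)

text \<open>The intertwining relation dictates the resolvent of \<open>v\<close>: undo the
  conjugated gauge, apply the resolvent of \<open>u\<close>, apply \<open>G\<close>. The norms of
  the outer factors are at most \<open>bilinear_const * C\<close> and 4 times that, whence the
  constant.\<close>

lemma gauge_resolvent:
  assumes z: "z \<in> resolvent_set H1 (dirac \<kappa> u)"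
  shows "z \<in> resolvent_set H1 (dirac \<kappa> v)"
    and "onorm (resolvent H1 (dirac \<kappa> v) z) \<le>
      4 * (bilinear_const * C)\<^sup>2 * onorm (resolvent H1 (dirac \<kappa> u) z)"
proof -
  define T where "T F = dirac \<kappa> u F - cscale z F" for F
  define S where "S F = dirac \<kappa> v F - cscale z F" for F
  define R where "R = resolvent H1 (dirac \<kappa> u) z"
  have bij: "bij_betw T H1 UNIV" and bl: "bounded_linear R"
    using z by (auto simp: resolvent_set_def T_def[abs_def] R_def)
  have R_eq: "R = inv_into H1 T" by (simp add: R_def resolvent_def T_def[abs_def])
  have R: "R g \<in> H1" "T (R g) = g" for g
    using bij by (auto simp: R_eq bij_betw_def intro: inv_into_into f_inv_into_f)
  have S1: "S (L2_mult G F) = L2_mult (sigma3_conj G) (T F)" "L2_mult G F \<in> H1" if "F \<in> H1" for F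
    using gauge_intertwines[OF G u v that] by (auto simp: S_def T_def)
  have T1: "T (L2_mult N F) = L2_mult (sigma3_conj N) (S F)" "L2_mult N F \<in> H1" if "F \<in> H1" for F
    using gauge_intertwines[OF G_inv v u that] by (auto simp: S_def T_def)
  define P where "P g = L2_mult G (R (L2_mult (sigma3_conj N) g))" for g
  have P: "P g \<in> H1" "S (P g) = g" for g
    unfolding P_def using S1 R by (auto simp: gauge_inverse)
  have inj: "inj_on S H1"
  proof (rule inj_onI)
    fix F F' assume F: "F \<in> H1" "F' \<in> H1" "S F = S F'"
    then have "T (L2_mult N F) = T (L2_mult N F')" using T1 by simp
    then have "L2_mult N F = L2_mult N F'" using bij T1(2) F by (auto simp: bij_betw_def inj_on_def)
    then show "F = F'" by (metis gauge_inverse(1))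
  qed
  have "S ` H1 = UNIV"
    using P by (metis UNIV_eq_I imageI)
  then have bijS: "bij_betw S H1 UNIV" using inj by (simp add: bij_betw_def)
  have eq: "resolvent H1 (dirac \<kappa> v) z = P"
  proof
    fix g
    have "inv_into H1 S g = P g" using inv_into_f_f[OF inj P(1), of g] P(2) by simp
    then show "resolvent H1 (dirac \<kappa> v) z g = P g" by (simp add: resolvent_def S_def[abs_def])
  qed
  note bG = bounded_linear_L2_mult[OF gauge_bounded_matrix[OF G u v]]
  note bN = bounded_linear_L2_mult[OF gauge_bounded_matrix_conj[OF G_inv v u]]
  have P_comp: "P = L2_mult G \<circ> (R \<circ> L2_mult (sigma3_conj N))" by (auto simp: P_def)
  have blRN: "bounded_linear (R \<circ> L2_mult (sigma3_conj N))"
    unfolding o_def by (rule bounded_linear_compose[OF bl bN(1)])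
  have blP: "bounded_linear P"
    unfolding P_comp by (simp add: o_def) (use bounded_linear_compose[OF bG(1) blRN] in \<open>simp add: o_def\<close>)
  show "z \<in> resolvent_set H1 (dirac \<kappa> v)"
    using bijS blP by (simp add: resolvent_set_def eq S_def[abs_def])
  have C: "0 \<le> C" using G by (simp add: dirac_gauge_def)
  have "onorm P \<le> onorm (L2_mult G) * onorm (R \<circ> L2_mult (sigma3_conj N))"
    unfolding P_comp by (rule onorm_compose[OF bG(1) blRN])
  also have "\<dots> \<le> onorm (L2_mult G) * (onorm R * onorm (L2_mult (sigma3_conj N)))"
    by (intro mult_left_mono onorm_compose bl bN(1) onorm_pos_le[OF bG(1)])
  also have "\<dots> \<le> (bilinear_const * C) * (onorm R * (bilinear_const * (4 * C)))"
    using C bilinear_const(1)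
    by (intro mult_mono bG(2) bN(2) order_refl mult_nonneg_nonneg onorm_pos_le bl bN(1)) auto
  finally show "onorm (resolvent H1 (dirac \<kappa> v) z) \<le>
      4 * (bilinear_const * C)\<^sup>2 * onorm (resolvent H1 (dirac \<kappa> u) z)"
    by (simp add: eq R_def[symmetric] power2_eq_square ac_simps)
qed

end

section \<open>Spectral invariance\<close>

lemma (in nls_solution) spectral_invariance:
  "(\<forall>t. op_spectrum H1 (dirac \<kappa> (q t)) = op_spectrum H1 (dirac \<kappa> (q 0))) \<and>
     (\<exists>B :: real \<Rightarrow> real \<Rightarrow> complex \<Rightarrow> complex ^ 2 ^ 2.
        (\<forall>t x z. invertible (B t x z) \<and> (\<lambda>w. B t w z) differentiable (at x)) \<and>
        (\<forall>t x y z. transfer_matrix \<kappa> (q t) x y z =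
           B t x z ** transfer_matrix \<kappa> (q 0) x y z ** matrix_inv (B t y z)) \<and>
        (\<forall>T K. bdd_above {opnorm (B t x z) + opnorm (matrix_inv (B t x z))
                            + opnorm (vderiv (\<lambda>w. B t w z) x) | t x z. \<bar>t\<bar> \<le> T \<and> norm z \<le> K}) \<and>
        (\<forall>t z. bij_betw (\<lambda>f x. B t x z *v f x)
                 (solutions_right \<kappa> (q 0) z) (solutions_right \<kappa> (q t) z) \<and>
               bij_betw (\<lambda>f x. B t x z *v f x)
                 (solutions_left \<kappa> (q 0) z) (solutions_left \<kappa> (q t) z) \<and>
               bij_betw (L2_mult (\<lambda>x. B t x z))
                 (op_kernel H1 (dirac \<kappa> (q 0)) z) (op_kernel H1 (dirac \<kappa> (q t)) z))) \<and>
     (\<forall>\<epsilon> \<in> {-1, 1}. \<forall>s t z y.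
        upper_growth \<kappa> (q t) \<epsilon> z y = upper_growth \<kappa> (q s) \<epsilon> z y \<and>
        lower_growth \<kappa> (q t) \<epsilon> z y = lower_growth \<kappa> (q s) \<epsilon> z y \<and>
        (\<forall>\<Lambda>. (growth_quotient \<kappa> (q s) \<epsilon> z y \<longlongrightarrow> \<Lambda>) at_top \<longleftrightarrow>
              (growth_quotient \<kappa> (q t) \<epsilon> z y \<longlongrightarrow> \<Lambda>) at_top)) \<and>
     (\<forall>T K. \<exists>C>0. \<forall>t z. \<bar>t\<bar> \<le> T \<longrightarrow> norm z \<le> K \<longrightarrow>
        z \<in> resolvent_set H1 (dirac \<kappa> (q 0)) \<longrightarrow> z \<in> resolvent_set H1 (dirac \<kappa> (q t)) \<longrightarrow>
          onorm (resolvent H1 (dirac \<kappa> (q t)) z) \<le> C * onorm (resolvent H1 (dirac \<kappa> (q 0)) z) \<and>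
          onorm (resolvent H1 (dirac \<kappa> (q 0)) z) \<le> C * onorm (resolvent H1 (dirac \<kappa> (q t)) z))"
proof -
  have pot: "bounded_potential (q t)" for t
    unfolding bounded_potential_def using q_continuous_slices(1) q_bounded[of "\<bar>t\<bar>"] by (metis order_refl)
  have gauges: "\<exists>C. dirac_gauge \<kappa> (q 0) (q t) z (\<lambda>x. B t x z) C \<and> dirac_gauge \<kappa> (q t) (q 0) z (\<lambda>x. matrix_inv (B t x z)) C" for t z
    using B_gauge[of "\<bar>t\<bar>" "norm z"] by (metis order_refl)
  have invinv: "matrix_inv (matrix_inv (B t x z)) = B t x z" and inv_inv: "invertible (matrix_inv (B t x z))" for t x z
    using matrix_inv_eqI[of "B t x z" "matrix_inv (B t x z)"] matrix_mult_inv[OF invertible_B] by auto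
  \<comment> \<open>The resolvent lemma is used again with the inverse matrix as gauge; its own
    inverse is the original one, so the same two gauge facts serve in the opposite order.\<close>
  have backward: "z \<in> resolvent_set H1 (dirac \<kappa> (q 0))"
    and backward_onorm: "onorm (resolvent H1 (dirac \<kappa> (q 0)) z) \<le> 4 * (bilinear_const * C)\<^sup>2 * onorm (resolvent H1 (dirac \<kappa> (q t)) z)"
    if g: "dirac_gauge \<kappa> (q 0) (q t) z (\<lambda>x. B t x z) C" "dirac_gauge \<kappa> (q t) (q 0) z (\<lambda>x. matrix_inv (B t x z)) C"
      and z: "z \<in> resolvent_set H1 (dirac \<kappa> (q t))" for t z C
    by (rule gauge_resolvent[OF g(2) _ inv_inv pot pot z]; simp add: invinv g)+
  note forth = gauge_resolvent[OF _ _ invertible_B pot pot]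
  have spec: "op_spectrum H1 (dirac \<kappa> (q t)) = op_spectrum H1 (dirac \<kappa> (q 0))" for t
  proof -
    have "z \<in> resolvent_set H1 (dirac \<kappa> (q t)) \<longleftrightarrow> z \<in> resolvent_set H1 (dirac \<kappa> (q 0))" for z
    proof -
      obtain C where g: "dirac_gauge \<kappa> (q 0) (q t) z (\<lambda>x. B t x z) C"
          "dirac_gauge \<kappa> (q t) (q 0) z (\<lambda>x. matrix_inv (B t x z)) C"
        using gauges by blast
      show ?thesis using backward[OF g] forth(1)[OF g] by blast
    qed
    then show ?thesis by (auto simp: op_spectrum_def)
  qed
  have B: "\<exists>B :: real \<Rightarrow> real \<Rightarrow> complex \<Rightarrow> complex ^ 2 ^ 2.
        (\<forall>t x z. invertible (B t x z) \<and> (\<lambda>w. B t w z) differentiable (at x)) \<and>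
        (\<forall>t x y z. transfer_matrix \<kappa> (q t) x y z =
           B t x z ** transfer_matrix \<kappa> (q 0) x y z ** matrix_inv (B t y z)) \<and>
        (\<forall>T K. bdd_above {opnorm (B t x z) + opnorm (matrix_inv (B t x z))
                            + opnorm (vderiv (\<lambda>w. B t w z) x) | t x z. \<bar>t\<bar> \<le> T \<and> norm z \<le> K}) \<and>
        (\<forall>t z. bij_betw (\<lambda>f x. B t x z *v f x)
                 (solutions_right \<kappa> (q 0) z) (solutions_right \<kappa> (q t) z) \<and>
               bij_betw (\<lambda>f x. B t x z *v f x)
                 (solutions_left \<kappa> (q 0) z) (solutions_left \<kappa> (q t) z) \<and>
               bij_betw (L2_mult (\<lambda>x. B t x z))
                 (op_kernel H1 (dirac \<kappa> (q 0)) z) (op_kernel H1 (dirac \<kappa> (q t)) z))"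
  proof (intro exI[of _ B] conjI allI)
    show "(\<lambda>w. B t w z) differentiable (at x)" for t x z
      using has_vector_derivative_B_space differentiableI_vector by blast
    fix t z
    obtain C where g: "dirac_gauge \<kappa> (q 0) (q t) z (\<lambda>x. B t x z) C"
        "dirac_gauge \<kappa> (q t) (q 0) z (\<lambda>x. matrix_inv (B t x z)) C"
      using gauges by blast
    show "bij_betw (\<lambda>f x. B t x z *v f x) (solutions_right \<kappa> (q 0) z) (solutions_right \<kappa> (q t) z)"
      and "bij_betw (\<lambda>f x. B t x z *v f x) (solutions_left \<kappa> (q 0) z) (solutions_left \<kappa> (q t) z)"
      by (rule gauge_bij_solutions[OF g invertible_B])+
    show "bij_betw (L2_mult (\<lambda>x. B t x z)) (op_kernel H1 (dirac \<kappa> (q 0)) z) (op_kernel H1 (dirac \<kappa> (q t)) z)"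
      by (rule gauge_kernel_bij[OF g invertible_B pot pot])
  qed (rule invertible_B transfer_matrix_conjugation B_bounded)+
  have res: "\<exists>C>0. \<forall>t z. \<bar>t\<bar> \<le> T \<longrightarrow> norm z \<le> K \<longrightarrow>
        z \<in> resolvent_set H1 (dirac \<kappa> (q 0)) \<longrightarrow> z \<in> resolvent_set H1 (dirac \<kappa> (q t)) \<longrightarrow>
          onorm (resolvent H1 (dirac \<kappa> (q t)) z) \<le> C * onorm (resolvent H1 (dirac \<kappa> (q 0)) z) \<and>
          onorm (resolvent H1 (dirac \<kappa> (q 0)) z) \<le> C * onorm (resolvent H1 (dirac \<kappa> (q t)) z)" for T K
  proof -
    obtain C where C: "\<And>t z. \<bar>t\<bar> \<le> T \<Longrightarrow> norm z \<le> K \<Longrightarrow> dirac_gauge \<kappa> (q 0) (q t) z (\<lambda>x. B t x z) C"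
      "\<And>t z. \<bar>t\<bar> \<le> T \<Longrightarrow> norm z \<le> K \<Longrightarrow> dirac_gauge \<kappa> (q t) (q 0) z (\<lambda>x. matrix_inv (B t x z)) C"
      using B_gauge by blast
    define D where "D = 4 * (bilinear_const * C)\<^sup>2"
    have nn: "0 \<le> onorm (resolvent H1 (dirac \<kappa> (q t)) z)" if "z \<in> resolvent_set H1 (dirac \<kappa> (q t))" for t z
      using that by (intro onorm_pos_le) (simp add: resolvent_set_def)
    \<comment> \<open>The claim asks for a strictly positive constant, while \<open>D\<close> may be
      0; hence \<open>D + 1\<close>.\<close>
    have up: "a \<le> (D + 1) * c" if "a \<le> D * c" "0 \<le> c" for a c
      using that by (simp add: algebra_simps)
    show ?thesis
    proof (intro exI[of _ "D + 1"] conjI allI impI)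
      show "0 < D + 1" unfolding D_def by (simp add: add_nonneg_pos)
      fix t z assume h: "\<bar>t\<bar> \<le> T" "norm z \<le> K" "z \<in> resolvent_set H1 (dirac \<kappa> (q 0))" "z \<in> resolvent_set H1 (dirac \<kappa> (q t))"
      show "onorm (resolvent H1 (dirac \<kappa> (q t)) z) \<le> (D + 1) * onorm (resolvent H1 (dirac \<kappa> (q 0)) z)"
        using forth(2)[OF C(1,2)[OF h(1,2)] h(3)] nn[OF h(3)] unfolding D_def[symmetric] by (rule up)
      show "onorm (resolvent H1 (dirac \<kappa> (q 0)) z) \<le> (D + 1) * onorm (resolvent H1 (dirac \<kappa> (q t)) z)"
        using backward_onorm[OF C(1,2)[OF h(1,2)] h(4)] nn[OF h(4)] unfolding D_def[symmetric] by (rule up)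
    qed
  qed
  show ?thesis
    by (intro conjI allI ballI spec B res growth_invariant)
qed

section \<open>Schwartz functions\<close>

text \<open>The weight (1 + |x|)^m replaces the monomial: it is at least 1 and multiplies additively
  in the exponent, so different decay orders combine without case distinctions. Conversely it is at
  most 2^m times 1 + |x|^m.\<close>

lemma schwartz_iff:
  "\<phi> \<in> schwartz \<longleftrightarrow> smooth \<phi> \<and> (\<forall>m n. \<exists>C. \<forall>x. (1 + \<bar>x\<bar>) ^ m * norm ((vderiv ^^ n) \<phi> x) \<le> C)"
proof
  assume S: "\<phi> \<in> schwartz"
  show "smooth \<phi> \<and> (\<forall>m n. \<exists>C. \<forall>x. (1 + \<bar>x\<bar>) ^ m * norm ((vderiv ^^ n) \<phi> x) \<le> C)"
  proof (intro conjI allI)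
    show "smooth \<phi>" using S by (simp add: schwartz_def)
    fix m n
    have "\<exists>C. \<forall>x. norm (x ^ k *\<^sub>R (vderiv ^^ n) \<phi> x) \<le> C" for k
      using S unfolding schwartz_def bounded_iff by blast
    then obtain C where C: "\<And>k x. \<bar>x\<bar> ^ k * norm ((vderiv ^^ n) \<phi> x) \<le> C k"
      by (simp add: power_abs) metis
    have "(1 + \<bar>x\<bar>) ^ m * norm ((vderiv ^^ n) \<phi> x) \<le> 2 ^ m * (C 0 + C m)" for x
    proof -
      have "(1 + \<bar>x\<bar>) ^ m \<le> (2 * max 1 \<bar>x\<bar>) ^ m" by (intro power_mono) auto
      also have "\<dots> \<le> 2 ^ m * (1 + \<bar>x\<bar> ^ m)"
        by (auto simp: power_mult_distrib max_def)
      finally have "(1 + \<bar>x\<bar>) ^ m * norm ((vderiv ^^ n) \<phi> x) \<le> 2 ^ m * (1 + \<bar>x\<bar> ^ m) * norm ((vderiv ^^ n) \<phi> x)"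
        by (intro mult_right_mono) auto
      also have "\<dots> = 2 ^ m * (\<bar>x\<bar> ^ 0 * norm ((vderiv ^^ n) \<phi> x) + \<bar>x\<bar> ^ m * norm ((vderiv ^^ n) \<phi> x))"
        by (simp add: algebra_simps)
      also have "\<dots> \<le> 2 ^ m * (C 0 + C m)" by (intro mult_left_mono add_mono C) auto
      finally show ?thesis .
    qed
    then show "\<exists>C. \<forall>x. (1 + \<bar>x\<bar>) ^ m * norm ((vderiv ^^ n) \<phi> x) \<le> C" by blast
  qed
next
  assume *: "smooth \<phi> \<and> (\<forall>m n. \<exists>C. \<forall>x. (1 + \<bar>x\<bar>) ^ m * norm ((vderiv ^^ n) \<phi> x) \<le> C)"
  have "bounded (range (\<lambda>x. x ^ m *\<^sub>R (vderiv ^^ n) \<phi> x))" for m n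
  proof -
    obtain C where C: "\<And>x. (1 + \<bar>x\<bar>) ^ m * norm ((vderiv ^^ n) \<phi> x) \<le> C" using * by blast
    have "norm (x ^ m *\<^sub>R (vderiv ^^ n) \<phi> x) \<le> C" for x
    proof -
      have "\<bar>x\<bar> ^ m \<le> (1 + \<bar>x\<bar>) ^ m" by (intro power_mono) auto
      then have "\<bar>x\<bar> ^ m * norm ((vderiv ^^ n) \<phi> x) \<le> (1 + \<bar>x\<bar>) ^ m * norm ((vderiv ^^ n) \<phi> x)"
        by (intro mult_right_mono) auto
      then show ?thesis using C[of x] by (simp add: power_abs)
    qed
    then show ?thesis by (auto simp: bounded_iff)
  qed
  then show "\<phi> \<in> schwartz" using * by (simp add: schwartz_def)
qed

lemma schwartz_smooth: "\<phi> \<in> schwartz \<Longrightarrow> smooth \<phi>"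
  by (simp add: schwartz_def)

lemma schwartz_bound:
  assumes "\<phi> \<in> schwartz"
  obtains C where "\<And>x. (1 + \<bar>x\<bar>) ^ m * norm ((vderiv ^^ n) \<phi> x) \<le> C"
  using assms unfolding schwartz_iff by blast

text \<open>The multipliers of the Schwartz space: the degree of polynomial growth may depend on the
  order of the derivative.\<close>

definition slowly_growing :: "(real \<Rightarrow> complex) \<Rightarrow> bool" where
  "slowly_growing a \<longleftrightarrow> smooth a \<and> (\<forall>n. \<exists>N C. \<forall>x. norm ((vderiv ^^ n) a x) \<le> C * (1 + \<bar>x\<bar>) ^ N)"

lemma schwartz_mult:
  assumes a: "slowly_growing a" and \<phi>: "\<phi> \<in> schwartz"
  shows "(\<lambda>x. a x * \<phi> x) \<in> schwartz"
  unfolding schwartz_iff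
proof (intro conjI allI)
  have sa: "smooth a" and s\<phi>: "smooth \<phi>" using assms by (auto simp: slowly_growing_def schwartz_def)
  show "smooth (\<lambda>x. a x * \<phi> x)" by (rule smooth_prod[OF bounded_bilinear_mult sa s\<phi>])
  fix m n
  obtain N C where a: "\<And>n x. norm ((vderiv ^^ n) a x) \<le> C n * (1 + \<bar>x\<bar>) ^ N n"
    using a unfolding slowly_growing_def by metis
  obtain D where D: "\<And>m n x. (1 + \<bar>x\<bar>) ^ m * norm ((vderiv ^^ n) \<phi> x) \<le> D m n"
    using \<phi> unfolding schwartz_iff by metis
  have C: "0 \<le> C n" for n using order_trans[OF norm_ge_zero a[of n 0]] by simp
  have "(1 + \<bar>x\<bar>) ^ m * norm ((vderiv ^^ n) (\<lambda>x. a x * \<phi> x) x) \<le>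
      (\<Sum>k\<le>n. real (n choose k) * (C k * D (m + N k) (n - k)))" for x
  proof -
    have "norm ((vderiv ^^ n) (\<lambda>x. a x * \<phi> x) x) \<le>
        (\<Sum>k\<le>n. real (n choose k) * (C k * (1 + \<bar>x\<bar>) ^ N k * norm ((vderiv ^^ (n - k)) \<phi> x)))"
      unfolding vderiv_power_prod[OF bounded_bilinear_mult sa s\<phi>]
    proof (rule sum_norm_le)
        fix k
        have "norm ((vderiv ^^ k) a x) * norm ((vderiv ^^ (n - k)) \<phi> x) \<le> C k * (1 + \<bar>x\<bar>) ^ N k * norm ((vderiv ^^ (n - k)) \<phi> x)"
          by (intro mult_right_mono a) auto
        then show "norm (real (n choose k) *\<^sub>R ((vderiv ^^ k) a x * (vderiv ^^ (n - k)) \<phi> x)) \<le>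
            real (n choose k) * (C k * (1 + \<bar>x\<bar>) ^ N k * norm ((vderiv ^^ (n - k)) \<phi> x))"
          unfolding norm_scaleR norm_mult by (simp add: mult_left_mono)
      qed
    then have "(1 + \<bar>x\<bar>) ^ m * norm ((vderiv ^^ n) (\<lambda>x. a x * \<phi> x) x) \<le> (1 + \<bar>x\<bar>) ^ m *
        (\<Sum>k\<le>n. real (n choose k) * (C k * (1 + \<bar>x\<bar>) ^ N k * norm ((vderiv ^^ (n - k)) \<phi> x)))"
      by (intro mult_left_mono) auto
    also have "\<dots> = (\<Sum>k\<le>n. real (n choose k) * (C k * ((1 + \<bar>x\<bar>) ^ (m + N k) * norm ((vderiv ^^ (n - k)) \<phi> x))))"
      by (simp add: sum_distrib_left power_add mult_ac)
    also have "\<dots> \<le> (\<Sum>k\<le>n. real (n choose k) * (C k * D (m + N k) (n - k)))"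
      by (intro sum_mono mult_left_mono D C) auto
    finally show ?thesis .
  qed
  then show "\<exists>C. \<forall>x. (1 + \<bar>x\<bar>) ^ m * norm ((vderiv ^^ n) (\<lambda>x. a x * \<phi> x) x) \<le> C" by blast
qed

lemma slowly_growing_boundedI:
  assumes "smooth a" "\<And>n. \<exists>C. \<forall>x. norm ((vderiv ^^ n) a x) \<le> C"
  shows "slowly_growing a"
  unfolding slowly_growing_def
proof (intro conjI allI assms(1))
  fix n
  obtain C where "\<forall>x. norm ((vderiv ^^ n) a x) \<le> C" using assms(2) by blast
  then show "\<exists>N C. \<forall>x. norm ((vderiv ^^ n) a x) \<le> C * (1 + \<bar>x\<bar>) ^ N"
    by (intro exI[of _ 0] exI[of _ C]) simp
qed

lemma slowly_growing_const: "slowly_growing (\<lambda>x. c)"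
proof -
  define D where "D n x = (case n of 0 \<Rightarrow> c | _ \<Rightarrow> 0)" for n :: nat and x :: real
  have D: "(D n has_vector_derivative D (Suc n) x) (at x)" for n x
    by (cases n) (auto simp: D_def[abs_def])
  have D0: "D 0 = (\<lambda>x. c)" by (simp add: D_def[abs_def])
  have "norm (D n x) \<le> norm c" for n x by (cases n) (auto simp: D_def)
  then show ?thesis
    using smoothI[of D, OF D] vderiv_power_eq[of D, OF D] unfolding D0
    by (intro slowly_growing_boundedI) auto
qed

lemma slowly_growing_of_real: "slowly_growing complex_of_real"
proof -
  define D :: "nat \<Rightarrow> real \<Rightarrow> complex" where
    "D n x = (case n of 0 \<Rightarrow> of_real x | Suc m \<Rightarrow> (case m of 0 \<Rightarrow> 1 | _ \<Rightarrow> 0))" for n :: nat and x :: real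
  have D: "(D n has_vector_derivative D (Suc n) x) (at x)" for n x
  proof (cases n)
    case 0
    have "(complex_of_real has_vector_derivative of_real 1) (at x)"
      by (rule bounded_linear.has_vector_derivative[OF bounded_linear_of_real has_vector_derivative_id])
    then show ?thesis using 0 by (simp add: D_def[abs_def])
  next
    case (Suc m)
    then show ?thesis by (cases m) (auto simp: D_def[abs_def])
  qed
  have D0: "D 0 = of_real" by (simp add: D_def[abs_def])
  have "norm (D n x) \<le> 1 * (1 + \<bar>x\<bar>) ^ 1" for n x
    by (cases n) (auto simp: D_def split: nat.split)
  then show ?thesis
    using smoothI[of D, OF D] vderiv_power_eq[of D, OF D] unfolding D0
    by (auto simp: slowly_growing_def intro!: exI[of _ 1])
qed

lemma slowly_growing_exp: "slowly_growing (\<lambda>x. exp (\<i> * of_real (a * x)))"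
proof -
  define D where "D n x = (\<i> * of_real a) ^ n * exp (\<i> * of_real (a * x))" for n :: nat and x :: real
  have D: "(D n has_vector_derivative D (Suc n) x) (at x)" for n x
  proof -
    have "((\<lambda>z. (\<i> * of_real a) ^ n * exp (\<i> * (of_real a * z))) has_field_derivative
        (\<i> * of_real a) ^ n * (exp (\<i> * (of_real a * of_real x)) * (\<i> * of_real a))) (at (of_real x))"
      by (auto intro!: derivative_eq_intros)
    from has_vector_derivative_real_field[OF this] show ?thesis
      by (simp add: D_def[abs_def] mult_ac)
  qed
  have D0: "D 0 = (\<lambda>x. exp (\<i> * of_real (a * x)))" by (simp add: D_def[abs_def])
  have "norm (D n x) \<le> \<bar>a\<bar> ^ n" for n x
    by (simp add: D_def norm_mult norm_power flip: of_real_mult)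
  then show ?thesis
    using smoothI[of D, OF D] vderiv_power_eq[of D, OF D] unfolding D0
    by (intro slowly_growing_boundedI) auto
qed

lemma vderiv_power_zero_on_open:
  assumes "open S" "\<And>x. x \<in> S \<Longrightarrow> f x = 0" "x \<in> S"
  shows "(vderiv ^^ n) f x = 0"
  using assms(3)
proof (induction n arbitrary: x)
  case (Suc n)
  have "((vderiv ^^ n) f has_vector_derivative 0) (at x)"
    by (rule has_vector_derivative_transform_within_open[OF has_vector_derivative_const assms(1)])
       (use Suc in auto)
  then have "vderiv ((vderiv ^^ n) f) x = 0" unfolding vderiv_def by (rule vector_derivative_at)
  then show ?case by simp
qed (use assms in auto)

lemma vderiv_power_zero_outside:
  assumes "\<And>x. x \<notin> {a..b} \<Longrightarrow> f x = 0" "x \<notin> {a..b}"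
  shows "(vderiv ^^ n) f x = 0"
  by (rule vderiv_power_zero_on_open[of "- {a..b}"]) (use assms in auto)

lemma bounded_vderiv_power:
  fixes f :: "real \<Rightarrow> 'a::real_normed_vector"
  assumes f: "smooth f" and z: "\<And>x. x \<notin> {a..b} \<Longrightarrow> f x = 0"
  shows "\<exists>C. \<forall>x. norm ((vderiv ^^ n) f x) \<le> C"
proof -
  have "bounded ((vderiv ^^ n) f ` {a..b})"
    by (intro compact_imp_bounded compact_continuous_image continuous_on_smooth f) auto
  then obtain C where C: "\<And>x. x \<in> {a..b} \<Longrightarrow> norm ((vderiv ^^ n) f x) \<le> C" unfolding bounded_iff by blast
  have "norm ((vderiv ^^ n) f x) \<le> max C 0" for x
  proof (cases "x \<in> {a..b}")
    case False
    have "(vderiv ^^ n) f x = 0" by (rule vderiv_power_zero_outside[OF z False])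
    then show ?thesis by simp
  qed (use C in \<open>auto simp: le_max_iff_disj\<close>)
  then show ?thesis by blast
qed

lemma slowly_growing_compact:
  assumes f: "smooth f" and z: "\<And>x. x \<notin> {a..b} \<Longrightarrow> f x = 0"
  shows "slowly_growing f"
  using bounded_vderiv_power[OF f z] by (intro slowly_growing_boundedI f)

lemma schwartz_compact:
  assumes f: "smooth f" and z: "\<And>x. x \<notin> {a..b} \<Longrightarrow> f x = 0"
  shows "f \<in> schwartz"
  unfolding schwartz_iff
proof (intro conjI allI f)
  fix m n
  obtain C where C: "\<And>x. norm ((vderiv ^^ n) f x) \<le> C" using bounded_vderiv_power[OF f z] by blast
  have "0 \<le> C" using order_trans[OF norm_ge_zero C] .
  have "(1 + \<bar>x\<bar>) ^ m * norm ((vderiv ^^ n) f x) \<le> (1 + max \<bar>a\<bar> \<bar>b\<bar>) ^ m * C" for x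
  proof (cases "x \<in> {a..b}")
    case True
    then show ?thesis using C \<open>0 \<le> C\<close> by (intro mult_mono power_mono) auto
  next
    case False
    have "(vderiv ^^ n) f x = 0" by (rule vderiv_power_zero_outside[OF z False])
    then show ?thesis using \<open>0 \<le> C\<close> by simp
  qed
  then show "\<exists>C. \<forall>x. (1 + \<bar>x\<bar>) ^ m * norm ((vderiv ^^ n) f x) \<le> C" by blast
qed

lemma schwartz_add:
  assumes "\<phi> \<in> schwartz" "\<psi> \<in> schwartz"
  shows "(\<lambda>x. \<phi> x + \<psi> x) \<in> schwartz"
  unfolding schwartz_iff
proof (intro conjI allI)
  note s = assms[THEN schwartz_smooth]
  show "smooth (\<lambda>x. \<phi> x + \<psi> x)" by (rule smooth_add[OF s])
  fix m n
  obtain C where C: "\<And>x. (1 + \<bar>x\<bar>) ^ m * norm ((vderiv ^^ n) \<phi> x) \<le> C" using schwartz_bound[OF assms(1)] by blast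
  obtain D where D: "\<And>x. (1 + \<bar>x\<bar>) ^ m * norm ((vderiv ^^ n) \<psi> x) \<le> D" using schwartz_bound[OF assms(2)] by blast
  have "(1 + \<bar>x\<bar>) ^ m * norm ((vderiv ^^ n) (\<lambda>x. \<phi> x + \<psi> x) x) \<le> C + D" for x
  proof -
    have "(1 + \<bar>x\<bar>) ^ m * norm ((vderiv ^^ n) \<phi> x + (vderiv ^^ n) \<psi> x)
        \<le> (1 + \<bar>x\<bar>) ^ m * (norm ((vderiv ^^ n) \<phi> x) + norm ((vderiv ^^ n) \<psi> x))"
      by (intro mult_left_mono norm_triangle_ineq) auto
    then show ?thesis
      using C[of x] D[of x] by (simp add: vderiv_power_add[OF s] distrib_left)
  qed
  then show "\<exists>C. \<forall>x. (1 + \<bar>x\<bar>) ^ m * norm ((vderiv ^^ n) (\<lambda>x. \<phi> x + \<psi> x) x) \<le> C" by blast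
qed

lemma schwartz_cmult: "\<phi> \<in> schwartz \<Longrightarrow> (\<lambda>x. c * \<phi> x) \<in> schwartz"
  by (rule schwartz_mult[OF slowly_growing_const])

lemma schwartz_uminus: "\<phi> \<in> schwartz \<Longrightarrow> (\<lambda>x. - \<phi> x) \<in> schwartz"
  using schwartz_cmult[of \<phi> "-1"] by simp

lemma schwartz_diff: "\<phi> \<in> schwartz \<Longrightarrow> \<psi> \<in> schwartz \<Longrightarrow> (\<lambda>x. \<phi> x - \<psi> x) \<in> schwartz"
  using schwartz_add[OF _ schwartz_uminus, of \<phi> \<psi>] by simp

lemma schwartz_zero: "(\<lambda>x. 0) \<in> schwartz"
  by (rule schwartz_compact[of _ 0 0]) (use slowly_growing_const in \<open>auto simp: slowly_growing_def\<close>)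

lemma schwartz_sum: "(\<And>i. i \<in> I \<Longrightarrow> \<phi> i \<in> schwartz) \<Longrightarrow> (\<lambda>x. \<Sum>i\<in>I. \<phi> i x) \<in> schwartz"
  by (induction I rule: infinite_finite_induct) (auto intro: schwartz_zero schwartz_add)

lemma schwartz_vderiv:
  assumes "\<phi> \<in> schwartz"
  shows "vderiv \<phi> \<in> schwartz"
  unfolding schwartz_iff
proof (intro conjI allI)
  show "smooth (vderiv \<phi>)" by (rule smooth_vderiv[OF schwartz_smooth[OF assms]])
  fix m n
  obtain C where C: "\<And>x. (1 + \<bar>x\<bar>) ^ m * norm ((vderiv ^^ Suc n) \<phi> x) \<le> C" using schwartz_bound[OF assms] by blast
  then show "\<exists>C. \<forall>x. (1 + \<bar>x\<bar>) ^ m * norm ((vderiv ^^ n) (vderiv \<phi>) x) \<le> C"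
    unfolding funpow_Suc_right by auto
qed

lemma schwartz_vderiv_power: "\<phi> \<in> schwartz \<Longrightarrow> (vderiv ^^ n) \<phi> \<in> schwartz"
  by (induction n) (auto intro: schwartz_vderiv)

lemma schwartz_affine:
  assumes \<phi>: "\<phi> \<in> schwartz" and a: "a \<noteq> 0"
  shows "(\<lambda>x. \<phi> (a * x + c)) \<in> schwartz"
  unfolding schwartz_iff
proof (intro conjI allI)
  note s = schwartz_smooth[OF \<phi>]
  show "smooth (\<lambda>x. \<phi> (a * x + c))" by (rule smooth_affine[OF s])
  fix m n
  obtain C where C: "\<And>x. (1 + \<bar>x\<bar>) ^ m * norm ((vderiv ^^ n) \<phi> x) \<le> C" using schwartz_bound[OF \<phi>] by blast
  \<comment> \<open>Chosen so that 1 + |x| is at most \<open>L\<close> times 1 + |a x + c|, from |x|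
    being at most (|a x + c| + |c|)/|a|.\<close>
  define L where "L = 1 + 1 / \<bar>a\<bar> + \<bar>c\<bar> / \<bar>a\<bar>"
  have L: "0 \<le> L" by (simp add: L_def)
  have "(1 + \<bar>x\<bar>) ^ m * norm ((vderiv ^^ n) (\<lambda>x. \<phi> (a * x + c)) x) \<le> L ^ m * \<bar>a\<bar> ^ n * C" for x
  proof -
    have "\<bar>x\<bar> = \<bar>(a * x + c) - c\<bar> / \<bar>a\<bar>" using a by (simp add: abs_mult)
    also have "\<dots> \<le> (\<bar>a * x + c\<bar> + \<bar>c\<bar>) / \<bar>a\<bar>" by (intro divide_right_mono) auto
    finally have "1 + \<bar>x\<bar> \<le> 1 + \<bar>a * x + c\<bar> / \<bar>a\<bar> + \<bar>c\<bar> / \<bar>a\<bar>" by (simp add: add_divide_distrib)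
    also have "\<dots> \<le> L * (1 + \<bar>a * x + c\<bar>)"
    proof -
      have "L * (1 + \<bar>a * x + c\<bar>) - (1 + \<bar>a * x + c\<bar> / \<bar>a\<bar> + \<bar>c\<bar> / \<bar>a\<bar>) =
          1 / \<bar>a\<bar> + \<bar>a * x + c\<bar> + \<bar>c\<bar> / \<bar>a\<bar> * \<bar>a * x + c\<bar>"
        by (simp add: L_def algebra_simps)
      moreover have "0 \<le> 1 / \<bar>a\<bar> + \<bar>a * x + c\<bar> + \<bar>c\<bar> / \<bar>a\<bar> * \<bar>a * x + c\<bar>" by simp
      ultimately show ?thesis by linarith
    qed
    finally have "(1 + \<bar>x\<bar>) ^ m \<le> L ^ m * (1 + \<bar>a * x + c\<bar>) ^ m"
      unfolding power_mult_distrib[symmetric] by (intro power_mono) auto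
    then have "(1 + \<bar>x\<bar>) ^ m * norm ((vderiv ^^ n) (\<lambda>x. \<phi> (a * x + c)) x) \<le>
        (L ^ m * (1 + \<bar>a * x + c\<bar>) ^ m) * (\<bar>a\<bar> ^ n * norm ((vderiv ^^ n) \<phi> (a * x + c)))"
      by (auto simp: vderiv_power_affine[OF s] power_abs intro!: mult_right_mono)
    also have "\<dots> = L ^ m * \<bar>a\<bar> ^ n * ((1 + \<bar>a * x + c\<bar>) ^ m * norm ((vderiv ^^ n) \<phi> (a * x + c)))"
      by (simp add: mult_ac)
    also have "\<dots> \<le> L ^ m * \<bar>a\<bar> ^ n * C" by (intro mult_left_mono C) (use L in auto)
    finally show ?thesis .
  qed
  then show "\<exists>C. \<forall>x. (1 + \<bar>x\<bar>) ^ m * norm ((vderiv ^^ n) (\<lambda>x. \<phi> (a * x + c)) x) \<le> C" by blast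
qed

lemma integrable_inverse_one_plus_square: "integrable lborel (\<lambda>x::real. inverse (1 + x\<^sup>2))"
  using integrable_inverse_1_plus_square by (simp add: set_integrable_def)

lemma schwartz_measurable: "\<phi> \<in> schwartz \<Longrightarrow> \<phi> \<in> borel_measurable borel"
  using continuous_on_smooth[OF schwartz_smooth, of \<phi> UNIV 0] by (auto intro: borel_measurable_continuous_onI)

lemma schwartz_decay:
  assumes "\<phi> \<in> schwartz"
  obtains C where "\<And>x. norm (\<phi> x) \<le> C * inverse (1 + x\<^sup>2)" "0 \<le> C"
proof -
  obtain C where C: "\<And>x. (1 + \<bar>x\<bar>) ^ 2 * norm ((vderiv ^^ 0) \<phi> x) \<le> C" using schwartz_bound[OF assms] by blast
  have "norm (\<phi> x) \<le> C * inverse (1 + x\<^sup>2)" for x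
  proof -
    have "(1 + x\<^sup>2) * norm (\<phi> x) \<le> (1 + \<bar>x\<bar>)\<^sup>2 * norm (\<phi> x)"
      by (intro mult_right_mono) (auto simp: power2_sum)
    with C[of x] have "(1 + x\<^sup>2) * norm (\<phi> x) \<le> C" by simp
    moreover have "0 < 1 + x\<^sup>2" by (rule add_pos_nonneg) auto
    ultimately show ?thesis by (simp add: field_simps)
  qed
  moreover have "0 \<le> C" using order_trans[OF _ C[of 0]] by simp
  ultimately show thesis using that by blast
qed

lemma schwartz_integrable:
  assumes "\<phi> \<in> schwartz"
  shows "integrable lborel \<phi>"
proof -
  obtain C where C: "\<And>x. norm (\<phi> x) \<le> C * inverse (1 + x\<^sup>2)" "0 \<le> C" using schwartz_decay[OF assms] by blast
  show ?thesis
  proof (rule Bochner_Integration.integrable_bound)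
    show "integrable lborel (\<lambda>x. C * inverse (1 + x\<^sup>2))"
      by (intro integrable_mult_right integrable_inverse_one_plus_square)
    show "\<phi> \<in> borel_measurable lborel" using schwartz_measurable[OF assms] by simp
    show "AE x in lborel. norm (\<phi> x) \<le> norm (C * inverse (1 + x\<^sup>2))"
      using C by (auto intro: order_trans)
  qed
qed

lemma schwartz_tendsto_0:
  assumes "\<phi> \<in> schwartz"
  shows "(\<phi> \<longlongrightarrow> 0) at_top" "(\<phi> \<longlongrightarrow> 0) at_bot"
proof -
  obtain C where C: "\<And>x. norm (\<phi> x) \<le> C * inverse (1 + x\<^sup>2)" using schwartz_decay[OF assms] by metis
  have "((\<lambda>x::real. C * inverse (1 + x\<^sup>2)) \<longlongrightarrow> 0) at_top" "((\<lambda>x::real. C * inverse (1 + x\<^sup>2)) \<longlongrightarrow> 0) at_bot"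
    by real_asymp+
  then show "(\<phi> \<longlongrightarrow> 0) at_top" "(\<phi> \<longlongrightarrow> 0) at_bot"
    using C by (auto intro!: Lim_null_comparison[of \<phi> "\<lambda>x. C * inverse (1 + x\<^sup>2)"] always_eventually)
qed

lemma schwartz_integral_vderiv:
  assumes "\<phi> \<in> schwartz"
  shows "(LINT x|lborel. vderiv \<phi> x) = 0"
proof -
  have "interval_lebesgue_integral lborel (-\<infinity>) \<infinity> (vderiv \<phi>) = 0 - 0"
  proof (rule interval_integral_FTC_integrable)
    show "(\<phi> has_vector_derivative vderiv \<phi> x) (at x)" for x
      using smooth_has_vector_derivative[OF schwartz_smooth[OF assms], of 0 x] by simp
    show "isCont (vderiv \<phi>) x" for x
      using continuous_on_smooth[OF schwartz_smooth[OF assms], of UNIV 1] by (simp add: continuous_on_eq_continuous_at)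
    show "set_integrable lborel (einterval (- \<infinity>) \<infinity>) (vderiv \<phi>)"
      using schwartz_integrable[OF schwartz_vderiv[OF assms]] by (simp add: set_integrable_def)
    show "((\<phi> \<circ> real_of_ereal) \<longlongrightarrow> 0) (at_right (- \<infinity>))" "((\<phi> \<circ> real_of_ereal) \<longlongrightarrow> 0) (at_left \<infinity>)"
      using schwartz_tendsto_0[OF assms] by (simp_all only: ereal_tendsto_simps)
  qed simp
  then show ?thesis by (simp add: interval_lebesgue_integral_def set_lebesgue_integral_def)
qed

section \<open>The Fourier transform\<close>

lemma fourier_exp_eq: "exp (- \<i> * of_real (x * \<xi>)) = exp (\<i> * of_real (- \<xi> * x))"
  by (simp add: mult.commute)

lemma norm_exp_i [simp]: "norm (exp (\<i> * of_real r)) = 1" "norm (exp (- (\<i> * of_real r))) = 1"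
  by (simp_all)

lemma fourier_integrand_schwartz: "\<phi> \<in> schwartz \<Longrightarrow> (\<lambda>x. exp (- \<i> * of_real (x * \<xi>)) * \<phi> x) \<in> schwartz"
  unfolding fourier_exp_eq by (rule schwartz_mult[OF slowly_growing_exp])

lemma norm_fourier_le:
  assumes "\<phi> \<in> schwartz"
  shows "norm (fourier \<phi> \<xi>) \<le> (LINT x|lborel. norm (\<phi> x))"
proof -
  have "norm (fourier \<phi> \<xi>) \<le> (LINT x|lborel. norm (exp (- \<i> * of_real (x * \<xi>)) * \<phi> x))"
    unfolding fourier_def by (rule integral_norm_bound)
  also have "\<dots> = (LINT x|lborel. norm (\<phi> x))" unfolding fourier_exp_eq norm_mult by simp
  finally show ?thesis .
qed

lemma norm_exp_i_remainder: "norm (exp (\<i> * of_real y) - 1 - \<i> * of_real y) \<le> y\<^sup>2"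
  using iexp_approx1[of y 1] by (simp add: numeral_2_eq_2 algebra_simps) (smt (verit) zero_le_square)

text \<open>The second-order remainder of the exponential is at most the square of its argument, so
  the error of the linearisation is at most the square of \<open>h\<close> times the integral
  \<open>M\<close> of x^2 |\<phi>(x)|, finite by Schwartz decay.\<close>

lemma fourier_has_vector_derivative:
  assumes \<phi>: "\<phi> \<in> schwartz"
  shows "(fourier \<phi> has_vector_derivative fourier (\<lambda>x. - \<i> * of_real x * \<phi> x) \<xi>) (at \<xi>)"
proof -
  have S1: "(\<lambda>x. - \<i> * of_real x * \<phi> x) \<in> schwartz"
    using schwartz_cmult[OF schwartz_mult[OF slowly_growing_of_real \<phi>], of "- \<i>"] by (simp add: mult.assoc)
  have S2: "(\<lambda>x. of_real x * (of_real x * \<phi> x)) \<in> schwartz"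
    by (intro schwartz_mult[OF slowly_growing_of_real] \<phi>)
  define M where "M = (LINT x|lborel. norm (of_real x * (of_real x * \<phi> x)))"
  have "norm (fourier \<phi> (\<xi> + h) - fourier \<phi> \<xi> - h *\<^sub>R fourier (\<lambda>x. - \<i> * of_real x * \<phi> x) \<xi>) \<le> h\<^sup>2 * M" for h
  proof -
    define a where "a x = exp (- \<i> * of_real (x * (\<xi> + h))) * \<phi> x" for x
    define b where "b x = exp (- \<i> * of_real (x * \<xi>)) * \<phi> x" for x
    define c where "c x = exp (- \<i> * of_real (x * \<xi>)) * (- \<i> * of_real x * \<phi> x)" for x
    have I: "integrable lborel a" "integrable lborel b" "integrable lborel c"
      unfolding a_def[abs_def] b_def[abs_def] c_def[abs_def]
      by (intro schwartz_integrable fourier_integrand_schwartz \<phi> S1)+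
    have int: "integrable lborel (\<lambda>x. a x - b x - h *\<^sub>R c x)"
      by (intro Bochner_Integration.integrable_diff integrable_scaleR_right I)
    have eq: "a x - b x - h *\<^sub>R c x = b x * (exp (\<i> * of_real (- (x * h))) - 1 - \<i> * of_real (- (x * h)))" for x
      by (simp add: a_def b_def c_def algebra_simps scaleR_conv_of_real exp_diff exp_minus exp_add divide_inverse)
    have "fourier \<phi> (\<xi> + h) - fourier \<phi> \<xi> - h *\<^sub>R fourier (\<lambda>x. - \<i> * of_real x * \<phi> x) \<xi> =
        (LINT x|lborel. a x - b x - h *\<^sub>R c x)"
      unfolding fourier_def a_def[symmetric] b_def[symmetric] c_def[symmetric]
      using I by simp
    also have "norm \<dots> \<le> (LINT x|lborel. h\<^sup>2 * norm (of_real x * (of_real x * \<phi> x)))"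
    proof (rule Bochner_Integration.integral_norm_bound_integral[OF int])
      show "integrable lborel (\<lambda>x. h\<^sup>2 * norm (of_real x * (of_real x * \<phi> x)))"
        by (intro integrable_mult_right integrable_norm schwartz_integrable[OF S2])
      fix x
      have "norm (a x - b x - h *\<^sub>R c x) \<le> norm (\<phi> x) * (- (x * h))\<^sup>2"
        unfolding eq unfolding b_def norm_mult fourier_exp_eq norm_exp_i by (intro mult_mono norm_exp_i_remainder) auto
      also have "\<dots> = h\<^sup>2 * norm (of_real x * (of_real x * \<phi> x))"
        by (simp add: norm_mult power2_eq_square)
      finally show "norm (a x - b x - h *\<^sub>R c x) \<le> h\<^sup>2 * norm (of_real x * (of_real x * \<phi> x))" .
    qed
    finally show ?thesis by (simp add: M_def)
  qed
  note est = this
  have "((\<lambda>h. norm (fourier \<phi> (\<xi> + h) - fourier \<phi> \<xi> - h *\<^sub>R fourier (\<lambda>x. - \<i> * of_real x * \<phi> x) \<xi>) / norm h) \<longlongrightarrow> 0) (at 0)"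
  proof (rule Lim_null_comparison)
    show "((\<lambda>h. \<bar>h\<bar> * M) \<longlongrightarrow> 0) (at 0)" by (intro tendsto_eq_intros) auto
    show "\<forall>\<^sub>F h in at 0. norm (norm (fourier \<phi> (\<xi> + h) - fourier \<phi> \<xi> - h *\<^sub>R fourier (\<lambda>x. - \<i> * of_real x * \<phi> x) \<xi>) / norm h) \<le> \<bar>h\<bar> * M"
      using eventually_neq_at_within[of 0]
    proof eventually_elim
      case (elim h)
      have "norm (fourier \<phi> (\<xi> + h) - fourier \<phi> \<xi> - h *\<^sub>R fourier (\<lambda>x. - \<i> * of_real x * \<phi> x) \<xi>) / \<bar>h\<bar> \<le> h\<^sup>2 * M / \<bar>h\<bar>"
        by (intro divide_right_mono est) auto
      also have "\<dots> = \<bar>h\<bar> * M" using elim by (simp add: power2_eq_square abs_if)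
      finally show ?case by simp
    qed
  qed
  then show ?thesis
    by (simp add: has_vector_derivative_def has_derivative_at bounded_linear_scaleR_left)
qed

text \<open>Multiplication by (-ix)^n corresponds to the n-th derivative of the Fourier transform,
  with the sign convention of \<open>fourier\<close>.\<close>

definition moment :: "nat \<Rightarrow> (real \<Rightarrow> complex) \<Rightarrow> real \<Rightarrow> complex" where
  "moment n \<phi> x = (- \<i> * of_real x) ^ n * \<phi> x"

lemma moment_schwartz: "\<phi> \<in> schwartz \<Longrightarrow> moment n \<phi> \<in> schwartz"
proof (induction n)
  case (Suc n)
  have "moment (Suc n) \<phi> = (\<lambda>x. (- \<i>) * (of_real x * moment n \<phi> x))"
    by (auto simp: moment_def)
  then show ?case using schwartz_cmult[OF schwartz_mult[OF slowly_growing_of_real Suc.IH[OF Suc.prems]], of "- \<i>"] by simp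
qed (simp add: moment_def[abs_def])

lemma
  assumes "\<phi> \<in> schwartz"
  shows smooth_fourier: "smooth (fourier \<phi>)"
    and vderiv_power_fourier: "(vderiv ^^ n) (fourier \<phi>) = fourier (moment n \<phi>)"
proof -
  have *: "(fourier (moment n \<phi>) has_vector_derivative fourier (moment (Suc n) \<phi>) x) (at x)" for n x
    using fourier_has_vector_derivative[OF moment_schwartz[OF assms], of n x]
    by (simp add: moment_def[abs_def] mult.assoc)
  have 0: "moment 0 \<phi> = \<phi>" by (simp add: moment_def[abs_def])
  show "smooth (fourier \<phi>)" "(vderiv ^^ n) (fourier \<phi>) = fourier (moment n \<phi>)"
    using smoothI[of "\<lambda>n. fourier (moment n \<phi>)", OF *] vderiv_power_eq[of "\<lambda>n. fourier (moment n \<phi>)", OF *]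
    by (simp_all add: 0)
qed

lemma fourier_vderiv:
  assumes \<phi>: "\<phi> \<in> schwartz"
  shows "fourier (vderiv \<phi>) \<xi> = \<i> * of_real \<xi> * fourier \<phi> \<xi>"
proof -
  let ?e = "\<lambda>x. exp (- \<i> * of_real (x * \<xi>))"
  have "vderiv (\<lambda>x. ?e x * \<phi> x) x = ?e x * vderiv \<phi> x + (- \<i> * of_real \<xi>) * (?e x * \<phi> x)" for x
  proof -
    have "((\<lambda>z. exp (- \<i> * (z * of_real \<xi>))) has_field_derivative exp (- \<i> * (of_real x * of_real \<xi>)) * (- \<i> * of_real \<xi>)) (at (of_real x))"
      by (auto intro!: derivative_eq_intros)
    from has_vector_derivative_real_field[OF this]
    have e: "(?e has_vector_derivative ?e x * (- \<i> * of_real \<xi>)) (at x)" by (simp add: o_def)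
    have "(\<phi> has_vector_derivative vderiv \<phi> x) (at x)"
      using smooth_has_vector_derivative[OF schwartz_smooth[OF \<phi>], of 0 x] by simp
    from has_vector_derivative_mult[OF e this] show ?thesis
      unfolding vderiv_def by (intro vector_derivative_at) (simp add: mult_ac)
  qed
  then have "0 = (LINT x|lborel. ?e x * vderiv \<phi> x + (- \<i> * of_real \<xi>) * (?e x * \<phi> x))"
    using schwartz_integral_vderiv[OF fourier_integrand_schwartz[OF \<phi>, of \<xi>]] by simp
  also have "\<dots> = fourier (vderiv \<phi>) \<xi> + (- \<i> * of_real \<xi>) * fourier \<phi> \<xi>"
    unfolding fourier_def
    using fourier_integrand_schwartz[OF \<phi>, THEN schwartz_integrable]
      fourier_integrand_schwartz[OF schwartz_vderiv[OF \<phi>], THEN schwartz_integrable]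
    by (subst Bochner_Integration.integral_add) (auto intro!: integrable_mult_right)
  finally show ?thesis by (simp add: algebra_simps)
qed

lemma fourier_vderiv_power:
  assumes \<phi>: "\<phi> \<in> schwartz"
  shows "fourier ((vderiv ^^ m) \<phi>) \<xi> = (\<i> * of_real \<xi>) ^ m * fourier \<phi> \<xi>"
  by (induction m) (simp_all add: fourier_vderiv[OF schwartz_vderiv_power[OF \<phi>]] mult.assoc)

text \<open>Up to a factor of modulus 1, the weighted derivative of the transform is the transform
  of a derivative of a moment, hence bounded by an L^1 norm. The inequality yields both membership
  of the transform in the Schwartz space and estimates of its seminorms.\<close>

lemma norm_power_vderiv_fourier_le:
  assumes \<phi>: "\<phi> \<in> schwartz"
  shows "norm (\<xi> ^ m *\<^sub>R (vderiv ^^ n) (fourier \<phi>) \<xi>) \<le> (LINT x|lborel. norm ((vderiv ^^ m) (moment n \<phi>) x))"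
proof -
  have "norm (\<xi> ^ m *\<^sub>R (vderiv ^^ n) (fourier \<phi>) \<xi>) = norm ((\<i> * of_real \<xi>) ^ m * fourier (moment n \<phi>) \<xi>)"
    by (simp add: vderiv_power_fourier[OF \<phi>] norm_mult norm_power power_abs)
  also have "\<dots> = norm (fourier ((vderiv ^^ m) (moment n \<phi>)) \<xi>)"
    by (simp only: fourier_vderiv_power[OF moment_schwartz[OF \<phi>]])
  also have "\<dots> \<le> (LINT x|lborel. norm ((vderiv ^^ m) (moment n \<phi>) x))"
    by (intro norm_fourier_le schwartz_vderiv_power moment_schwartz \<phi>)
  finally show ?thesis .
qed

lemma fourier_schwartz:
  assumes "\<phi> \<in> schwartz"
  shows "fourier \<phi> \<in> schwartz"
proof -
  have "bounded (range (\<lambda>x. x ^ m *\<^sub>R (vderiv ^^ n) (fourier \<phi>) x))" for m n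
    unfolding bounded_iff using norm_power_vderiv_fourier_le[OF assms] by blast
  then show ?thesis using smooth_fourier[OF assms] by (simp add: schwartz_def)
qed

lemma schwartz_seminorm_fourier_le:
  assumes "\<phi> \<in> schwartz"
  shows "schwartz_seminorm m n (fourier \<phi>) \<le> (LINT x|lborel. norm ((vderiv ^^ m) (moment n \<phi>) x))"
  unfolding schwartz_seminorm_def
  by (rule cSUP_least) (auto simp del: norm_scaleR intro: norm_power_vderiv_fourier_le[OF assms])

lemma inv_fourier_eq: "inv_fourier \<phi> x = 1 / (2 * of_real pi) * fourier \<phi> (- x)"
  by (simp add: inv_fourier_def fourier_def mult.commute)

lemma inv_fourier_schwartz: "\<phi> \<in> schwartz \<Longrightarrow> inv_fourier \<phi> \<in> schwartz"
  using schwartz_cmult[OF schwartz_affine[OF fourier_schwartz, of \<phi> "-1" 0], of "1 / (2 * of_real pi)"]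
  by (simp add: inv_fourier_eq[abs_def])

lemma fourier_add:
  "\<phi> \<in> schwartz \<Longrightarrow> \<psi> \<in> schwartz \<Longrightarrow> fourier (\<lambda>x. \<phi> x + \<psi> x) \<xi> = fourier \<phi> \<xi> + fourier \<psi> \<xi>"
  unfolding fourier_def distrib_left
  by (intro Bochner_Integration.integral_add schwartz_integrable fourier_integrand_schwartz)

lemma fourier_cmult: "fourier (\<lambda>x. c * \<phi> x) \<xi> = c * fourier \<phi> \<xi>"
  unfolding fourier_def by (simp add: mult.left_commute)

lemma fourier_sum:
  assumes "finite I" "\<And>i. i \<in> I \<Longrightarrow> \<phi> i \<in> schwartz"
  shows "fourier (\<lambda>x. \<Sum>i\<in>I. \<phi> i x) \<xi> = (\<Sum>i\<in>I. fourier (\<phi> i) \<xi>)"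
  using assms
proof (induction I rule: finite_induct)
  case (insert i I)
  then show ?case by (simp add: fourier_add schwartz_sum)
qed (simp add: fourier_def)

section \<open>Gaussian functions\<close>

lemma exp_ge_power_over_fact: "0 \<le> y \<Longrightarrow> y ^ n / fact n \<le> exp y" for y :: real
  using sum_le_suminf[OF summable_exp_generic[of y], of "{n}"] by (simp add: exp_def divide_inverse mult.commute)

text \<open>A single term of the exponential series at x^2/2 bounds x^(2i) times the Gaussian; lower
  powers are covered by |x|^i being at most 1 + x^(2i).\<close>

lemma abs_power_gauss_le: "\<bar>x\<bar> ^ i * exp (- x\<^sup>2 / 2) \<le> 1 + 2 ^ i * fact i" for x :: real
proof -
  have "\<bar>x\<bar> ^ i \<le> 1 + (x\<^sup>2) ^ i"
  proof (cases "\<bar>x\<bar> \<le> 1")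
    case True
    then have "\<bar>x\<bar> ^ i \<le> 1" by (intro power_le_one) auto
    then show ?thesis by (auto intro: add_increasing2)
  next
    case False
    then have "\<bar>x\<bar> ^ 1 \<le> \<bar>x\<bar> ^ 2" by (intro power_increasing) auto
    then have "\<bar>x\<bar> ^ i \<le> (x\<^sup>2) ^ i" by (intro power_mono) auto
    then show ?thesis by simp
  qed
  then have "\<bar>x\<bar> ^ i * exp (- x\<^sup>2 / 2) \<le> (1 + (x\<^sup>2) ^ i) * exp (- x\<^sup>2 / 2)" by (intro mult_right_mono) auto
  also have "\<dots> = exp (- x\<^sup>2 / 2) + (x\<^sup>2) ^ i * exp (- x\<^sup>2 / 2)" by (simp add: algebra_simps)
  also have "\<dots> \<le> 1 + 2 ^ i * fact i"
  proof (intro add_mono)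
    have "(x\<^sup>2 / 2) ^ i / fact i \<le> exp (x\<^sup>2 / 2)" by (intro exp_ge_power_over_fact) auto
    then show "(x\<^sup>2) ^ i * exp (- x\<^sup>2 / 2) \<le> 2 ^ i * fact i"
      by (simp add: exp_minus power_divide field_simps)
  qed auto
  finally show ?thesis .
qed

lemma poly_gauss_bounded: "\<exists>C. \<forall>x. \<bar>poly p x\<bar> * exp (- x\<^sup>2 / 2) \<le> C" for p :: "real poly"
proof -
  have "\<bar>poly p x\<bar> * exp (- x\<^sup>2 / 2) \<le> (\<Sum>i\<le>degree p. \<bar>coeff p i\<bar> * (1 + 2 ^ i * fact i))" for x
  proof -
    have "\<bar>poly p x\<bar> \<le> (\<Sum>i\<le>degree p. \<bar>coeff p i * x ^ i\<bar>)" unfolding poly_altdef by (rule sum_abs)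
    then have "\<bar>poly p x\<bar> * exp (- x\<^sup>2 / 2) \<le> (\<Sum>i\<le>degree p. \<bar>coeff p i * x ^ i\<bar>) * exp (- x\<^sup>2 / 2)"
      by (intro mult_right_mono) auto
    also have "\<dots> = (\<Sum>i\<le>degree p. \<bar>coeff p i\<bar> * (\<bar>x\<bar> ^ i * exp (- x\<^sup>2 / 2)))"
      by (simp add: sum_distrib_right abs_mult power_abs mult.assoc)
    also have "\<dots> \<le> (\<Sum>i\<le>degree p. \<bar>coeff p i\<bar> * (1 + 2 ^ i * fact i))"
      by (intro sum_mono mult_left_mono abs_power_gauss_le) auto
    finally show ?thesis .
  qed
  then show ?thesis by blast
qed

definition gauss :: "real \<Rightarrow> real" where
  "gauss x = exp (- x\<^sup>2 / 2)"

lemma gauss_schwartz: "(\<lambda>x. complex_of_real (gauss x)) \<in> schwartz"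
proof -
  \<comment> \<open>The derivative of H times the Gaussian is (H' - x H) times the Gaussian, so
    these are the Hermite polynomials up to sign.\<close>
  define H :: "nat \<Rightarrow> real poly" where "H n = ((\<lambda>p. pderiv p - [:0, 1:] * p) ^^ n) 1" for n
  define D where "D n x = complex_of_real (poly (H n) x * gauss x)" for n x
  have D: "(D n has_vector_derivative D (Suc n) x) (at x)" for n x
  proof -
    have "((\<lambda>x. poly (H n) x * gauss x) has_real_derivative
        poly (H n) x * (exp (- x\<^sup>2 / 2) * (- x)) + poly (pderiv (H n)) x * gauss x) (at x)"
      unfolding gauss_def by (auto intro!: derivative_eq_intros)
    also have "poly (H n) x * (exp (- x\<^sup>2 / 2) * (- x)) + poly (pderiv (H n)) x * gauss x = poly (H (Suc n)) x * gauss x"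
      by (simp add: H_def gauss_def algebra_simps)
    finally show ?thesis
      unfolding D_def[abs_def] by (intro has_vector_derivative_of_real)
        (simp add: has_real_derivative_iff_has_vector_derivative)
  qed
  have D0: "D 0 = (\<lambda>x. complex_of_real (gauss x))" by (simp add: D_def[abs_def] H_def)
  show ?thesis
    unfolding schwartz_iff D0[symmetric] vderiv_power_eq[of D, OF D]
  proof (intro conjI allI)
    show "smooth (D 0)" by (rule smoothI[of D, OF D])
    fix m n
    \<comment> \<open>The weight (1 + |x|)^m is at most the polynomial 2^m (1 + x^(2m)); merging it
      with the Hermite polynomial leaves one polynomial times a Gaussian to bound.\<close>
    obtain C where C: "\<And>x. \<bar>poly (smult (2 ^ m) (1 + monom 1 (2 * m)) * H n) x\<bar> * exp (- x\<^sup>2 / 2) \<le> C"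
      using poly_gauss_bounded by blast
    have "(1 + \<bar>x\<bar>) ^ m * norm (D n x) \<le> C" for x
    proof -
      have "(1 + \<bar>x\<bar>) ^ m \<le> (2 * max 1 \<bar>x\<bar>) ^ m" by (intro power_mono) auto
      also have "\<dots> \<le> 2 ^ m * (1 + x ^ (2 * m))"
      proof (cases "\<bar>x\<bar> \<le> 1")
        case False
        then have "\<bar>x\<bar> ^ m \<le> \<bar>x\<bar> ^ (2 * m)" by (intro power_increasing) auto
        then have "\<bar>x\<bar> ^ m \<le> 1 + x ^ (2 * m)" by (simp add: power_mult power_even_abs)
        then show ?thesis using False by (simp add: max_def power_mult_distrib)
      qed (simp add: max_def power_mult)
      finally have "(1 + \<bar>x\<bar>) ^ m * (\<bar>poly (H n) x\<bar> * exp (- x\<^sup>2 / 2)) \<le> 2 ^ m * (1 + x ^ (2 * m)) * (\<bar>poly (H n) x\<bar> * exp (- x\<^sup>2 / 2))"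
        by (intro mult_right_mono) auto
      also have "\<dots> = \<bar>poly (smult (2 ^ m) (1 + monom 1 (2 * m)) * H n) x\<bar> * exp (- x\<^sup>2 / 2)"
        by (simp add: poly_monom abs_mult power_mult)
      also note C
      finally show ?thesis by (simp add: D_def gauss_def norm_mult abs_mult)
    qed
    then show "\<exists>C. \<forall>x. (1 + \<bar>x\<bar>) ^ m * norm (D n x) \<le> C" by blast
  qed
qed

section \<open>Fourier inversion\<close>

lemma gauss_nonneg [simp]: "0 \<le> gauss x" and gauss_le_1: "gauss x \<le> 1" and gauss_minus [simp]: "gauss (- x) = gauss x"
  by (auto simp: gauss_def)

lemma gauss_measurable [measurable]: "gauss \<in> borel_measurable borel"
  unfolding gauss_def[abs_def] by measurable

lemma integrable_gauss: "integrable lborel gauss"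
proof -
  have "integrable lborel (\<lambda>x. norm (complex_of_real (gauss x)))"
    by (intro integrable_norm schwartz_integrable gauss_schwartz)
  then show ?thesis by simp
qed

lemma std_normal_density_gauss: "std_normal_density x = gauss x / sqrt (2 * pi)"
  by (simp add: std_normal_density_def gauss_def)

text \<open>The characteristic function of the standard normal distribution, freed of its
  normalising factor.\<close>

lemma integral_exp_gauss:
  "(LINT x|lborel. exp (\<i> * of_real (t * x)) * of_real (gauss x)) = of_real (sqrt (2 * pi) * gauss t)"
proof -
  have "char std_normal_distribution t = (LINT x|lborel. std_normal_density x *\<^sub>R exp (\<i> * of_real (t * x)))"
    unfolding char_def by (subst integral_density) auto
  also have "\<dots> = (LINT x|lborel. of_real (1 / sqrt (2 * pi)) * (exp (\<i> * of_real (t * x)) * of_real (gauss x)))"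
    by (simp add: std_normal_density_gauss scaleR_conv_of_real mult_ac)
  also have "\<dots> = of_real (1 / sqrt (2 * pi)) * (LINT x|lborel. exp (\<i> * of_real (t * x)) * of_real (gauss x))"
    by (rule integral_mult_right_zero)
  finally have "of_real (1 / sqrt (2 * pi)) * (LINT x|lborel. exp (\<i> * of_real (t * x)) * of_real (gauss x)) = complex_of_real (gauss t)"
    by (simp add: char_std_normal_distribution gauss_def)
  then show ?thesis by (simp add: field_simps)
qed

lemma integral_gauss: "(LINT x|lborel. gauss x) = sqrt (2 * pi)"
proof -
  have "complex_of_real (LINT x|lborel. gauss x) = of_real (sqrt (2 * pi))"
    using integral_exp_gauss[of 0] by (simp add: gauss_def integral_complex_of_real)
  then show ?thesis by (simp only: of_real_eq_iff)
qed

text \<open>The normal density with mean \<open>x\<close> and standard deviation 1/n; as n grows it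
  is an approximate identity at \<open>x\<close>.\<close>

definition gauss_kernel :: "real \<Rightarrow> real \<Rightarrow> real \<Rightarrow> real" where
  "gauss_kernel n x y = n / sqrt (2 * pi) * gauss (n * (y - x))"

text \<open>Integrability against one fixed Gaussian suffices: away from \<open>x\<close> every
  narrower kernel is a small multiple of that Gaussian. Near \<open>x\<close> the function is
  bounded by continuity and dominated convergence applies after rescaling.\<close>

lemma gauss_kernel_tendsto:
  fixes f :: "real \<Rightarrow> complex"
  assumes [measurable]: "f \<in> borel_measurable borel" and c: "isCont f x"
    and I: "integrable lborel (\<lambda>y. f y * of_real (gauss (y - x)))"
  shows "(\<lambda>n. LINT y|lborel. f y * of_real (gauss_kernel (real (Suc n)) x y)) \<longlonglongrightarrow> f x"
proof -
  obtain d where d: "d > 0" "\<And>y. \<bar>y - x\<bar> < d \<Longrightarrow> norm (f y - f x) < 1"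
    using c unfolding continuous_at_eps_delta by (metis dist_norm dist_commute real_norm_def zero_less_one)
  define M where "M = norm (f x) + 1"
  have M: "norm (f y) \<le> M" if "\<bar>y - x\<bar> < d" for y
    using norm_triangle_sub[of "f y" "f x"] d(2)[OF that] by (simp add: M_def)
  define g where "g y = indicator {x - d<..<x + d} y *\<^sub>R f y" for y
  define h where "h y = indicator (- {x - d<..<x + d}) y *\<^sub>R f y" for y
  have [measurable]: "g \<in> borel_measurable borel" "h \<in> borel_measurable borel"
    unfolding g_def[abs_def] h_def[abs_def] by measurable
  have gM: "norm (g y) \<le> M" for y
    using M[of y] by (auto simp: g_def indicator_def M_def)
  have f: "f y = g y + h y" for y by (auto simp: g_def h_def indicator_def)
  define k where "k n y = complex_of_real (gauss_kernel (real (Suc n)) x y)" for n y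
  define K where "K = sqrt (2 * pi)"
  have K: "K > 0" by (simp add: K_def)
  have kn: "integrable lborel (k n)" for n
  proof -
    have "(\<lambda>y. complex_of_real (real (Suc n) / K) * of_real (gauss (real (Suc n) * y + (- real (Suc n) * x)))) \<in> schwartz"
      by (intro schwartz_cmult schwartz_affine[OF gauss_schwartz]) simp
    from schwartz_integrable[OF this] show ?thesis
      by (simp add: k_def[abs_def] gauss_kernel_def K_def algebra_simps)
  qed
  have gk: "integrable lborel (\<lambda>y. g y * k n y)" for n
  proof (rule Bochner_Integration.integrable_bound)
    show "integrable lborel (\<lambda>y. of_real M * k n y)" by (intro integrable_mult_right kn)
    show "(\<lambda>y. g y * k n y) \<in> borel_measurable lborel"
      using kn[of n] by (auto dest: borel_measurable_integrable)
    show "AE y in lborel. norm (g y * k n y) \<le> norm (of_real M * k n y)"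
      unfolding norm_mult norm_of_real by (intro AE_I2 mult_right_mono order_trans[OF gM abs_ge_self]) auto
  qed
  \<comment> \<open>At distance at least \<open>d\<close> from \<open>x\<close>, with n standing for
    \<open>real (Suc n)\<close>, the narrow Gaussian equals the wide one times exp(-(n^2 - 1)(y -
    x)^2/2), at most exp(-(n^2 - 1) d^2/2). The prefactor n of the kernel does not prevent
    convergence to 0.\<close>
  define c where "c n = real (Suc n) * exp (- ((real (Suc n))\<^sup>2 - 1) * d\<^sup>2 / 2)" for n
  have hk_le: "norm (h y * k n y) \<le> c n / K * norm (f y * of_real (gauss (y - x)))" for n y
  proof (cases "\<bar>y - x\<bar> < d")
    case True
    then have "h y = 0" by (auto simp: h_def indicator_def)
    then show ?thesis using K by (simp add: c_def)
  next
    case False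
    have "((real (Suc n))\<^sup>2 - 1) * d\<^sup>2 \<le> ((real (Suc n))\<^sup>2 - 1) * (y - x)\<^sup>2"
    proof (intro mult_left_mono)
      show "d\<^sup>2 \<le> (y - x)\<^sup>2" using False d(1) abs_le_square_iff[of d "y - x"] by simp
      show "0 \<le> (real (Suc n))\<^sup>2 - 1" using power_mono[of 1 "real (Suc n)" 2] by simp
    qed
    then have "- (real (Suc n) * (y - x))\<^sup>2 / 2 \<le> - ((real (Suc n))\<^sup>2 - 1) * d\<^sup>2 / 2 + - (y - x)\<^sup>2 / 2"
      unfolding power_mult_distrib by (simp add: algebra_simps)
    then have "gauss (real (Suc n) * (y - x)) \<le> exp (- ((real (Suc n))\<^sup>2 - 1) * d\<^sup>2 / 2) * gauss (y - x)"
      unfolding gauss_def exp_add[symmetric] exp_le_cancel_iff .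
    then have "real (Suc n) * gauss (real (Suc n) * (y - x)) \<le> c n * gauss (y - x)"
      unfolding c_def mult.assoc by (intro mult_left_mono) auto
    then have "real (Suc n) * gauss (real (Suc n) * (y - x)) / K \<le> c n * gauss (y - x) / K"
      using K by (intro divide_right_mono) auto
    then have "norm (k n y) \<le> c n * gauss (y - x) / K"
      unfolding k_def norm_of_real using K by (simp add: gauss_kernel_def K_def[symmetric] abs_mult)
    moreover have "norm (h y) \<le> norm (f y)" by (auto simp: h_def indicator_def)
    ultimately have "norm (h y * k n y) \<le> norm (f y) * (c n * gauss (y - x) / K)"
      unfolding norm_mult by (intro mult_mono) auto
    then show ?thesis by (simp add: norm_mult mult_ac)
  qed
  have hk: "integrable lborel (\<lambda>y. h y * k n y)" for n
  proof (rule Bochner_Integration.integrable_bound)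
    show "integrable lborel (\<lambda>y. c n / K * norm (f y * of_real (gauss (y - x))))"
      by (intro integrable_mult_right integrable_norm I)
    show "(\<lambda>y. h y * k n y) \<in> borel_measurable lborel"
      using kn[of n] by (auto dest: borel_measurable_integrable)
    show "AE y in lborel. norm (h y * k n y) \<le> norm (c n / K * norm (f y * of_real (gauss (y - x))))"
      unfolding real_norm_def by (intro AE_I2 order_trans[OF hk_le abs_ge_self])
  qed
  have "(\<lambda>n. LINT y|lborel. h y * k n y) \<longlonglongrightarrow> 0"
  proof (rule Lim_null_comparison)
    show "\<forall>\<^sub>F n in sequentially. norm (LINT y|lborel. h y * k n y) \<le> c n / K * (LINT y|lborel. norm (f y * of_real (gauss (y - x))))"
    proof (intro always_eventually allI)
      fix n
      have "norm (LINT y|lborel. h y * k n y) \<le> (LINT y|lborel. c n / K * norm (f y * of_real (gauss (y - x))))"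
        by (rule Bochner_Integration.integral_norm_bound_integral[OF hk _ hk_le])
           (intro integrable_mult_right integrable_norm I)
      then show "norm (LINT y|lborel. h y * k n y) \<le> c n / K * (LINT y|lborel. norm (f y * of_real (gauss (y - x))))"
        by simp
    qed
    have "c \<longlonglongrightarrow> 0" unfolding c_def[abs_def] using d(1) by real_asymp
    from tendsto_mult[OF tendsto_divide[OF this tendsto_const[of K]] tendsto_const] K
    show "(\<lambda>n. c n / K * (LINT y|lborel. norm (f y * of_real (gauss (y - x))))) \<longlonglongrightarrow> 0" by simp
  qed
  moreover have "(\<lambda>n. LINT y|lborel. g y * k n y) \<longlonglongrightarrow> f x"
  proof -
    \<comment> \<open>The substitution y = x + s/n, with n standing for \<open>real (Suc n)\<close>,
      moves the dependence on n from the kernel into the bounded function, so that one Gaussian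
      dominates the whole sequence.\<close>
    have sub: "(LINT y|lborel. g y * k n y) = (LINT s|lborel. g (x + s / real (Suc n)) * of_real (gauss s / K))" for n
    proof -
      have "(LINT y|lborel. g y * k n y) = \<bar>1 / real (Suc n)\<bar> *\<^sub>R
          (LINT s|lborel. g (x + 1 / real (Suc n) * s) * k n (x + 1 / real (Suc n) * s))"
        by (rule lborel_integral_real_affine) simp
      also have "\<dots> = (LINT s|lborel. \<bar>1 / real (Suc n)\<bar> *\<^sub>R (g (x + 1 / real (Suc n) * s) * k n (x + 1 / real (Suc n) * s)))"
        by simp
      also have "\<dots> = (LINT s|lborel. g (x + s / real (Suc n)) * of_real (gauss s / K))"
        by (intro Bochner_Integration.integral_cong refl)
           (simp add: k_def gauss_kernel_def K_def scaleR_conv_of_real field_simps del: of_nat_Suc)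
      finally show ?thesis .
    qed
    have "(\<lambda>n. LINT s|lborel. g (x + s / real (Suc n)) * of_real (gauss s / K)) \<longlonglongrightarrow> (LINT s|lborel. f x * of_real (gauss s / K))"
    proof (rule integral_dominated_convergence[where w = "\<lambda>s. M * (gauss s / K)"])
      show "integrable lborel (\<lambda>s. M * (gauss s / K))"
        by (intro integrable_mult_right integrable_divide_zero integrable_gauss)
      show "AE s in lborel. (\<lambda>n. g (x + s / real (Suc n)) * of_real (gauss s / K)) \<longlonglongrightarrow> f x * of_real (gauss s / K)"
      proof (intro AE_I2 tendsto_mult tendsto_const)
        fix s
        have "(\<lambda>n. s * inverse (real (Suc n))) \<longlonglongrightarrow> s * 0"
          by (intro tendsto_mult tendsto_const LIMSEQ_inverse_real_of_nat)
        then have "(\<lambda>n. x + s / real (Suc n)) \<longlonglongrightarrow> x + 0" by (intro tendsto_add tendsto_const) (simp add: divide_inverse)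
        moreover have "isCont g x"
        proof -
          have "\<forall>\<^sub>F y in nhds x. g y = f y"
            unfolding eventually_nhds using d(1) by (intro exI[of _ "{x - d<..<x + d}"]) (auto simp: g_def)
          then show ?thesis using c isCont_cong by blast
        qed
        ultimately have "(\<lambda>n. g (x + s / real (Suc n))) \<longlonglongrightarrow> g x"
          using isCont_tendsto_compose[of x g "\<lambda>n. x + s / real (Suc n)" sequentially] by simp
        then show "(\<lambda>n. g (x + s / real (Suc n))) \<longlonglongrightarrow> f x" using d(1) by (simp add: g_def)
      qed
      show "AE s in lborel. norm (g (x + s / real (Suc n)) * of_real (gauss s / K)) \<le> M * (gauss s / K)" for n
        unfolding norm_mult norm_of_real using gM K
          by (intro AE_I2 mult_mono) (auto intro: order_trans[OF norm_ge_zero gM])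
    qed measurable
    also have "(LINT s|lborel. f x * of_real (gauss s / K)) = f x * of_real ((LINT s|lborel. gauss s) / K)"
      by (simp add: integral_complex_of_real)
    also have "\<dots> = f x" using K by (simp add: integral_gauss K_def)
    finally show ?thesis by (simp add: sub)
  qed
  ultimately have "(\<lambda>n. (LINT y|lborel. g y * k n y) + (LINT y|lborel. h y * k n y)) \<longlonglongrightarrow> f x + 0"
    by (intro tendsto_add)
  moreover have "(LINT y|lborel. g y * k n y) + (LINT y|lborel. h y * k n y) = (LINT y|lborel. f y * k n y)" for n
    using gk hk by (simp add: f distrib_right)
  ultimately show ?thesis by (simp add: k_def)
qed

text \<open>The exponential has modulus 1, so integrability of both factors suffices for Fubini. The
  parameter \<open>s\<close> carries the sign and serves both transforms.\<close>

lemma fubini_exp: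
  fixes a b :: "real \<Rightarrow> complex"
  assumes a: "integrable lborel a" and b: "integrable lborel b"
  shows "(LINT \<xi>|lborel. a \<xi> * (LINT x|lborel. exp (\<i> * of_real (s * \<xi> * x)) * b x)) =
    (LINT x|lborel. b x * (LINT \<xi>|lborel. exp (\<i> * of_real (s * \<xi> * x)) * a \<xi>))"
proof -
  have [measurable]: "a \<in> borel_measurable borel" "b \<in> borel_measurable borel"
    using a b by (auto dest: borel_measurable_integrable)
  let ?k = "\<lambda>(\<xi>, x). a \<xi> * (exp (\<i> * of_real (s * \<xi> * x)) * b x)"
  have n: "norm (exp (\<i> * of_real (s * \<xi> * x)) * b x) = norm (b x)" for \<xi> x by (simp add: norm_mult del: of_real_mult)
  have int: "integrable (lborel \<Otimes>\<^sub>M lborel) ?k"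
  proof (rule lborel_pair.Fubini_integrable)
    show "?k \<in> borel_measurable (lborel \<Otimes>\<^sub>M lborel)" by measurable
    show "integrable lborel (\<lambda>\<xi>. LINT x|lborel. norm (?k (\<xi>, x)))"
      unfolding prod.case norm_mult[of "a _"] n using a by (simp add: integrable_norm)
    have "integrable lborel (\<lambda>x. exp (\<i> * of_real (s * \<xi> * x)) * b x)" for \<xi>
      by (rule Bochner_Integration.integrable_bound[OF b]) (use n in \<open>auto\<close>)
    then show "AE \<xi> in lborel. integrable lborel (\<lambda>x. ?k (\<xi>, x))" by simp
  qed
  have "(LINT \<xi>|lborel. LINT x|lborel. a \<xi> * (exp (\<i> * of_real (s * \<xi> * x)) * b x)) =
      (LINT x|lborel. LINT \<xi>|lborel. a \<xi> * (exp (\<i> * of_real (s * \<xi> * x)) * b x))"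
    using lborel_pair.Fubini_integral[OF int] by simp
  also have "\<dots> = (LINT x|lborel. LINT \<xi>|lborel. b x * (exp (\<i> * of_real (s * \<xi> * x)) * a \<xi>))"
    by (simp add: mult_ac)
  finally show ?thesis by simp
qed

lemma fourier_as_exp: "fourier \<phi> \<xi> = (LINT x|lborel. exp (\<i> * of_real (-1 * \<xi> * x)) * \<phi> x)"
  unfolding fourier_def fourier_exp_eq by simp

text \<open>The iterated integral is not absolutely convergent, so a Gaussian cut-off in frequency
  is inserted before exchanging the integrals. The inner integral becomes 2 pi times the Gaussian
  kernel; the two limits of the regularised integral must agree.\<close>

lemma inv_fourier_fourier:
  assumes \<psi>: "\<psi> \<in> schwartz"
  shows "inv_fourier (fourier \<psi>) x = \<psi> x"
proof -
  \<comment> \<open>The dilated Gaussian tends to 1 pointwise and stays at most 1, so removing the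
    cut-off is dominated by the integrable function
    \<open>norm (fourier \<psi> \<xi>)\<close>.\<close>
  define a where "a n \<xi> = complex_of_real (gauss (\<xi> / real (Suc n))) * exp (\<i> * of_real (x * \<xi>))" for n \<xi>
  have aS: "a n \<in> schwartz" for n
  proof -
    have "(\<lambda>\<xi>. complex_of_real (gauss (1 / real (Suc n) * \<xi> + 0))) \<in> schwartz"
      by (rule schwartz_affine[OF gauss_schwartz]) simp
    from schwartz_mult[OF slowly_growing_exp[of x] this] show ?thesis
      by (simp add: a_def[abs_def] mult.commute)
  qed
  have F: "fourier \<psi> \<in> schwartz" by (rule fourier_schwartz[OF \<psi>])
  have lim1: "(\<lambda>n. LINT \<xi>|lborel. a n \<xi> * fourier \<psi> \<xi>) \<longlonglongrightarrow> (LINT \<xi>|lborel. exp (\<i> * of_real (x * \<xi>)) * fourier \<psi> \<xi>)"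
  proof (rule integral_dominated_convergence[where w = "\<lambda>\<xi>. norm (fourier \<psi> \<xi>)"])
    show "integrable lborel (\<lambda>\<xi>. norm (fourier \<psi> \<xi>))" by (intro integrable_norm schwartz_integrable F)
    show "AE \<xi> in lborel. (\<lambda>n. a n \<xi> * fourier \<psi> \<xi>) \<longlonglongrightarrow> exp (\<i> * of_real (x * \<xi>)) * fourier \<psi> \<xi>"
    proof (intro AE_I2 tendsto_mult tendsto_const)
      fix \<xi>
      have "(\<lambda>n. \<xi> * inverse (real (Suc n))) \<longlonglongrightarrow> \<xi> * 0"
        by (intro tendsto_mult tendsto_const LIMSEQ_inverse_real_of_nat)
      then have "(\<lambda>n. \<xi> / real (Suc n)) \<longlonglongrightarrow> 0" by (simp add: divide_inverse)
      then have "(\<lambda>n. gauss (\<xi> / real (Suc n))) \<longlonglongrightarrow> exp (- 0\<^sup>2 / 2)"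
        unfolding gauss_def by (intro tendsto_intros) auto
      then have "(\<lambda>n. complex_of_real (gauss (\<xi> / real (Suc n))) * exp (\<i> * of_real (x * \<xi>))) \<longlonglongrightarrow>
          of_real (exp (- 0\<^sup>2 / 2)) * exp (\<i> * of_real (x * \<xi>))"
        by (intro tendsto_mult tendsto_of_real tendsto_const)
      then show "(\<lambda>n. a n \<xi>) \<longlonglongrightarrow> exp (\<i> * of_real (x * \<xi>))" by (simp add: a_def)
    qed
    show "(\<lambda>\<xi>. a n \<xi> * fourier \<psi> \<xi>) \<in> borel_measurable lborel" for n
      using schwartz_measurable[OF aS] schwartz_measurable[OF F] by simp
    show "(\<lambda>\<xi>. exp (\<i> * of_real (x * \<xi>)) * fourier \<psi> \<xi>) \<in> borel_measurable lborel"
      using schwartz_measurable[OF schwartz_mult[OF slowly_growing_exp F]] by simp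
    show "AE \<xi> in lborel. norm (a n \<xi> * fourier \<psi> \<xi>) \<le> norm (fourier \<psi> \<xi>)" for n
      unfolding a_def norm_mult norm_exp_i using gauss_le_1
      by (intro AE_I2) (auto intro!: mult_left_le_one_le)
  qed
  have "(LINT \<xi>|lborel. a n \<xi> * fourier \<psi> \<xi>) = 2 * of_real pi * (LINT y|lborel. \<psi> y * of_real (gauss_kernel (real (Suc n)) x y))" for n
  proof -
    have inner: "(LINT \<xi>|lborel. exp (\<i> * of_real (-1 * \<xi> * y)) * a n \<xi>) =
        2 * of_real pi * of_real (gauss_kernel (real (Suc n)) x y)" for y
    proof -
      have "(LINT \<xi>|lborel. exp (\<i> * of_real (-1 * \<xi> * y)) * a n \<xi>) = \<bar>real (Suc n)\<bar> *\<^sub>R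
          (LINT s|lborel. exp (\<i> * of_real (-1 * (0 + real (Suc n) * s) * y)) * a n (0 + real (Suc n) * s))"
        by (rule lborel_integral_real_affine) simp
      also have "(LINT s|lborel. exp (\<i> * of_real (-1 * (0 + real (Suc n) * s) * y)) * a n (0 + real (Suc n) * s)) =
          (LINT s|lborel. exp (\<i> * of_real ((real (Suc n) * (x - y)) * s)) * of_real (gauss s))"
        by (intro Bochner_Integration.integral_cong refl)
           (simp add: a_def algebra_simps exp_diff exp_minus exp_add divide_inverse del: of_nat_Suc)
      also have "\<dots> = of_real (sqrt (2 * pi) * gauss (real (Suc n) * (x - y)))" by (rule integral_exp_gauss)
      finally have "(LINT \<xi>|lborel. exp (\<i> * of_real (-1 * \<xi> * y)) * a n \<xi>) =
          of_real (real (Suc n) * (sqrt (2 * pi) * gauss (real (Suc n) * (x - y))))"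
        by (simp add: scaleR_conv_of_real del: of_nat_Suc)
      also have "gauss (real (Suc n) * (x - y)) = gauss (real (Suc n) * (y - x))"
        using gauss_minus[of "real (Suc n) * (x - y)"] by (simp add: algebra_simps)
      also have "real (Suc n) * (sqrt (2 * pi) * gauss (real (Suc n) * (y - x))) = 2 * pi * gauss_kernel (real (Suc n)) x y"
      proof -
        define K where "K = sqrt (2 * pi)"
        have "2 * pi = K * K" "K \<noteq> 0" by (simp_all add: K_def)
        then show ?thesis unfolding gauss_kernel_def K_def[symmetric] by simp
      qed
      finally show ?thesis by simp
    qed
    have "(LINT \<xi>|lborel. a n \<xi> * fourier \<psi> \<xi>) =
        (LINT y|lborel. \<psi> y * (LINT \<xi>|lborel. exp (\<i> * of_real (-1 * \<xi> * y)) * a n \<xi>))"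
      unfolding fourier_as_exp by (rule fubini_exp[OF schwartz_integrable[OF aS] schwartz_integrable[OF \<psi>]])
    then show ?thesis unfolding inner by (simp add: mult.left_commute[of _ "2 * complex_of_real pi"])
  qed
  moreover have "(\<lambda>n. LINT y|lborel. \<psi> y * of_real (gauss_kernel (real (Suc n)) x y)) \<longlonglongrightarrow> \<psi> x"
  proof (rule gauss_kernel_tendsto)
    show "\<psi> \<in> borel_measurable borel" by (rule schwartz_measurable[OF \<psi>])
    show "isCont \<psi> x"
      using continuous_on_smooth[OF schwartz_smooth[OF \<psi>], of UNIV 0] by (simp add: continuous_on_eq_continuous_at)
    show "integrable lborel (\<lambda>y. \<psi> y * of_real (gauss (y - x)))"
    proof (rule Bochner_Integration.integrable_bound[OF schwartz_integrable[OF \<psi>]])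
      show "(\<lambda>y. \<psi> y * of_real (gauss (y - x))) \<in> borel_measurable lborel"
        using schwartz_measurable[OF \<psi>] by simp
      show "AE y in lborel. norm (\<psi> y * of_real (gauss (y - x))) \<le> norm (\<psi> y)"
        using gauss_le_1 by (intro AE_I2) (auto simp: norm_mult intro!: mult_right_le_one_le)
    qed
  qed
  ultimately have "(\<lambda>n. LINT \<xi>|lborel. a n \<xi> * fourier \<psi> \<xi>) \<longlonglongrightarrow> 2 * of_real pi * \<psi> x"
    by (simp add: tendsto_mult_left)
  with lim1 have "(LINT \<xi>|lborel. exp (\<i> * of_real (x * \<xi>)) * fourier \<psi> \<xi>) = 2 * of_real pi * \<psi> x"
    by (rule LIMSEQ_unique)
  then show ?thesis by (simp add: inv_fourier_def)
qed

lemma fourier_inv_fourier: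
  assumes "\<psi> \<in> schwartz"
  shows "fourier (inv_fourier \<psi>) x = \<psi> x"
proof -
  have "fourier (inv_fourier \<psi>) x = \<bar>-1\<bar> *\<^sub>R (LINT \<xi>|lborel. exp (- \<i> * of_real ((0 + -1 * \<xi>) * x)) * inv_fourier \<psi> (0 + -1 * \<xi>))"
    unfolding fourier_def by (rule lborel_integral_real_affine) simp
  also have "\<dots> = (LINT \<xi>|lborel. 1 / (2 * of_real pi) * (exp (\<i> * of_real (x * \<xi>)) * fourier \<psi> \<xi>))"
    by (simp add: inv_fourier_eq mult_ac)
  also have "\<dots> = inv_fourier (fourier \<psi>) x" unfolding inv_fourier_def by (rule integral_mult_right_zero)
  finally show ?thesis by (simp add: inv_fourier_fourier[OF assms])
qed

text \<open>A frequency multiplier acts as convolution with its Fourier transform; the factor 1/(2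
  pi) stems from the inverse transform.\<close>

lemma fourier_mult_inv_fourier:
  assumes a: "a \<in> schwartz" and \<phi>: "\<phi> \<in> schwartz"
  shows "fourier (\<lambda>\<xi>. a \<xi> * inv_fourier \<phi> \<xi>) y = 1 / (2 * of_real pi) * (LINT x|lborel. \<phi> x * fourier a (y - x))"
proof -
  have inner: "(LINT \<xi>|lborel. exp (\<i> * of_real (1 * \<xi> * x)) * (exp (- \<i> * of_real (\<xi> * y)) * a \<xi>)) = fourier a (y - x)" for x
    unfolding fourier_def
    by (intro Bochner_Integration.integral_cong refl) (simp add: algebra_simps exp_diff exp_minus exp_add divide_inverse)
  have "fourier (\<lambda>\<xi>. a \<xi> * inv_fourier \<phi> \<xi>) y =
      (LINT \<xi>|lborel. 1 / (2 * of_real pi) * ((exp (- \<i> * of_real (\<xi> * y)) * a \<xi>) * (LINT x|lborel. exp (\<i> * of_real (1 * \<xi> * x)) * \<phi> x)))"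
    unfolding fourier_def inv_fourier_def by (simp add: mult_ac)
  also have "\<dots> = 1 / (2 * of_real pi) * (LINT \<xi>|lborel. (exp (- \<i> * of_real (\<xi> * y)) * a \<xi>) * (LINT x|lborel. exp (\<i> * of_real (1 * \<xi> * x)) * \<phi> x))"
    by (rule integral_mult_right_zero)
  also have "(LINT \<xi>|lborel. (exp (- \<i> * of_real (\<xi> * y)) * a \<xi>) * (LINT x|lborel. exp (\<i> * of_real (1 * \<xi> * x)) * \<phi> x)) =
      (LINT x|lborel. \<phi> x * (LINT \<xi>|lborel. exp (\<i> * of_real (1 * \<xi> * x)) * (exp (- \<i> * of_real (\<xi> * y)) * a \<xi>)))"
    by (rule fubini_exp[OF schwartz_integrable[OF fourier_integrand_schwartz[OF a]] schwartz_integrable[OF \<phi>]])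
  finally show ?thesis unfolding inner .
qed

section \<open>Frequency boxes\<close>

lemma
  assumes "\<And>i. i \<in> I \<Longrightarrow> smooth (f i)" "finite I"
  shows smooth_sum: "smooth (\<lambda>x. \<Sum>i\<in>I. f i x)"
    and vderiv_power_sum: "(vderiv ^^ n) (\<lambda>x. \<Sum>i\<in>I. f i x) = (\<lambda>x. \<Sum>i\<in>I. (vderiv ^^ n) (f i) x)"
proof -
  define D where "D n x = (\<Sum>i\<in>I. (vderiv ^^ n) (f i) x)" for n x
  have *: "(D n has_vector_derivative D (Suc n) x) (at x)" for n x
    unfolding D_def[abs_def] by (intro has_vector_derivative_sum smooth_has_vector_derivative assms)
  show "smooth (\<lambda>x. \<Sum>i\<in>I. f i x)"
    "(vderiv ^^ n) (\<lambda>x. \<Sum>i\<in>I. f i x) = (\<lambda>x. \<Sum>i\<in>I. (vderiv ^^ n) (f i) x)"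
    using smoothI[of D, OF *] vderiv_power_eq[of D, OF *, of n] by (simp_all add: D_def[abs_def])
qed

locale partition =
  fixes \<eta> :: "real \<Rightarrow> real"
  assumes \<eta>: "partition_profile \<eta>"
begin

lemma \<eta>_smooth: "smooth \<eta>" and \<eta>_zero: "1 \<le> \<bar>\<xi>\<bar> \<Longrightarrow> \<eta> \<xi> = 0"
  and \<eta>_sum: "((\<lambda>k::int. \<eta> (\<xi> - of_int k)) has_sum 1) UNIV"
proof -
  show "smooth \<eta>" "((\<lambda>k::int. \<eta> (\<xi> - of_int k)) has_sum 1) UNIV"
    using \<eta> by (auto simp: partition_profile_def test_function_def)
  have "{x. \<eta> x \<noteq> 0} \<subseteq> {-1<..<1}"
    by (rule order_trans[OF closure_subset]) (use \<eta> in \<open>simp add: partition_profile_def test_function_def\<close>)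
  then show "\<eta> \<xi> = 0" if "1 \<le> \<bar>\<xi>\<bar>" using that by force
qed

text \<open>Only integers within distance 1 of the point contribute, so the infinite partition of
  unity becomes a finite identity over any set containing them.\<close>

lemma \<eta>_finite_sum:
  assumes "finite I" "\<And>k::int. k \<notin> I \<Longrightarrow> 1 \<le> \<bar>\<xi> - of_int k\<bar>"
  shows "(\<Sum>k\<in>I. \<eta> (\<xi> - of_int k)) = 1"
proof -
  have "((\<lambda>k::int. \<eta> (\<xi> - of_int k)) has_sum (\<Sum>k\<in>I. \<eta> (\<xi> - of_int k))) UNIV"
    using assms by (intro has_sum_finite_neutralI) (auto intro: \<eta>_zero)
  then show ?thesis using \<eta>_sum has_sum_unique by blast
qed

definition bump :: "int \<Rightarrow> real \<Rightarrow> complex" where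
  "bump k \<xi> = of_real (\<eta> (\<xi> - of_int k))"

lemma bump_shift: "bump k \<xi> = bump 0 (1 * \<xi> + (- of_int k))"
  by (simp add: bump_def)

lemma bump_0_smooth: "smooth (bump 0)"
  using smooth_linear[OF \<eta>_smooth bounded_linear_of_real] by (simp add: bump_def[abs_def])

lemma bump_smooth: "smooth (bump k)"
  using smooth_affine[OF bump_0_smooth, of 1 "- of_int k"] unfolding bump_shift[of k, symmetric] .

lemma bump_zero: "1 \<le> \<bar>\<xi> - of_int k\<bar> \<Longrightarrow> bump k \<xi> = 0"
  by (simp add: bump_def \<eta>_zero)

lemma bump_zero_outside: "\<xi> \<notin> {of_int k - 1..of_int k + 1} \<Longrightarrow> bump k \<xi> = 0"
  by (rule bump_zero) auto

lemma bump_slowly_growing: "slowly_growing (bump k)"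
  by (rule slowly_growing_compact[OF bump_smooth bump_zero_outside])

lemma bump_schwartz: "bump k \<in> schwartz"
  by (rule schwartz_compact[OF bump_smooth bump_zero_outside])

lemma vderiv_power_bump: "(vderiv ^^ n) (bump k) \<xi> = (vderiv ^^ n) (bump 0) (\<xi> - of_int k)"
  using vderiv_power_affine[OF bump_0_smooth, of n 1 "- of_int k"] unfolding bump_shift[of k, symmetric] by simp

lemma freq_box_eq: "freq_box \<eta> k F \<phi> = F (fourier (\<lambda>\<xi>. bump k \<xi> * inv_fourier \<phi> \<xi>))"
  by (simp add: freq_box_def inv_fourier_dist_def mult_dist_def fourier_dist_def bump_def)

text \<open>The remainder \<open>1 - \<Sum>\<^bsub>|k| \<le> N\<^esub> bump k\<close> has derivatives bounded uniformly in \<open>N\<close>, since at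
  most three boxes meet at every point, and it vanishes on \<open>(1 - N, N - 1)\<close>.\<close>

definition remainder :: "nat \<Rightarrow> real \<Rightarrow> complex" where
  "remainder N \<xi> = 1 + (\<Sum>k\<in>{- int N..int N}. (- 1) * bump k \<xi>)"

lemma remainder_slowly_growing: "slowly_growing (remainder N)"
  and remainder_smooth: "smooth (remainder N)"
  and remainder_bounded: "\<exists>C. \<forall>N \<xi>. norm ((vderiv ^^ n) (remainder N) \<xi>) \<le> C"
  and remainder_zero: "\<bar>\<xi>\<bar> < real N - 1 \<Longrightarrow> (vderiv ^^ n) (remainder N) \<xi> = 0"
proof -
  have c: "smooth (\<lambda>x. c)" for c :: complex using slowly_growing_const[of c] by (simp add: slowly_growing_def)
  have mb: "smooth (\<lambda>\<xi>. (- 1) * bump k \<xi>)" for k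
    using smooth_linear[OF bump_smooth[of k] bounded_linear_mult_right[of "-1"]] .
  have s2: "smooth (\<lambda>\<xi>. \<Sum>k\<in>{- int N..int N}. (- 1) * bump k \<xi>)" for N
    by (intro smooth_sum mb) auto
  show s: "smooth (remainder N)" for N
    unfolding remainder_def[abs_def] by (rule smooth_add[OF c s2])
  have bnd: "\<exists>C. \<forall>N \<xi>. norm ((vderiv ^^ n) (remainder N) \<xi>) \<le> C" for n
  proof -
    obtain M where M: "\<And>\<xi>. norm ((vderiv ^^ n) (bump 0) \<xi>) \<le> M"
      using bounded_vderiv_power[OF bump_0_smooth bump_zero_outside] by blast
    have Mk: "norm ((vderiv ^^ n) (bump k) \<xi>) \<le> M" for k \<xi>
      by (subst vderiv_power_bump) (rule M)
    obtain D where D: "\<And>\<xi>. norm ((vderiv ^^ n) (\<lambda>x. 1 :: complex) \<xi>) \<le> D"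
    proof -
      have "(vderiv ^^ n) (\<lambda>x. 1 :: complex) \<xi> = (if n = 0 then 1 else 0)" for \<xi>
      proof (cases n)
        case (Suc m)
        have v: "vderiv (\<lambda>x. 1 :: complex) = (\<lambda>x. 0)" by (auto simp: vderiv_def[abs_def])
        have "(vderiv ^^ n) (\<lambda>x. 1 :: complex) \<xi> = (vderiv ^^ m) (\<lambda>x. 0 :: complex) \<xi>"
          unfolding Suc funpow_Suc_right by (simp add: v)
        then show ?thesis using vderiv_power_zero_on_open[OF open_UNIV, of "\<lambda>x. 0 :: complex" \<xi> m] Suc by simp
      qed simp
      then show thesis by (intro that[of 1]) simp
    qed
    have "norm ((vderiv ^^ n) (remainder N) \<xi>) \<le> D + 3 * M" for N \<xi>
    proof -
      \<comment> \<open>The integers within distance 1 of the point: at most three, whatever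
        \<open>N\<close> is. This makes the bound uniform in \<open>N\<close>.\<close>
      let ?J = "{- int N..int N} \<inter> {\<lceil>\<xi> - 1\<rceil>..\<lfloor>\<xi> + 1\<rfloor>}"
      have "(vderiv ^^ n) (remainder N) \<xi> = (vderiv ^^ n) (\<lambda>x. 1) \<xi> + (\<Sum>k\<in>{- int N..int N}. (- 1) * (vderiv ^^ n) (bump k) \<xi>)"
        unfolding remainder_def[abs_def] vderiv_power_add[OF c s2]
        by (subst vderiv_power_sum[OF mb]) (simp_all add: vderiv_power_linear[OF bump_smooth bounded_linear_mult_right[of "-1"], simplified])
      also have "(\<Sum>k\<in>{- int N..int N}. (- 1) * (vderiv ^^ n) (bump k) \<xi>) = (\<Sum>k\<in>?J. (- 1) * (vderiv ^^ n) (bump k) \<xi>)"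
      proof (rule sum.mono_neutral_right)
        show "\<forall>k\<in>{- int N..int N} - ?J. (- 1) * (vderiv ^^ n) (bump k) \<xi> = 0"
        proof
          fix k assume "k \<in> {- int N..int N} - ?J"
          then have "k < \<lceil>\<xi> - 1\<rceil> \<or> \<lfloor>\<xi> + 1\<rfloor> < k" by fastforce
          then have "of_int k < \<xi> - 1 \<or> \<xi> + 1 < of_int k" by linarith
          then have "\<xi> \<notin> {of_int k - 1..of_int k + 1}" by auto
          from vderiv_power_zero_outside[OF bump_zero_outside this, where n = n]
          show "(- 1) * (vderiv ^^ n) (bump k) \<xi> = 0" by simp
        qed
      qed auto
      finally have "norm ((vderiv ^^ n) (remainder N) \<xi>) \<le> D + (\<Sum>k\<in>?J. norm ((- 1) * (vderiv ^^ n) (bump k) \<xi>))"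
        by (simp only:) (intro order_trans[OF norm_triangle_ineq] add_mono D norm_sum)
      also have "(\<Sum>k\<in>?J. norm ((- 1) * (vderiv ^^ n) (bump k) \<xi>)) \<le> (\<Sum>k\<in>?J. M)"
        by (intro sum_mono) (simp add: norm_mult Mk)
      also have "\<dots> = real (card ?J) * M" by simp
      also have "\<dots> \<le> 3 * M"
      proof (rule mult_right_mono)
        have "card ?J \<le> card {\<lceil>\<xi> - 1\<rceil>..\<lfloor>\<xi> + 1\<rfloor>}" by (intro card_mono) auto
        also have "\<dots> \<le> 3"
        proof -
          have "\<lfloor>\<xi> + 1\<rfloor> - \<lceil>\<xi> - 1\<rceil> \<le> 2" by linarith
          then show ?thesis unfolding card_atLeastAtMost_int by linarith
        qed
        finally show "real (card ?J) \<le> 3" by simp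
        show "0 \<le> M" using order_trans[OF norm_ge_zero M] .
      qed
      finally show ?thesis by simp
    qed
    then show ?thesis by blast
  qed
  then show "\<exists>C. \<forall>N \<xi>. norm ((vderiv ^^ n) (remainder N) \<xi>) \<le> C" .
  show "slowly_growing (remainder N)" using bnd by (intro slowly_growing_boundedI s) blast
  show "(vderiv ^^ n) (remainder N) \<xi> = 0" if "\<bar>\<xi>\<bar> < real N - 1"
  proof (rule vderiv_power_zero_on_open)
    show "\<xi> \<in> {1 - real N<..<real N - 1}" using that by auto
    fix x assume x: "x \<in> {1 - real N<..<real N - 1}"
    have "(\<Sum>k\<in>{- int N..int N}. \<eta> (x - of_int k)) = 1"
    proof (rule \<eta>_finite_sum)
      fix k :: int assume "k \<notin> {- int N..int N}"
      then have "k \<ge> int N + 1 \<or> k \<le> - int N - 1" by auto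
      then have "real_of_int k \<ge> real N + 1 \<or> real_of_int k \<le> - real N - 1" by linarith
      then show "1 \<le> \<bar>x - of_int k\<bar>" using x by auto
    qed simp
    then have "complex_of_real (\<Sum>k\<in>{- int N..int N}. \<eta> (x - of_int k)) = 1" by simp
    then show "remainder N x = 0" by (simp add: remainder_def bump_def sum_negf)
  qed simp
qed

text \<open>By Leibniz the derivatives are dominated, uniformly in \<open>N\<close>, by derivatives
  of \<open>w\<close>, and at each frequency they vanish once \<open>N\<close> is large; dominated
  convergence concludes.\<close>

lemma integral_remainder_tendsto_0:
  assumes w: "w \<in> schwartz"
  shows "(\<lambda>N. LINT \<xi>|lborel. norm ((vderiv ^^ m) (\<lambda>\<xi>. remainder N \<xi> * w \<xi>) \<xi>)) \<longlonglongrightarrow> 0"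
proof -
  obtain C where C: "\<And>i N \<xi>. norm ((vderiv ^^ i) (remainder N) \<xi>) \<le> C i"
    using remainder_bounded by metis
  have S: "(\<lambda>\<xi>. remainder N \<xi> * w \<xi>) \<in> schwartz" for N
    by (rule schwartz_mult[OF remainder_slowly_growing w])
  have "(\<lambda>N. LINT \<xi>|lborel. norm ((vderiv ^^ m) (\<lambda>\<xi>. remainder N \<xi> * w \<xi>) \<xi>)) \<longlonglongrightarrow> (LINT \<xi>|(lborel :: real measure). 0)"
  proof (rule integral_dominated_convergence[where w = "\<lambda>\<xi>. \<Sum>i\<le>m. real (m choose i) * (C i * norm ((vderiv ^^ (m - i)) w \<xi>))"])
    show "integrable lborel (\<lambda>\<xi>. \<Sum>i\<le>m. real (m choose i) * (C i * norm ((vderiv ^^ (m - i)) w \<xi>)))"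
      by (intro Bochner_Integration.integrable_sum integrable_mult_right integrable_norm schwartz_integrable schwartz_vderiv_power w)
    show "(\<lambda>\<xi>. norm ((vderiv ^^ m) (\<lambda>\<xi>. remainder N \<xi> * w \<xi>) \<xi>)) \<in> borel_measurable lborel" for N
      using schwartz_measurable[OF schwartz_vderiv_power[OF S]] by simp
    show "AE \<xi> in lborel. (\<lambda>N. norm ((vderiv ^^ m) (\<lambda>\<xi>. remainder N \<xi> * w \<xi>) \<xi>)) \<longlonglongrightarrow> 0"
    proof (intro AE_I2 tendsto_eventually)
      fix \<xi>
      obtain N0 where N0: "\<bar>\<xi>\<bar> + 1 < real N0" using reals_Archimedean2 by blast
      show "\<forall>\<^sub>F N in sequentially. norm ((vderiv ^^ m) (\<lambda>\<xi>. remainder N \<xi> * w \<xi>) \<xi>) = 0"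
        using eventually_ge_at_top[of N0]
      proof eventually_elim
        case (elim N)
        then have "\<bar>\<xi>\<bar> < real N - 1" using N0 by linarith
        then show ?case
          by (simp add: vderiv_power_prod[OF bounded_bilinear_mult remainder_smooth schwartz_smooth[OF w]] remainder_zero)
      qed
    qed
    show "AE \<xi> in lborel. norm (norm ((vderiv ^^ m) (\<lambda>\<xi>. remainder N \<xi> * w \<xi>) \<xi>)) \<le>
        (\<Sum>i\<le>m. real (m choose i) * (C i * norm ((vderiv ^^ (m - i)) w \<xi>)))" for N
    proof (intro AE_I2)
      fix \<xi>
      have "norm ((vderiv ^^ m) (\<lambda>\<xi>. remainder N \<xi> * w \<xi>) \<xi>) \<le>
        (\<Sum>i\<le>m. real (m choose i) * (C i * norm ((vderiv ^^ (m - i)) w \<xi>)))"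
        unfolding vderiv_power_prod[OF bounded_bilinear_mult remainder_smooth schwartz_smooth[OF w]]
        by (rule sum_norm_le) (auto simp: norm_mult intro!: mult_left_mono mult_right_mono C)
      then show "norm (norm ((vderiv ^^ m) (\<lambda>\<xi>. remainder N \<xi> * w \<xi>) \<xi>)) \<le>
        (\<Sum>i\<le>m. real (m choose i) * (C i * norm ((vderiv ^^ (m - i)) w \<xi>)))" by simp
    qed
  qed simp
  then show ?thesis by simp
qed

end

section \<open>Convergence of the frequency decomposition of a tempered distribution\<close>

lemma schwartz_seminorm_nonneg:
  assumes "\<psi> \<in> schwartz"
  shows "0 \<le> schwartz_seminorm m n \<psi>"
proof -
  have "bdd_above (range (\<lambda>x. norm (x ^ m *\<^sub>R (vderiv ^^ n) \<psi> x)))"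
    using assms by (auto simp: schwartz_def bounded_iff bdd_above_def simp del: norm_scaleR)
  from cSUP_upper2[OF this UNIV_I, of 0 0] show ?thesis
    unfolding schwartz_seminorm_def by simp
qed

lemma
  assumes "tempered F"
  shows tempered_add: "\<phi> \<in> schwartz \<Longrightarrow> \<psi> \<in> schwartz \<Longrightarrow> F (\<lambda>x. \<phi> x + \<psi> x) = F \<phi> + F \<psi>"
    and tempered_cmult: "\<phi> \<in> schwartz \<Longrightarrow> F (\<lambda>x. c * \<phi> x) = c * F \<phi>"
  using assms by (auto simp: tempered_def)

lemma tempered_diff:
  assumes "tempered F" "\<phi> \<in> schwartz" "\<psi> \<in> schwartz"
  shows "F (\<lambda>x. \<phi> x - \<psi> x) = F \<phi> - F \<psi>"
  using tempered_add[OF assms(1,2) schwartz_cmult[OF assms(3), of "-1"]] tempered_cmult[OF assms(1,3), of "-1"] by simp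

lemma tempered_sum:
  assumes F: "tempered F" and "finite I" "\<And>i. i \<in> I \<Longrightarrow> \<phi> i \<in> schwartz"
  shows "F (\<lambda>x. \<Sum>i\<in>I. \<phi> i x) = (\<Sum>i\<in>I. F (\<phi> i))"
  using assms(2,3)
proof (induction I rule: finite_induct)
  case empty
  then show ?case using tempered_cmult[OF F schwartz_zero, of 0] by simp
next
  case (insert i I)
  then show ?case by (simp add: tempered_add[OF F] schwartz_sum)
qed

context partition
begin

text \<open>The error of a partial sum is \<open>F\<close> applied to the transform of
  \<open>remainder N\<close> times the inverse transform of \<open>\<phi>\<close>. Temperedness
  bounds it by finitely many seminorms of a transform, hence by L^1 norms of derivatives of
  moments.\<close>

lemma freq_box_sums:
  assumes F: "tempered F" and \<phi>: "\<phi> \<in> schwartz"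
  shows "(\<lambda>N. \<Sum>k\<in>{- int N..int N}. freq_box \<eta> k F \<phi>) \<longlonglongrightarrow> F \<phi>"
proof -
  define g where "g = inv_fourier \<phi>"
  have g: "g \<in> schwartz" unfolding g_def by (rule inv_fourier_schwartz[OF \<phi>])
  have bg: "(\<lambda>\<xi>. bump k \<xi> * g \<xi>) \<in> schwartz" for k by (rule schwartz_mult[OF bump_slowly_growing g])
  define h where "h N = (\<lambda>\<xi>. remainder N \<xi> * g \<xi>)" for N
  have h: "h N \<in> schwartz" for N unfolding h_def by (rule schwartz_mult[OF remainder_slowly_growing g])
  have diff: "F \<phi> - (\<Sum>k\<in>{- int N..int N}. freq_box \<eta> k F \<phi>) = F (fourier (h N))" for N
  proof -
    have eq: "fourier (h N) = (\<lambda>x. \<phi> x - (\<Sum>k\<in>{- int N..int N}. fourier (\<lambda>\<xi>. bump k \<xi> * g \<xi>) x))"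
    proof
      fix x
      have "h N = (\<lambda>\<xi>. g \<xi> + (-1) * (\<Sum>k\<in>{- int N..int N}. bump k \<xi> * g \<xi>))"
        by (simp add: h_def remainder_def algebra_simps sum_distrib_left sum_negf)
      then have "fourier (h N) x = fourier g x + (-1) * (\<Sum>k\<in>{- int N..int N}. fourier (\<lambda>\<xi>. bump k \<xi> * g \<xi>) x)"
        by (simp only: fourier_add[OF g schwartz_cmult[OF schwartz_sum[OF bg]]] fourier_cmult
            fourier_sum[OF finite_atLeastAtMost_int bg])
      then show "fourier (h N) x = \<phi> x - (\<Sum>k\<in>{- int N..int N}. fourier (\<lambda>\<xi>. bump k \<xi> * g \<xi>) x)"
        by (simp add: g_def fourier_inv_fourier[OF \<phi>])
    qed
    show ?thesis
      unfolding eq freq_box_eq g_def[symmetric]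
      by (subst tempered_diff[OF F \<phi> schwartz_sum[OF fourier_schwartz[OF bg]]])
         (simp add: tempered_sum[OF F _ fourier_schwartz[OF bg]])
  qed
  obtain M C where MC: "\<And>\<phi>. \<phi> \<in> schwartz \<Longrightarrow> norm (F \<phi>) \<le> C * (\<Sum>m\<le>M. \<Sum>n\<le>M. schwartz_seminorm m n \<phi>)"
    using F unfolding tempered_def by blast
  have "(\<lambda>N. F (fourier (h N))) \<longlonglongrightarrow> 0"
  proof (rule Lim_null_comparison)
    \<comment> \<open>Taking moments is multiplication, so it commutes with the remainder factor and
      each L^1 norm has the form treated before.\<close>
    have mom: "moment n (h N) = (\<lambda>\<xi>. remainder N \<xi> * moment n g \<xi>)" for n N
      by (auto simp: moment_def h_def)
    have "(\<lambda>N. \<bar>C\<bar> * (\<Sum>m\<le>M. \<Sum>n\<le>M. LINT x|lborel. norm ((vderiv ^^ m) (moment n (h N)) x))) \<longlonglongrightarrow> \<bar>C\<bar> * (\<Sum>m\<le>M. \<Sum>n\<le>M. 0)"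
      unfolding mom by (intro tendsto_mult tendsto_const tendsto_sum integral_remainder_tendsto_0 moment_schwartz g)
    then show "(\<lambda>N. \<bar>C\<bar> * (\<Sum>m\<le>M. \<Sum>n\<le>M. LINT x|lborel. norm ((vderiv ^^ m) (moment n (h N)) x))) \<longlonglongrightarrow> 0" by simp
    show "\<forall>\<^sub>F N in sequentially. norm (F (fourier (h N))) \<le> \<bar>C\<bar> * (\<Sum>m\<le>M. \<Sum>n\<le>M. LINT x|lborel. norm ((vderiv ^^ m) (moment n (h N)) x))"
    proof (intro always_eventually allI)
      fix N
      have "norm (F (fourier (h N))) \<le> C * (\<Sum>m\<le>M. \<Sum>n\<le>M. schwartz_seminorm m n (fourier (h N)))"
        by (rule MC[OF fourier_schwartz[OF h]])
      also have "\<dots> \<le> \<bar>C\<bar> * (\<Sum>m\<le>M. \<Sum>n\<le>M. schwartz_seminorm m n (fourier (h N)))"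
        by (intro mult_right_mono sum_nonneg schwartz_seminorm_nonneg fourier_schwartz h) auto
      also have "\<dots> \<le> \<bar>C\<bar> * (\<Sum>m\<le>M. \<Sum>n\<le>M. LINT x|lborel. norm ((vderiv ^^ m) (moment n (h N)) x))"
        by (intro mult_left_mono sum_mono schwartz_seminorm_fourier_le h) auto
      finally show "norm (F (fourier (h N))) \<le> \<bar>C\<bar> * (\<Sum>m\<le>M. \<Sum>n\<le>M. LINT x|lborel. norm ((vderiv ^^ m) (moment n (h N)) x))" .
    qed
  qed
  from tendsto_diff[OF tendsto_const[of "F \<phi>"] this] show ?thesis
    unfolding diff[symmetric] by simp
qed

text \<open>The infimum defining \<open>linf_norm\<close> need not be attained a priori, so the
  bound is proved with an excess \<open>e\<close> and the excess is then removed.\<close>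

lemma norm_freq_box_le:
  assumes fin: "linf_norm (freq_box \<eta> k F) < \<infinity>" and \<phi>: "\<phi> \<in> schwartz"
  shows "norm (freq_box \<eta> k F \<phi>) \<le> enn2real (linf_norm (freq_box \<eta> k F)) * (LINT x|lborel. norm (\<phi> x))"
proof -
  define b where "b = enn2real (linf_norm (freq_box \<eta> k F))"
  have b: "linf_norm (freq_box \<eta> k F) = ennreal b" "0 \<le> b" using fin by (auto simp: b_def)
  define L where "L = (LINT x|lborel. norm (\<phi> x))"
  have L: "0 \<le> L" by (simp add: L_def)
  have le: "norm (freq_box \<eta> k F \<phi>) \<le> (b + e) * L" if e: "e > 0" for e
  proof -
    have "linf_norm (freq_box \<eta> k F) < ennreal (b + e)" using b e by (simp add: ennreal_less_iff)
    then obtain C g where C: "0 \<le> C" "ennreal C < ennreal (b + e)" and g: "g \<in> borel_measurable lborel"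
      "represents g (freq_box \<eta> k F)" "AE x in lborel. norm (g x) \<le> C"
      unfolding linf_norm_def Inf_less_iff by blast
    have Ce: "C \<le> b + e" using C by (simp add: ennreal_less_iff)
    have i: "integrable lborel (\<lambda>x. g x * \<phi> x)" and F: "freq_box \<eta> k F \<phi> = (LINT x|lborel. g x * \<phi> x)"
      using g(2) \<phi> by (auto simp: represents_def fun_dist_def)
    have "norm (LINT x|lborel. g x * \<phi> x) \<le> (LINT x|lborel. norm (g x * \<phi> x))" by (rule integral_norm_bound)
    also have "\<dots> \<le> (LINT x|lborel. C * norm (\<phi> x))"
    proof (rule integral_mono_AE)
      show "AE x in lborel. norm (g x * \<phi> x) \<le> C * norm (\<phi> x)"
        using g(3) by eventually_elim (simp add: norm_mult mult_right_mono)
    qed (auto intro!: integrable_norm i integrable_mult_right schwartz_integrable[OF \<phi>])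
    also have "\<dots> = C * L" by (simp add: L_def)
    also have "\<dots> \<le> (b + e) * L" using Ce L by (rule mult_right_mono)
    finally show ?thesis by (simp add: F)
  qed
  have "norm (freq_box \<eta> k F \<phi>) \<le> b * L + d" if d: "d > 0" for d
  proof -
    \<comment> \<open>Dividing by \<open>L + 1\<close> instead of \<open>L\<close> covers a test
      function with vanishing L^1 norm.\<close>
    have "norm (freq_box \<eta> k F \<phi>) \<le> (b + d / (L + 1)) * L" using L d by (intro le) auto
    also have "\<dots> \<le> b * L + d" using L d by (simp add: field_simps)
    finally show ?thesis .
  qed
  then have "norm (freq_box \<eta> k F \<phi>) \<le> b * L" by (rule field_le_epsilon)
  then show ?thesis by (simp add: b_def L_def)
qed

end

section \<open>Bernstein's inequality for differences\<close>

definition dshift :: "real \<Rightarrow> (real \<Rightarrow> complex) \<Rightarrow> real \<Rightarrow> complex" where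
  "dshift h f x = f (x + h) - f x"

abbreviation dshifts :: "real list \<Rightarrow> (real \<Rightarrow> complex) \<Rightarrow> real \<Rightarrow> complex" where
  "dshifts hs f \<equiv> fold dshift hs f"

lemma dshift_schwartz: "\<phi> \<in> schwartz \<Longrightarrow> dshift h \<phi> \<in> schwartz"
  using schwartz_diff[OF schwartz_affine[of \<phi> 1 h]] by (simp add: dshift_def[abs_def])

lemma dshifts_schwartz: "\<phi> \<in> schwartz \<Longrightarrow> dshifts hs \<phi> \<in> schwartz"
  by (induction hs arbitrary: \<phi>) (auto intro: dshift_schwartz)

lemma dshift_commute: "dshift h (dshift k f) = dshift k (dshift h f)"
  by (auto simp: dshift_def fun_eq_iff algebra_simps)

lemma dshifts_dshift: "dshifts hs (dshift h f) = dshift h (dshifts hs f)"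
proof (induction hs arbitrary: f)
  case (Cons a hs)
  then show ?case by (simp only: fold.simps o_apply dshift_commute[of a h])
qed simp

lemma
  assumes "smooth f"
  shows smooth_dshift: "smooth (dshift h f)"
    and vderiv_power_dshift: "(vderiv ^^ n) (dshift h f) = dshift h ((vderiv ^^ n) f)"
proof -
  have s: "smooth (\<lambda>x. f (x + h))" and v: "(vderiv ^^ n) (\<lambda>x. f (x + h)) = (\<lambda>x. (vderiv ^^ n) f (x + h))" for n
    using smooth_affine[OF assms, of 1 h] vderiv_power_affine[OF assms, of n 1 h] by simp_all
  have s': "smooth (\<lambda>x. (- 1) * f x)" and v': "(vderiv ^^ n) (\<lambda>x. (- 1) * f x) = (\<lambda>x. (- 1) * (vderiv ^^ n) f x)" for n
    using smooth_linear[OF assms bounded_linear_mult_right] vderiv_power_linear[OF assms bounded_linear_mult_right] by blast+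
  have e: "dshift h f = (\<lambda>x. f (x + h) + (- 1) * f x)" for f by (auto simp: dshift_def)
  show "smooth (dshift h f)" unfolding e by (rule smooth_add[OF s s'])
  show "(vderiv ^^ n) (dshift h f) = dshift h ((vderiv ^^ n) f)"
    unfolding e vderiv_power_add[OF s s'] v v' ..
qed

text \<open>The mean value inequality, once for each step: every difference costs one derivative and
  a factor |h|, and the evaluation points move at most the total length of the steps.\<close>

lemma norm_dshifts_le:
  assumes "smooth f" "\<And>u. \<bar>u - s\<bar> \<le> sum_list (map abs hs) \<Longrightarrow> norm ((vderiv ^^ length hs) f u) \<le> B"
  shows "norm (dshifts hs f s) \<le> prod_list (map abs hs) * B"
  using assms
proof (induction hs arbitrary: f B)
  case (Cons h hs)
  have "norm ((vderiv ^^ length hs) (dshift h f) u) \<le> \<bar>h\<bar> * B" if u: "\<bar>u - s\<bar> \<le> sum_list (map abs hs)" for u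
  proof -
    let ?g = "(vderiv ^^ length hs) f"
    have "norm (?g (u + h) - ?g u) \<le> B * norm (u + h - u)"
    proof (rule differentiable_bound[where S = "closed_segment u (u + h)" and f' = "\<lambda>w d. d *\<^sub>R (vderiv ^^ Suc (length hs)) f w"])
      fix w assume w: "w \<in> closed_segment u (u + h)"
      show "(?g has_derivative (\<lambda>d. d *\<^sub>R (vderiv ^^ Suc (length hs)) f w)) (at w within closed_segment u (u + h))"
        using smooth_has_vector_derivative[OF Cons.prems(1), of "length hs" w]
        by (simp add: has_vector_derivative_def has_derivative_at_withinI)
      have "\<bar>w - u\<bar> \<le> \<bar>h\<bar>" using w by (auto simp: closed_segment_eq_real_ivl split: if_splits)
      then have "\<bar>w - s\<bar> \<le> sum_list (map abs (h # hs))" using u by simp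
      from Cons.prems(2)[OF this] have "norm ((vderiv ^^ Suc (length hs)) f w) \<le> B" by simp
      moreover have "onorm (\<lambda>d. d *\<^sub>R (vderiv ^^ Suc (length hs)) f w) = norm ((vderiv ^^ Suc (length hs)) f w)"
        using onorm_scaleR_left[OF bounded_linear_ident, of "(vderiv ^^ Suc (length hs)) f w"] by (simp add: onorm_id)
      ultimately show "onorm (\<lambda>d. d *\<^sub>R (vderiv ^^ Suc (length hs)) f w) \<le> B" by simp
    qed auto
    then show ?thesis by (simp add: vderiv_power_dshift[OF Cons.prems(1)] dshift_def mult.commute)
  qed
  from Cons.IH[OF smooth_dshift[OF Cons.prems(1)] this] show ?case by (simp add: mult_ac)
qed simp

text \<open>Translating the integration variable moves each difference from one factor to the other.
  The kernel is evaluated at y - x, so the step keeps its sign.\<close>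

lemma convolution_dshifts:
  assumes "\<phi> \<in> schwartz" "K \<in> schwartz"
  shows "(LINT x|lborel. dshifts hs \<phi> x * K (y - x)) = (LINT x|lborel. \<phi> x * dshifts hs K (y - x))"
  using assms
proof (induction hs arbitrary: \<phi>)
  case (Cons h hs)
  let ?L = "dshifts hs K"
  have L: "?L \<in> schwartz" by (rule dshifts_schwartz[OF Cons.prems(2)])
  have int: "integrable lborel (\<lambda>x. \<psi> x * ?L (c - x))" if \<psi>: "\<psi> \<in> schwartz" for \<psi> c
  proof -
    obtain C where C: "\<And>x. norm (?L x) \<le> C * inverse (1 + x\<^sup>2)" "0 \<le> C" using schwartz_decay[OF L] by blast
    have C': "norm (?L x) \<le> C" for x
    proof -
      have "inverse (1 + x\<^sup>2) \<le> 1" by (simp add: inverse_le_1_iff)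
      then have "C * inverse (1 + x\<^sup>2) \<le> C * 1" using C(2) by (intro mult_left_mono)
      then show ?thesis using C(1)[of x] by simp
    qed
    show ?thesis
    proof (rule Bochner_Integration.integrable_bound)
      show "integrable lborel (\<lambda>x. of_real C * \<psi> x)" by (intro integrable_mult_right schwartz_integrable \<psi>)
      show "(\<lambda>x. \<psi> x * ?L (c - x)) \<in> borel_measurable lborel"
        using schwartz_measurable[OF \<psi>] schwartz_measurable[OF L] by measurable
      show "AE x in lborel. norm (\<psi> x * ?L (c - x)) \<le> norm (of_real C * \<psi> x)"
        unfolding norm_mult norm_of_real mult.commute[of "\<bar>C\<bar>"]
        by (intro AE_I2 mult_left_mono order_trans[OF C' abs_ge_self]) auto
    qed
  qed
  have \<phi>': "(\<lambda>x. \<phi> (x + h)) \<in> schwartz" using schwartz_affine[OF Cons.prems(1), of 1 h] by simp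
  have shift: "(LINT x|lborel. \<phi> (x + h) * ?L (y - x)) = (LINT x|lborel. \<phi> x * ?L (y + h - x))"
  proof -
    have "(LINT x|lborel. \<phi> x * ?L (y + h - x)) = \<bar>1\<bar> *\<^sub>R (LINT x|lborel. \<phi> (h + 1 * x) * ?L (y + h - (h + 1 * x)))"
      by (rule lborel_integral_real_affine) simp
    then show ?thesis by (simp add: add.commute)
  qed
  have "(LINT x|lborel. dshifts (h # hs) \<phi> x * K (y - x)) = (LINT x|lborel. dshift h \<phi> x * ?L (y - x))"
    using Cons.IH[OF dshift_schwartz[OF Cons.prems(1)] Cons.prems(2)] by simp
  also have "\<dots> = (LINT x|lborel. \<phi> (x + h) * ?L (y - x)) - (LINT x|lborel. \<phi> x * ?L (y - x))"
    unfolding dshift_def[of h \<phi>] left_diff_distrib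
    by (rule Bochner_Integration.integral_diff[OF int[OF \<phi>'] int[OF Cons.prems(1)]])
  also have "\<dots> = (LINT x|lborel. \<phi> x * ?L (y + h - x)) - (LINT x|lborel. \<phi> x * ?L (y - x))"
    unfolding shift ..
  also have "\<dots> = (LINT x|lborel. \<phi> x * ?L (y + h - x) - \<phi> x * ?L (y - x))"
    by (rule Bochner_Integration.integral_diff[symmetric, OF int[OF Cons.prems(1)] int[OF Cons.prems(1)]])
  also have "\<dots> = (LINT x|lborel. \<phi> x * dshifts (h # hs) K (y - x))"
    by (intro Bochner_Integration.integral_cong refl) (simp add: dshifts_dshift dshift_def algebra_simps)
  finally show ?case .
qed simp

text \<open>Young's inequality in L^1, by Tonelli's argument with the explicit integrable majorant
  of the kernel.\<close>

lemma L1_norm_convolution_le: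
  fixes \<phi> K \<theta> :: "real \<Rightarrow> complex"
  assumes \<phi>: "integrable lborel \<phi>" and [measurable]: "K \<in> borel_measurable borel"
    and K: "\<And>s. norm (K s) \<le> c * inverse (1 + s\<^sup>2)"
    and \<theta>: "integrable lborel \<theta>" "\<And>y. \<theta> y = (LINT x|lborel. \<phi> x * K (y - x))"
  shows "(LINT y|lborel. norm (\<theta> y)) \<le> c * (LINT s|lborel. inverse (1 + s\<^sup>2)) * (LINT x|lborel. norm (\<phi> x))"
proof -
  define W where "W s = inverse (1 + s\<^sup>2)" for s :: real
  have W: "integrable lborel W" "\<And>s. 0 \<le> W s"
    using integrable_inverse_one_plus_square by (auto simp: W_def[abs_def])
  have [measurable]: "W \<in> borel_measurable borel" unfolding W_def[abs_def] by measurable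
  have [measurable]: "\<phi> \<in> borel_measurable borel" using \<phi> by (auto dest: borel_measurable_integrable)
  have shift: "integrable lborel (\<lambda>y. W (y - x))" "(LINT y|lborel. W (y - x)) = (LINT s|lborel. W s)" for x
    using lborel_integrable_real_affine[OF W(1), of 1 "- x"] lborel_integral_real_affine[of 1 W "- x"] by (simp_all add: add.commute)
  have shift': "integrable lborel (\<lambda>x. W (y - x))" for y
    using lborel_integrable_real_affine[OF W(1), of "-1" y] by simp
  have W1: "W s \<le> 1" for s by (simp add: W_def inverse_le_1_iff)
  have int: "integrable (lborel \<Otimes>\<^sub>M lborel) (\<lambda>(x, y). norm (\<phi> x) * (c * W (y - x)))"
  proof (rule lborel_pair.Fubini_integrable)
    show "(\<lambda>(x, y). norm (\<phi> x) * (c * W (y - x))) \<in> borel_measurable (lborel \<Otimes>\<^sub>M lborel)" by measurable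
    have "(LINT y|lborel. norm (norm (\<phi> x) * (c * W (y - x)))) = norm (\<phi> x) * (\<bar>c\<bar> * (LINT s|lborel. W s))" for x
      using W(2) by (simp add: abs_mult shift)
    then show "integrable lborel (\<lambda>x. LINT y|lborel. norm (case (x, y) of (x, y) \<Rightarrow> norm (\<phi> x) * (c * W (y - x))))"
      using \<phi> by simp
    show "AE x in lborel. integrable lborel (\<lambda>y. case (x, y) of (x, y) \<Rightarrow> norm (\<phi> x) * (c * W (y - x)))"
      using shift(1) by simp
  qed
  have "(LINT y|lborel. norm (\<theta> y)) \<le> (LINT y|lborel. LINT x|lborel. norm (\<phi> x) * (c * W (y - x)))"
  proof (rule integral_mono)
    show "integrable lborel (\<lambda>y. norm (\<theta> y))" by (intro integrable_norm \<theta>)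
    show "integrable lborel (\<lambda>y. LINT x|lborel. norm (\<phi> x) * (c * W (y - x)))"
      using lborel_pair.integrable_snd[OF int] by simp
    fix y
    have "norm (\<theta> y) \<le> (LINT x|lborel. norm (\<phi> x * K (y - x)))" unfolding \<theta>(2) by (rule integral_norm_bound)
    also have "\<dots> \<le> (LINT x|lborel. norm (\<phi> x) * (c * W (y - x)))"
    proof (rule integral_mono)
      have le: "norm (\<phi> x * K (y - x)) \<le> norm (\<phi> x) * (c * W (y - x))" for x
        unfolding norm_mult W_def by (intro mult_left_mono K) auto
      have c: "0 \<le> c" using order_trans[OF norm_ge_zero K[of 0]] by simp
      show i: "integrable lborel (\<lambda>x. norm (\<phi> x) * (c * W (y - x)))"
      proof (rule Bochner_Integration.integrable_bound)
        show "integrable lborel (\<lambda>x. c * norm (\<phi> x))" by (intro integrable_mult_right integrable_norm \<phi>)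
        show "AE x in lborel. norm (norm (\<phi> x) * (c * W (y - x))) \<le> norm (c * norm (\<phi> x))"
          using W W1 c by (intro AE_I2) (auto simp: abs_mult mult_ac intro!: mult_left_mono mult_left_le)
      qed measurable
      show "integrable lborel (\<lambda>x. norm (\<phi> x * K (y - x)))"
        by (rule Bochner_Integration.integrable_bound[OF i]) (use le in \<open>auto intro!: AE_I2 order_trans[OF le abs_ge_self]\<close>)
      show "norm (\<phi> x * K (y - x)) \<le> norm (\<phi> x) * (c * W (y - x))" for x by (rule le)
    qed
    finally show "norm (\<theta> y) \<le> (LINT x|lborel. norm (\<phi> x) * (c * W (y - x)))" .
  qed
  also have "\<dots> = (LINT x|lborel. LINT y|lborel. norm (\<phi> x) * (c * W (y - x)))"
    using lborel_pair.Fubini_integral[OF int] by simp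
  also have "\<dots> = c * (LINT s|lborel. W s) * (LINT x|lborel. norm (\<phi> x))"
    by (simp add: shift mult_ac)
  finally show ?thesis by (simp add: W_def)
qed

context partition
begin

text \<open>A fattened cut-off: the neighbouring bumps complete the partition of unity on the
  support of \<open>bump k\<close>, so this function equals 1 there.\<close>

definition wide :: "int \<Rightarrow> real \<Rightarrow> complex" where
  "wide k \<xi> = (\<Sum>j\<in>{k - 1..k + 1}. bump j \<xi>)"

lemma wide_schwartz: "wide k \<in> schwartz"
  unfolding wide_def[abs_def] by (intro schwartz_sum bump_schwartz)

lemma wide_shift: "wide k (\<xi> + of_int k) = wide 0 \<xi>"
proof -
  have "(\<Sum>j\<in>{k - 1..k + 1}. bump j (\<xi> + of_int k)) = (\<Sum>j\<in>{- 1..1}. bump j \<xi>)"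
    by (rule sum.reindex_bij_witness[of _ "\<lambda>j. j + k" "\<lambda>j. j - k"]) (auto simp: bump_def algebra_simps)
  then show ?thesis by (simp add: wide_def)
qed

lemma bump_mult_wide: "bump k \<xi> * wide k \<xi> = bump k \<xi>"
proof (cases "1 \<le> \<bar>\<xi> - of_int k\<bar>")
  case False
  have "(\<Sum>j\<in>{k - 1..k + 1}. \<eta> (\<xi> - of_int j)) = 1"
  proof (rule \<eta>_finite_sum)
    fix j assume "j \<notin> {k - 1..k + 1}"
    then have "j \<le> k - 2 \<or> j \<ge> k + 2" by auto
    then have "real_of_int j \<le> real_of_int k - 2 \<or> real_of_int j \<ge> real_of_int k + 2" by linarith
    then show "1 \<le> \<bar>\<xi> - of_int j\<bar>" using False by auto
  qed simp
  then have "complex_of_real (\<Sum>j\<in>{k - 1..k + 1}. \<eta> (\<xi> - of_int j)) = 1" by simp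
  then show ?thesis by (simp add: wide_def bump_def)
qed (simp add: bump_zero)

text \<open>Recentring the cut-off at frequency 0 turns the shift by \<open>k\<close> into a
  modulation of modulus 1. The moment factor (-i (k + \<xi>))^j expands binomially, and resumming
  the powers of |k| gives (1 + |k|)^j.\<close>

lemma norm_fourier_wide_le:
  "\<exists>M\<ge>0. \<forall>k u. norm ((vderiv ^^ j) (fourier (wide k)) u) \<le> M * (1 + \<bar>real_of_int k\<bar>) ^ j * inverse (1 + u\<^sup>2)"
proof -
  have m0: "fourier (moment i (wide 0)) \<in> schwartz" for i
    by (intro fourier_schwartz moment_schwartz wide_schwartz)
  have "\<exists>C. \<forall>u. norm (fourier (moment i (wide 0)) u) \<le> C * inverse (1 + u\<^sup>2)" for i
    using schwartz_decay[OF m0] by metis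
  then obtain C where C: "\<And>i u. norm (fourier (moment i (wide 0)) u) \<le> C i * inverse (1 + u\<^sup>2)" by metis
  define M where "M = (\<Sum>i\<le>j. \<bar>C i\<bar>)"
  have CM: "C i \<le> M" if "i \<le> j" for i
    unfolding M_def using that 
    using member_le_sum[of i "{..j}" "\<lambda>i. \<bar>C i\<bar>"] by (auto intro: order_trans[OF abs_ge_self])
  have "norm ((vderiv ^^ j) (fourier (wide k)) u) \<le> M * (1 + \<bar>real_of_int k\<bar>) ^ j * inverse (1 + u\<^sup>2)" for k u
  proof -
    let ?c = "\<lambda>i. of_nat (j choose i) * (- \<i> * of_int k) ^ (j - i)"
    have "(vderiv ^^ j) (fourier (wide k)) u = fourier (moment j (wide k)) u"
      by (simp add: vderiv_power_fourier[OF wide_schwartz])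
    also have "\<dots> = \<bar>1\<bar> *\<^sub>R (LINT \<xi>|lborel. exp (- \<i> * of_real ((of_int k + 1 * \<xi>) * u)) * moment j (wide k) (of_int k + 1 * \<xi>))"
      unfolding fourier_def by (rule lborel_integral_real_affine) simp
    also have "\<dots> = (LINT \<xi>|lborel. exp (- \<i> * of_real (of_int k * u)) * (exp (- \<i> * of_real (\<xi> * u)) * (\<Sum>i\<le>j. ?c i * moment i (wide 0) \<xi>)))"
    proof -
      have "moment j (wide k) (of_int k + \<xi>) = (\<Sum>i\<le>j. ?c i * moment i (wide 0) \<xi>)" for \<xi>
      proof -
        have "moment j (wide k) (of_int k + \<xi>) = (- \<i> * of_real \<xi> + - \<i> * of_int k) ^ j * wide 0 \<xi>"
          using wide_shift[of k \<xi>] by (simp add: moment_def algebra_simps)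
        also have "\<dots> = (\<Sum>i\<le>j. ?c i * moment i (wide 0) \<xi>)"
          unfolding binomial_ring sum_distrib_right
          by (intro sum.cong refl) (simp only: moment_def mult_ac)
        finally show ?thesis .
      qed
      moreover have "exp (- \<i> * of_real ((of_int k + 1 * \<xi>) * u)) = exp (- \<i> * of_real (of_int k * u)) * exp (- \<i> * of_real (\<xi> * u))" for \<xi>
        by (simp add: algebra_simps flip: exp_add)
      ultimately show ?thesis by (simp add: mult.assoc)
    qed
    also have "\<dots> = exp (- \<i> * of_real (of_int k * u)) * fourier (\<lambda>\<xi>. \<Sum>i\<le>j. ?c i * moment i (wide 0) \<xi>) u"
      unfolding fourier_def by (rule integral_mult_right_zero)
    also have "fourier (\<lambda>\<xi>. \<Sum>i\<le>j. ?c i * moment i (wide 0) \<xi>) u = (\<Sum>i\<le>j. ?c i * fourier (moment i (wide 0)) u)"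
      by (subst fourier_sum) (auto intro!: schwartz_cmult moment_schwartz wide_schwartz simp: fourier_cmult)
    finally have "norm ((vderiv ^^ j) (fourier (wide k)) u) = norm (\<Sum>i\<le>j. ?c i * fourier (moment i (wide 0)) u)"
      using norm_exp_i(2)[of "of_int k * u"] by (simp only: norm_mult mult_minus_left mult_1_left)
    also have "\<dots> \<le> (\<Sum>i\<le>j. real (j choose i) * \<bar>real_of_int k\<bar> ^ (j - i) * (M * inverse (1 + u\<^sup>2)))"
    proof (rule sum_norm_le)
      fix i assume i: "i \<in> {..j}"
      have "norm (fourier (moment i (wide 0)) u) \<le> M * inverse (1 + u\<^sup>2)"
        using CM[of i] i by (intro order_trans[OF C] mult_right_mono) auto
      then show "norm (?c i * fourier (moment i (wide 0)) u) \<le> real (j choose i) * \<bar>real_of_int k\<bar> ^ (j - i) * (M * inverse (1 + u\<^sup>2))"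
        by (auto simp: norm_mult norm_power intro!: mult_left_mono)
    qed
    also have "\<dots> = M * (1 + \<bar>real_of_int k\<bar>) ^ j * inverse (1 + u\<^sup>2)"
      unfolding binomial_ring by (simp add: sum_distrib_left sum_distrib_right mult_ac)
    finally show ?thesis .
  qed
  moreover have "0 \<le> M" by (auto simp: M_def intro: sum_nonneg)
  ultimately show ?thesis by blast
qed

text \<open>Inserting the fattened cut-off does not change the box but replaces the test function by
  a convolution with a smooth kernel. The differences pass to the kernel, where derivatives of order
  \<open>j\<close> cost (1 + |k|)^j; the constant is independent of the box.\<close>

lemma bernstein:
  fixes j :: nat
  obtains A where "0 \<le> A"
    "\<And>F k \<phi> hs. \<lbrakk>linf_norm (freq_box \<eta> k F) < \<infinity>; \<phi> \<in> schwartz; length hs = j; \<And>h. h \<in> set hs \<Longrightarrow> \<bar>h\<bar> \<le> 1\<rbrakk> \<Longrightarrow>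
       norm (freq_box \<eta> k F (dshifts hs \<phi>)) \<le>
         A * (1 + \<bar>real_of_int k\<bar>) ^ j * prod_list (map abs hs) *
         (enn2real (linf_norm (freq_box \<eta> k F)) * (LINT x|lborel. norm (\<phi> x)))"
proof -
  obtain M where M: "M \<ge> 0" "\<And>k u. norm ((vderiv ^^ j) (fourier (wide k)) u) \<le> M * (1 + \<bar>real_of_int k\<bar>) ^ j * inverse (1 + u\<^sup>2)"
    using norm_fourier_wide_le[of j] by blast
  define I where "I = (LINT s|lborel. inverse (1 + (s::real)\<^sup>2))"
  have I: "0 \<le> I" by (simp add: I_def)
  \<comment> \<open>Steps of length at most 1 move the evaluation point from \<open>s\<close> by at
    most \<open>j\<close>, and s^2 is at most 2 u^2 + 2 (u - s)^2. Hence 1 + s^2 is at most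
    \<open>L\<close> times 1 + u^2, which restores decay in \<open>s\<close>. In \<open>A\<close>
    the remaining factors are the kernel constant, the integral of the majorant and 1/(2 pi) from
    the convolution formula.\<close>
  define L where "L = 2 + 2 * (real j)\<^sup>2"
  define A where "A = M * L * I / (2 * pi)"
  have L: "0 \<le> L" by (simp add: L_def)
  have "norm (freq_box \<eta> k F (dshifts hs \<phi>)) \<le>
         A * (1 + \<bar>real_of_int k\<bar>) ^ j * prod_list (map abs hs) *
         (enn2real (linf_norm (freq_box \<eta> k F)) * (LINT x|lborel. norm (\<phi> x)))"
    if fin: "linf_norm (freq_box \<eta> k F) < \<infinity>" and \<phi>: "\<phi> \<in> schwartz" and hs: "length hs = j"
      and h1: "\<And>h. h \<in> set hs \<Longrightarrow> \<bar>h\<bar> \<le> 1" for F k \<phi> hs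
  proof -
    let ?\<psi> = "dshifts hs \<phi>"
    define \<rho> where "\<rho> = prod_list (map abs hs)"
    have \<rho>: "0 \<le> \<rho>" unfolding \<rho>_def by (induction hs) auto
    define K where "K = fourier (wide k)"
    have K: "K \<in> schwartz" unfolding K_def by (intro fourier_schwartz wide_schwartz)
    have \<psi>: "?\<psi> \<in> schwartz" by (rule dshifts_schwartz[OF \<phi>])
    have w\<psi>: "(\<lambda>\<xi>. wide k \<xi> * inv_fourier ?\<psi> \<xi>) \<in> schwartz"
    proof -
      have "slowly_growing (wide k)"
      proof (rule slowly_growing_compact[OF schwartz_smooth[OF wide_schwartz]])
        fix \<xi> assume "\<xi> \<notin> {of_int k - 2..of_int k + 2 :: real}"
        then have "bump i \<xi> = 0" if "i \<in> {k - 1..k + 1}" for i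
        proof -
          have "real_of_int k - 1 \<le> of_int i" "of_int i \<le> real_of_int k + 1" using that by auto
          with \<open>\<xi> \<notin> _\<close> show ?thesis by (intro bump_zero) auto
        qed
        then show "wide k \<xi> = 0" by (simp add: wide_def)
      qed
      then show ?thesis by (rule schwartz_mult) (rule inv_fourier_schwartz[OF \<psi>])
    qed
    define \<theta> where "\<theta> = fourier (\<lambda>\<xi>. wide k \<xi> * inv_fourier ?\<psi> \<xi>)"
    have \<theta>: "\<theta> \<in> schwartz" unfolding \<theta>_def by (rule fourier_schwartz[OF w\<psi>])
    \<comment> \<open>On the support of \<open>bump k\<close> the fattened cut-off is 1, so the box
      cannot distinguish the two test functions.\<close>
    have box: "freq_box \<eta> k F ?\<psi> = freq_box \<eta> k F \<theta>"
    proof -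
      have "bump k \<xi> * inv_fourier \<theta> \<xi> = bump k \<xi> * inv_fourier ?\<psi> \<xi>" for \<xi>
        unfolding \<theta>_def inv_fourier_fourier[OF w\<psi>] using bump_mult_wide[of k \<xi>] by (simp flip: mult.assoc)
      then show ?thesis unfolding freq_box_eq by (simp only:)
    qed
    define D where "D s = 1 / (2 * of_real pi) * dshifts hs K s" for s
    have \<theta>_conv: "\<theta> y = (LINT x|lborel. \<phi> x * D (y - x))" for y
    proof -
      have "\<theta> y = 1 / (2 * of_real pi) * (LINT x|lborel. \<phi> x * dshifts hs K (y - x))"
        unfolding \<theta>_def fourier_mult_inv_fourier[OF wide_schwartz \<psi>]
        using convolution_dshifts[OF \<phi> K, of hs y] by (simp only: K_def)
      also have "\<dots> = (LINT x|lborel. 1 / (2 * of_real pi) * (\<phi> x * dshifts hs K (y - x)))"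
        by (rule integral_mult_right_zero[symmetric])
      finally show ?thesis by (simp add: D_def mult_ac)
    qed
    have D_le: "norm (D s) \<le> (\<rho> * (M * (1 + \<bar>real_of_int k\<bar>) ^ j * L) / (2 * pi)) * inverse (1 + s\<^sup>2)" for s
    proof -
      have "norm (dshifts hs K s) \<le> \<rho> * (M * (1 + \<bar>real_of_int k\<bar>) ^ j * (L * inverse (1 + s\<^sup>2)))"
        unfolding \<rho>_def
      proof (rule norm_dshifts_le[OF schwartz_smooth[OF K]])
        fix u assume u: "\<bar>u - s\<bar> \<le> sum_list (map abs hs)"
        have "sum_list (map abs hs) \<le> real (length hs)"
          using h1 by (induction hs) (auto intro: add_mono)
        then have us: "\<bar>u - s\<bar> \<le> real j" using u hs by simp
        have "s\<^sup>2 \<le> 2 * u\<^sup>2 + 2 * (u - s)\<^sup>2"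
          using zero_le_power2[of "2 * u - s"] by (simp add: power2_eq_square algebra_simps)
        also have "(u - s)\<^sup>2 \<le> (real j)\<^sup>2" using us by (metis abs_ge_zero power2_abs power_mono)
        finally have "s\<^sup>2 \<le> 2 * u\<^sup>2 + 2 * (real j)\<^sup>2" by simp
        moreover have "L * (1 + u\<^sup>2) = 2 + 2 * u\<^sup>2 + 2 * (real j)\<^sup>2 + 2 * (real j * u)\<^sup>2"
          by (simp add: L_def algebra_simps power_mult_distrib)
        ultimately have "1 + s\<^sup>2 \<le> L * (1 + u\<^sup>2)"
          using zero_le_power2[of "real j * u"] by linarith
        moreover have "0 < 1 + s\<^sup>2" "0 < 1 + u\<^sup>2" by (auto intro: add_pos_nonneg)
        ultimately have "inverse (1 + u\<^sup>2) \<le> L * inverse (1 + s\<^sup>2)" by (simp add: field_simps)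
        then have "M * (1 + \<bar>real_of_int k\<bar>) ^ j * inverse (1 + u\<^sup>2) \<le> M * (1 + \<bar>real_of_int k\<bar>) ^ j * (L * inverse (1 + s\<^sup>2))"
          using M(1) by (intro mult_left_mono) auto
        then show "norm ((vderiv ^^ length hs) K u) \<le> M * (1 + \<bar>real_of_int k\<bar>) ^ j * (L * inverse (1 + s\<^sup>2))"
          unfolding hs K_def by (rule order_trans[OF M(2)])
      qed
      then have "norm (D s) \<le> 1 / (2 * pi) * (\<rho> * (M * (1 + \<bar>real_of_int k\<bar>) ^ j * (L * inverse (1 + s\<^sup>2))))"
        unfolding D_def norm_mult by (intro mult_mono) (auto simp: norm_divide norm_mult)
      then show ?thesis by (simp add: mult_ac)
    qed
    have "D \<in> borel_measurable borel"
      unfolding D_def[abs_def] by (intro schwartz_measurable schwartz_cmult dshifts_schwartz K)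
    from L1_norm_convolution_le[OF schwartz_integrable[OF \<phi>] this D_le schwartz_integrable[OF \<theta>] \<theta>_conv]
    have \<theta>1: "(LINT y|lborel. norm (\<theta> y)) \<le> A * (1 + \<bar>real_of_int k\<bar>) ^ j * \<rho> * (LINT x|lborel. norm (\<phi> x))"
      by (simp add: A_def I_def mult_ac)
    have "norm (freq_box \<eta> k F ?\<psi>) \<le> enn2real (linf_norm (freq_box \<eta> k F)) * (LINT y|lborel. norm (\<theta> y))"
      unfolding box by (rule norm_freq_box_le[OF fin \<theta>])
    also have "\<dots> \<le> enn2real (linf_norm (freq_box \<eta> k F)) * (A * (1 + \<bar>real_of_int k\<bar>) ^ j * \<rho> * (LINT x|lborel. norm (\<phi> x)))"
      by (intro mult_left_mono \<theta>1) auto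
    finally show ?thesis by (simp add: \<rho>_def mult_ac)
  qed
  moreover have "0 \<le> A" using M(1) L I by (simp add: A_def)
  ultimately show thesis using that by blast
qed

end

section \<open>Regularity of functions with finite X-norm\<close>

context partition
begin

text \<open>Passes from extended nonnegative sums to real ones. Every weight is at least 1, so each
  box has a finite norm and its real value loses nothing.\<close>

lemma X_norm_finite:
  assumes fin: "X_norm \<eta> 5 F < \<infinity>"
  shows "linf_norm (freq_box \<eta> k F) < \<infinity>"
    and "finite I \<Longrightarrow> (\<Sum>k\<in>I. (1 + (of_int k)\<^sup>2) powr (5 / 2) * enn2real (linf_norm (freq_box \<eta> k F)))
      \<le> enn2real (X_norm \<eta> 5 F)"
proof -
  define w where "w k = (1 + (real_of_int k)\<^sup>2) powr (5 / 2)" for k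
  have w: "1 \<le> w k" for k unfolding w_def by (rule ge_one_powr_ge_zero) auto
  let ?t = "\<lambda>k. ennreal (w k) * linf_norm (freq_box \<eta> k F)"
  have X: "X_norm \<eta> 5 F = (\<Sum>\<^sub>\<infinity>k. ?t k)" by (simp add: X_norm_def w_def)
  have le: "(\<Sum>k\<in>I. ?t k) \<le> X_norm \<eta> 5 F" if "finite I" for I
    unfolding X using that by (subst nonneg_infsum_complete) (auto intro: SUP_upper)
  have lf: "linf_norm (freq_box \<eta> k F) < \<infinity>" for k
  proof -
    have "1 * linf_norm (freq_box \<eta> k F) \<le> ?t k"
      using w[of k] by (intro mult_right_mono) auto
    also have "\<dots> \<le> X_norm \<eta> 5 F" using le[of "{k}"] by simp
    finally show ?thesis using fin by (auto elim: le_less_trans)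
  qed
  then show "linf_norm (freq_box \<eta> k F) < \<infinity>" .
  assume I: "finite I"
  define b where "b k = enn2real (linf_norm (freq_box \<eta> k F))" for k
  have b: "linf_norm (freq_box \<eta> k F) = ennreal (b k)" "0 \<le> b k" for k
    using lf[of k] by (auto simp: b_def)
  have "ennreal (\<Sum>k\<in>I. w k * b k) = (\<Sum>k\<in>I. ?t k)"
    unfolding b(1) using w b(2) by (subst sum_ennreal[symmetric]) (auto simp: ennreal_mult order_trans[OF zero_le_one w])
  also have "\<dots> \<le> ennreal (enn2real (X_norm \<eta> 5 F))" using le[OF I] fin by simp
  finally have "(\<Sum>k\<in>I. w k * b k) \<le> enn2real (X_norm \<eta> 5 F)" by (simp add: ennreal_le_iff)
  then show "(\<Sum>k\<in>I. (1 + (of_int k)\<^sup>2) powr (5 / 2) * enn2real (linf_norm (freq_box \<eta> k F)))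
      \<le> enn2real (X_norm \<eta> 5 F)" by (simp add: w_def b_def)
qed

text \<open>Sums the box estimates over all frequencies; the powers of |k| from Bernstein are
  absorbed by the weight of the norm.\<close>

lemma tempered_dshifts_le:
  assumes "j \<le> 3"
  obtains A where "0 \<le> A"
    "\<And>F \<phi> hs. \<lbrakk>tempered F; X_norm \<eta> 5 F < \<infinity>; \<phi> \<in> schwartz; length hs = j; \<And>h. h \<in> set hs \<Longrightarrow> \<bar>h\<bar> \<le> 1\<rbrakk> \<Longrightarrow>
       norm (F (dshifts hs \<phi>)) \<le> A * prod_list (map abs hs) * enn2real (X_norm \<eta> 5 F) * (LINT x|lborel. norm (\<phi> x))"
proof -
  obtain A where A: "0 \<le> A"
    "\<And>F k \<phi> hs. \<lbrakk>linf_norm (freq_box \<eta> k F) < \<infinity>; \<phi> \<in> schwartz; length hs = j; \<And>h. h \<in> set hs \<Longrightarrow> \<bar>h\<bar> \<le> 1\<rbrakk> \<Longrightarrow>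
       norm (freq_box \<eta> k F (dshifts hs \<phi>)) \<le>
         A * (1 + \<bar>real_of_int k\<bar>) ^ j * prod_list (map abs hs) *
         (enn2real (linf_norm (freq_box \<eta> k F)) * (LINT x|lborel. norm (\<phi> x)))"
    using bernstein[of j] by blast
  have "norm (F (dshifts hs \<phi>)) \<le> (A * 4) * prod_list (map abs hs) * enn2real (X_norm \<eta> 5 F) * (LINT x|lborel. norm (\<phi> x))"
    if F: "tempered F" "X_norm \<eta> 5 F < \<infinity>" and \<phi>: "\<phi> \<in> schwartz" and hs: "length hs = j" "\<And>h. h \<in> set hs \<Longrightarrow> \<bar>h\<bar> \<le> 1"
    for F \<phi> hs
  proof (rule Lim_norm_ubound[OF _ freq_box_sums[OF F(1) dshifts_schwartz[OF \<phi>]]])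
    define \<rho> where "\<rho> = prod_list (map abs hs)"
    define L where "L = (LINT x|lborel. norm (\<phi> x))"
    define b where "b k = enn2real (linf_norm (freq_box \<eta> k F))" for k
    have nn: "0 \<le> \<rho>" "0 \<le> L" "0 \<le> b k" for k
      unfolding \<rho>_def L_def b_def by (induction hs) auto
    \<comment> \<open>The exponent \<open>j\<close> is at most 4 and (1 + |k|)^2 is at most 2 (1 +
      k^2); squaring gives the factor 4 and the exponent 2, which is below 5/2.\<close>
    have w: "(1 + \<bar>real_of_int k\<bar>) ^ j \<le> 4 * (1 + (real_of_int k)\<^sup>2) powr (5 / 2)" for k
    proof -
      have "(1 + \<bar>real_of_int k\<bar>) ^ j \<le> (1 + \<bar>real_of_int k\<bar>) ^ (2 * 2)" using assms by (intro power_increasing) auto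
      also have "\<dots> = ((1 + \<bar>real_of_int k\<bar>)\<^sup>2)\<^sup>2" by (rule power_mult)
      also have "\<dots> \<le> (2 * (1 + (real_of_int k)\<^sup>2))\<^sup>2"
      proof (rule power_mono)
        show "(1 + \<bar>real_of_int k\<bar>)\<^sup>2 \<le> 2 * (1 + (real_of_int k)\<^sup>2)"
          using sum_squares_bound[of 1 "\<bar>real_of_int k\<bar>"] by (simp add: power2_sum)
      qed auto
      also have "\<dots> = 4 * (1 + (real_of_int k)\<^sup>2) powr 2"
        unfolding power_mult_distrib by (simp add: add_pos_nonneg)
      also have "\<dots> \<le> 4 * (1 + (real_of_int k)\<^sup>2) powr (5 / 2)"
        by (intro mult_left_mono powr_mono) auto
      finally show ?thesis .
    qed
    show "\<forall>\<^sub>F N in sequentially. norm (\<Sum>k\<in>{- int N..int N}. freq_box \<eta> k F (dshifts hs \<phi>)) \<le> A * 4 * prod_list (map abs hs) * enn2real (X_norm \<eta> 5 F) * (LINT x|lborel. norm (\<phi> x))"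
    proof (intro always_eventually allI)
      fix N
      have "norm (\<Sum>k\<in>{- int N..int N}. freq_box \<eta> k F (dshifts hs \<phi>)) \<le>
          (\<Sum>k\<in>{- int N..int N}. A * 4 * \<rho> * L * ((1 + (real_of_int k)\<^sup>2) powr (5 / 2) * b k))"
      proof (rule sum_norm_le)
        fix k
        have "norm (freq_box \<eta> k F (dshifts hs \<phi>)) \<le> A * (1 + \<bar>real_of_int k\<bar>) ^ j * \<rho> * (b k * L)"
          unfolding \<rho>_def b_def L_def by (rule A(2)[OF X_norm_finite(1)[OF F(2)] \<phi> hs])
        also have "\<dots> = (1 + \<bar>real_of_int k\<bar>) ^ j * (A * \<rho> * b k * L)" by (simp add: mult_ac)
        also have "\<dots> \<le> (4 * (1 + (real_of_int k)\<^sup>2) powr (5 / 2)) * (A * \<rho> * b k * L)"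
          using A(1) nn by (intro mult_right_mono w) auto
        finally show "norm (freq_box \<eta> k F (dshifts hs \<phi>)) \<le> A * 4 * \<rho> * L * ((1 + (real_of_int k)\<^sup>2) powr (5 / 2) * b k)"
          by (simp add: mult_ac)
      qed
      also have "\<dots> = A * 4 * \<rho> * L * (\<Sum>k\<in>{- int N..int N}. (1 + (real_of_int k)\<^sup>2) powr (5 / 2) * b k)"
        by (rule sum_distrib_left[symmetric])
      also have "\<dots> \<le> A * 4 * \<rho> * L * enn2real (X_norm \<eta> 5 F)"
        unfolding b_def using A(1) nn X_norm_finite(2)[OF F(2)] by (intro mult_left_mono) auto
      finally show "norm (\<Sum>k\<in>{- int N..int N}. freq_box \<eta> k F (dshifts hs \<phi>)) \<le> A * 4 * prod_list (map abs hs) * enn2real (X_norm \<eta> 5 F) * (LINT x|lborel. norm (\<phi> x))"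
        by (simp add: \<rho>_def L_def mult_ac)
    qed
  qed simp
  then show thesis using A(1) by (intro that[of "A * 4"]) auto
qed

end

section \<open>From estimates for distributions to pointwise estimates\<close>

lemma gauss_kernel_schwartz: "(\<lambda>y. complex_of_real (gauss_kernel (real (Suc n)) x y)) \<in> schwartz"
proof -
  have "(\<lambda>y. complex_of_real (real (Suc n) / sqrt (2 * pi)) * of_real (gauss (real (Suc n) * y + (- real (Suc n) * x)))) \<in> schwartz"
    by (intro schwartz_cmult schwartz_affine[OF gauss_schwartz]) simp
  then show ?thesis by (simp add: gauss_kernel_def algebra_simps)
qed

lemma gauss_kernel_L1_norm: "(LINT y|lborel. norm (complex_of_real (gauss_kernel (real (Suc n)) x y))) = 1"
proof -
  have "(LINT y|lborel. norm (complex_of_real (gauss_kernel (real (Suc n)) x y))) = (LINT y|lborel. gauss_kernel (real (Suc n)) x y)"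
    unfolding norm_of_real by (simp add: gauss_kernel_def)
  also have "\<dots> = \<bar>1 / real (Suc n)\<bar> *\<^sub>R (LINT s|lborel. gauss_kernel (real (Suc n)) x (x + 1 / real (Suc n) * s))"
    by (rule lborel_integral_real_affine) simp
  also have "(\<lambda>s. gauss_kernel (real (Suc n)) x (x + 1 / real (Suc n) * s)) = (\<lambda>s. real (Suc n) / sqrt (2 * pi) * gauss s)"
    by (simp add: gauss_kernel_def del: of_nat_Suc)
  finally show ?thesis by (simp add: integral_gauss del: of_nat_Suc)
qed

lemma dshifts_translate: "dshifts hs f (y + h) = dshifts hs (\<lambda>y. f (y + h)) y"
proof (induction hs arbitrary: f)
  case (Cons a hs)
  have "dshift a (\<lambda>y. f (y + h)) = (\<lambda>y. dshift a f (y + h))" by (auto simp: dshift_def algebra_simps)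
  then show ?case using Cons[of "dshift a f"] by simp
qed simp

lemma dshifts_tendsto:
  assumes "\<And>x. (\<lambda>n. f n x) \<longlonglongrightarrow> g x"
  shows "(\<lambda>n. dshifts hs (f n) x) \<longlonglongrightarrow> dshifts hs g x"
  using assms
proof (induction hs arbitrary: f g)
  case (Cons h hs)
  have "(\<lambda>n. dshift h (f n) x) \<longlonglongrightarrow> dshift h g x" for x
    unfolding dshift_def by (intro tendsto_diff Cons.prems)
  from Cons.IH[OF this] show ?case by simp
qed simp

text \<open>The distribution is tested against Gaussian kernels, whose L^1 norm is 1 and which
  concentrate at \<open>x\<close>; continuity of \<open>f\<close> recovers its value in the
  limit.\<close>

lemma (in partition) dshifts_le:
  assumes "j \<le> 3"
  obtains A where "0 \<le> A"
    "\<And>F f hs x. \<lbrakk>tempered F; X_norm \<eta> 5 F < \<infinity>; represents f F; continuous_on UNIV f; length hs = j; \<And>h. h \<in> set hs \<Longrightarrow> \<bar>h\<bar> \<le> 1\<rbrakk> \<Longrightarrow>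
       norm (dshifts hs f x) \<le> A * prod_list (map abs hs) * enn2real (X_norm \<eta> 5 F)"
proof -
  obtain A where A: "0 \<le> A"
    "\<And>F \<phi> hs. \<lbrakk>tempered F; X_norm \<eta> 5 F < \<infinity>; \<phi> \<in> schwartz; length hs = j; \<And>h. h \<in> set hs \<Longrightarrow> \<bar>h\<bar> \<le> 1\<rbrakk> \<Longrightarrow>
       norm (F (dshifts hs \<phi>)) \<le> A * prod_list (map abs hs) * enn2real (X_norm \<eta> 5 F) * (LINT x|lborel. norm (\<phi> x))"
    using tempered_dshifts_le[OF assms] by blast
  have "norm (dshifts hs f x) \<le> A * prod_list (map abs hs) * enn2real (X_norm \<eta> 5 F)"
    if F: "tempered F" "X_norm \<eta> 5 F < \<infinity>" and f: "represents f F" "continuous_on UNIV f"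
      and hs: "length hs = j" "\<And>h. h \<in> set hs \<Longrightarrow> \<bar>h\<bar> \<le> 1" for F f hs x
  proof -
    define G where "G n x = (\<lambda>y. complex_of_real (gauss_kernel (real (Suc n)) x y))" for n x
    have G: "G n x \<in> schwartz" for n x unfolding G_def by (rule gauss_kernel_schwartz)
    \<comment> \<open>Shifting the kernel's argument by h moves its centre by -h. Differences of the
      test function are thus differences in the centre with reversed steps, and the estimate sees
      only their absolute values.\<close>
    have tr: "F (dshifts ks (G n x)) = dshifts (map uminus ks) (\<lambda>x. F (G n x)) x" for ks n x
    proof (induction ks arbitrary: x)
      case (Cons h ks)
      have S: "dshifts ks (G n x) \<in> schwartz" for x by (rule dshifts_schwartz[OF G])
      have Gh: "(\<lambda>y. G n x (y + h)) = G n (x - h)"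
        by (auto simp: G_def gauss_kernel_def algebra_simps)
      have "dshift h (dshifts ks (G n x)) = (\<lambda>y. dshifts ks (G n (x - h)) y - dshifts ks (G n x) y)"
        unfolding Gh[symmetric] dshifts_translate[symmetric] by (simp add: dshift_def[abs_def])
      then have "F (dshifts (h # ks) (G n x)) = F (\<lambda>y. dshifts ks (G n (x - h)) y - dshifts ks (G n x) y)"
        by (simp add: dshifts_dshift)
      also have "\<dots> = F (dshifts ks (G n (x - h))) - F (dshifts ks (G n x))"
        by (rule tempered_diff[OF F(1) S S])
      also have "\<dots> = dshift (- h) (dshifts (map uminus ks) (\<lambda>x. F (G n x))) x"
        unfolding Cons.IH by (simp add: dshift_def)
      finally show ?case by (simp add: dshifts_dshift)
    qed simp
    have lim: "(\<lambda>n. F (G n x)) \<longlonglongrightarrow> f x" for x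
    proof -
      have "(\<lambda>n. LINT y|lborel. f y * of_real (gauss_kernel (real (Suc n)) x y)) \<longlonglongrightarrow> f x"
      proof (rule gauss_kernel_tendsto)
        show "f \<in> borel_measurable borel" using f(2) by (rule borel_measurable_continuous_onI)
        show "isCont f x" using f(2) by (simp add: continuous_on_eq_continuous_at)
        have "(\<lambda>y. complex_of_real (gauss (1 * y + (- x)))) \<in> schwartz"
          by (rule schwartz_affine[OF gauss_schwartz]) simp
        then show "integrable lborel (\<lambda>y. f y * of_real (gauss (y - x)))"
          using f(1) by (simp add: represents_def)
      qed
      moreover have "F (G n x) = (LINT y|lborel. f y * of_real (gauss_kernel (real (Suc n)) x y))" for n
        using f(1) G[of n x] unfolding represents_def fun_dist_def by (simp add: G_def)
      ultimately show ?thesis by simp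
    qed
    let ?ks = "map uminus hs"
    have "(\<lambda>n. F (dshifts ?ks (G n x))) \<longlonglongrightarrow> dshifts hs f x"
      unfolding tr by (simp add: o_def dshifts_tendsto[OF lim])
    then show ?thesis
    proof (rule Lim_norm_ubound[OF sequentially_bot])
      show "\<forall>\<^sub>F n in sequentially. norm (F (dshifts ?ks (G n x))) \<le> A * prod_list (map abs hs) * enn2real (X_norm \<eta> 5 F)"
      proof (intro always_eventually allI)
        fix n
        have "norm (F (dshifts ?ks (G n x))) \<le> A * prod_list (map abs ?ks) * enn2real (X_norm \<eta> 5 F) * (LINT y|lborel. norm (G n x y))"
          by (rule A(2)[OF F G]) (use hs in auto)
        also have "(LINT y|lborel. norm (G n x y)) = 1" unfolding G_def by (rule gauss_kernel_L1_norm)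
        finally show "norm (F (dshifts ?ks (G n x))) \<le> A * prod_list (map abs hs) * enn2real (X_norm \<eta> 5 F)"
          by (simp add: o_def)
      qed
    qed
  qed
  then show thesis using A(1) that by blast
qed

text \<open>No continuity of the derivative enters: the bound on difference quotients passes to the
  limit at the single point.\<close>

lemma first_derivative_le:
  fixes f :: "real \<Rightarrow> 'a::real_normed_vector"
  assumes f: "(f has_vector_derivative f') (at x)" and le: "\<And>h. \<bar>h\<bar> \<le> 1 \<Longrightarrow> norm (f (x + h) - f x) \<le> c * \<bar>h\<bar>"
  shows "norm f' \<le> c"
proof -
  have "((\<lambda>h. norm (f (x + h) - f x - h *\<^sub>R f') / norm h) \<longlongrightarrow> 0) (at 0)"
    using f by (simp add: has_vector_derivative_def has_derivative_at)
  then have "((\<lambda>h. norm (f (x + h) - f x - h *\<^sub>R f') / norm h + c) \<longlongrightarrow> 0 + c) (at 0)"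
    by (intro tendsto_add tendsto_const)
  then have "norm f' \<le> 0 + c"
  proof (rule tendsto_le[OF _ _ tendsto_const, rotated])
    show "\<forall>\<^sub>F h in at 0. norm f' \<le> norm (f (x + h) - f x - h *\<^sub>R f') / norm h + c"
      unfolding eventually_at
    proof (intro exI[of _ 1] conjI ballI impI)
      fix h :: real assume "h \<noteq> 0 \<and> dist h 0 < 1"
      then have h: "h \<noteq> 0" "\<bar>h\<bar> \<le> 1" by auto
      have "\<bar>h\<bar> * norm f' = norm (h *\<^sub>R f')" by simp
      also have "\<dots> = norm ((f (x + h) - f x) - (f (x + h) - f x - h *\<^sub>R f'))" by simp
      also have "\<dots> \<le> norm (f (x + h) - f x) + norm (f (x + h) - f x - h *\<^sub>R f')" by (rule norm_triangle_ineq4)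
      also have "\<dots> \<le> c * \<bar>h\<bar> + norm (f (x + h) - f x - h *\<^sub>R f')" using le[OF h(2)] by simp
      finally show "norm f' \<le> norm (f (x + h) - f x - h *\<^sub>R f') / norm h + c" using h(1) by (simp add: field_simps)
    qed simp
  qed simp
  then show ?thesis by simp
qed

text \<open>Only differentiability of \<open>f1\<close> at the single point \<open>x\<close> is required, so the second-order
  expansion is Peano's.\<close>

lemma second_derivative_le:
  fixes f f1 :: "real \<Rightarrow> 'a::real_normed_vector"
  assumes f: "\<And>y. (f has_vector_derivative f1 y) (at y)" and f1: "(f1 has_vector_derivative f2) (at x)"
    and le: "\<And>h. \<bar>h\<bar> \<le> 1 \<Longrightarrow> norm (f (x + h + h) - f (x + h) - (f (x + h) - f x)) \<le> c * h\<^sup>2"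
  shows "norm f2 \<le> c"
proof (rule field_le_epsilon)
  fix e :: real assume "e > 0"
  \<comment> \<open>The remainder is used once at distance 2h and twice at distance h, giving 4 e' +
    2 e' times the square of h; hence the factor 6.\<close>
  define e' where "e' = e / 6"
  have e': "e' > 0" using \<open>e > 0\<close> by (simp add: e'_def)
  have "((\<lambda>h. norm (f1 (x + h) - f1 x - h *\<^sub>R f2) / norm h) \<longlongrightarrow> 0) (at 0)"
    using f1 by (simp add: has_vector_derivative_def has_derivative_at)
  from tendstoD[OF this e'] obtain d where d: "d > 0"
    "\<And>h. h \<noteq> 0 \<Longrightarrow> \<bar>h\<bar> < d \<Longrightarrow> norm (f1 (x + h) - f1 x - h *\<^sub>R f2) / \<bar>h\<bar> < e'"
    unfolding eventually_at by auto
  have rem: "norm (f1 y - f1 x - (y - x) *\<^sub>R f2) \<le> e' * (y - x)" if "x \<le> y" "y < x + d" for y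
  proof (cases "y = x")
    case False
    then have "norm (f1 y - f1 x - (y - x) *\<^sub>R f2) / (y - x) < e'" using d(2)[of "y - x"] that by simp
    then show ?thesis using False that by (simp add: divide_less_eq mult.commute)
  qed simp
  define R where "R y = f y - (y - x) *\<^sub>R f1 x - ((y - x)\<^sup>2 / 2) *\<^sub>R f2" for y
  have R: "(R has_vector_derivative (f1 y - f1 x - (y - x) *\<^sub>R f2)) (at y)" for y
  proof -
    have "((\<lambda>y. (y - x)\<^sup>2 / 2) has_real_derivative (y - x)) (at y)"
      by (auto intro!: derivative_eq_intros)
    moreover have "((\<lambda>y. y - x) has_real_derivative 1) (at y)" by (auto intro!: derivative_eq_intros)
    ultimately show ?thesis
      unfolding R_def[abs_def]
      using has_vector_derivative_diff[OF has_vector_derivative_diff[OF f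
          has_vector_derivative_scaleR[OF _ has_vector_derivative_const]]
          has_vector_derivative_scaleR[OF _ has_vector_derivative_const]]
      by fastforce
  qed
  have Rb: "norm (R y - R x) \<le> e' * (y - x)\<^sup>2" if y: "x \<le> y" "y < x + d" for y
  proof -
    have "norm (R y - R x) \<le> e' * (y - x) * norm (y - x)"
    proof (rule differentiable_bound[where S = "{x..y}" and f' = "\<lambda>w h. h *\<^sub>R (f1 w - f1 x - (w - x) *\<^sub>R f2)"])
      fix w assume w: "w \<in> {x..y}"
      show "(R has_derivative (\<lambda>h. h *\<^sub>R (f1 w - f1 x - (w - x) *\<^sub>R f2))) (at w within {x..y})"
        using R[of w] by (simp add: has_vector_derivative_def has_derivative_at_withinI)
      have "onorm (\<lambda>h. h *\<^sub>R (f1 w - f1 x - (w - x) *\<^sub>R f2)) = norm (f1 w - f1 x - (w - x) *\<^sub>R f2)"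
        using onorm_scaleR_left[OF bounded_linear_ident, of "f1 w - f1 x - (w - x) *\<^sub>R f2"] by (simp add: onorm_id)
      also have "\<dots> \<le> e' * (w - x)" using w y by (intro rem) auto
      also have "\<dots> \<le> e' * (y - x)" using w e' by (intro mult_left_mono) auto
      finally show "onorm (\<lambda>h. h *\<^sub>R (f1 w - f1 x - (w - x) *\<^sub>R f2)) \<le> e' * (y - x)" .
    qed (use y in auto)
    then show ?thesis using y by (simp add: power2_eq_square mult.assoc)
  qed
  \<comment> \<open>The step is at most 1, as the difference bound demands, and twice the step is
    below \<open>d\<close>, as the expansion demands.\<close>
  define h where "h = min 1 (d / 3)"
  have h: "0 < h" "\<bar>h\<bar> \<le> 1" "h + h < d" using d(1) by (auto simp: h_def min_def)
  have "h\<^sup>2 *\<^sub>R f2 = (f (x + h + h) - f (x + h) - (f (x + h) - f x)) - ((R (x + h + h) - R x) - 2 *\<^sub>R (R (x + h) - R x))"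
  proof -
    define a b where "a = h *\<^sub>R f1 x" and "b = (h\<^sup>2 / 2) *\<^sub>R f2"
    have R2: "R (x + h + h) = f (x + h + h) - 2 *\<^sub>R a - 4 *\<^sub>R b"
      by (simp add: R_def a_def b_def power2_eq_square)
    have "4 *\<^sub>R b = (2 + 2) *\<^sub>R b" by simp
    also have "\<dots> = (b + b) + (b + b)" unfolding scaleR_add_left scaleR_2 ..
    finally have b4: "4 *\<^sub>R b = (b + b) + (b + b)" .
    have R1: "R (x + h) = f (x + h) - a - b" "R x = f x" and b2: "h\<^sup>2 *\<^sub>R f2 = b + b"
      by (simp_all add: R_def a_def b_def flip: scaleR_2)
    show ?thesis unfolding R1 R2 b2 b4 scaleR_2 by (simp add: algebra_simps)
  qed
  then have "h\<^sup>2 * norm f2 = norm ((f (x + h + h) - f (x + h) - (f (x + h) - f x)) - ((R (x + h + h) - R x) - 2 *\<^sub>R (R (x + h) - R x)))"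
    by (metis abs_power2 norm_scaleR)
  also have "\<dots> \<le> c * h\<^sup>2 + (e' * (h + h)\<^sup>2 + 2 * (e' * h\<^sup>2))"
  proof -
    have "norm (R (x + h + h) - R x) \<le> e' * (h + h)\<^sup>2" using Rb[of "x + h + h"] h by (simp add: add.assoc)
    moreover have "norm (2 *\<^sub>R (R (x + h) - R x)) \<le> 2 * (e' * h\<^sup>2)" using Rb[of "x + h"] h by simp
    ultimately show ?thesis
      using le[OF h(2)] norm_triangle_ineq4[of "R (x + h + h) - R x" "2 *\<^sub>R (R (x + h) - R x)"]
        norm_triangle_ineq4[of "f (x + h + h) - f (x + h) - (f (x + h) - f x)" "R (x + h + h) - R x - 2 *\<^sub>R (R (x + h) - R x)"]
      by linarith
  qed
  also have "\<dots> = h\<^sup>2 * (c + e)" by (simp add: e'_def power2_eq_square algebra_simps)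
  finally show "norm f2 \<le> c + e" using h(1) by simp
qed

text \<open>Bounds on differences of order 0, 1 and 2 bound the jet, and those of order 3 give
  continuity of the second derivative. The constant is uniform over all distributions, so it can be
  applied to the difference of two times as well.\<close>

lemma (in partition) jet_bounds:
  obtains A where "0 \<le> A"
    "\<And>F f f1 f2 x. \<lbrakk>tempered F; X_norm \<eta> 5 F < \<infinity>; represents f F;
       \<And>x. (f has_vector_derivative f1 x) (at x); \<And>x. (f1 has_vector_derivative f2 x) (at x)\<rbrakk> \<Longrightarrow>
       norm (f x) \<le> A * enn2real (X_norm \<eta> 5 F) \<and> norm (f1 x) \<le> A * enn2real (X_norm \<eta> 5 F) \<and>
       norm (f2 x) \<le> A * enn2real (X_norm \<eta> 5 F) \<and> isCont f2 x"
proof -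
  have "\<exists>A\<ge>0. \<forall>F f hs x. tempered F \<longrightarrow> X_norm \<eta> 5 F < \<infinity> \<longrightarrow> represents f F \<longrightarrow> continuous_on UNIV f \<longrightarrow>
      length hs = j \<longrightarrow> (\<forall>h\<in>set hs. \<bar>h\<bar> \<le> 1) \<longrightarrow>
      norm (dshifts hs f x) \<le> A * prod_list (map abs hs) * enn2real (X_norm \<eta> 5 F)" if "j \<le> 3" for j
    using dshifts_le[OF that] by (metis (no_types, lifting))
  then obtain a where a: "\<And>j. j \<le> 3 \<Longrightarrow> 0 \<le> a j" "\<And>j F f hs x. \<lbrakk>j \<le> 3; tempered F; X_norm \<eta> 5 F < \<infinity>; represents f F; continuous_on UNIV f;
      length hs = j; \<forall>h\<in>set hs. \<bar>h\<bar> \<le> 1\<rbrakk> \<Longrightarrow> norm (dshifts hs f x) \<le> a j * prod_list (map abs hs) * enn2real (X_norm \<eta> 5 F)"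
    by metis
  define A where "A = a 0 + a 1 + a 2"
  have A: "a 0 \<le> A" "a 1 \<le> A" "a 2 \<le> A" "0 \<le> A" using a(1)[of 0] a(1)[of 1] a(1)[of 2] by (auto simp: A_def)
  have "norm (f x) \<le> A * enn2real (X_norm \<eta> 5 F) \<and> norm (f1 x) \<le> A * enn2real (X_norm \<eta> 5 F) \<and>
       norm (f2 x) \<le> A * enn2real (X_norm \<eta> 5 F) \<and> isCont f2 x"
    if F: "tempered F" "X_norm \<eta> 5 F < \<infinity>" "represents f F"
      and f: "\<And>x. (f has_vector_derivative f1 x) (at x)" and f1: "\<And>x. (f1 has_vector_derivative f2 x) (at x)"
    for F f f1 f2 x
  proof -
    define X where "X = enn2real (X_norm \<eta> 5 F)"
    have X: "0 \<le> X" by (simp add: X_def)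
    have c: "continuous_on UNIV f"
      using f by (auto intro!: continuous_at_imp_continuous_on has_vector_derivative_continuous)
    have b: "norm (dshifts hs f x) \<le> a (length hs) * prod_list (map abs hs) * X" if "length hs \<le> 3" "\<forall>h\<in>set hs. \<bar>h\<bar> \<le> 1" for hs x
      unfolding X_def using that by (intro a F c) auto
    have 0: "norm (f x) \<le> a 0 * X" using b[of "[]" x] by simp
    have 1: "norm (f1 x) \<le> a 1 * X"
    proof (rule first_derivative_le[OF f])
      fix h :: real assume "\<bar>h\<bar> \<le> 1"
      then show "norm (f (x + h) - f x) \<le> a 1 * X * \<bar>h\<bar>" using b[of "[h]" x] by (simp add: dshift_def mult_ac)
    qed
    have 2: "norm (f2 x) \<le> a 2 * X"
    proof (rule second_derivative_le[OF f f1])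
      fix h :: real assume "\<bar>h\<bar> \<le> 1"
      then show "norm (f (x + h + h) - f (x + h) - (f (x + h) - f x)) \<le> a 2 * X * h\<^sup>2"
        using b[of "[h, h]" x] by (simp add: dshift_def power2_eq_square numeral_2_eq_2 mult_ac)
    qed
    \<comment> \<open>The second-derivative bound is applied to a first difference of
      \<open>f\<close>. Its second differences are third differences of \<open>f\<close>, so the
      second derivative is Lipschitz on steps of length at most 1.\<close>
    have 3: "norm (f2 (x + d) - f2 x) \<le> a 3 * X * \<bar>d\<bar>" if d: "\<bar>d\<bar> \<le> 1" for d
    proof (rule second_derivative_le[of "dshift d f" "dshift d f1"])
      have sh: "((\<lambda>y. g (y + d)) has_vector_derivative g') (at y)" if "(g has_vector_derivative g') (at (y + d))"
        for g :: "real \<Rightarrow> complex" and g' y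
        using vector_diff_chain_at[of "\<lambda>y. y + d" 1 y g g'] that
          has_vector_derivative_add[OF has_vector_derivative_id[of "at y"] has_vector_derivative_const[of d]]
        by (simp add: o_def)
      show "(dshift d f has_vector_derivative dshift d f1 y) (at y)" for y
        unfolding dshift_def[abs_def] by (intro has_vector_derivative_diff sh f)
      show "(dshift d f1 has_vector_derivative f2 (x + d) - f2 x) (at x)"
        unfolding dshift_def[abs_def] by (intro has_vector_derivative_diff sh f1)
      fix h :: real assume "\<bar>h\<bar> \<le> 1"
      then show "norm (dshift d f (x + h + h) - dshift d f (x + h) - (dshift d f (x + h) - dshift d f x)) \<le> a 3 * X * \<bar>d\<bar> * h\<^sup>2"
        using b[of "[d, h, h]" x] d
        by (simp add: dshift_def[of h] power2_eq_square numeral_3_eq_3 mult_ac)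
    qed
    have "isCont f2 x"
      unfolding isCont_iff
    proof (rule LIM_zero_cancel, rule Lim_null_comparison)
      show "((\<lambda>d. a 3 * X * \<bar>d\<bar>) \<longlongrightarrow> 0) (at 0)" by (intro tendsto_eq_intros) auto
      show "\<forall>\<^sub>F d in at 0. norm (f2 (x + d) - f2 x) \<le> a 3 * X * \<bar>d\<bar>"
        unfolding eventually_at by (intro exI[of _ 1]) (use 3 in auto)
    qed
    moreover have "a 0 * X \<le> A * X" "a 1 * X \<le> A * X" "a 2 * X \<le> A * X"
      using A X by (auto intro: mult_right_mono)
    ultimately show ?thesis using 0 1 2 unfolding X_def by linarith
  qed
  then show thesis using A(4) that by blast
qed

section \<open>Joint regularity of solutions with values in the X-space\<close>

lemma tempered_difference:
  assumes F: "tempered F" and G: "tempered G"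
  shows "tempered (\<lambda>\<phi>. F \<phi> - G \<phi>)"
  unfolding tempered_def
proof (intro conjI ballI allI)
  show "F (\<lambda>x. \<phi> x + \<psi> x) - G (\<lambda>x. \<phi> x + \<psi> x) = F \<phi> - G \<phi> + (F \<psi> - G \<psi>)" if "\<phi> \<in> schwartz" "\<psi> \<in> schwartz" for \<phi> \<psi>
    using that by (simp add: tempered_add[OF F] tempered_add[OF G])
  show "F (\<lambda>x. c * \<phi> x) - G (\<lambda>x. c * \<phi> x) = c * (F \<phi> - G \<phi>)" if "\<phi> \<in> schwartz" for c \<phi>
    using that by (simp add: tempered_cmult[OF F] tempered_cmult[OF G] right_diff_distrib)
  obtain N C where F: "\<And>\<phi>. \<phi> \<in> schwartz \<Longrightarrow> norm (F \<phi>) \<le> C * (\<Sum>m\<le>N. \<Sum>n\<le>N. schwartz_seminorm m n \<phi>)"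
    using F unfolding tempered_def by blast
  obtain M D where G: "\<And>\<phi>. \<phi> \<in> schwartz \<Longrightarrow> norm (G \<phi>) \<le> D * (\<Sum>m\<le>M. \<Sum>n\<le>M. schwartz_seminorm m n \<phi>)"
    using G unfolding tempered_def by blast
  have mono: "C * (\<Sum>m\<le>N. \<Sum>n\<le>N. schwartz_seminorm m n \<phi>) \<le> \<bar>C\<bar> * (\<Sum>m\<le>N'. \<Sum>n\<le>N'. schwartz_seminorm m n \<phi>)"
    if \<phi>: "\<phi> \<in> schwartz" and "N \<le> N'" for N N' C \<phi>
  proof -
    have "(\<Sum>m\<le>N. \<Sum>n\<le>N. schwartz_seminorm m n \<phi>) \<le> (\<Sum>m\<le>N'. \<Sum>n\<le>N. schwartz_seminorm m n \<phi>)"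
      using \<open>N \<le> N'\<close> by (intro sum_mono2 sum_nonneg schwartz_seminorm_nonneg \<phi>) auto
    also have "\<dots> \<le> (\<Sum>m\<le>N'. \<Sum>n\<le>N'. schwartz_seminorm m n \<phi>)"
      using \<open>N \<le> N'\<close> by (intro sum_mono sum_mono2 schwartz_seminorm_nonneg \<phi>) auto
    finally have "\<bar>C\<bar> * (\<Sum>m\<le>N. \<Sum>n\<le>N. schwartz_seminorm m n \<phi>) \<le> \<bar>C\<bar> * (\<Sum>m\<le>N'. \<Sum>n\<le>N'. schwartz_seminorm m n \<phi>)"
      by (intro mult_left_mono) auto
    moreover have "C * (\<Sum>m\<le>N. \<Sum>n\<le>N. schwartz_seminorm m n \<phi>) \<le> \<bar>C\<bar> * (\<Sum>m\<le>N. \<Sum>n\<le>N. schwartz_seminorm m n \<phi>)"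
      by (intro mult_right_mono sum_nonneg schwartz_seminorm_nonneg \<phi>) auto
    ultimately show ?thesis by linarith
  qed
  show "\<exists>N C. \<forall>\<phi>\<in>schwartz. norm (F \<phi> - G \<phi>) \<le> C * (\<Sum>m\<le>N. \<Sum>n\<le>N. schwartz_seminorm m n \<phi>)"
  proof (intro exI ballI)
    fix \<phi> assume \<phi>: "\<phi> \<in> schwartz"
    have "norm (F \<phi> - G \<phi>) \<le> norm (F \<phi>) + norm (G \<phi>)" by (rule norm_triangle_ineq4)
    also have "\<dots> \<le> \<bar>C\<bar> * (\<Sum>m\<le>max N M. \<Sum>n\<le>max N M. schwartz_seminorm m n \<phi>) + \<bar>D\<bar> * (\<Sum>m\<le>max N M. \<Sum>n\<le>max N M. schwartz_seminorm m n \<phi>)"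
      by (intro add_mono order_trans[OF F[OF \<phi>] mono[OF \<phi>]] order_trans[OF G[OF \<phi>] mono[OF \<phi>]]) auto
    finally show "norm (F \<phi> - G \<phi>) \<le> (\<bar>C\<bar> + \<bar>D\<bar>) * (\<Sum>m\<le>max N M. \<Sum>n\<le>max N M. schwartz_seminorm m n \<phi>)"
      by (simp add: distrib_right)
  qed
qed

lemma represents_difference:
  assumes "represents f F" "represents g G"
  shows "represents (\<lambda>x. f x - g x) (\<lambda>\<phi>. F \<phi> - G \<phi>)"
  using assms unfolding represents_def fun_dist_def by (auto simp: left_diff_distrib)

text \<open>By linearity the jet bound applies to the difference of the solution at two times, so
  each derivative up to order two is continuous in time uniformly in x. With continuity in x at
  fixed time this gives joint continuity.\<close>

lemma X_solution_strip_regular: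
  assumes part: "partition_profile \<eta>" and sol: "X_global_solution \<eta> \<kappa> q\<^sub>0 q"
  shows "strip_regular q"
proof -
  interpret partition \<eta> by unfold_locales (rule part)
  have cl: "classical_solution \<kappa> q" and rep: "\<And>t. represents (q t) (fun_dist (q t))"
    and X: "X_continuous \<eta> 5 (\<lambda>t. fun_dist (q t))"
    using sol by (auto simp: X_global_solution_def)
  have temp: "tempered (fun_dist (q t))" and Xfin: "X_norm \<eta> 5 (fun_dist (q t)) < \<infinity>"
    and Xlim: "((\<lambda>r. X_norm \<eta> 5 (\<lambda>\<phi>. fun_dist (q r) \<phi> - fun_dist (q t) \<phi>)) \<longlongrightarrow> 0) (at t)" for t
    using X by (auto simp: X_continuous_def X_space_def)
  have d: "(q t has_vector_derivative vderiv (q t) x) (at x)"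
    "(vderiv (q t) has_vector_derivative vderiv (vderiv (q t)) x) (at x)" for t x
    using cl unfolding classical_solution_def by (auto simp: vderiv_def[abs_def] vector_derivative_works[symmetric])
  obtain A where A: "0 \<le> A"
    "\<And>F f f1 f2 x. \<lbrakk>tempered F; X_norm \<eta> 5 F < \<infinity>; represents f F;
       \<And>x. (f has_vector_derivative f1 x) (at x); \<And>x. (f1 has_vector_derivative f2 x) (at x)\<rbrakk> \<Longrightarrow>
       norm (f x) \<le> A * enn2real (X_norm \<eta> 5 F) \<and> norm (f1 x) \<le> A * enn2real (X_norm \<eta> 5 F) \<and>
       norm (f2 x) \<le> A * enn2real (X_norm \<eta> 5 F) \<and> isCont f2 x"
    using jet_bounds by blast
  define J where "J j t x = (vderiv ^^ j) (q t) x" for j t x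
  have J: "J 0 t x = q t x" "J (Suc 0) t x = vderiv (q t) x" "J 2 t x = vderiv (vderiv (q t)) x" for t x
    by (simp_all add: J_def numeral_2_eq_2)
  have j012: "j = 0 \<or> j = Suc 0 \<or> j = 2" if "j \<le> 2" for j :: nat using that by auto
  have Jbound: "norm (J j t x) \<le> A * enn2real (X_norm \<eta> 5 (fun_dist (q t)))" and Jcont: "isCont (J j t) x"
    if "j \<le> 2" for j t x
  proof -
    note b = A(2)[OF temp Xfin rep d, of t x]
    show "norm (J j t x) \<le> A * enn2real (X_norm \<eta> 5 (fun_dist (q t)))"
      using j012[OF that] b by (auto simp: J)
    show "isCont (J j t) x"
      using j012[OF that] b has_vector_derivative_continuous[OF d(1)] has_vector_derivative_continuous[OF d(2)]
      by (auto simp: J[abs_def])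
  qed
  have Jdiff: "\<exists>\<delta>>0. \<forall>r. \<bar>r - t\<bar> < \<delta> \<longrightarrow> (\<forall>j\<le>2. \<forall>x. norm (J j r x - J j t x) < e)" if e: "e > 0" for t e
  proof -
    \<comment> \<open>The denominator uses \<open>A + 1\<close> because \<open>A\<close> may be 0;
      the factor 2 leaves room for a strict inequality.\<close>
    define e' where "e' = e / (2 * (A + 1))"
    have e': "0 < e'" "A * e' < e" using e A(1) by (auto simp: e'_def field_simps intro: add_nonneg_pos)
    have "\<forall>\<^sub>F r in at t. X_norm \<eta> 5 (\<lambda>\<phi>. fun_dist (q r) \<phi> - fun_dist (q t) \<phi>) < ennreal e'"
      using order_tendstoD(2)[OF Xlim, of "ennreal e'"] e' by simp
    then obtain \<delta> where \<delta>: "\<delta> > 0" "\<And>r. r \<noteq> t \<Longrightarrow> \<bar>r - t\<bar> < \<delta> \<Longrightarrow>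
        X_norm \<eta> 5 (\<lambda>\<phi>. fun_dist (q r) \<phi> - fun_dist (q t) \<phi>) < ennreal e'"
      unfolding eventually_at by (auto simp: dist_real_def)
    have "norm (J j r x - J j t x) < e" if r: "\<bar>r - t\<bar> < \<delta>" and j: "j \<le> 2" for r j x
    proof (cases "r = t")
      case False
      let ?F = "\<lambda>\<phi>. fun_dist (q r) \<phi> - fun_dist (q t) \<phi>"
      have n: "X_norm \<eta> 5 ?F < ennreal e'" by (rule \<delta>(2)[OF False r])
      then have fin: "X_norm \<eta> 5 ?F < \<infinity>" by (rule less_trans) simp
      have x: "enn2real (X_norm \<eta> 5 ?F) \<le> e'" using n e'(1) by (intro enn2real_leI) auto
      have "norm (q r x - q t x) \<le> A * enn2real (X_norm \<eta> 5 ?F) \<and>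
          norm (vderiv (q r) x - vderiv (q t) x) \<le> A * enn2real (X_norm \<eta> 5 ?F) \<and>
          norm (vderiv (vderiv (q r)) x - vderiv (vderiv (q t)) x) \<le> A * enn2real (X_norm \<eta> 5 ?F) \<and>
          isCont (\<lambda>x. vderiv (vderiv (q r)) x - vderiv (vderiv (q t)) x) x"
        by (rule A(2)[OF tempered_difference[OF temp temp] fin represents_difference[OF rep rep]];
            intro has_vector_derivative_diff d)
      then have "norm (J j r x - J j t x) \<le> A * enn2real (X_norm \<eta> 5 ?F)" using j012[OF j] by (auto simp: J)
      also have "\<dots> \<le> A * e'" by (intro mult_left_mono x A)
      finally show ?thesis using e'(2) by simp
    qed (use e in simp)
    then show ?thesis using \<delta>(1) by blast
  qed
  show ?thesis
    unfolding strip_regular_def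
  proof (intro allI impI conjI)
    fix T :: real and j :: nat assume j: "j \<le> 2"
    show "continuous_on ({-T..T} \<times> UNIV) (\<lambda>(t, x). (vderiv ^^ j) (q t) x)"
    proof (rule continuous_at_imp_continuous_on, rule ballI)
      fix p :: "real \<times> real"
      obtain t x where p: "p = (t, x)" by (cases p)
      show "isCont (\<lambda>(t, x). (vderiv ^^ j) (q t) x) p"
        unfolding p continuous_at_eps_delta
      proof (intro allI impI)
        fix e :: real assume e: "0 < e"
        obtain \<delta> where \<delta>: "\<delta> > 0" "\<And>r y. \<bar>r - t\<bar> < \<delta> \<Longrightarrow> norm (J j r y - J j t y) < e / 2"
          using Jdiff[of "e / 2" t] e j by auto
        obtain \<gamma> where \<gamma>: "\<gamma> > 0" "\<And>y. \<bar>y - x\<bar> < \<gamma> \<Longrightarrow> norm (J j t y - J j t x) < e / 2"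
          using Jcont[OF j, of x t] e unfolding continuous_at_eps_delta dist_norm
          using half_gt_zero[OF e] by (metis real_norm_def)
        show "\<exists>d>0. \<forall>p'. dist p' (t, x) < d \<longrightarrow> dist (case p' of (t, x) \<Rightarrow> (vderiv ^^ j) (q t) x) (case (t, x) of (t, x) \<Rightarrow> (vderiv ^^ j) (q t) x) < e"
        proof (intro exI[of _ "min \<delta> \<gamma>"] conjI allI impI)
          fix p' :: "real \<times> real" assume p': "dist p' (t, x) < min \<delta> \<gamma>"
          obtain r y where ry: "p' = (r, y)" by (cases p')
          have "\<bar>r - t\<bar> < \<delta>" "\<bar>y - x\<bar> < \<gamma>"
            using p' dist_fst_le[of p' "(t, x)"] dist_snd_le[of p' "(t, x)"] by (auto simp: ry dist_real_def)
          then have "norm (J j r y - J j t y) < e / 2" "norm (J j t y - J j t x) < e / 2" using \<delta> \<gamma> by auto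
          then have "norm (J j r y - J j t x) < e"
            using norm_triangle_ineq[of "J j r y - J j t y" "J j t y - J j t x"] by simp
          then show "dist (case p' of (t, x) \<Rightarrow> (vderiv ^^ j) (q t) x) (case (t, x) of (t, x) \<Rightarrow> (vderiv ^^ j) (q t) x) < e"
            by (simp add: ry dist_norm J_def)
        qed (use \<delta> \<gamma> in auto)
      qed
    qed
    obtain \<delta> where \<delta>: "\<And>t. \<delta> t > 0" "\<And>t r x. \<bar>r - t\<bar> < \<delta> t \<Longrightarrow> norm (J j r x - J j t x) < 1"
      using Jdiff[of 1] j by (metis zero_less_one)
    obtain D where D: "finite D" "{-T..T} \<subseteq> (\<Union>t\<in>D. ball t (\<delta> t))"
    proof (rule compactE_image[OF compact_Icc[of "- T" T], of UNIV "\<lambda>t. ball t (\<delta> t)"])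
      show "{-T..T} \<subseteq> (\<Union>t. ball t (\<delta> t))"
      proof
        fix t show "t \<in> (\<Union>t. ball t (\<delta> t))" using \<delta>(1)[of t] by (intro UN_I[of t]) auto
      qed
    qed auto
    \<comment> \<open>On each of finitely many time intervals covering the strip the jet stays
      within 1 of its value at the centre; the sum of the nonnegative central bounds dominates each
      of them.\<close>
    define M where "M = (\<Sum>t\<in>D. A * enn2real (X_norm \<eta> 5 (fun_dist (q t))))"
    have "norm (J j r x) \<le> M + 1" if r: "r \<in> {-T..T}" for r x
    proof -
      obtain t where t: "t \<in> D" "\<bar>r - t\<bar> < \<delta> t" using D(2) r by (auto simp: dist_real_def abs_minus_commute)
      have "norm (J j t x) \<le> A * enn2real (X_norm \<eta> 5 (fun_dist (q t)))" by (rule Jbound[OF j])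
      also have "\<dots> \<le> M" unfolding M_def using D(1) t(1) A(1) by (intro member_le_sum) auto
      finally show ?thesis
        using \<delta>(2)[OF t(2), of x] norm_triangle_sub[of "J j r x" "J j t x"] by simp
    qed
    then show "bounded ((\<lambda>(t, x). (vderiv ^^ j) (q t) x) ` ({-T..T} \<times> UNIV))"
      unfolding bounded_iff by (intro exI[of _ "M + 1"]) (auto simp: J_def)
  qed
qed

theorem theorem49:
  fixes \<kappa> :: real and q :: "real \<Rightarrow> real \<Rightarrow> complex"
  assumes kappa: "\<kappa> \<in> {1, -1}"
    and q: "(\<exists>\<eta>. \<exists>q\<^sub>0 \<in> X_space \<eta> 5. partition_profile \<eta> \<and> X_global_solution \<eta> \<kappa> q\<^sub>0 q) \<or>
            (classical_solution \<kappa> q \<and> strip_regular q)"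
  shows
    "(\<forall>t. op_spectrum H1 (dirac \<kappa> (q t)) = op_spectrum H1 (dirac \<kappa> (q 0))) \<and>
     (\<exists>B :: real \<Rightarrow> real \<Rightarrow> complex \<Rightarrow> complex ^ 2 ^ 2.
        (\<forall>t x z. invertible (B t x z) \<and> (\<lambda>w. B t w z) differentiable (at x)) \<and>
        (\<forall>t x y z. transfer_matrix \<kappa> (q t) x y z =
           B t x z ** transfer_matrix \<kappa> (q 0) x y z ** matrix_inv (B t y z)) \<and>
        (\<forall>T K. bdd_above {opnorm (B t x z) + opnorm (matrix_inv (B t x z))
                            + opnorm (vderiv (\<lambda>w. B t w z) x) | t x z. \<bar>t\<bar> \<le> T \<and> norm z \<le> K}) \<and>
        (\<forall>t z. bij_betw (\<lambda>f x. B t x z *v f x)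
                 (solutions_right \<kappa> (q 0) z) (solutions_right \<kappa> (q t) z) \<and>
               bij_betw (\<lambda>f x. B t x z *v f x)
                 (solutions_left \<kappa> (q 0) z) (solutions_left \<kappa> (q t) z) \<and>
               bij_betw (L2_mult (\<lambda>x. B t x z))
                 (op_kernel H1 (dirac \<kappa> (q 0)) z) (op_kernel H1 (dirac \<kappa> (q t)) z))) \<and>
     (\<forall>\<epsilon> \<in> {-1, 1}. \<forall>s t z y.
        upper_growth \<kappa> (q t) \<epsilon> z y = upper_growth \<kappa> (q s) \<epsilon> z y \<and>
        lower_growth \<kappa> (q t) \<epsilon> z y = lower_growth \<kappa> (q s) \<epsilon> z y \<and>
        (\<forall>\<Lambda>. (growth_quotient \<kappa> (q s) \<epsilon> z y \<longlongrightarrow> \<Lambda>) at_top \<longleftrightarrow>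
              (growth_quotient \<kappa> (q t) \<epsilon> z y \<longlongrightarrow> \<Lambda>) at_top)) \<and>
     (\<forall>T K. \<exists>C>0. \<forall>t z. \<bar>t\<bar> \<le> T \<longrightarrow> norm z \<le> K \<longrightarrow>
        z \<in> resolvent_set H1 (dirac \<kappa> (q 0)) \<longrightarrow> z \<in> resolvent_set H1 (dirac \<kappa> (q t)) \<longrightarrow>
          onorm (resolvent H1 (dirac \<kappa> (q t)) z) \<le> C * onorm (resolvent H1 (dirac \<kappa> (q 0)) z) \<and>
          onorm (resolvent H1 (dirac \<kappa> (q 0)) z) \<le> C * onorm (resolvent H1 (dirac \<kappa> (q t)) z))"
proof -
  have "classical_solution \<kappa> q \<and> strip_regular q"
    using q X_solution_strip_regular unfolding X_global_solution_def by blast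
  then interpret nls_solution \<kappa> q
    using kappa by unfold_locales auto
  show ?thesis by (rule spectral_invariance)
qed

end
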